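(* There exist universal constants $c,C>0$ such that for every dimension $n\ge 1$ and every geometric convex function $\varphi$ on $\mathbb{R}^n$ with $0<\int_{\mathbb{R}^n}e^{-\varphi}<\infty$, \[ c^{n}\,|B_2^n|^{2}\le\int_{\mathbb{R}^n}e^{-\varphi}\cdot\int_{\mathbb{R}^n}e^{-\varphi^{\circ}}, \] and if in addition $\varphi$ is even (i.e. $e^{-\varphi}$ is an even geometric log-concave function), then also \[ \int_{\mathbb{R}^n}e^{-\varphi}\cdot\int_{\mathbb{R}^n}e^{-\varphi^{\circ}}\le\left(|B_2^n|\,n!\right)^{2}\left(1+\frac{C}{n}\right). \]
   Context: $B_2^n$ is the Euclidean unit ball of $\mathbb{R}^n$ and $|\cdot|$ denotes Lebesgue volume. A geometric convex function is a lower semi-continuous convex function $\varphi:\mathbb{R}^n\to[0,\infty]$ with $\varphi(0)=0$; a geometric log-concave function is $f=e^{-\varphi}$ with $\varphi$ geometric convex. The polarity transform is $\varphi^{\circ}(x)=\sup_{y\in\mathbb{R}^n}\frac{\langle x,y\rangle-1}{\varphi(y)}$, with the conventions $\frac{+}{0}=\infty$, $\frac{0}{0}=0$, $\frac{-}{0}=0$. *)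

theory Defs
  imports "HOL-Analysis.Analysis"
begin

text \<open>R^n is modelled as the product measure space PiM {..<n} lborel,
  whose points are extensional functions nat => real supported on {..<n}.\<close>

definition Rn :: "nat \<Rightarrow> (nat \<Rightarrow> real) measure" where
  "Rn n = PiM {..<n} (\<lambda>_. lborel)"

definition Rn_set :: "nat \<Rightarrow> (nat \<Rightarrow> real) set" where
  "Rn_set n = PiE {..<n} (\<lambda>_. UNIV)"

definition Rn_zero :: "nat \<Rightarrow> (nat \<Rightarrow> real)" where
  "Rn_zero n = restrict (\<lambda>_. 0) {..<n}"

definition Rn_neg :: "nat \<Rightarrow> (nat \<Rightarrow> real) \<Rightarrow> (nat \<Rightarrow> real)" where
  "Rn_neg n x = restrict (\<lambda>i. - x i) {..<n}"

definition Rn_comb :: "nat \<Rightarrow> real \<Rightarrow> (nat \<Rightarrow> real) \<Rightarrow> (nat \<Rightarrow> real) \<Rightarrow> (nat \<Rightarrow> real)" where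
  "Rn_comb n t x y = restrict (\<lambda>i. t * x i + (1 - t) * y i) {..<n}"

definition Rn_inner :: "nat \<Rightarrow> (nat \<Rightarrow> real) \<Rightarrow> (nat \<Rightarrow> real) \<Rightarrow> real" where
  "Rn_inner n x y = (\<Sum>i<n. x i * y i)"

definition unit_ball :: "nat \<Rightarrow> (nat \<Rightarrow> real) set" where
  "unit_ball n = {x \<in> Rn_set n. (\<Sum>i<n. (x i)\<^sup>2) \<le> 1}"

definition geometric_convex :: "nat \<Rightarrow> ((nat \<Rightarrow> real) \<Rightarrow> ereal) \<Rightarrow> bool" where
  "geometric_convex n \<phi> \<longleftrightarrow>
     (\<forall>x\<in>Rn_set n. 0 \<le> \<phi> x) \<and>
     \<phi> (Rn_zero n) = 0 \<and>
     (\<forall>x\<in>Rn_set n. \<forall>y\<in>Rn_set n. \<forall>t\<in>{0..1::real}.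
        \<phi> (Rn_comb n t x y) \<le> ereal t * \<phi> x + ereal (1 - t) * \<phi> y) \<and>
     (\<forall>x\<in>Rn_set n. \<phi> x \<le> Liminf (at x within Rn_set n) \<phi>)"

text \<open>The quotient a/b with conventions +/0 = \<infinity>, 0/0 = 0, -/0 = 0 (and a/\<infinity> = 0).\<close>
definition polar_quot :: "real \<Rightarrow> ereal \<Rightarrow> ereal" where
  "polar_quot a b = (if b = 0 then (if a > 0 then \<infinity> else 0) else ereal a / b)"

definition polarity :: "nat \<Rightarrow> ((nat \<Rightarrow> real) \<Rightarrow> ereal) \<Rightarrow> (nat \<Rightarrow> real) \<Rightarrow> ereal" where
  "polarity n \<phi> x = (SUP y\<in>Rn_set n. polar_quot (Rn_inner n x y - 1) (\<phi> y))"

definition exp_neg :: "ereal \<Rightarrow> real" where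
  "exp_neg v = (if v = \<infinity> then 0 else exp (- real_of_ereal v))"

definition int_exp_neg :: "nat \<Rightarrow> ((nat \<Rightarrow> real) \<Rightarrow> ereal) \<Rightarrow> ennreal" where
  "int_exp_neg n \<phi> = (\<integral>\<^sup>+ x. ennreal (exp_neg (\<phi> x)) \<partial>Rn n)"

end

theory Submission
  imports Defs "HOL-Probability.Probability" "HOL-Library.Function_Algebras"
begin

text \<open>
  Write \<open>K\<^sub>s = {\<phi> \<le> s}\<close> and \<open>L\<^sub>t = {\<phi>\<degree> \<le> t}\<close>, so that \<open>\<langle>x,y\<rangle> \<le> 1 + st\<close> for \<open>x \<in> K\<^sub>s\<close>, \<open>y \<in> L\<^sub>t\<close>.

  Upper bound: if \<open>\<phi>\<close> is even, the Blaschke-Santalo inequality gives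
  \<open>\<bar>K\<^sub>s\<bar> \<bar>L\<^sub>t\<bar> \<le> (1 + st)\<^sup>n \<bar>B\<bar>\<^sup>2\<close>; the multiplicative Prekopa-Leindler inequality applied to
  \<open>e\<^sup>-\<^sup>s \<bar>K\<^sub>s\<bar>\<close> and \<open>e\<^sup>-\<^sup>t \<bar>L\<^sub>t\<bar>\<close> reduces the claim to bounding the integral of
  \<open>e\<^sup>-\<^sup>r (1 + r\<^sup>2)\<^bsup>n/2\<^esup>\<close> over \<open>r > 0\<close> by \<open>n! (1 + O(1/n))\<close>. Blaschke-Santalo itself follows by
  symmetrising both sets in each coordinate, which leaves the unconditional case, where
  Prekopa-Leindler on the orthant applies.

  Lower bound: \<open>\<phi>\<degree> \<le> 1\<close> on the polar of \<open>K = K\<^sub>1\<close>, so the product of the integrals is at least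
  \<open>e\<^sup>-\<^sup>2 \<bar>K\<bar> \<bar>K\<degree>\<bar>\<close>, and the Bourgain-Milman inequality remains. It is proved in the spirit of Kuperberg.
  After passing to \<open>D = K - K\<close>, approximate \<open>D\<close> by a polytope and take a homogeneous, strongly monotone,
  piecewise linear field \<open>J\<close> such that \<open>q(a) = \<langle>a, J a\<rangle> \<le> 1\<close> forces \<open>a\<close> into a multiple of \<open>D\<close> and
  \<open>J a\<close> into a multiple of \<open>D\<degree>\<close>. In the coordinates \<open>(x, y) = (a + b, J a - J b)\<close> the form \<open>\<langle>x,y\<rangle>\<close> is
  \<open>q(a) - q(b)\<close> plus a cross term, and Lebesgue measure pulls back to a measure \<open>\<nu>\<close> homogeneous of
  degree \<open>n\<close> in \<open>a\<close> and in \<open>b\<close> separately. Hence rotating the phase of the regularised Fresnel integral of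
  \<open>exp (i\<langle>x,y\<rangle>)\<close> by \<open>w = e\<^bsup>i\<psi>\<^esup>\<close>, that is, replacing \<open>i q(a) - i q(b)\<close> by \<open>i w q(a) - i q(b)/w\<close>, does not
  change its value; at \<open>w = i\<close> it is dominated by the integral of \<open>exp (- (q(a) + q(b))/2)\<close>. This bounds
  \<open>\<nu>{q(a) \<le> 1, q(b) \<le> 1}\<close>, and so the volume of a multiple of \<open>D \<times> D\<degree>\<close>, from below.
\<close>

section \<open>Lebesgue measure on coordinate subspaces\<close>

text \<open>The Fresnel integral of exp (i<x,y>) is known exactly and does not depend on the body,
  but its integrand has modulus close to one and says nothing about volumes until phase is turned
  into decay. Turning it is possible because the integral is holomorphic in w and constant along
  rays, so its derivative vanishes. Constancy along rays dictates the form of \<open>J\<close>: the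
  pulled back density must be invariant under dilating a and b separately, and a field linear on
  finitely many cones has a density constant on products of cones, so that only linear maps need a
  change of variables and no Jacobian is computed. The duality map of a polytope norm is neither
  single valued nor strongly monotone; two quadratic penalties, on the coefficients and on the
  vector, repair this at the price of absolute constants. Symmetry of K - K turns one-sided bounds
  by functionals into bounds for |<u,x>|; volume grows by at most 4^n. In the upper bound the weight
  r^n e^(-r) concentrates near r = n, where (1 + r^(-2))^(n/2) is 1 + O(1/n); r below n/4
  contributes an exponentially small share of n!.\<close>

text \<open>A vector indexed by \<open>I\<close> is extended by \<open>0\<close>, so that all dimensions live in one type and
  the topology and the algebra are those of the function space.\<close>

instantiation "fun" :: (type, real_vector) real_vector
begin

definition scaleR_fun_def: "c *\<^sub>R f = (\<lambda>x. c *\<^sub>R f x)"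

instance
  by standard (auto simp: scaleR_fun_def fun_eq_iff algebra_simps)

end

lemma scaleR_fun_apply: "(c *\<^sub>R f) x = c *\<^sub>R f x"
  by (simp add: scaleR_fun_def)

type_synonym vec = "nat \<Rightarrow> real"

definition coord_space :: "nat set \<Rightarrow> vec set" where
  "coord_space I = {x. \<forall>i. i \<notin> I \<longrightarrow> x i = 0}"

definition zext :: "nat set \<Rightarrow> vec \<Rightarrow> vec" where
  "zext I x = (\<lambda>i. if i \<in> I then x i else 0)"

definition leb :: "nat set \<Rightarrow> vec measure" where
  "leb I = distr (PiM I (\<lambda>_. lborel)) borel (zext I)"

definition dot :: "nat set \<Rightarrow> vec \<Rightarrow> vec \<Rightarrow> real" where
  "dot I x y = (\<Sum>i\<in>I. x i * y i)"

lemma coord_space_algebra [simp]: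
  "0 \<in> coord_space I"
  "x \<in> coord_space I \<Longrightarrow> y \<in> coord_space I \<Longrightarrow> x + y \<in> coord_space I"
  "x \<in> coord_space I \<Longrightarrow> y \<in> coord_space I \<Longrightarrow> x - y \<in> coord_space I"
  "x \<in> coord_space I \<Longrightarrow> - x \<in> coord_space I"
  "x \<in> coord_space I \<Longrightarrow> c *\<^sub>R x \<in> coord_space I"
  by (auto simp: coord_space_def scaleR_fun_apply)

lemma zext_in_coord_space [simp]: "zext I x \<in> coord_space I"
  by (simp add: zext_def coord_space_def)

lemma zext_id: "x \<in> coord_space I \<Longrightarrow> zext I x = x"
  by (auto simp: zext_def coord_space_def fun_eq_iff)

lemma borel_measurable_vecI:
  fixes f :: "'a \<Rightarrow> vec"
  assumes "\<And>i. (\<lambda>x. f x i) \<in> borel_measurable M"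
  shows "f \<in> borel_measurable M"
  by (rule measurable_coordinatewise_then_product) (use assms in simp)

lemma measurable_component [measurable]: "(\<lambda>x::vec. x i) \<in> borel_measurable borel"
  by (intro borel_measurable_continuous_onI continuous_on_product_coordinates)

lemma measurable_component_comp [measurable (raw)]:
  fixes f :: "'a \<Rightarrow> vec"
  assumes "f \<in> borel_measurable M"
  shows "(\<lambda>x. f x i) \<in> borel_measurable M"
  using measurable_compose[OF assms measurable_component] .

lemma measurable_zext: "zext I \<in> measurable (PiM I (\<lambda>_. lborel)) borel"
proof (rule borel_measurable_vecI)
  fix i show "(\<lambda>x. zext I x i) \<in> borel_measurable (PiM I (\<lambda>_. lborel))"
    by (cases "i \<in> I") (auto simp: zext_def intro: measurable_component_singleton[where M="\<lambda>_. lborel", simplified])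
qed

lemma measurable_vec_upd [measurable (raw)]:
  fixes f :: "'a \<Rightarrow> vec"
  assumes [measurable]: "f \<in> borel_measurable M" "g \<in> borel_measurable M"
  shows "(\<lambda>x. (f x)(i := g x)) \<in> borel_measurable M"
proof (rule borel_measurable_vecI)
  fix k show "(\<lambda>x. ((f x)(i := g x)) k) \<in> borel_measurable M"
    by (cases "k = i") simp_all
qed

lemma measurable_fun_upd [measurable]: "fun_upd (x::vec) i \<in> borel_measurable borel"
  by (rule measurable_vec_upd[of "\<lambda>_. x" borel "\<lambda>t. t"]) simp_all

lemma measurable_vec_add [measurable (raw)]:
  fixes f g :: "'a \<Rightarrow> vec"
  assumes [measurable]: "f \<in> borel_measurable M" "g \<in> borel_measurable M"
  shows "(\<lambda>x. f x + g x) \<in> borel_measurable M"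
  by (rule borel_measurable_vecI) simp

lemma measurable_vec_diff [measurable (raw)]:
  fixes f g :: "'a \<Rightarrow> vec"
  assumes [measurable]: "f \<in> borel_measurable M" "g \<in> borel_measurable M"
  shows "(\<lambda>x. f x - g x) \<in> borel_measurable M"
  by (rule borel_measurable_vecI) simp

lemma measurable_vec_uminus [measurable (raw)]:
  fixes f :: "'a \<Rightarrow> vec"
  assumes [measurable]: "f \<in> borel_measurable M"
  shows "(\<lambda>x. - f x) \<in> borel_measurable M"
  by (rule borel_measurable_vecI) simp

lemma measurable_vec_scaleR [measurable (raw)]:
  fixes f :: "'a \<Rightarrow> vec"
  assumes [measurable]: "f \<in> borel_measurable M" "c \<in> borel_measurable M"
  shows "(\<lambda>x. c x *\<^sub>R f x) \<in> borel_measurable M"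
  by (rule borel_measurable_vecI) (simp add: scaleR_fun_apply)

lemma measurable_dot [measurable (raw)]:
  fixes f g :: "'a \<Rightarrow> vec"
  assumes [measurable]: "f \<in> borel_measurable M" "g \<in> borel_measurable M"
  shows "(\<lambda>x. dot I (f x) (g x)) \<in> borel_measurable M"
  unfolding dot_def by simp

lemma space_leb [simp]: "space (leb I) = UNIV"
  and sets_leb [simp, measurable_cong]: "sets (leb I) = sets borel"
  by (simp_all add: leb_def)

lemma nn_integral_leb:
  "f \<in> borel_measurable borel \<Longrightarrow>
    (\<integral>\<^sup>+x. f x \<partial>leb I) = (\<integral>\<^sup>+x. f (zext I x) \<partial>PiM I (\<lambda>_. lborel))"
  by (simp add: leb_def nn_integral_distr measurable_zext)

interpretation lborel_product: product_sigma_finite "\<lambda>_::nat. lborel :: real measure"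
  by standard

text \<open>Fubini in a single coordinate. Together with \<open>nn_integral_leb_empty\<close> it
  lets facts on boxes, translations, dilations, orthants and Gaussians be proved by induction on
  \<open>I\<close>, with only the line as analytic input.\<close>

lemma nn_integral_leb_insert:
  assumes "finite I" "i \<notin> I" and [measurable]: "f \<in> borel_measurable borel"
  shows "(\<integral>\<^sup>+x. f x \<partial>leb (insert i I)) = (\<integral>\<^sup>+x. (\<integral>\<^sup>+t. f (x(i := t)) \<partial>lborel) \<partial>leb I)"
proof -
  note measurable_zext[measurable]
  have eq: "zext (insert i I) (x(i := t)) = (zext I x)(i := t)" for x t
    using assms by (auto simp: zext_def)
  have "(\<integral>\<^sup>+x. f x \<partial>leb (insert i I)) =
      (\<integral>\<^sup>+x. f (zext (insert i I) x) \<partial>PiM (insert i I) (\<lambda>_. lborel))"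
    by (rule nn_integral_leb) fact
  also have "\<dots> = (\<integral>\<^sup>+x. (\<integral>\<^sup>+t. f (zext (insert i I) (x(i := t))) \<partial>lborel) \<partial>PiM I (\<lambda>_. lborel))"
    by (rule lborel_product.product_nn_integral_insert) (use assms in \<open>auto intro: measurable_compose[OF measurable_zext]\<close>)
  also have "\<dots> = (\<integral>\<^sup>+x. (\<integral>\<^sup>+t. f ((zext I x)(i := t)) \<partial>lborel) \<partial>PiM I (\<lambda>_. lborel))"
    by (simp add: eq)
  also have "\<dots> = (\<integral>\<^sup>+x. (\<integral>\<^sup>+t. f (x(i := t)) \<partial>lborel) \<partial>leb I)"
    by (subst nn_integral_leb) simp_all
  finally show ?thesis .
qed

lemma nn_integral_leb_empty:
  assumes [measurable]: "f \<in> borel_measurable borel"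
  shows "(\<integral>\<^sup>+x. f x \<partial>leb {}) = f 0"
proof -
  have "zext {} x = 0" for x by (simp add: zext_def fun_eq_iff)
  then show ?thesis
    by (subst nn_integral_leb) (simp_all add: PiM_empty nn_integral_count_space_finite)
qed

lemma AE_leb_coord_space: "AE x in leb I. x \<in> coord_space I"
proof -
  have "{x \<in> space borel. x \<in> coord_space I} = (\<Inter>i\<in>-I. {x \<in> space borel. (x::vec) i = 0})"
    by (auto simp: coord_space_def)
  also have "\<dots> \<in> sets borel"
  proof (cases "I = UNIV")
    case False
    then show ?thesis by (intro sets.countable_INT'') auto
  qed (simp)
  finally show ?thesis
    unfolding leb_def by (subst AE_distr_iff) (auto intro: measurable_zext)
qed

lemma emeasure_leb_box:
  assumes "finite I" "R \<ge> 0"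
  shows "emeasure (leb I) {x. \<forall>i\<in>I. \<bar>x i\<bar> \<le> R} = ennreal ((2 * R) ^ card I)"
  using assms(1)
proof (induction I)
  case empty
  have "emeasure (leb {}) UNIV = (\<integral>\<^sup>+x. 1 \<partial>leb {})"
    by simp
  also have "\<dots> = 1" by (rule nn_integral_leb_empty) simp
  finally show ?case by simp
next
  case (insert i I)
  have m[measurable]: "{x::vec. \<forall>k\<in>A. \<bar>x k\<bar> \<le> R} \<in> sets borel" if "finite A" for A
    using that by measurable
  have "emeasure (leb (insert i I)) {x. \<forall>i\<in>insert i I. \<bar>x i\<bar> \<le> R} =
     (\<integral>\<^sup>+x. indicator {x. \<forall>i\<in>insert i I. \<bar>x i\<bar> \<le> R} x \<partial>leb (insert i I))"
    using m[of "insert i I"] insert.hyps by simp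
  also have "\<dots> = (\<integral>\<^sup>+x. (\<integral>\<^sup>+t. indicator {x. \<forall>i\<in>insert i I. \<bar>x i\<bar> \<le> R} (x(i := t)) \<partial>lborel) \<partial>leb I)"
    using m[of "insert i I"] insert.hyps by (intro nn_integral_leb_insert) auto
  also have "\<dots> = (\<integral>\<^sup>+x. (\<integral>\<^sup>+t. indicator {x. \<forall>i\<in>I. \<bar>x i\<bar> \<le> R} x * indicator {-R..R} t \<partial>lborel) \<partial>leb I)"
    using insert.hyps by (intro nn_integral_cong) (auto simp: indicator_def)
  also have "\<dots> = (\<integral>\<^sup>+x. indicator {x. \<forall>i\<in>I. \<bar>x i\<bar> \<le> R} x * ennreal (2 * R) \<partial>leb I)"
    using assms by (subst nn_integral_cmult) auto
  also have "\<dots> = emeasure (leb I) {x. \<forall>i\<in>I. \<bar>x i\<bar> \<le> R} * ennreal (2 * R)"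
    using m[of I] insert.hyps by (subst nn_integral_multc) auto
  also have "\<dots> = ennreal ((2 * R) ^ card (insert i I))"
    using insert assms(2) by (simp add: ennreal_mult[symmetric] mult.commute)
  finally show ?case .
qed

lemma sigma_finite_leb:
  assumes "finite I" shows "sigma_finite_measure (leb I)"
proof
  let ?A = "range (\<lambda>k::nat. {x::vec. \<forall>i\<in>I. \<bar>x i\<bar> \<le> real k})"
  show "\<exists>A. countable A \<and> A \<subseteq> sets (leb I) \<and> \<Union>A = space (leb I) \<and> (\<forall>a\<in>A. emeasure (leb I) a \<noteq> \<infinity>)"
  proof (intro exI[of _ ?A] conjI ballI)
    show "?A \<subseteq> sets (leb I)" using assms by auto
    show "\<Union>?A = space (leb I)"
    proof -
      have "\<exists>k::nat. \<forall>i\<in>I. \<bar>x i\<bar> \<le> real k" for x :: vec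
      proof -
        obtain k :: nat where "(\<Sum>i\<in>I. \<bar>x i\<bar>) \<le> real k" using real_arch_simple by blast
        moreover have "\<bar>x i\<bar> \<le> (\<Sum>i\<in>I. \<bar>x i\<bar>)" if "i \<in> I" for i
          using that assms by (intro member_le_sum) auto
        ultimately show ?thesis by (meson order_trans)
      qed
      then show ?thesis by auto
    qed
    fix a assume "a \<in> ?A"
    then show "emeasure (leb I) a \<noteq> \<infinity>"
      using assms by (auto simp: emeasure_leb_box)
  qed simp
qed

section \<open>Translations and dilations of Lebesgue measure\<close>

lemma nn_integral_leb_translate:
  assumes "finite I" and "v \<in> coord_space I" and "f \<in> borel_measurable borel"
  shows "(\<integral>\<^sup>+x. f (x + v) \<partial>leb I) = (\<integral>\<^sup>+x. f x \<partial>leb I)"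
  using assms
proof (induction I arbitrary: v f)
  case empty
  note [measurable] = empty.prems(2)
  have "v = 0" using empty by (auto simp: coord_space_def fun_eq_iff)
  then show ?case by simp
next
  case (insert i I)
  note [measurable] = insert.prems(2)
  define w where "w = v(i := 0)"
  have w: "w \<in> coord_space I" using insert.prems by (auto simp: w_def coord_space_def)
  have eq: "x(i := t) + v = (x + w)(i := t + v i)" for x t
    by (auto simp: w_def fun_eq_iff)
  interpret sigma_finite_measure "leb I" by (rule sigma_finite_leb) fact
  have "(\<integral>\<^sup>+x. f (x + v) \<partial>leb (insert i I)) =
      (\<integral>\<^sup>+x. (\<integral>\<^sup>+t. f (x(i := t) + v) \<partial>lborel) \<partial>leb I)"
    using insert.hyps by (intro nn_integral_leb_insert) auto
  also have "\<dots> = (\<integral>\<^sup>+x. (\<integral>\<^sup>+t. f ((x + w)(i := v i + 1 * t)) \<partial>lborel) \<partial>leb I)"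
    by (simp only: eq mult_1 add.commute[of "v i"])
  also have "\<dots> = (\<integral>\<^sup>+x. (\<integral>\<^sup>+t. f ((x + w)(i := t)) \<partial>lborel) \<partial>leb I)"
  proof (rule nn_integral_cong)
    fix x
    show "(\<integral>\<^sup>+t. f ((x + w)(i := v i + 1 * t)) \<partial>lborel) = (\<integral>\<^sup>+t. f ((x + w)(i := t)) \<partial>lborel)"
      using nn_integral_real_affine[where c=1 and t="v i" and f="\<lambda>t. f ((x + w)(i := t))"] by simp
  qed
  also have "\<dots> = (\<integral>\<^sup>+x. (\<integral>\<^sup>+t. f (x(i := t)) \<partial>lborel) \<partial>leb I)"
    by (rule insert.IH[OF w]) measurable
  also have "\<dots> = (\<integral>\<^sup>+x. f x \<partial>leb (insert i I))"
    using insert.hyps by (intro nn_integral_leb_insert[symmetric]) auto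
  finally show ?case .
qed

lemma nn_integral_leb_scale:
  assumes "finite I" and "c \<noteq> 0" and "f \<in> borel_measurable borel"
  shows "(\<integral>\<^sup>+x. f x \<partial>leb I) = ennreal (\<bar>c\<bar> ^ card I) * (\<integral>\<^sup>+x. f (c *\<^sub>R x) \<partial>leb I)"
  using assms
proof (induction I arbitrary: f)
  case empty
  note [measurable] = empty.prems(2)
  have "(\<integral>\<^sup>+x. f (c *\<^sub>R x) \<partial>leb {}) = f (c *\<^sub>R 0)"
    by (rule nn_integral_leb_empty) measurable
  then show ?case by (simp add: nn_integral_leb_empty)
next
  case (insert i I)
  note [measurable] = insert.prems(2)
  have eq: "c *\<^sub>R (x(i := t)) = (c *\<^sub>R x)(i := 0 + c * t)" for x :: vec and t
    by (auto simp: fun_eq_iff scaleR_fun_apply)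
  have "(\<integral>\<^sup>+x. f x \<partial>leb (insert i I)) = (\<integral>\<^sup>+x. (\<integral>\<^sup>+t. f (x(i := t)) \<partial>lborel) \<partial>leb I)"
    using insert.hyps by (intro nn_integral_leb_insert) auto
  also have "\<dots> = (\<integral>\<^sup>+x. ennreal \<bar>c\<bar> * (\<integral>\<^sup>+t. f (x(i := 0 + c * t)) \<partial>lborel) \<partial>leb I)"
    using insert.prems(1) by (intro nn_integral_cong nn_integral_real_affine) auto
  also have "\<dots> = ennreal \<bar>c\<bar> * (\<integral>\<^sup>+x. (\<integral>\<^sup>+t. f (x(i := 0 + c * t)) \<partial>lborel) \<partial>leb I)"
    by (rule nn_integral_cmult) simp
  also have "(\<integral>\<^sup>+x. (\<integral>\<^sup>+t. f (x(i := 0 + c * t)) \<partial>lborel) \<partial>leb I) = ennreal (\<bar>c\<bar> ^ card I) *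
     (\<integral>\<^sup>+x. (\<integral>\<^sup>+t. f ((c *\<^sub>R x)(i := 0 + c * t)) \<partial>lborel) \<partial>leb I)"
    by (rule insert.IH[OF insert.prems(1)]) measurable
  also have "(\<integral>\<^sup>+x. (\<integral>\<^sup>+t. f ((c *\<^sub>R x)(i := 0 + c * t)) \<partial>lborel) \<partial>leb I) =
     (\<integral>\<^sup>+x. f (c *\<^sub>R x) \<partial>leb (insert i I))"
    using insert.hyps by (subst nn_integral_leb_insert) (simp_all add: eq)
  finally show ?case
    using insert.hyps by (simp add: mult.assoc[symmetric] ennreal_mult)
qed

lemma nn_integral_leb_uminus:
  assumes "finite I" "f \<in> borel_measurable borel"
  shows "(\<integral>\<^sup>+x. f (- x) \<partial>leb I) = (\<integral>\<^sup>+x. f x \<partial>leb I)"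
  using nn_integral_leb_scale[of I "-1" f] assms by simp

lemma emeasure_leb_scale:
  assumes "finite I" and "c > 0" and [measurable]: "A \<in> sets borel"
  shows "emeasure (leb I) ((\<lambda>x. c *\<^sub>R x) ` A) = ennreal (c ^ card I) * emeasure (leb I) A"
proof -
  have img: "(\<lambda>x. c *\<^sub>R x) ` A = (\<lambda>x. (1/c) *\<^sub>R x) -` A \<inter> space borel"
  proof -
    have "x \<in> (\<lambda>x. c *\<^sub>R x) ` A" if "(1/c) *\<^sub>R x \<in> A" for x
      using that assms(2) by (intro image_eqI[of _ _ "(1/c) *\<^sub>R x"]) auto
    then show ?thesis using assms(2) by auto
  qed
  have m[measurable]: "(\<lambda>x. c *\<^sub>R x) ` A \<in> sets borel"
    unfolding img by measurable
  have "emeasure (leb I) ((\<lambda>x. c *\<^sub>R x) ` A) = (\<integral>\<^sup>+x. indicator ((\<lambda>x. c *\<^sub>R x) ` A) x \<partial>leb I)"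
    by simp
  also have "\<dots> = ennreal (\<bar>c\<bar> ^ card I) * (\<integral>\<^sup>+x. indicator ((\<lambda>x. c *\<^sub>R x) ` A) (c *\<^sub>R x) \<partial>leb I)"
    using assms by (intro nn_integral_leb_scale) auto
  also have "(\<lambda>x. indicator ((\<lambda>x. c *\<^sub>R x) ` A) (c *\<^sub>R x) :: ennreal) = indicator A"
    using assms(2) by (intro ext) (auto simp: indicator_def)
  finally show ?thesis using assms(2) by (simp only: abs_of_pos) simp
qed

section \<open>The inner product of coordinate vectors\<close>

lemma dot_simps:
  "dot I (x + y) z = dot I x z + dot I y z"
  "dot I z (x + y) = dot I z x + dot I z y"
  "dot I (x - y) z = dot I x z - dot I y z"
  "dot I z (x - y) = dot I z x - dot I z y"
  "dot I (c *\<^sub>R x) z = c * dot I x z"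
  "dot I z (c *\<^sub>R x) = c * dot I z x"
  "dot I (- x) z = - dot I x z"
  "dot I z (- x) = - dot I z x"
  "dot I 0 z = 0" "dot I z 0 = 0"
  by (simp_all add: dot_def scaleR_fun_apply algebra_simps sum.distrib sum_subtractf sum_distrib_left sum_negf)

lemma dot_commute: "dot I x y = dot I y x"
  by (simp add: dot_def mult.commute)

lemma dot_nonneg [simp]: "dot I x x \<ge> 0"
  by (simp add: dot_def sum_nonneg)

lemma dot_eq_0_iff:
  assumes "finite I" "x \<in> coord_space I"
  shows "dot I x x = 0 \<longleftrightarrow> x = 0"
proof -
  have "dot I x x = 0 \<longleftrightarrow> (\<forall>i\<in>I. x i * x i = 0)"
    unfolding dot_def using assms by (intro sum_nonneg_eq_0_iff) auto
  then show ?thesis using assms by (auto simp: coord_space_def fun_eq_iff)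
qed

lemma dot_Cauchy_Schwarz: "(dot I x y)\<^sup>2 \<le> dot I x x * dot I y y"
  unfolding dot_def using Cauchy_Schwarz_ineq_sum[of x y I] by (simp add: power2_eq_square)

lemma dot_AM_GM: "2 * \<bar>dot I x y\<bar> \<le> dot I x x + dot I y y"
proof -
  have "0 \<le> dot I (x - y) (x - y)" "0 \<le> dot I (x + y) (x + y)" by simp_all
  then show ?thesis by (simp add: dot_simps dot_commute[of I y x])
qed

lemma component_le_dot: "finite I \<Longrightarrow> i \<in> I \<Longrightarrow> (x i)\<^sup>2 \<le> dot I x x"
  unfolding dot_def power2_eq_square by (rule member_le_sum) auto

section \<open>The Prekopa-Leindler inequality\<close>

lemma nn_integral_layer_cake:
  assumes "sigma_finite_measure M" and [measurable]: "f \<in> borel_measurable M"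
  shows "(\<integral>\<^sup>+x. f x \<partial>M) =
    (\<integral>\<^sup>+t. indicator {0..} t * emeasure M {x \<in> space M. ennreal t < f x} \<partial>lborel)"
proof -
  interpret M: sigma_finite_measure M by fact
  interpret pair_sigma_finite M lborel ..
  have f: "f x = (\<integral>\<^sup>+t. indicator {0..} t * (if ennreal t < f x then 1 else 0) \<partial>lborel)" for x
  proof (cases "f x")
    case (real c)
    have "(\<integral>\<^sup>+t. indicator {0..} t * (if ennreal t < f x then 1 else 0) \<partial>lborel) = (\<integral>\<^sup>+t. indicator {0..<c} t \<partial>lborel)"
      using real by (intro nn_integral_cong) (auto simp: indicator_def ennreal_less_iff)
    also have "\<dots> = ennreal c" using real by simp
    finally show ?thesis using real by simp
  next
    case top
    have "(\<integral>\<^sup>+t. indicator {0..} t * (if ennreal t < f x then 1 else 0) \<partial>lborel) = (\<integral>\<^sup>+t. indicator {0::real..} t \<partial>lborel)"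
      using top by (intro nn_integral_cong) (auto simp: indicator_def)
    also have "\<dots> = emeasure lborel {0::real..}" by simp
    also have "\<dots> = \<infinity>"
    proof (rule ccontr)
      assume "emeasure lborel {0::real..} \<noteq> \<infinity>"
      then obtain c where c: "emeasure lborel {0::real..} = ennreal c" "c \<ge> 0"
        by (cases "emeasure lborel {0::real..}") auto
      have "emeasure lborel {0..c + 1} \<le> emeasure lborel {0::real..}"
        by (intro emeasure_mono) auto
      then show False using c by (simp add: ennreal_le_iff)
    qed
    finally show ?thesis using top by simp
  qed
  have "(\<integral>\<^sup>+x. f x \<partial>M) = (\<integral>\<^sup>+x. (\<integral>\<^sup>+t. indicator {0..} t * (if ennreal t < f x then 1 else 0) \<partial>lborel) \<partial>M)"
    by (subst f) simp
  also have "\<dots> = (\<integral>\<^sup>+t. (\<integral>\<^sup>+x. indicator {0..} t * (if ennreal t < f x then 1 else 0) \<partial>M) \<partial>lborel)"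
    by (rule Fubini'[symmetric]) measurable
  also have "\<dots> = (\<integral>\<^sup>+t. indicator {0..} t * emeasure M {x \<in> space M. ennreal t < f x} \<partial>lborel)"
  proof (intro nn_integral_cong)
    fix t :: real
    have "(\<integral>\<^sup>+x. (if ennreal t < f x then 1 else 0) \<partial>M) = (\<integral>\<^sup>+x. indicator {x \<in> space M. ennreal t < f x} x \<partial>M)"
      by (intro nn_integral_cong) (auto simp: indicator_def)
    also have "\<dots> = emeasure M {x \<in> space M. ennreal t < f x}" by simp
    finally show "(\<integral>\<^sup>+x. indicator {0..} t * (if ennreal t < f x then 1 else 0) \<partial>M) =
       indicator {0..} t * emeasure M {x \<in> space M. ennreal t < f x}"
      by (subst nn_integral_cmult) auto
  qed
  finally show ?thesis .
qed

text \<open>Stands in for the supremum of \<open>A\<close>, which may be infinite or not attained: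
  \<open>Brunn_Minkowski_line\<close> needs points of the sets themselves, because only midpoints of
  such points are known to lie in \<open>C\<close>.\<close>

lemma cofinal_sequence:
  fixes A :: "real set"
  assumes "A \<noteq> {}"
  obtains a :: "nat \<Rightarrow> real" where "range a \<subseteq> A" "incseq a" "A \<subseteq> (\<Union>k. {..a k})"
proof -
  have "\<exists>a::nat \<Rightarrow> real. range a \<subseteq> A \<and> A \<subseteq> (\<Union>k. {..a k})"
  proof (cases "\<exists>m\<in>A. \<forall>x\<in>A. x \<le> m")
    case True
    then obtain m where "m \<in> A" "\<forall>x\<in>A. x \<le> m" by auto
    then show ?thesis by (intro exI[of _ "\<lambda>_. m"]) auto
  next
    case nomax: False
    show ?thesis
    proof (cases "bdd_above A")
      case True
      define s where "s = Sup A"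
      have "\<exists>x\<in>A. s - 1 / Suc k < x" for k
        using less_cSup_iff[OF assms True, of "s - 1 / Suc k"] by (simp add: s_def)
      then obtain a where a: "\<And>k. a k \<in> A" "\<And>k::nat. s - 1 / Suc k < a k" by metis
      have "\<exists>k. x \<le> a k" if xA: "x \<in> A" for x
      proof -
        obtain y where y: "y \<in> A" "x < y" using nomax xA by (meson not_le)
        have "y \<le> s" unfolding s_def using y True by (intro cSup_upper) auto
        then have "0 < s - x" using y by simp
        then obtain k where "1 / real (Suc k) < s - x" using nat_approx_posE by blast
        with a(2)[of k] show ?thesis by (intro exI[of _ k]) linarith
      qed
      then show ?thesis using a by (intro exI[of _ a]) auto
    next
      case False
      then have "\<exists>x\<in>A. real k < x" for k
        unfolding bdd_above_def by (meson not_le)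
      then obtain a where a: "\<And>k. a k \<in> A" "\<And>k::nat. real k < a k" by metis
      have "\<exists>k. x \<le> a k" for x
      proof -
        obtain k :: nat where "x \<le> real k" using real_arch_simple by blast
        with a(2)[of k] show ?thesis by (intro exI[of _ k]) linarith
      qed
      then show ?thesis using a by (intro exI[of _ a]) auto
    qed
  qed
  then obtain a :: "nat \<Rightarrow> real" where a: "range a \<subseteq> A" "A \<subseteq> (\<Union>k. {..a k})" by auto
  \<comment> \<open>Running maxima make the sequence increasing without leaving
    \<open>A\<close>.\<close>
  define b where "b k = Max (a ` {..k})" for k
  have "b k \<in> a ` {..k}" for k unfolding b_def by (rule Max_in) auto
  then have "range b \<subseteq> A" using a(1) by blast
  moreover have "incseq b" unfolding b_def by (intro incseq_SucI Max_mono) auto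
  moreover have ab: "a k \<le> b k" for k unfolding b_def by (rule Max_ge) auto
  moreover have "A \<subseteq> (\<Union>k. {..b k})"
  proof
    fix x assume "x \<in> A"
    then obtain k where "x \<le> a k" using a(2) by auto
    with ab[of k] show "x \<in> (\<Union>k. {..b k})" by (auto intro: order_trans)
  qed
  ultimately show ?thesis using that by blast
qed

text \<open>Cut \<open>A\<close> at one of its points a and \<open>B\<close> at one of its points b.
  Midpoints of b with the part of \<open>A\<close> left of a lie in \<open>C\<close> left of (a +
  b)/2, midpoints of a with the part of \<open>B\<close> right of b lie in \<open>C\<close> right of
  it, and the two pieces share at most one point. Letting a run to the right end of \<open>A\<close>
  and b to the left end of \<open>B\<close> exhausts both sets.\<close>

lemma Brunn_Minkowski_line:
  fixes A B C :: "real set"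
  assumes [measurable]: "A \<in> sets borel" "B \<in> sets borel" "C \<in> sets borel"
    and "A \<noteq> {}" "B \<noteq> {}" and C: "\<And>a b. a \<in> A \<Longrightarrow> b \<in> B \<Longrightarrow> (a + b) / 2 \<in> C"
  shows "emeasure lborel A + emeasure lborel B \<le> 2 * emeasure lborel C"
proof -
  have half: "emeasure lborel X \<le> 2 * emeasure lborel Y"
    if [measurable]: "X \<in> sets borel" "Y \<in> sets borel" and XY: "\<And>x. x \<in> X \<Longrightarrow> (x + c) / 2 \<in> Y"
    for X Y :: "real set" and c
  proof -
    have "emeasure lborel X = (\<integral>\<^sup>+x. indicator X x \<partial>lborel)" by simp
    also have "\<dots> = ennreal \<bar>2\<bar> * (\<integral>\<^sup>+x. indicator X (- c + 2 * x) \<partial>lborel)"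
      by (rule nn_integral_real_affine) auto
    also have "\<dots> \<le> ennreal \<bar>2\<bar> * (\<integral>\<^sup>+x. indicator Y x \<partial>lborel)"
    proof (intro mult_left_mono nn_integral_mono)
      fix x :: real
      show "indicator X (- c + 2 * x) \<le> (indicator Y x :: ennreal)"
        using XY[of "- c + 2 * x"] by (auto simp: indicator_def)
    qed simp
    finally show ?thesis by simp
  qed
  have step: "emeasure lborel (A \<inter> {..a}) + emeasure lborel (B \<inter> {b..}) \<le> 2 * emeasure lborel C"
    if "a \<in> A" "b \<in> B" for a b
  proof -
    let ?m = "(a + b) / 2"
    have "emeasure lborel (A \<inter> {..a}) \<le> 2 * emeasure lborel (C \<inter> {..?m})"
      by (rule half[of _ _ b]) (use C that in \<open>auto simp: field_simps\<close>)
    moreover have "emeasure lborel (B \<inter> {b..}) \<le> 2 * emeasure lborel (C \<inter> {?m..})"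
      by (rule half[of _ _ a]) (use C that in \<open>auto simp: add.commute[of _ a]\<close>)
    moreover have "emeasure lborel (C \<inter> {?m..}) = emeasure lborel (C \<inter> {?m<..})"
    proof (rule emeasure_eq_AE)
      show "AE x in lborel. (x \<in> C \<inter> {?m..}) = (x \<in> C \<inter> {?m<..})"
        using AE_lborel_singleton[of ?m] by eventually_elim auto
    qed auto
    moreover have "emeasure lborel (C \<inter> {..?m}) + emeasure lborel (C \<inter> {?m<..}) = emeasure lborel C"
    proof -
      have "emeasure lborel (C \<inter> {..?m}) + emeasure lborel (C \<inter> {?m<..}) = emeasure lborel ((C \<inter> {..?m}) \<union> (C \<inter> {?m<..}))"
        by (intro plus_emeasure) auto
      also have "(C \<inter> {..?m}) \<union> (C \<inter> {?m<..}) = C" by auto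
      finally show ?thesis .
    qed
    ultimately show ?thesis
      by (metis add_mono distrib_left)
  qed
  obtain a where a: "range a \<subseteq> A" "incseq a" "A \<subseteq> (\<Union>k. {..a k})"
    using cofinal_sequence[OF \<open>A \<noteq> {}\<close>] by blast
  obtain b' where b': "range b' \<subseteq> uminus ` B" "incseq b'" "uminus ` B \<subseteq> (\<Union>k. {..b' k})"
  proof -
    have "uminus ` B \<noteq> {}" using \<open>B \<noteq> {}\<close> by simp
    from cofinal_sequence[OF this] that show ?thesis by blast
  qed
  define b where "b k = - b' k" for k
  have b: "b k \<in> B" for k
  proof -
    have "b' k \<in> uminus ` B" using b'(1) by blast
    then show ?thesis by (auto simp: b_def)
  qed
  have bdec: "b l \<le> b k" if "k \<le> l" for k l using b'(2) that by (auto simp: b_def incseq_def)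
  have bcov: "\<exists>k. b k \<le> x" if "x \<in> B" for x
  proof -
    have "- x \<in> (\<Union>k. {..b' k})" using b'(3) that by blast
    then show ?thesis by (auto simp: b_def intro: minus_le_iff[THEN iffD1])
  qed
  have A: "emeasure lborel A = (SUP k. emeasure lborel (A \<inter> {..a k}))"
  proof -
    have "A = (\<Union>k. A \<inter> {..a k})" using a(3) by auto
    then have "emeasure lborel A = emeasure lborel (\<Union>k. A \<inter> {..a k})" by simp
    also have "\<dots> = (SUP k. emeasure lborel (A \<inter> {..a k}))"
      by (rule SUP_emeasure_incseq[symmetric])
         (use a(2) in \<open>auto simp: incseq_def intro: order_trans\<close>)
    finally show ?thesis .
  qed
  have B: "emeasure lborel B = (SUP k. emeasure lborel (B \<inter> {b k..}))"
  proof -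
    have "B = (\<Union>k. B \<inter> {b k..})" using bcov by auto
    then have "emeasure lborel B = emeasure lborel (\<Union>k. B \<inter> {b k..})" by simp
    also have "\<dots> = (SUP k. emeasure lborel (B \<inter> {b k..}))"
      by (rule SUP_emeasure_incseq[symmetric])
         (use bdec in \<open>auto simp: incseq_def intro: order_trans\<close>)
    finally show ?thesis .
  qed
  have "emeasure lborel A + emeasure lborel B = (SUP k. emeasure lborel (A \<inter> {..a k}) + emeasure lborel (B \<inter> {b k..}))"
    unfolding A B
  proof (rule ennreal_SUP_add[symmetric])
    show "incseq (\<lambda>k. emeasure lborel (A \<inter> {..a k}))"
      using a(2) by (auto simp: incseq_def intro!: emeasure_mono intro: order_trans)
    show "incseq (\<lambda>k. emeasure lborel (B \<inter> {b k..}))"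
      using bdec by (auto simp: incseq_def intro!: emeasure_mono intro: order_trans)
  qed
  also have "\<dots> \<le> 2 * emeasure lborel C"
    using a(1) b by (intro SUP_least step) auto
  finally show ?thesis .
qed

lemma ennreal_AM_GM: "4 * (a * b) \<le> (a + b)\<^sup>2" for a b :: ennreal
proof (cases "a = \<infinity> \<or> b = \<infinity>")
  case True
  then show ?thesis by (auto simp: power2_eq_square ennreal_top_mult ennreal_mult_top)
next
  case False
  then obtain x y where xy: "a = ennreal x" "b = ennreal y" "x \<ge> 0" "y \<ge> 0"
    by (cases a; cases b) auto
  have "4 * (x * y) \<le> (x + y)\<^sup>2"
    using zero_le_power2[of "x - y"] by (simp add: power2_eq_square algebra_simps)
  then have "ennreal (4 * (x * y)) \<le> ennreal ((x + y)\<^sup>2)" by (rule ennreal_leI)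
  then show ?thesis using xy
    by (simp add: ennreal_mult ennreal_power[symmetric] flip: ennreal_plus)
qed

text \<open>Supremum one for both functions makes every superlevel set below height 1 nonempty, so
  the Brunn-Minkowski inequality on the line applies at each height. Integrating over the heights
  gives an inequality for the sum of the integrals, which is stronger than the one for their
  product.\<close>

lemma Prekopa_Leindler_normalized:
  fixes f g h :: "real \<Rightarrow> ennreal"
  assumes [measurable]: "f \<in> borel_measurable borel" "g \<in> borel_measurable borel" "h \<in> borel_measurable borel"
    and le1: "\<And>x. f x \<le> 1" "\<And>x. g x \<le> 1"
    and sup1: "\<And>r. 0 \<le> r \<Longrightarrow> r < 1 \<Longrightarrow> \<exists>x. ennreal r < f x" "\<And>r. 0 \<le> r \<Longrightarrow> r < 1 \<Longrightarrow> \<exists>x. ennreal r < g x"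
    and fgh: "\<And>s t. f s * g t \<le> (h ((s + t) / 2))\<^sup>2"
  shows "(\<integral>\<^sup>+x. f x \<partial>lborel) + (\<integral>\<^sup>+x. g x \<partial>lborel) \<le> 2 * (\<integral>\<^sup>+x. h x \<partial>lborel)"
proof -
  note lc = nn_integral_layer_cake[OF sigma_finite_lborel]
  let ?E = "\<lambda>u t. emeasure lborel {x \<in> space lborel. ennreal t < u x}"
  have key: "?E f t + ?E g t \<le> 2 * ?E h t" if "0 \<le> t" for t
  proof (cases "t < 1")
    case True
    show ?thesis
    proof (rule Brunn_Minkowski_line)
      fix a b assume "a \<in> {x \<in> space lborel. ennreal t < f x}" "b \<in> {x \<in> space lborel. ennreal t < g x}"
      then have ab: "ennreal t < f a" "ennreal t < g b" by auto
      obtain p where p: "f a = ennreal p" "p \<ge> 0" using le1(1)[of a] by (cases "f a") (auto simp: top_unique)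
      obtain q where q: "g b = ennreal q" "q \<ge> 0" using le1(2)[of b] by (cases "g b") (auto simp: top_unique)
      have "t * t < p * q" using ab p q that by (intro mult_strict_mono) (auto simp: ennreal_less_iff)
      then have "ennreal t * ennreal t < f a * g b"
        using p q that by (simp add: ennreal_less_iff flip: ennreal_mult)
      with fgh[of a b] have "(ennreal t)\<^sup>2 < (h ((a + b) / 2))\<^sup>2"
        by (simp add: power2_eq_square)
      then have "ennreal t < h ((a + b) / 2)"
        by (meson not_le power_mono zero_le)
      then show "(a + b) / 2 \<in> {x \<in> space lborel. ennreal t < h x}" by simp
    qed (use sup1[OF that True] in auto)
  next
    case False
    then have "1 \<le> ennreal t" by (simp add: ennreal_ge_1)
    then have "{x \<in> space lborel. ennreal t < f x} = {}" "{x \<in> space lborel. ennreal t < g x} = {}"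
      using order_trans[OF le1(1)] order_trans[OF le1(2)] by (auto simp: not_less)
    then show ?thesis by simp
  qed
  have "(\<integral>\<^sup>+x. f x \<partial>lborel) + (\<integral>\<^sup>+x. g x \<partial>lborel) =
     (\<integral>\<^sup>+t. indicator {0..} t * ?E f t + indicator {0..} t * ?E g t \<partial>lborel)"
    by (subst lc[of f], simp, subst lc[of g], simp, rule nn_integral_add[symmetric]) measurable
  also have "\<dots> \<le> (\<integral>\<^sup>+t. 2 * (indicator {0..} t * ?E h t) \<partial>lborel)"
    using key by (intro nn_integral_mono) (auto simp: indicator_def)
  also have "\<dots> = 2 * (\<integral>\<^sup>+x. h x \<partial>lborel)"
    by (subst lc[of h], simp, rule nn_integral_cmult) measurable
  finally show ?thesis .
qed

text \<open>Dividing \<open>f\<close> and \<open>g\<close> by their suprema a and b and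
  \<open>h\<close> by sqrt (a b) keeps the hypothesis and normalises both suprema. The inequality
  for the sum then yields the one for the product by AM-GM, and the normalising factors
  cancel.\<close>

lemma Prekopa_Leindler_bounded:
  fixes f g h :: "real \<Rightarrow> ennreal"
  assumes [measurable]: "f \<in> borel_measurable borel" "g \<in> borel_measurable borel" "h \<in> borel_measurable borel"
    and bnd: "\<And>x. f x \<le> ennreal K" "\<And>x. g x \<le> ennreal K"
    and fgh: "\<And>s t. f s * g t \<le> (h ((s + t) / 2))\<^sup>2"
  shows "(\<integral>\<^sup>+x. f x \<partial>lborel) * (\<integral>\<^sup>+x. g x \<partial>lborel) \<le> (\<integral>\<^sup>+x. h x \<partial>lborel)\<^sup>2"
proof (cases "(\<forall>x. f x = 0) \<or> (\<forall>x. g x = 0)")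
  case True
  then show ?thesis by auto
next
  case False
  have ex: "\<exists>c>0. (\<forall>x. u x \<le> ennreal c) \<and> (\<forall>r. 0 \<le> r \<longrightarrow> r < 1 \<longrightarrow> (\<exists>x. ennreal (r * c) < u x))"
    if nz: "\<not> (\<forall>x. u x = 0)" and b: "\<And>x. u x \<le> ennreal K" for u :: "real \<Rightarrow> ennreal"
  proof -
    have "(SUP x. u x) \<le> ennreal K" by (intro SUP_least b)
    then obtain c where c: "(SUP x. u x) = ennreal c" "c \<ge> 0"
      by (cases "SUP x. u x") (auto simp: top_unique)
    obtain x0 where "u x0 \<noteq> 0" using nz by auto
    then have "0 < u x0" by (simp add: zero_less_iff_neq_zero)
    also have "u x0 \<le> ennreal c" unfolding c(1)[symmetric] by (rule SUP_upper) simp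
    finally have "c > 0" using ennreal_less_zero_iff by blast
    moreover have "\<exists>x. ennreal (r * c) < u x" if "0 \<le> r" "r < 1" for r
    proof -
      have "ennreal (r * c) < (SUP x. u x)" unfolding c(1) using that \<open>c > 0\<close> by (simp add: ennreal_less_iff)
      then show ?thesis by (auto simp: less_SUP_iff)
    qed
    moreover have "u x \<le> ennreal c" for x unfolding c(1)[symmetric] by (rule SUP_upper) simp
    ultimately show ?thesis by blast
  qed
  obtain a where a: "a > 0" "\<And>x. f x \<le> ennreal a" "\<And>r. 0 \<le> r \<Longrightarrow> r < 1 \<Longrightarrow> \<exists>x. ennreal (r * a) < f x"
    using ex[of f] False bnd(1) by auto
  obtain b where b: "b > 0" "\<And>x. g x \<le> ennreal b" "\<And>r. 0 \<le> r \<Longrightarrow> r < 1 \<Longrightarrow> \<exists>x. ennreal (r * b) < g x"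
    using ex[of g] False bnd(2) by auto
  define F where "F x = ennreal (1/a) * f x" for x
  define G where "G x = ennreal (1/b) * g x" for x
  define H where "H x = ennreal (1/sqrt (a*b)) * h x" for x
  have inv: "ennreal (1/c) * ennreal c = 1" if "c > 0" for c
    using that by (simp flip: ennreal_mult)
  have [measurable]: "F \<in> borel_measurable borel" "G \<in> borel_measurable borel" "H \<in> borel_measurable borel"
    unfolding F_def G_def H_def by measurable
  have "(\<integral>\<^sup>+x. F x \<partial>lborel) + (\<integral>\<^sup>+x. G x \<partial>lborel) \<le> 2 * (\<integral>\<^sup>+x. H x \<partial>lborel)"
  proof (rule Prekopa_Leindler_normalized)
    show "F x \<le> 1" for x unfolding F_def using mult_left_mono[OF a(2)[of x], of "ennreal (1/a)"] inv[OF a(1)] by simp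
    show "G x \<le> 1" for x unfolding G_def using mult_left_mono[OF b(2)[of x], of "ennreal (1/b)"] inv[OF b(1)] by simp
    show "\<exists>x. ennreal r < F x" if r: "0 \<le> r" "r < 1" for r
    proof -
      obtain x where "ennreal (r * a) < f x" using a(3)[OF r] by auto
      then have "ennreal (1/a) * ennreal (r * a) < F x" unfolding F_def
        using a(1) by (intro ennreal_mult_strict_left_mono) auto
      also have "ennreal (1/a) * ennreal (r * a) = ennreal r"
        using a(1) r by (simp flip: ennreal_mult)
      finally show ?thesis by auto
    qed
    show "\<exists>x. ennreal r < G x" if r: "0 \<le> r" "r < 1" for r
    proof -
      obtain x where "ennreal (r * b) < g x" using b(3)[OF r] by auto
      then have "ennreal (1/b) * ennreal (r * b) < G x" unfolding G_def
        using b(1) by (intro ennreal_mult_strict_left_mono) auto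
      also have "ennreal (1/b) * ennreal (r * b) = ennreal r"
        using b(1) r by (simp flip: ennreal_mult)
      finally show ?thesis by auto
    qed
    show "F s * G t \<le> (H ((s + t) / 2))\<^sup>2" for s t
    proof -
      have "(ennreal (1 / sqrt (a*b)))\<^sup>2 = ennreal (1/a) * ennreal (1/b)"
        using a(1) b(1) by (simp add: ennreal_power flip: ennreal_mult) (simp add: power_divide)
      then have "(H ((s + t) / 2))\<^sup>2 = ennreal (1/a) * ennreal (1/b) * (h ((s + t) / 2))\<^sup>2"
        unfolding H_def by (simp add: power_mult_distrib)
      moreover have "F s * G t = ennreal (1/a) * ennreal (1/b) * (f s * g t)"
        unfolding F_def G_def by (simp add: ac_simps)
      ultimately show ?thesis using fgh[of s t] by (simp add: mult_left_mono)
    qed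
  qed measurable
  then have le: "((\<integral>\<^sup>+x. F x \<partial>lborel) + (\<integral>\<^sup>+x. G x \<partial>lborel))\<^sup>2 \<le> 4 * (\<integral>\<^sup>+x. H x \<partial>lborel)\<^sup>2"
    using power_mono[of "(\<integral>\<^sup>+x. F x \<partial>lborel) + (\<integral>\<^sup>+x. G x \<partial>lborel)" _ 2]
    by (fastforce simp: power_mult_distrib)
  have "4 * ((\<integral>\<^sup>+x. F x \<partial>lborel) * (\<integral>\<^sup>+x. G x \<partial>lborel)) \<le> 4 * (\<integral>\<^sup>+x. H x \<partial>lborel)\<^sup>2"
    using ennreal_AM_GM le by (rule order_trans)
  then have FGH: "(\<integral>\<^sup>+x. F x \<partial>lborel) * (\<integral>\<^sup>+x. G x \<partial>lborel) \<le> (\<integral>\<^sup>+x. H x \<partial>lborel)\<^sup>2"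
    by (subst (asm) ennreal_mult_le_mult_iff) auto
  have f: "(\<integral>\<^sup>+x. f x \<partial>lborel) = ennreal a * (\<integral>\<^sup>+x. F x \<partial>lborel)"
    unfolding F_def using inv[OF a(1)] by (simp add: nn_integral_cmult mult.assoc[symmetric] mult.commute[of "ennreal a"])
  have g: "(\<integral>\<^sup>+x. g x \<partial>lborel) = ennreal b * (\<integral>\<^sup>+x. G x \<partial>lborel)"
    unfolding G_def using inv[OF b(1)] by (simp add: nn_integral_cmult mult.assoc[symmetric] mult.commute[of "ennreal b"])
  have h: "(\<integral>\<^sup>+x. h x \<partial>lborel) = ennreal (sqrt (a*b)) * (\<integral>\<^sup>+x. H x \<partial>lborel)"
    unfolding H_def using inv[of "sqrt (a*b)"] a(1) b(1)
    by (simp add: nn_integral_cmult mult.assoc[symmetric] mult.commute[of "ennreal (sqrt (a*b))"])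
  have "(ennreal (sqrt (a*b)))\<^sup>2 = ennreal a * ennreal b"
    using a(1) b(1) by (simp add: ennreal_power flip: ennreal_mult)
  then have "(\<integral>\<^sup>+x. h x \<partial>lborel)\<^sup>2 = ennreal a * ennreal b * (\<integral>\<^sup>+x. H x \<partial>lborel)\<^sup>2"
    unfolding h by (simp add: power_mult_distrib)
  moreover have "(\<integral>\<^sup>+x. f x \<partial>lborel) * (\<integral>\<^sup>+x. g x \<partial>lborel) =
     ennreal a * ennreal b * ((\<integral>\<^sup>+x. F x \<partial>lborel) * (\<integral>\<^sup>+x. G x \<partial>lborel))"
    unfolding f g by (simp add: ac_simps)
  ultimately show ?thesis using FGH by (simp add: mult_left_mono)
qed

text \<open>Truncating \<open>f\<close> and \<open>g\<close> keeps the hypothesis with the same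
  \<open>h\<close>, so the bounded case passes to the limit by monotone convergence. Two different
  truncation heights are first raised to their maximum.\<close>

theorem Prekopa_Leindler_line:
  fixes f g h :: "real \<Rightarrow> ennreal"
  assumes [measurable]: "f \<in> borel_measurable borel" "g \<in> borel_measurable borel" "h \<in> borel_measurable borel"
    and fgh: "\<And>s t. f s * g t \<le> (h ((s + t) / 2))\<^sup>2"
  shows "(\<integral>\<^sup>+x. f x \<partial>lborel) * (\<integral>\<^sup>+x. g x \<partial>lborel) \<le> (\<integral>\<^sup>+x. h x \<partial>lborel)\<^sup>2"
proof -
  have mc: "(\<integral>\<^sup>+x. u x \<partial>lborel) = (SUP k::nat. \<integral>\<^sup>+x. min (u x) (ennreal (real k)) \<partial>lborel)"
    if [measurable]: "u \<in> borel_measurable borel" for u :: "real \<Rightarrow> ennreal"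
  proof -
    have "u x = (SUP k::nat. min (u x) (ennreal (real k)))" for x
    proof (cases "u x")
      case (real r)
      obtain k :: nat where "r \<le> real k" using real_arch_simple by blast
      then have "u x \<le> min (u x) (ennreal (real k))" using real by (simp add: ennreal_leI)
      then have "u x \<le> (SUP k::nat. min (u x) (ennreal (real k)))" by (rule SUP_upper2[rotated]) simp
      then show ?thesis by (intro antisym SUP_least) auto
    next
      case top
      then show ?thesis using ennreal_SUP_of_nat_eq_top[symmetric] by (simp add: ennreal_of_nat_eq_real_of_nat del: SUP_eq_top_iff ennreal_SUP_of_nat_eq_top)
    qed
    then have "(\<integral>\<^sup>+x. u x \<partial>lborel) = (\<integral>\<^sup>+x. (SUP k::nat. min (u x) (ennreal (real k))) \<partial>lborel)"
      by simp
    also have "\<dots> = (SUP k::nat. \<integral>\<^sup>+x. min (u x) (ennreal (real k)) \<partial>lborel)"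
      by (rule nn_integral_monotone_convergence_SUP)
         (auto simp: incseq_def le_fun_def intro!: min.coboundedI2 ennreal_leI)
    finally show ?thesis .
  qed
  let ?I = "\<lambda>u k. \<integral>\<^sup>+x. min (u x) (ennreal (real k)) \<partial>lborel"
  have inc: "?I u k \<le> ?I u l" if "k \<le> l" for u :: "real \<Rightarrow> ennreal" and k l :: nat
    using that by (intro nn_integral_mono min.mono ennreal_leI) auto
  have "?I f k * ?I g l \<le> (\<integral>\<^sup>+x. h x \<partial>lborel)\<^sup>2" for k l
  proof -
    have "?I f k * ?I g l \<le> ?I f (max k l) * ?I g (max k l)"
      by (intro mult_mono inc) auto
    also have "\<dots> \<le> (\<integral>\<^sup>+x. h x \<partial>lborel)\<^sup>2"
    proof (rule Prekopa_Leindler_bounded[where K="real (max k l)"])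
      show "min (f s) (ennreal (real (max k l))) * min (g t) (ennreal (real (max k l))) \<le> (h ((s + t) / 2))\<^sup>2" for s t
        by (rule order_trans[OF mult_mono fgh]) auto
    qed auto
    finally show ?thesis .
  qed
  then have "(SUP k. ?I f k) * (SUP l. ?I g l) \<le> (\<integral>\<^sup>+x. h x \<partial>lborel)\<^sup>2"
    by (simp add: SUP_mult_right_ennreal SUP_mult_left_ennreal SUP_least)
  then show ?thesis using mc[of f] mc[of g] by simp
qed

section \<open>The multiplicative form on the half line and the passage to several
  coordinates\<close>

lemma density_Ioi_eq_distr_exp:
  "density lborel (indicator {0::real<..}) = distr (density lborel (\<lambda>a. ennreal (exp a))) borel exp"
proof (rule measure_eqI)
  fix A :: "real set" assume "A \<in> sets (density lborel (indicator {0::real<..}))"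
  then have A[measurable]: "A \<in> sets borel" by simp
  have [measurable]: "exp -` A \<in> sets (borel :: real measure)"
    using measurable_sets[of "exp::real\<Rightarrow>real" borel borel A] by simp
  \<comment> \<open>The substitution x = exp a is made on compact intervals and extended by monotone
    convergence.\<close>
  let ?J = "\<lambda>k::nat. {- real k..real k}"
  let ?E = "\<lambda>k::nat. {exp (- real k)..exp (real k)}"
  have un: "(\<Union>k. ?E k) = {0<..}"
  proof -
    have "\<exists>k::nat. exp (- real k) \<le> x \<and> x \<le> exp (real k)" if "x > 0" for x
    proof -
      obtain k :: nat where "\<bar>ln x\<bar> \<le> real k" using real_arch_simple by blast
      then have "- real k \<le> ln x" "ln x \<le> real k" by auto
      then show ?thesis using that
        by (intro exI[of _ k]) (metis exp_le_cancel_iff exp_ln)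
    qed
    then show ?thesis by (auto intro: less_le_trans[OF exp_gt_zero])
  qed
  have sub: "emeasure lborel (A \<inter> ?E k) = (\<integral>\<^sup>+a. ennreal (exp a) * indicator (exp -` A \<inter> ?J k) a \<partial>lborel)" for k
  proof -
    have "(\<integral>\<^sup>+x. ennreal (indicator A x * indicator {exp (- real k)..exp (real k)} x) \<partial>lborel) =
       (\<integral>\<^sup>+x. ennreal (indicator A (exp x) * exp x * indicator {- real k..real k} x) \<partial>lborel)"
      by (rule nn_integral_substitution)
         (auto simp: set_borel_measurable_def intro!: derivative_eq_intros continuous_intros)
    moreover have "(\<integral>\<^sup>+x. ennreal (indicator A x * indicator (?E k) x) \<partial>lborel) = emeasure lborel (A \<inter> ?E k)"
    proof -
      have "(\<lambda>x. ennreal (indicator A x * indicator (?E k) x)) = indicator (A \<inter> ?E k)"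
        by (auto simp: fun_eq_iff indicator_def)
      then show ?thesis by simp
    qed
    moreover have "(\<integral>\<^sup>+x. ennreal (indicator A (exp x) * exp x * indicator (?J k) x) \<partial>lborel) =
      (\<integral>\<^sup>+a. ennreal (exp a) * indicator (exp -` A \<inter> ?J k) a \<partial>lborel)"
      by (intro nn_integral_cong) (auto simp: indicator_def)
    ultimately show ?thesis by simp
  qed
  have incE: "incseq (\<lambda>k. A \<inter> ?E k)"
  proof (rule incseq_SucI)
    fix k show "A \<inter> ?E k \<subseteq> A \<inter> ?E (Suc k)"
    proof -
      have "exp (- real (Suc k)) \<le> exp (- real k)" "exp (real k) \<le> exp (real (Suc k))" by simp_all
      then have "?E k \<subseteq> ?E (Suc k)" by (simp only: atLeastatMost_subset_iff) blast
      then show ?thesis by blast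
    qed
  qed
  have "emeasure (density lborel (indicator {0::real<..})) A = (\<integral>\<^sup>+x. indicator {0<..} x * indicator A x \<partial>lborel)"
    by (simp add: emeasure_density)
  also have "\<dots> = (\<integral>\<^sup>+x. indicator (\<Union>k. A \<inter> ?E k) x \<partial>lborel)"
    using un by (intro nn_integral_cong) (auto simp: indicator_def)
  also have "\<dots> = emeasure lborel (\<Union>k. A \<inter> ?E k)" by (intro nn_integral_indicator) auto
  also have "\<dots> = (SUP k. emeasure lborel (A \<inter> ?E k))"
    using incE by (intro SUP_emeasure_incseq[symmetric]) auto
  also have "\<dots> = (SUP k. \<integral>\<^sup>+a. ennreal (exp a) * indicator (exp -` A \<inter> ?J k) a \<partial>lborel)"
    by (simp only: sub)
  also have "\<dots> = (\<integral>\<^sup>+a. (SUP k. ennreal (exp a) * indicator (exp -` A \<inter> ?J k) a) \<partial>lborel)"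
    by (rule nn_integral_monotone_convergence_SUP[symmetric])
       (auto simp: incseq_def le_fun_def indicator_def)
  also have "\<dots> = (\<integral>\<^sup>+a. ennreal (exp a) * indicator (exp -` A) a \<partial>lborel)"
  proof (intro nn_integral_cong)
    fix a :: real
    obtain k :: nat where k: "\<bar>a\<bar> \<le> real k" using real_arch_simple by blast
    show "(SUP k. ennreal (exp a) * indicator (exp -` A \<inter> ?J k) a) = ennreal (exp a) * indicator (exp -` A) a"
    proof (rule antisym)
      show "(SUP k. ennreal (exp a) * indicator (exp -` A \<inter> ?J k) a) \<le> ennreal (exp a) * indicator (exp -` A) a"
        by (intro SUP_least) (auto simp: indicator_def)
      show "ennreal (exp a) * indicator (exp -` A) a \<le> (SUP k. ennreal (exp a) * indicator (exp -` A \<inter> ?J k) a)"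
        using k by (intro SUP_upper2[of k]) (auto simp: indicator_def)
    qed
  qed
  also have "\<dots> = emeasure (density lborel (\<lambda>a. ennreal (exp a))) (exp -` A)"
    by (simp add: emeasure_density)
  also have "\<dots> = emeasure (distr (density lborel (\<lambda>a. ennreal (exp a))) borel exp) A"
    by (simp add: emeasure_distr)
  finally show "emeasure (density lborel (indicator {0::real<..})) A = emeasure (distr (density lborel (\<lambda>a. ennreal (exp a))) borel exp) A" .
qed simp

lemma nn_integral_Ioi_eq_exp:
  assumes [measurable]: "f \<in> borel_measurable borel"
  shows "(\<integral>\<^sup>+x. f x * indicator {0::real<..} x \<partial>lborel) = (\<integral>\<^sup>+a. f (exp a) * ennreal (exp a) \<partial>lborel)"
proof -
  have "(\<integral>\<^sup>+x. f x * indicator {0::real<..} x \<partial>lborel) = (\<integral>\<^sup>+x. f x \<partial>density lborel (indicator {0::real<..}))"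
    by (simp add: nn_integral_density mult.commute)
  also have "\<dots> = (\<integral>\<^sup>+a. f (exp a) * ennreal (exp a) \<partial>lborel)"
    unfolding density_Ioi_eq_distr_exp by (simp add: nn_integral_distr nn_integral_density mult.commute)
  finally show ?thesis .
qed

text \<open>The substitution s = exp a turns geometric into arithmetic means, and the Jacobian
  respects the hypothesis because the product of exp a and exp b is the square of exp ((a +
  b)/2).\<close>

theorem Prekopa_Leindler_multiplicative:
  fixes f g h :: "real \<Rightarrow> ennreal"
  assumes [measurable]: "f \<in> borel_measurable borel" "g \<in> borel_measurable borel" "h \<in> borel_measurable borel"
    and fgh: "\<And>s t. 0 < s \<Longrightarrow> 0 < t \<Longrightarrow> f s * g t \<le> (h (sqrt (s * t)))\<^sup>2"
  shows "(\<integral>\<^sup>+x. f x * indicator {0<..} x \<partial>lborel) * (\<integral>\<^sup>+x. g x * indicator {0<..} x \<partial>lborel)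
    \<le> (\<integral>\<^sup>+x. h x * indicator {0<..} x \<partial>lborel)\<^sup>2"
proof -
  have "(\<integral>\<^sup>+a. f (exp a) * ennreal (exp a) \<partial>lborel) * (\<integral>\<^sup>+a. g (exp a) * ennreal (exp a) \<partial>lborel)
     \<le> (\<integral>\<^sup>+a. h (exp a) * ennreal (exp a) \<partial>lborel)\<^sup>2"
  proof (rule Prekopa_Leindler_line)
    fix a b :: real
    have e: "sqrt (exp a * exp b) = exp ((a + b) / 2)"
      by (rule real_sqrt_unique) (simp_all add: exp_double[symmetric] exp_add[symmetric] power2_eq_square)
    have "ennreal (exp a) * ennreal (exp b) = (ennreal (exp ((a + b) / 2)))\<^sup>2"
      by (simp add: ennreal_power exp_double[symmetric] exp_add[symmetric] flip: ennreal_mult)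
    moreover have "f (exp a) * g (exp b) \<le> (h (exp ((a + b) / 2)))\<^sup>2"
      using fgh[of "exp a" "exp b"] e by simp
    ultimately have "(f (exp a) * g (exp b)) * (ennreal (exp a) * ennreal (exp b)) \<le> (h (exp ((a + b) / 2)))\<^sup>2 * (ennreal (exp ((a + b) / 2)))\<^sup>2"
      by (simp add: mult_right_mono)
    then show "f (exp a) * ennreal (exp a) * (g (exp b) * ennreal (exp b)) \<le> (h (exp ((a + b) / 2)) * ennreal (exp ((a + b) / 2)))\<^sup>2"
      by (simp add: power_mult_distrib ac_simps)
  qed measurable
  then show ?thesis by (simp add: nn_integral_Ioi_eq_exp)
qed

text \<open>One induction serves both means: \<open>m\<close> is the arithmetic mean on the whole
  line or the geometric mean on the half line. For fixed remaining coordinates, the inequality on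
  the line is exactly the hypothesis for the functions obtained by integrating out one coordinate.
  The condition on \<open>m 0 0\<close> belongs to the empty index set, where the only point is
  0.\<close>

lemma Prekopa_Leindler_tensorize:
  fixes S :: "real set" and m :: "real \<Rightarrow> real \<Rightarrow> real" and f g h :: "vec \<Rightarrow> ennreal"
  assumes S[measurable]: "S \<in> sets borel" and m0: "m 0 0 = 0"
    and line: "\<And>u v w :: real \<Rightarrow> ennreal. u \<in> borel_measurable borel \<Longrightarrow> v \<in> borel_measurable borel \<Longrightarrow>
       w \<in> borel_measurable borel \<Longrightarrow> (\<And>s t. s \<in> S \<Longrightarrow> t \<in> S \<Longrightarrow> u s * v t \<le> (w (m s t))\<^sup>2) \<Longrightarrow>
       (\<integral>\<^sup>+x. u x * indicator S x \<partial>lborel) * (\<integral>\<^sup>+x. v x * indicator S x \<partial>lborel) \<le> (\<integral>\<^sup>+x. w x * indicator S x \<partial>lborel)\<^sup>2"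
    and fin: "finite I"
    and meas: "f \<in> borel_measurable borel" "g \<in> borel_measurable borel" "h \<in> borel_measurable borel"
    and fgh: "\<And>x y. (\<forall>i\<in>I. x i \<in> S) \<Longrightarrow> (\<forall>i\<in>I. y i \<in> S) \<Longrightarrow> f x * g y \<le> (h (\<lambda>i. m (x i) (y i)))\<^sup>2"
  shows "(\<integral>\<^sup>+x. f x * indicator {x. \<forall>i\<in>I. x i \<in> S} x \<partial>leb I) * (\<integral>\<^sup>+x. g x * indicator {x. \<forall>i\<in>I. x i \<in> S} x \<partial>leb I)
    \<le> (\<integral>\<^sup>+x. h x * indicator {x. \<forall>i\<in>I. x i \<in> S} x \<partial>leb I)\<^sup>2"
  using fin meas fgh
proof (induction I arbitrary: f g h)
  case empty
  note [measurable] = empty.prems(1-3)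
  have "(\<integral>\<^sup>+x. u x * indicator {x. \<forall>i\<in>{}. x i \<in> S} x \<partial>leb {}) = u 0" if "u \<in> borel_measurable borel" for u
    using nn_integral_leb_empty[OF that] by simp
  moreover have "f 0 * g 0 \<le> (h 0)\<^sup>2"
    using empty.prems(4)[of 0 0] m0 by (simp add: zero_fun_def)
  ultimately show ?case using empty.prems by simp
next
  case (insert i I)
  note [measurable] = insert.prems(1-3)
  define P where "P u x = (\<integral>\<^sup>+t. u (x(i := t)) * indicator S t \<partial>lborel)" for u :: "vec \<Rightarrow> ennreal" and x
  have Pm: "P u \<in> borel_measurable borel" if [measurable]: "u \<in> borel_measurable borel" for u
    unfolding P_def by measurable
  have red: "(\<integral>\<^sup>+x. u x * indicator {x. \<forall>k\<in>insert i I. x k \<in> S} x \<partial>leb (insert i I)) =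
     (\<integral>\<^sup>+x. P u x * indicator {x. \<forall>k\<in>I. x k \<in> S} x \<partial>leb I)"
    if [measurable]: "u \<in> borel_measurable borel" for u
  proof -
    have [measurable]: "{x::vec. \<forall>k\<in>insert i I. x k \<in> S} \<in> sets borel"
      using insert.hyps by measurable
    have "(\<integral>\<^sup>+x. u x * indicator {x. \<forall>k\<in>insert i I. x k \<in> S} x \<partial>leb (insert i I)) =
      (\<integral>\<^sup>+x. (\<integral>\<^sup>+t. u (x(i := t)) * indicator {x. \<forall>k\<in>insert i I. x k \<in> S} (x(i := t)) \<partial>lborel) \<partial>leb I)"
      by (rule nn_integral_leb_insert[OF insert.hyps(1,2)]) measurable
    also have "\<dots> = (\<integral>\<^sup>+x. (\<integral>\<^sup>+t. (u (x(i := t)) * indicator S t) * indicator {x. \<forall>k\<in>I. x k \<in> S} x \<partial>lborel) \<partial>leb I)"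
    proof (intro nn_integral_cong)
      fix x :: vec and t :: real
      have "x(i := t) \<in> {x. \<forall>k\<in>insert i I. x k \<in> S} \<longleftrightarrow> t \<in> S \<and> x \<in> {x. \<forall>k\<in>I. x k \<in> S}"
        using insert.hyps(2) by auto
      then show "u (x(i := t)) * indicator {x. \<forall>k\<in>insert i I. x k \<in> S} (x(i := t)) =
         (u (x(i := t)) * indicator S t) * indicator {x. \<forall>k\<in>I. x k \<in> S} x"
        by (simp add: indicator_def)
    qed
    also have "\<dots> = (\<integral>\<^sup>+x. P u x * indicator {x. \<forall>k\<in>I. x k \<in> S} x \<partial>leb I)"
    proof (rule nn_integral_cong)
      fix x :: vec
      have "(\<lambda>t. u (x(i := t)) * indicator S t) \<in> borel_measurable lborel"
        using measurable_compose[OF measurable_fun_upd that] by simp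
      show "(\<integral>\<^sup>+t. (u (x(i := t)) * indicator S t) * indicator {x. \<forall>k\<in>I. x k \<in> S} x \<partial>lborel) =
        P u x * indicator {x. \<forall>k\<in>I. x k \<in> S} x"
        unfolding P_def by (rule nn_integral_multc) fact
    qed
    finally show ?thesis .
  qed
  have "(\<integral>\<^sup>+x. P f x * indicator {x. \<forall>k\<in>I. x k \<in> S} x \<partial>leb I) * (\<integral>\<^sup>+x. P g x * indicator {x. \<forall>k\<in>I. x k \<in> S} x \<partial>leb I)
    \<le> (\<integral>\<^sup>+x. P h x * indicator {x. \<forall>k\<in>I. x k \<in> S} x \<partial>leb I)\<^sup>2"
  proof (rule insert.IH)
    fix x y :: vec assume xy: "\<forall>k\<in>I. x k \<in> S" "\<forall>k\<in>I. y k \<in> S"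
    show "P f x * P g y \<le> (P h (\<lambda>k. m (x k) (y k)))\<^sup>2"
      unfolding P_def
    proof (rule line)
      fix s t assume "s \<in> S" "t \<in> S"
      then have "f (x(i := s)) * g (y(i := t)) \<le> (h (\<lambda>k. m ((x(i := s)) k) ((y(i := t)) k)))\<^sup>2"
        using xy by (intro insert.prems(4)) auto
      also have "(\<lambda>k. m ((x(i := s)) k) ((y(i := t)) k)) = (\<lambda>k. m (x k) (y k))(i := m s t)"
        by auto
      finally show "f (x(i := s)) * g (y(i := t)) \<le> (h ((\<lambda>k. m (x k) (y k))(i := m s t)))\<^sup>2" .
    qed measurable
  qed (use Pm insert.prems in auto)
  then show ?case using insert.prems by (simp only: red)
qed

theorem Prekopa_Leindler:
  fixes f g h :: "vec \<Rightarrow> ennreal"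
  assumes "finite I"
    and [measurable]: "f \<in> borel_measurable borel" "g \<in> borel_measurable borel" "h \<in> borel_measurable borel"
    and fgh: "\<And>x y. f x * g y \<le> (h ((1/2) *\<^sub>R (x + y)))\<^sup>2"
  shows "(\<integral>\<^sup>+x. f x \<partial>leb I) * (\<integral>\<^sup>+x. g x \<partial>leb I) \<le> (\<integral>\<^sup>+x. h x \<partial>leb I)\<^sup>2"
proof -
  have "(\<integral>\<^sup>+x. f x * indicator {x. \<forall>i\<in>I. x i \<in> UNIV} x \<partial>leb I) * (\<integral>\<^sup>+x. g x * indicator {x. \<forall>i\<in>I. x i \<in> UNIV} x \<partial>leb I)
    \<le> (\<integral>\<^sup>+x. h x * indicator {x. \<forall>i\<in>I. x i \<in> UNIV} x \<partial>leb I)\<^sup>2"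
  proof (rule Prekopa_Leindler_tensorize[where m="\<lambda>s t. (s + t) / 2"])
    fix x y :: vec
    have "(1/2) *\<^sub>R (x + y) = (\<lambda>i. (x i + y i) / 2)" by (simp add: fun_eq_iff scaleR_fun_apply)
    with fgh[of x y] show "f x * g y \<le> (h (\<lambda>i. (x i + y i) / 2))\<^sup>2" by metis
  next
    fix u v w :: "real \<Rightarrow> ennreal"
    assume "u \<in> borel_measurable borel" "v \<in> borel_measurable borel" "w \<in> borel_measurable borel"
      "\<And>s t. s \<in> UNIV \<Longrightarrow> t \<in> UNIV \<Longrightarrow> u s * v t \<le> (w ((s + t) / 2))\<^sup>2"
    then show "(\<integral>\<^sup>+x. u x * indicator UNIV x \<partial>lborel) * (\<integral>\<^sup>+x. v x * indicator UNIV x \<partial>lborel) \<le> (\<integral>\<^sup>+x. w x * indicator UNIV x \<partial>lborel)\<^sup>2"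
      using Prekopa_Leindler_line[of u v w] by simp
  qed (use assms in auto)
  then show ?thesis by simp
qed

theorem Prekopa_Leindler_orthant:
  fixes f g h :: "vec \<Rightarrow> ennreal"
  assumes "finite I"
    and "f \<in> borel_measurable borel" "g \<in> borel_measurable borel" "h \<in> borel_measurable borel"
    and "\<And>x y. \<forall>i\<in>I. 0 < x i \<Longrightarrow> \<forall>i\<in>I. 0 < y i \<Longrightarrow> f x * g y \<le> (h (\<lambda>i. sqrt (x i * y i)))\<^sup>2"
  shows "(\<integral>\<^sup>+x. f x * indicator {x. \<forall>i\<in>I. 0 < x i} x \<partial>leb I) * (\<integral>\<^sup>+x. g x * indicator {x. \<forall>i\<in>I. 0 < x i} x \<partial>leb I)
    \<le> (\<integral>\<^sup>+x. h x * indicator {x. \<forall>i\<in>I. 0 < x i} x \<partial>leb I)\<^sup>2"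
proof -
  have "(\<integral>\<^sup>+x. f x * indicator {x. \<forall>i\<in>I. x i \<in> {0<..}} x \<partial>leb I) * (\<integral>\<^sup>+x. g x * indicator {x. \<forall>i\<in>I. x i \<in> {0<..}} x \<partial>leb I)
    \<le> (\<integral>\<^sup>+x. h x * indicator {x. \<forall>i\<in>I. x i \<in> {0<..}} x \<partial>leb I)\<^sup>2"
    by (rule Prekopa_Leindler_tensorize[where m="\<lambda>s t. sqrt (s * t)"])
       (use assms Prekopa_Leindler_multiplicative in auto)
  then show ?thesis by simp
qed

section \<open>The Blaschke-Santalo inequality\<close>

lemma measurable_coord_space [measurable]: "coord_space I \<in> sets borel"
proof -
  have "coord_space I = (\<Inter>i\<in>-I. {x \<in> space borel. (x::vec) i = 0})"
    by (auto simp: coord_space_def)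
  also have "\<dots> \<in> sets borel"
  proof (cases "I = UNIV")
    case False
    then show ?thesis by (intro sets.countable_INT'') auto
  qed simp
  finally show ?thesis .
qed

text \<open>The topology is that of the product over all natural numbers, so compactness is
  Tychonoff's theorem: \<open>coord_space\<close> pins the coordinates outside \<open>I\<close> to
  the compact set {0}.\<close>

lemma compact_box: "compact {x \<in> coord_space I. \<forall>i\<in>I. \<bar>x i\<bar> \<le> R}"
proof -
  have "{x \<in> coord_space I. \<forall>i\<in>I. \<bar>x i\<bar> \<le> R} = PiE UNIV (\<lambda>i. if i \<in> I then {-R..R} else {0})"
    by (auto simp: coord_space_def PiE_def Pi_def abs_le_iff split: if_splits)
  moreover have "compactin (product_topology (\<lambda>_. euclidean) UNIV) (PiE UNIV (\<lambda>i. if i \<in> I then {-R..R} else {0::real}))"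
    by (subst compactin_PiE) auto
  ultimately show ?thesis by (simp add: euclidean_product_topology)
qed

lemma continuous_on_fst_component: "continuous_on A (\<lambda>x::vec \<times> vec. fst x k)"
  and continuous_on_snd_component: "continuous_on A (\<lambda>x::vec \<times> vec. snd x k)"
  by (rule continuous_on_product_then_coordinatewise, intro continuous_intros)+

lemma ennreal_power2_le_imp_le:
  fixes a b :: ennreal assumes "a\<^sup>2 \<le> b\<^sup>2" shows "a \<le> b"
proof (cases b)
  case (real y)
  then have "a\<^sup>2 < \<infinity>" using assms by (simp add: ennreal_power order_le_less_trans)
  then obtain x where x: "a = ennreal x" "x \<ge> 0" by (cases a) (auto simp: power2_eq_square ennreal_top_mult)
  then have "x\<^sup>2 \<le> y\<^sup>2" using assms real by (simp add: ennreal_power)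
  then show ?thesis using real x by (auto intro: ennreal_leI power2_le_imp_le)
qed simp

text \<open>Reflections carry the open positive orthant onto all open orthants, and the coordinate
  hyperplanes are null; the induction halves one line at a time.\<close>

lemma nn_integral_leb_unconditional:
  assumes "finite I" and "f \<in> borel_measurable borel"
    and "\<And>i x. i \<in> I \<Longrightarrow> f (x(i := - x i)) = f x"
  shows "(\<integral>\<^sup>+x. f x \<partial>leb I) = 2 ^ card I * (\<integral>\<^sup>+x. f x * indicator {x. \<forall>i\<in>I. 0 < x i} x \<partial>leb I)"
  using assms
proof (induction I arbitrary: f)
  case empty
  then show ?case by simp
next
  case (insert i I)
  note [measurable] = insert.prems(1)
  have [measurable]: "{x::vec. \<forall>k\<in>insert i I. 0 < x k} \<in> sets borel"
    using insert.hyps by measurable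
  define P where "P x = (\<integral>\<^sup>+t. f (x(i := t)) * indicator {0<..} t \<partial>lborel)" for x
  have m[measurable]: "(\<lambda>t. f (x(i := t))) \<in> borel_measurable borel" for x
    using measurable_compose[OF measurable_fun_upd insert.prems(1)] .
  have Pm[measurable]: "P \<in> borel_measurable borel" unfolding P_def by measurable
  have even: "(\<integral>\<^sup>+t. f (x(i := t)) \<partial>lborel) = 2 * P x" for x
  proof -
    have neg: "f (x(i := - t)) = f (x(i := t))" for t
      using insert.prems(2)[OF insertI1, of "x(i := t)"] by (simp only: fun_upd_upd fun_upd_same)
    have "(\<integral>\<^sup>+t. f (x(i := t)) * indicator {..<0} t \<partial>lborel) =
       ennreal \<bar>-1\<bar> * (\<integral>\<^sup>+t. f (x(i := 0 + (-1) * t)) * indicator {..<0} (0 + (-1) * t) \<partial>lborel)"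
      by (rule nn_integral_real_affine) (simp_all add: m)
    also have "\<dots> = P x"
      unfolding P_def by (simp add: neg indicator_def)
    finally have "(\<integral>\<^sup>+t. f (x(i := t)) * indicator {..<0} t \<partial>lborel) = P x" .
    moreover have "(\<integral>\<^sup>+t. f (x(i := t)) \<partial>lborel) =
      (\<integral>\<^sup>+t. f (x(i := t)) * indicator {0<..} t + f (x(i := t)) * indicator {..<0} t \<partial>lborel)"
    proof (rule nn_integral_cong_AE)
      show "AE t in lborel. f (x(i := t)) = f (x(i := t)) * indicator {0<..} t + f (x(i := t)) * indicator {..<0} t"
        using AE_lborel_singleton[of "0::real"] by eventually_elim (auto simp: indicator_def)
    qed
    moreover have "\<dots> = P x + (\<integral>\<^sup>+t. f (x(i := t)) * indicator {..<0} t \<partial>lborel)"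
      unfolding P_def by (rule nn_integral_add) (simp_all add: m)
    ultimately show ?thesis by (simp add: mult_2)
  qed
  have "(\<integral>\<^sup>+x. f x \<partial>leb (insert i I)) = (\<integral>\<^sup>+x. 2 * P x \<partial>leb I)"
    using nn_integral_leb_insert[OF insert.hyps(1,2) insert.prems(1)] by (simp only: even)
  also have "\<dots> = 2 * (\<integral>\<^sup>+x. P x \<partial>leb I)" by (rule nn_integral_cmult) simp
  also have "(\<integral>\<^sup>+x. P x \<partial>leb I) = 2 ^ card I * (\<integral>\<^sup>+x. P x * indicator {x. \<forall>i\<in>I. 0 < x i} x \<partial>leb I)"
  proof (rule insert.IH[OF Pm])
    fix k x assume k: "k \<in> I"
    then have "i \<noteq> k" using insert.hyps by auto
    have "f ((x(k := - x k))(i := t)) = f (x(i := t))" for t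
    proof -
      have "(x(k := - x k))(i := t) = (x(i := t))(k := - (x(i := t)) k)"
        using \<open>i \<noteq> k\<close> by (auto simp: fun_eq_iff)
      then show ?thesis using insert.prems(2)[OF insertI2[OF k], of "x(i := t)"] by metis
    qed
    then show "P (x(k := - x k)) = P x" unfolding P_def by simp
  qed
  also have "(\<integral>\<^sup>+x. P x * indicator {x. \<forall>i\<in>I. 0 < x i} x \<partial>leb I) =
     (\<integral>\<^sup>+x. f x * indicator {x. \<forall>k\<in>insert i I. 0 < x k} x \<partial>leb (insert i I))"
  proof -
    have "(\<integral>\<^sup>+x. f x * indicator {x. \<forall>k\<in>insert i I. 0 < x k} x \<partial>leb (insert i I)) =
      (\<integral>\<^sup>+x. (\<integral>\<^sup>+t. f (x(i := t)) * indicator {x. \<forall>k\<in>insert i I. 0 < x k} (x(i := t)) \<partial>lborel) \<partial>leb I)"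
      by (rule nn_integral_leb_insert[OF insert.hyps(1,2)]) measurable
    also have "\<dots> = (\<integral>\<^sup>+x. (\<integral>\<^sup>+t. (f (x(i := t)) * indicator {0<..} t) * indicator {x. \<forall>k\<in>I. 0 < x k} x \<partial>lborel) \<partial>leb I)"
    proof (intro nn_integral_cong)
      fix x :: vec and t :: real
      have "x(i := t) \<in> {x. \<forall>k\<in>insert i I. 0 < x k} \<longleftrightarrow> 0 < t \<and> x \<in> {x. \<forall>k\<in>I. 0 < x k}"
        using insert.hyps(2) by auto
      then show "f (x(i := t)) * indicator {x. \<forall>k\<in>insert i I. 0 < x k} (x(i := t)) =
         (f (x(i := t)) * indicator {0<..} t) * indicator {x. \<forall>k\<in>I. 0 < x k} x"
        by (simp add: indicator_def)
    qed
    also have "\<dots> = (\<integral>\<^sup>+x. P x * indicator {x. \<forall>i\<in>I. 0 < x i} x \<partial>leb I)"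
      unfolding P_def by (intro nn_integral_cong nn_integral_multc) (simp add: m)
    finally show ?thesis by simp
  qed
  finally show ?case using insert.hyps by (simp add: mult.assoc)
qed

section \<open>The unconditional case\<close>

definition uball :: "nat set \<Rightarrow> vec set" where
  "uball I = {x. dot I x x \<le> 1}"

lemma measurable_uball [measurable]: "uball I \<in> sets borel"
  unfolding uball_def by measurable

text \<open>For x in \<open>K\<close> and y in \<open>L\<close> with positive entries, the vector
  with entries sqrt (x_i y_i) has squared norm <x,y>, which is at most 1. Geometric means of the two
  sets thus stay in the ball.\<close>

lemma Blaschke_Santalo_unconditional:
  assumes I: "finite I" and [measurable]: "K \<in> sets borel" "L \<in> sets borel"
    and K: "\<And>i x. i \<in> I \<Longrightarrow> x(i := - x i) \<in> K \<longleftrightarrow> x \<in> K"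
    and L: "\<And>i x. i \<in> I \<Longrightarrow> x(i := - x i) \<in> L \<longleftrightarrow> x \<in> L"
    and KL: "\<And>x y. x \<in> K \<Longrightarrow> y \<in> L \<Longrightarrow> dot I x y \<le> 1"
  shows "emeasure (leb I) K * emeasure (leb I) L \<le> (emeasure (leb I) (uball I))\<^sup>2"
proof -
  let ?O = "{x::vec. \<forall>i\<in>I. 0 < x i}"
  let ?p = "\<lambda>A. \<integral>\<^sup>+x. indicator A x * indicator ?O x \<partial>leb I"
  have "?p K * ?p L \<le> (?p (uball I))\<^sup>2"
  proof (rule Prekopa_Leindler_orthant[OF I])
    fix x y :: vec assume pos: "\<forall>i\<in>I. 0 < x i" "\<forall>i\<in>I. 0 < y i"
    have "dot I (\<lambda>i. sqrt (x i * y i)) (\<lambda>i. sqrt (x i * y i)) = dot I x y"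
      unfolding dot_def using pos by (intro sum.cong) (auto simp: abs_mult[symmetric] abs_of_pos)
    then show "indicator K x * indicator L y \<le> (indicator (uball I) (\<lambda>i. sqrt (x i * y i)) :: ennreal)\<^sup>2"
      using KL[of x y] by (auto simp: indicator_def uball_def)
  qed measurable
  then have "(2 ^ card I)\<^sup>2 * (?p K * ?p L) \<le> (2 ^ card I)\<^sup>2 * (?p (uball I))\<^sup>2"
    by (rule mult_left_mono) simp
  moreover have full: "emeasure (leb I) A = 2 ^ card I * ?p A"
    if [measurable]: "A \<in> sets borel" and "\<And>i x. i \<in> I \<Longrightarrow> x(i := - x i) \<in> A \<longleftrightarrow> x \<in> A" for A
  proof -
    have "(\<integral>\<^sup>+x. indicator A x \<partial>leb I) = 2 ^ card I * ?p A"
      by (rule nn_integral_leb_unconditional[OF I]) (use that in \<open>auto simp: indicator_def\<close>)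
    then show ?thesis by simp
  qed
  moreover have "x(i := - x i) \<in> uball I \<longleftrightarrow> x \<in> uball I" if "i \<in> I" for i x
  proof -
    have "dot I (x(i := - x i)) (x(i := - x i)) = dot I x x"
      unfolding dot_def by (intro sum.cong) auto
    then show ?thesis by (simp add: uball_def)
  qed
  ultimately show ?thesis
    using full[of K] full[of L] full[of "uball I"] K L
    by (simp add: power_mult_distrib power2_eq_square ac_simps)
qed

text \<open>\<open>K'\<close> is the Steiner symmetral of \<open>K\<close> (for convex \<open>K\<close>); the slice of \<open>L'\<close> at height \<open>r\<close> is the mean of the
  slices of \<open>L\<close> at \<open>r\<close> and \<open>-r\<close>, which is no smaller by Brunn-Minkowski because the two are reflections
  of each other.\<close>
lemma Steiner_step:
  fixes K L :: "vec set"
  assumes J: "finite J" "i \<in> J" and K: "compact K" and L: "compact L"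
    and symK: "\<And>x. x \<in> K \<Longrightarrow> - x \<in> K" and symL: "\<And>x. x \<in> L \<Longrightarrow> - x \<in> L"
    and KL: "\<And>x y. x \<in> K \<Longrightarrow> y \<in> L \<Longrightarrow> dot J x y \<le> 1"
  obtains K' L' where "compact K'" "compact L'"
    "\<And>x. x \<in> K' \<Longrightarrow> - x \<in> K'" "\<And>x. x \<in> L' \<Longrightarrow> - x \<in> L'"
    "\<And>x y. x \<in> K' \<Longrightarrow> y \<in> L' \<Longrightarrow> dot J x y \<le> 1"
    "emeasure (leb J) K \<le> emeasure (leb J) K'" "emeasure (leb J) L \<le> emeasure (leb J) L'"
    "\<And>x. x \<in> K' \<Longrightarrow> x(i := - x i) \<in> K'" "\<And>x. x \<in> L' \<Longrightarrow> x(i := - x i) \<in> L'"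
    "\<And>j. (\<And>x. x \<in> K \<Longrightarrow> x(j := - x j) \<in> K) \<Longrightarrow> (\<And>x. x \<in> K' \<Longrightarrow> x(j := - x j) \<in> K')"
    "\<And>j. (\<And>x. x \<in> L \<Longrightarrow> x(j := - x j) \<in> L) \<Longrightarrow> (\<And>x. x \<in> L' \<Longrightarrow> x(j := - x j) \<in> L')"
proof -
  define I where "I = J - {i}"
  have I: "finite I" "i \<notin> I" "J = insert i I" using J by (auto simp: I_def)
  \<comment> \<open>Both new sets are continuous images of compact sets of pairs. This gives
    compactness, hence measurability, although \<open>K\<close> and \<open>L\<close> are not assumed
    convex.\<close>
  define sK where "sK = (\<lambda>x::vec \<times> vec. (fst x)(i := (fst x i - snd x i) / 2))"
  define sL where "sL = (\<lambda>x::vec \<times> vec. ((1/2) *\<^sub>R (fst x + snd x))(i := fst x i))"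
  define K' where "K' = sK ` ((K \<times> K) \<inter> {(p, q). \<forall>k. k \<noteq> i \<longrightarrow> p k = q k})"
  define L' where "L' = sL ` ((L \<times> L) \<inter> {(p, q). p i = - q i})"
  have K'I: "x(i := (a - b) / 2) \<in> K'" if "x(i := a) \<in> K" "x(i := b) \<in> K" for x a b
    unfolding K'_def by (rule image_eqI[of _ _ "(x(i := a), x(i := b))"]) (use that in \<open>auto simp: sK_def\<close>)
  have K'E: "\<exists>y a b. x = y(i := (a - b) / 2) \<and> y(i := a) \<in> K \<and> y(i := b) \<in> K" if x: "x \<in> K'" for x
  proof -
    obtain p q where pq: "p \<in> K" "q \<in> K" "\<forall>k. k \<noteq> i \<longrightarrow> p k = q k" "x = p(i := (p i - q i) / 2)"
      using x unfolding K'_def sK_def by auto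
    have "p(i := q i) = q" using pq(3) by auto
    then show ?thesis using pq by (intro exI[of _ p] exI[of _ "p i"] exI[of _ "q i"]) auto
  qed
  have L'I: "((1/2) *\<^sub>R (x + y))(i := r) \<in> L'" if "x(i := r) \<in> L" "y(i := - r) \<in> L" for x y r
    unfolding L'_def
    by (rule image_eqI[of _ _ "(x(i := r), y(i := - r))"])
       (use that in \<open>auto simp: sL_def fun_eq_iff scaleR_fun_apply\<close>)
  have L'E: "\<exists>x y r. z = ((1/2) *\<^sub>R (x + y))(i := r) \<and> x(i := r) \<in> L \<and> y(i := - r) \<in> L" if z: "z \<in> L'" for z
  proof -
    obtain p q where pq: "p \<in> L" "q \<in> L" "p i = - q i" "z = ((1/2) *\<^sub>R (p + q))(i := p i)"
      using z unfolding L'_def sL_def by auto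
    have "p(i := p i) = p" "q(i := - p i) = q" using pq(3) by auto
    then show ?thesis using pq by (intro exI[of _ p] exI[of _ q] exI[of _ "p i"]) auto
  qed
  have cK: "compact K'"
    unfolding K'_def
  proof (rule compact_continuous_image)
    show "continuous_on ((K \<times> K) \<inter> {(p, q). \<forall>k. k \<noteq> i \<longrightarrow> p k = q k}) sK"
      unfolding sK_def
    proof (rule continuous_on_coordinatewise_then_product)
      fix k show "continuous_on ((K \<times> K) \<inter> {(p, q). \<forall>k. k \<noteq> i \<longrightarrow> p k = q k}) (\<lambda>x. ((fst x)(i := (fst x i - snd x i) / 2)) k)"
        by (cases "k = i", simp_all)
           (intro continuous_on_divide continuous_on_diff continuous_on_const continuous_on_fst_component continuous_on_snd_component, simp?)+
    qed
    have "closed {(p::vec, q). \<forall>k. k \<noteq> i \<longrightarrow> p k = q k}"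
    proof -
      have "{(p::vec, q). \<forall>k. k \<noteq> i \<longrightarrow> p k = q k} = (\<Inter>k\<in>-{i}. {x. fst x k = snd x k})" by auto
      also have "closed \<dots>"
        by (intro closed_INT ballI closed_Collect_eq continuous_on_fst_component continuous_on_snd_component)
      finally show ?thesis .
    qed
    then show "compact ((K \<times> K) \<inter> {(p, q). \<forall>k. k \<noteq> i \<longrightarrow> p k = q k})"
      by (intro compact_Int_closed compact_Times K)
  qed
  have cL: "compact L'"
    unfolding L'_def
  proof (rule compact_continuous_image)
    show "continuous_on ((L \<times> L) \<inter> {(p, q). p i = - q i}) sL"
      unfolding sL_def
    proof (rule continuous_on_coordinatewise_then_product)
      fix k show "continuous_on ((L \<times> L) \<inter> {(p, q). p i = - q i}) (\<lambda>x. (((1/2) *\<^sub>R (fst x + snd x))(i := fst x i)) k)"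
        by (cases "k = i", simp_all add: scaleR_fun_apply)
           (intro continuous_on_divide continuous_on_add continuous_on_const continuous_on_fst_component continuous_on_snd_component, simp?)+
    qed
    have "closed {(p::vec, q). p i = - q i}"
      unfolding case_prod_beta
      by (intro closed_Collect_eq continuous_on_minus continuous_on_fst_component continuous_on_snd_component)
    then show "compact ((L \<times> L) \<inter> {(p, q). p i = - q i})"
      by (intro compact_Int_closed compact_Times L)
  qed
  have [measurable]: "K \<in> sets borel" "L \<in> sets borel" "K' \<in> sets borel" "L' \<in> sets borel"
    using K L cK cL by (auto intro: borel_compact)
  have neg_upd: "- (x(i := a)) = (- x)(i := - a)" for x :: vec and a
    by (auto simp: fun_eq_iff)
  have secm: "{t. x(i := t) \<in> A} \<in> sets borel" if "A \<in> sets borel" for A and x :: vec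
    using measurable_sets[OF measurable_fun_upd that, of x i] by (simp add: vimage_def)
  have mK: "emeasure (leb J) K \<le> emeasure (leb J) K'"
  proof -
    have sec: "(\<integral>\<^sup>+t. indicator K (x(i := t)) \<partial>lborel) \<le> (\<integral>\<^sup>+t. indicator K' (x(i := t)) \<partial>lborel)" for x
    proof -
      have e: "(\<integral>\<^sup>+t. indicator A (x(i := t)) \<partial>lborel) = emeasure lborel {t. x(i := t) \<in> A}" if "A \<in> sets borel" for A
      proof -
        have "(\<integral>\<^sup>+t. indicator A (x(i := t)) \<partial>lborel) = (\<integral>\<^sup>+t. indicator {t. x(i := t) \<in> A} t \<partial>lborel)"
          by (intro nn_integral_cong) (auto simp: indicator_def)
        then show ?thesis using secm[OF that] by simp
      qed
      \<comment> \<open>The slice of \<open>K'\<close> contains all half differences of points of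
        the slice \<open>?A\<close>, so Brunn-Minkowski on the line is applied to \<open>?A\<close>
        and its reflection.\<close>
      let ?A = "{t. x(i := t) \<in> K}" and ?C = "{t. x(i := t) \<in> K'}"
      have "emeasure lborel ?A \<le> emeasure lborel ?C"
      proof (cases "?A = {}")
        case False
        have [measurable]: "?A \<in> sets borel" "?C \<in> sets borel" by (auto intro: secm)
        have B: "uminus ` ?A = uminus -` ?A \<inter> space borel" by force
        have [measurable]: "uminus ` ?A \<in> sets borel" unfolding B by measurable
        have "emeasure lborel (uminus ` ?A) = (\<integral>\<^sup>+t. indicator (uminus ` ?A) t \<partial>lborel)" by simp
        also have "\<dots> = ennreal \<bar>-1\<bar> * (\<integral>\<^sup>+t. indicator (uminus ` ?A) (0 + (-1) * t) \<partial>lborel)"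
          by (rule nn_integral_real_affine) auto
        also have "\<dots> = (\<integral>\<^sup>+t. indicator ?A t \<partial>lborel)"
        proof -
          have "(\<lambda>t. indicator (uminus ` ?A) (0 + (-1) * t) :: ennreal) = indicator ?A"
            by (intro ext) (auto simp: indicator_def)
          then show ?thesis by simp
        qed
        finally have "emeasure lborel (uminus ` ?A) = emeasure lborel ?A" by simp
        moreover have "emeasure lborel ?A + emeasure lborel (uminus ` ?A) \<le> 2 * emeasure lborel ?C"
        proof (rule Brunn_Minkowski_line)
          fix a b assume "a \<in> ?A" "b \<in> uminus ` ?A"
          then obtain b' where "b = - b'" "x(i := a) \<in> K" "x(i := b') \<in> K" by auto
          then show "(a + b) / 2 \<in> ?C" using K'I[of x a b'] by simp
        qed (use False in auto)
        ultimately have "2 * emeasure lborel ?A \<le> 2 * emeasure lborel ?C" by (simp add: mult_2)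
        then show ?thesis by (subst (asm) ennreal_mult_le_mult_iff) auto
      qed simp
      then show ?thesis by (simp add: e)
    qed
    have "(\<integral>\<^sup>+x. indicator K x \<partial>leb J) \<le> (\<integral>\<^sup>+x. indicator K' x \<partial>leb J)"
    proof -
      have "(\<integral>\<^sup>+x. indicator A x \<partial>leb J) = (\<integral>\<^sup>+x. (\<integral>\<^sup>+t. indicator A (x(i := t)) \<partial>lborel) \<partial>leb I)"
        if "A \<in> sets borel" for A :: "vec set"
        unfolding I(3) by (rule nn_integral_leb_insert[OF I(1,2)]) (rule borel_measurable_indicator[OF that])
      note this[OF \<open>K \<in> sets borel\<close>] this[OF \<open>K' \<in> sets borel\<close>]
      then show ?thesis by (simp only: nn_integral_mono sec)
    qed
    then show ?thesis by simp
  qed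
  have mL: "emeasure (leb J) L \<le> emeasure (leb J) L'"
  proof -
    interpret leb: sigma_finite_measure "leb I" by (rule sigma_finite_leb) fact
    interpret pair_sigma_finite "leb I" lborel ..
    have updm[measurable]: "(\<lambda>x. x(i := t)) \<in> borel_measurable borel" for t :: real
      by (rule measurable_vec_upd) simp_all
    have sec: "(\<integral>\<^sup>+x. indicator L (x(i := t)) \<partial>leb I) \<le> (\<integral>\<^sup>+x. indicator L' (x(i := t)) \<partial>leb I)" for t
    proof (rule ennreal_power2_le_imp_le)
      have "(\<integral>\<^sup>+x. indicator L (x(i := t)) \<partial>leb I) * (\<integral>\<^sup>+x. indicator L (x(i := - t)) \<partial>leb I)
        \<le> (\<integral>\<^sup>+x. indicator L' (x(i := t)) \<partial>leb I)\<^sup>2"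
      proof (rule Prekopa_Leindler[OF I(1)])
        show "indicator L (x(i := t)) * indicator L (y(i := - t)) \<le> (indicator L' (((1/2) *\<^sub>R (x + y))(i := t)) :: ennreal)\<^sup>2" for x y
          using L'I[of x t y] by (auto simp: indicator_def)
      qed measurable
      moreover have "(\<integral>\<^sup>+x. indicator L (x(i := - t)) \<partial>leb I) = (\<integral>\<^sup>+x. indicator L (x(i := t)) \<partial>leb I)"
      proof -
        have "(indicator L (x(i := - t)) :: ennreal) = indicator L ((- x)(i := t))" for x
          using symL[of "x(i := - t)"] symL[of "(- x)(i := t)"] neg_upd[of x "- t"] neg_upd[of "- x" t]
          by (auto simp: indicator_def)
        then have "(\<integral>\<^sup>+x. indicator L (x(i := - t)) \<partial>leb I) = (\<integral>\<^sup>+x. indicator L ((- x)(i := t)) \<partial>leb I)" by simp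
        also have "\<dots> = (\<integral>\<^sup>+x. indicator L (x(i := t)) \<partial>leb I)"
          by (rule nn_integral_leb_uminus[OF I(1), where f="\<lambda>x. indicator L (x(i := t))"]) measurable
        finally show ?thesis .
      qed
      ultimately show "(\<integral>\<^sup>+x. indicator L (x(i := t)) \<partial>leb I)\<^sup>2 \<le> (\<integral>\<^sup>+x. indicator L' (x(i := t)) \<partial>leb I)\<^sup>2"
        by (simp add: power2_eq_square)
    qed
    have swap: "(\<integral>\<^sup>+x. indicator A x \<partial>leb J) = (\<integral>\<^sup>+t. (\<integral>\<^sup>+x. indicator A (x(i := t)) \<partial>leb I) \<partial>lborel)"
      if [measurable]: "A \<in> sets borel" for A :: "vec set"
    proof -
      have "(\<integral>\<^sup>+x. indicator A x \<partial>leb J) = (\<integral>\<^sup>+x. (\<integral>\<^sup>+t. indicator A (x(i := t)) \<partial>lborel) \<partial>leb I)"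
        unfolding I(3) by (rule nn_integral_leb_insert[OF I(1,2)]) measurable
      also have "\<dots> = (\<integral>\<^sup>+t. (\<integral>\<^sup>+x. indicator A (x(i := t)) \<partial>leb I) \<partial>lborel)"
        by (rule Fubini'[symmetric]) measurable
      finally show ?thesis .
    qed
    have "(\<integral>\<^sup>+x. indicator L x \<partial>leb J) \<le> (\<integral>\<^sup>+x. indicator L' x \<partial>leb J)"
      using sec by (simp add: swap nn_integral_mono del: nn_integral_indicator)
    then show ?thesis by simp
  qed
  have pol: "dot J x y \<le> 1" if x: "x \<in> K'" and y: "y \<in> L'" for x y
  proof -
    obtain p a b where p: "x = p(i := (a - b) / 2)" "p(i := a) \<in> K" "p(i := b) \<in> K" using K'E[OF x] by auto
    obtain u v r where u: "y = ((1/2) *\<^sub>R (u + v))(i := r)" "u(i := r) \<in> L" "v(i := - r) \<in> L" using L'E[OF y] by auto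
    have ins: "dot J w z = w i * z i + dot I w z" for w z unfolding dot_def I(3) using I(1,2) by simp
    have loc: "dot I (w(i := s)) (z(i := t)) = dot I w z" for w z s t
      unfolding dot_def using I(2) by (intro sum.cong) auto
    \<comment> \<open>Averaging these two inequalities suffices: the terms a r and -b r combine to
      (a - b)/2 times r, the contribution of the new coordinates at i.\<close>
    have "dot J (p(i := a)) (u(i := r)) \<le> 1" "dot J (p(i := b)) (v(i := - r)) \<le> 1"
      using KL p u by auto
    then have "a * r + dot I p u \<le> 1" "- b * r + dot I p v \<le> 1" by (simp_all add: ins loc)
    moreover have "dot J x y = (a - b) / 2 * r + (dot I p u + dot I p v) / 2"
      unfolding p(1) u(1) by (simp add: ins loc dot_simps)
    ultimately show ?thesis by (simp add: field_simps)
  qed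
  show thesis
  proof (rule that[OF cK cL])
    show "- x \<in> K'" if x: "x \<in> K'" for x
    proof -
      obtain p a b where p: "x = p(i := (a - b) / 2)" "p(i := a) \<in> K" "p(i := b) \<in> K" using K'E[OF x] by auto
      show ?thesis using K'I[of "- p" "- a" "- b"] symK[OF p(2)] symK[OF p(3)] p(1)
        by (simp add: neg_upd) (metis minus_diff_eq minus_divide_left neg_upd)
    qed
    show "- z \<in> L'" if z: "z \<in> L'" for z
    proof -
      obtain u v r where u: "z = ((1/2) *\<^sub>R (u + v))(i := r)" "u(i := r) \<in> L" "v(i := - r) \<in> L" using L'E[OF z] by auto
      have "((1/2) *\<^sub>R (- u + - v))(i := - r) \<in> L'"
        using symL[OF u(2)] symL[OF u(3)] by (intro L'I) (simp_all add: neg_upd)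
      moreover have "- z = ((1/2) *\<^sub>R (- u + - v))(i := - r)"
        unfolding u(1) by (auto simp: fun_eq_iff scaleR_fun_apply field_simps)
      ultimately show ?thesis by simp
    qed
    show "x(i := - x i) \<in> K'" if x: "x \<in> K'" for x
    proof -
      obtain p a b where p: "x = p(i := (a - b) / 2)" "p(i := a) \<in> K" "p(i := b) \<in> K" using K'E[OF x] by auto
      have "x(i := - x i) = p(i := (b - a) / 2)" unfolding p(1) by (auto simp: fun_eq_iff field_simps)
      then show ?thesis using K'I[OF p(3,2)] by simp
    qed
    show "z(i := - z i) \<in> L'" if z: "z \<in> L'" for z
    proof -
      obtain u v r where u: "z = ((1/2) *\<^sub>R (u + v))(i := r)" "u(i := r) \<in> L" "v(i := - r) \<in> L" using L'E[OF z] by auto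
      have "z(i := - z i) = ((1/2) *\<^sub>R (v + u))(i := - r)" unfolding u(1) by (auto simp: fun_eq_iff scaleR_fun_apply)
      then show ?thesis using L'I[of v "- r" u] u by simp
    qed
    show "x(j := - x j) \<in> K'" if inv: "\<And>x. x \<in> K \<Longrightarrow> x(j := - x j) \<in> K" and x: "x \<in> K'" for j x
    proof -
      obtain p a b where p: "x = p(i := (a - b) / 2)" "p(i := a) \<in> K" "p(i := b) \<in> K" using K'E[OF x] by auto
      show ?thesis
      proof (cases "j = i")
        case True
        have "x(i := - x i) = p(i := (b - a) / 2)" unfolding p(1) by (auto simp: fun_eq_iff field_simps)
        then show ?thesis using K'I[OF p(3,2)] True by simp
      next
        case False
        have "(p(i := c))(j := - (p(i := c)) j) = (p(j := - p j))(i := c)" for c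
          using False by (auto simp: fun_eq_iff)
        then have "(p(j := - p j))(i := (a - b) / 2) \<in> K'"
          using inv[OF p(2)] inv[OF p(3)] by (intro K'I) metis+
        moreover have "x(j := - x j) = (p(j := - p j))(i := (a - b) / 2)"
          unfolding p(1) using False by (auto simp: fun_eq_iff)
        ultimately show ?thesis by simp
      qed
    qed
    show "z(j := - z j) \<in> L'" if inv: "\<And>x. x \<in> L \<Longrightarrow> x(j := - x j) \<in> L" and z: "z \<in> L'" for j z
    proof -
      obtain u v r where u: "z = ((1/2) *\<^sub>R (u + v))(i := r)" "u(i := r) \<in> L" "v(i := - r) \<in> L" using L'E[OF z] by auto
      show ?thesis
      proof (cases "j = i")
        case True
        have "z(i := - z i) = ((1/2) *\<^sub>R (v + u))(i := - r)" unfolding u(1) by (auto simp: fun_eq_iff scaleR_fun_apply)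
        then show ?thesis using L'I[of v "- r" u] u True by simp
      next
        case False
        have *: "(w(i := c))(j := - (w(i := c)) j) = (w(j := - w j))(i := c)" for c and w :: vec
          using False by (auto simp: fun_eq_iff)
        have "((1/2) *\<^sub>R (u(j := - u j) + v(j := - v j)))(i := r) \<in> L'"
          using inv[OF u(2)] inv[OF u(3)] by (intro L'I) (metis *)+
        moreover have "z(j := - z j) = ((1/2) *\<^sub>R (u(j := - u j) + v(j := - v j)))(i := r)"
          unfolding u(1) using False by (auto simp: fun_eq_iff scaleR_fun_apply field_simps)
        ultimately show ?thesis by simp
      qed
    qed
  qed (use pol mK mL in auto)
qed

text \<open>\<open>good S A B\<close> records that the coordinates in \<open>S\<close> have been
  symmetrised. A step in a new coordinate keeps the reflections already gained, so after finitely
  many steps both sets are unconditional, with volumes that have not decreased.\<close>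

lemma Blaschke_Santalo_compact:
  fixes K L :: "vec set"
  assumes J: "finite J" and K: "compact K" and L: "compact L"
    and symK: "\<And>x. x \<in> K \<Longrightarrow> - x \<in> K" and symL: "\<And>x. x \<in> L \<Longrightarrow> - x \<in> L"
    and KL: "\<And>x y. x \<in> K \<Longrightarrow> y \<in> L \<Longrightarrow> dot J x y \<le> 1"
  shows "emeasure (leb J) K * emeasure (leb J) L \<le> (emeasure (leb J) (uball J))\<^sup>2"
proof -
  define good where "good S A B \<longleftrightarrow> compact A \<and> compact B \<and> (\<forall>x\<in>A. - x \<in> A) \<and> (\<forall>x\<in>B. - x \<in> B) \<and>
    (\<forall>x\<in>A. \<forall>y\<in>B. dot J x y \<le> 1) \<and> emeasure (leb J) K \<le> emeasure (leb J) A \<and> emeasure (leb J) L \<le> emeasure (leb J) B \<and>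
    (\<forall>j\<in>S. \<forall>x\<in>A. x(j := - x j) \<in> A) \<and> (\<forall>j\<in>S. \<forall>x\<in>B. x(j := - x j) \<in> B)" for S A B
  have goodD: "compact A" "compact B" "\<And>x. x \<in> A \<Longrightarrow> - x \<in> A" "\<And>x. x \<in> B \<Longrightarrow> - x \<in> B"
      "\<And>x y. x \<in> A \<Longrightarrow> y \<in> B \<Longrightarrow> dot J x y \<le> 1" "emeasure (leb J) K \<le> emeasure (leb J) A" "emeasure (leb J) L \<le> emeasure (leb J) B"
      "\<And>j x. j \<in> S \<Longrightarrow> x \<in> A \<Longrightarrow> x(j := - x j) \<in> A" "\<And>j x. j \<in> S \<Longrightarrow> x \<in> B \<Longrightarrow> x(j := - x j) \<in> B"
    if g: "good S A B" for S A B
    using g unfolding good_def by - (elim conjE, (assumption | erule (1) bspec | (drule (1) bspec, erule (1) bspec)))+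
  have ex: "\<exists>A B. good S A B" if "finite S" "S \<subseteq> J" for S
    using that
  proof (induction S rule: finite_subset_induct')
    case empty
    have "good {} K L" unfolding good_def
      by (intro conjI ballI K L symK symL KL order.refl) auto
    then show ?case by (intro exI)
  next
    case (insert i S)
    from insert.IH obtain K1 L1 where "good S K1 L1" by (elim exE)
    note 1 = goodD[OF this]
    show ?case
    proof (rule Steiner_step[OF J \<open>i \<in> J\<close> 1(1-5)])
      fix K' L' assume 2: "compact K'" "compact L'" "\<And>x. x \<in> K' \<Longrightarrow> - x \<in> K'" "\<And>x. x \<in> L' \<Longrightarrow> - x \<in> L'"
        "\<And>x y. x \<in> K' \<Longrightarrow> y \<in> L' \<Longrightarrow> dot J x y \<le> 1"
        "emeasure (leb J) K1 \<le> emeasure (leb J) K'" "emeasure (leb J) L1 \<le> emeasure (leb J) L'"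
        "\<And>x. x \<in> K' \<Longrightarrow> x(i := - x i) \<in> K'" "\<And>x. x \<in> L' \<Longrightarrow> x(i := - x i) \<in> L'"
        "\<And>j x. (\<And>x. x \<in> K1 \<Longrightarrow> x(j := - x j) \<in> K1) \<Longrightarrow> x \<in> K' \<Longrightarrow> x(j := - x j) \<in> K'"
        "\<And>j x. (\<And>x. x \<in> L1 \<Longrightarrow> x(j := - x j) \<in> L1) \<Longrightarrow> x \<in> L' \<Longrightarrow> x(j := - x j) \<in> L'"
      have K': "x(j := - x j) \<in> K'" if "j \<in> insert i S" "x \<in> K'" for j x
        using that(1)
      proof (rule insertE)
        assume "j = i" then show ?thesis using 2(8)[OF that(2)] by (simp only:)
      next
        assume "j \<in> S" show ?thesis by (rule 2(10)[OF 1(8)[OF \<open>j \<in> S\<close>] that(2)])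
      qed
      have L': "x(j := - x j) \<in> L'" if "j \<in> insert i S" "x \<in> L'" for j x
        using that(1)
      proof (rule insertE)
        assume "j = i" then show ?thesis using 2(9)[OF that(2)] by (simp only:)
      next
        assume "j \<in> S" show ?thesis by (rule 2(11)[OF 1(9)[OF \<open>j \<in> S\<close>] that(2)])
      qed
      have "good (insert i S) K' L'"
        unfolding good_def
        by (intro conjI ballI, rule 2(1), rule 2(2), erule 2(3), erule 2(4),
            erule (1) 2(5), rule order_trans[OF 1(6) 2(6)], rule order_trans[OF 1(7) 2(7)], erule (1) K', erule (1) L')
      then show ?case by (intro exI)
    qed
  qed
  obtain K' L' where "good J K' L'" using ex[OF J order.refl] by (elim exE)
  note 1 = goodD[OF this]
  have iff: "x(j := - x j) \<in> A \<longleftrightarrow> x \<in> A" if "\<And>x. x \<in> A \<Longrightarrow> x(j := - x j) \<in> A" for A :: "vec set" and j x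
  proof
    assume "x(j := - x j) \<in> A"
    from that[OF this] show "x \<in> A" by (simp only: fun_upd_upd fun_upd_same minus_minus fun_upd_triv)
  qed (rule that)
  have "emeasure (leb J) K * emeasure (leb J) L \<le> emeasure (leb J) K' * emeasure (leb J) L'"
    using 1 by (intro mult_mono) auto
  also have "\<dots> \<le> (emeasure (leb J) (uball J))\<^sup>2"
    by (rule Blaschke_Santalo_unconditional[OF J borel_compact[OF 1(1)] borel_compact[OF 1(2)] iff[OF 1(8)] iff[OF 1(9)] 1(5)])
  finally show ?thesis .
qed

lemma emeasure_leb_closed_exhaust:
  assumes J: "finite J" and K: "closed K"
  shows "emeasure (leb J) K = (SUP k::nat. emeasure (leb J) (K \<inter> {x \<in> coord_space J. \<forall>i\<in>J. \<bar>x i\<bar> \<le> real k}))"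
proof -
  let ?B = "\<lambda>k::nat. {x \<in> coord_space J. \<forall>i\<in>J. \<bar>x i\<bar> \<le> real k}"
  have [measurable]: "K \<in> sets borel" "?B k \<in> sets borel" for k
    using K compact_box[of J "real k"] by (auto intro: borel_closed borel_compact)
  have un: "(\<Union>k. K \<inter> ?B k) = K \<inter> coord_space J"
  proof -
    have "\<exists>k::nat. \<forall>i\<in>J. \<bar>x i\<bar> \<le> real k" for x :: vec
    proof -
      obtain k :: nat where k: "(\<Sum>i\<in>J. \<bar>x i\<bar>) \<le> real k" using real_arch_simple by blast
      have "\<bar>x i\<bar> \<le> (\<Sum>i\<in>J. \<bar>x i\<bar>)" if "i \<in> J" for i
        using that J by (intro member_le_sum) auto
      then show ?thesis using k by (meson order_trans)
    qed
    then show ?thesis by auto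
  qed
  have "emeasure (leb J) K = emeasure (leb J) (K \<inter> coord_space J)"
    using AE_leb_coord_space[of J] by (intro emeasure_eq_AE) auto
  also have "\<dots> = emeasure (leb J) (\<Union>k. K \<inter> ?B k)" by (simp only: un)
  also have "\<dots> = (SUP k. emeasure (leb J) (K \<inter> ?B k))"
    by (rule SUP_emeasure_incseq[symmetric]) (auto simp: incseq_def intro: order_trans)
  finally show ?thesis .
qed

text \<open>The sublevel sets to which this is applied are closed but may be unbounded. Intersecting
  with growing boxes reduces to compact sets, because \<open>leb J\<close> only sees
  \<open>coord_space J\<close>.\<close>

theorem Blaschke_Santalo:
  fixes K L :: "vec set"
  assumes J: "finite J" and K: "closed K" and L: "closed L"
    and symK: "\<And>x. x \<in> K \<Longrightarrow> - x \<in> K" and symL: "\<And>x. x \<in> L \<Longrightarrow> - x \<in> L"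
    and KL: "\<And>x y. x \<in> K \<inter> coord_space J \<Longrightarrow> y \<in> L \<inter> coord_space J \<Longrightarrow> dot J x y \<le> 1"
  shows "emeasure (leb J) K * emeasure (leb J) L \<le> (emeasure (leb J) (uball J))\<^sup>2"
proof -
  let ?B = "\<lambda>k::nat. {x \<in> coord_space J. \<forall>i\<in>J. \<bar>x i\<bar> \<le> real k}"
  have "emeasure (leb J) (K \<inter> ?B k) * emeasure (leb J) (L \<inter> ?B l) \<le> (emeasure (leb J) (uball J))\<^sup>2" for k l
    by (rule Blaschke_Santalo_compact[OF J])
       (use K L symK symL KL in \<open>auto intro!: closed_Int_compact compact_box\<close>)
  then show ?thesis
    unfolding emeasure_leb_closed_exhaust[OF J K] emeasure_leb_closed_exhaust[OF J L]
    by (simp add: SUP_mult_right_ennreal SUP_mult_left_ennreal SUP_least)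
qed

section \<open>Monotone piecewise linear fields\<close>

text \<open>Banach iteration of x - \<eta> (G x - v), which strong monotonicity makes a contraction
  when \<eta> is small compared with the Lipschitz bound. The limit is formed coordinatewise, and
  the Lipschitz bound carries the vanishing residual over to it.\<close>

lemma strongly_monotone_surjective:
  fixes G :: "vec \<Rightarrow> vec"
  assumes I: "finite I" and GE: "\<And>x. x \<in> coord_space I \<Longrightarrow> G x \<in> coord_space I"
    and \<kappa>: "\<kappa> > 0"
    and mono: "\<And>x y. x \<in> coord_space I \<Longrightarrow> y \<in> coord_space I \<Longrightarrow> \<kappa> * dot I (x - y) (x - y) \<le> dot I (G x - G y) (x - y)"
    and lip: "\<And>x y. x \<in> coord_space I \<Longrightarrow> y \<in> coord_space I \<Longrightarrow> dot I (G x - G y) (G x - G y) \<le> \<Lambda> * dot I (x - y) (x - y)"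
    and v: "v \<in> coord_space I"
  shows "\<exists>a\<in>coord_space I. G a = v"
proof -
  \<comment> \<open>Enlarging the constant to at least \<kappa>^2 keeps the contraction factor 1 -
    \<kappa>^2/L nonnegative; \<eta> = \<kappa>/L minimises the factor 1 - 2 \<eta> \<kappa> +
    \<eta>^2 L.\<close>
  define L where "L = max \<Lambda> (\<kappa>\<^sup>2)"
  have L: "L \<ge> \<kappa>\<^sup>2" "L \<ge> \<Lambda>" "L > 0" using \<kappa> by (auto simp: L_def less_max_iff_disj)
  define \<eta> where "\<eta> = \<kappa> / L"
  have \<eta>: "\<eta> > 0" using \<kappa> L by (simp add: \<eta>_def)
  define \<rho> where "\<rho> = 1 - \<kappa>\<^sup>2 / L"
  have \<rho>: "0 \<le> \<rho>" "\<rho> < 1" using L \<kappa> by (auto simp: \<rho>_def)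
  define \<Phi> where "\<Phi> x = x - \<eta> *\<^sub>R (G x - v)" for x
  have \<Phi>E: "\<Phi> x \<in> coord_space I" if "x \<in> coord_space I" for x
    unfolding \<Phi>_def using that GE v by simp
  have contr: "dot I (\<Phi> x - \<Phi> y) (\<Phi> x - \<Phi> y) \<le> \<rho> * dot I (x - y) (x - y)"
    if xy: "x \<in> coord_space I" "y \<in> coord_space I" for x y
  proof -
    define d g where "d = x - y" and "g = G x - G y"
    have eq: "\<Phi> x - \<Phi> y = d - \<eta> *\<^sub>R g" by (simp add: \<Phi>_def d_def g_def algebra_simps)
    have "dot I (d - \<eta> *\<^sub>R g) (d - \<eta> *\<^sub>R g) = dot I d d - 2 * \<eta> * dot I g d + \<eta>\<^sup>2 * dot I g g"
      by (simp add: dot_simps dot_commute[of I d g] power2_eq_square algebra_simps)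
    also have "\<dots> \<le> dot I d d - 2 * \<eta> * (\<kappa> * dot I d d) + \<eta>\<^sup>2 * (L * dot I d d)"
    proof -
      have "2 * \<eta> * (\<kappa> * dot I d d) \<le> 2 * \<eta> * dot I g d"
        using mono[OF xy] \<eta> unfolding d_def g_def by (intro mult_left_mono) auto
      moreover have "dot I g g \<le> L * dot I d d"
        using lip[OF xy] L(2) unfolding d_def g_def by (meson dot_nonneg mult_right_mono order_trans)
      then have "\<eta>\<^sup>2 * dot I g g \<le> \<eta>\<^sup>2 * (L * dot I d d)" by (intro mult_left_mono) auto
      ultimately show ?thesis by linarith
    qed
    also have "\<dots> = \<rho> * dot I d d"
      using L(3) by (simp add: \<eta>_def \<rho>_def field_simps power2_eq_square)
    finally show ?thesis unfolding eq d_def .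
  qed
  define a where "a k = (\<Phi> ^^ k) 0" for k :: nat
  have aE: "a k \<in> coord_space I" for k unfolding a_def
    by (induction k) (simp_all only: funpow.simps id_apply comp_apply coord_space_algebra \<Phi>E)
  have aS: "a (Suc k) = \<Phi> (a k)" for k by (simp add: a_def)
  define C where "C = dot I (a 1 - a 0) (a 1 - a 0)"
  have step: "dot I (a (Suc k) - a k) (a (Suc k) - a k) \<le> \<rho> ^ k * C" for k
  proof (induction k)
    case (Suc k)
    have "dot I (a (Suc (Suc k)) - a (Suc k)) (a (Suc (Suc k)) - a (Suc k)) \<le> \<rho> * dot I (a (Suc k) - a k) (a (Suc k) - a k)"
      using contr[OF aE[of "Suc k"] aE[of k]] by (simp add: aS)
    also have "\<dots> \<le> \<rho> * (\<rho> ^ k * C)" using Suc \<rho> by (intro mult_left_mono)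
    finally show ?case by (simp only: power_Suc mult.assoc)
  qed (simp only: C_def power_0 mult_1 One_nat_def order.refl)
  have conv: "convergent (\<lambda>k. a k i)" if i: "i \<in> I" for i
  proof -
    have bnd: "norm (a (Suc k) i - a k i) \<le> sqrt C * sqrt \<rho> ^ k" for k
    proof -
      have "((a (Suc k) - a k) i)\<^sup>2 \<le> \<rho> ^ k * C"
        using component_le_dot[OF I i] step by (rule order_trans)
      then have "sqrt (((a (Suc k) - a k) i)\<^sup>2) \<le> sqrt (\<rho> ^ k * C)" by (rule real_sqrt_le_mono)
      then show ?thesis unfolding real_sqrt_abs by (simp add: real_sqrt_mult real_sqrt_power mult.commute)
    qed
    have sg: "summable (\<lambda>k. sqrt C * sqrt \<rho> ^ k)"
      using \<rho> by (intro summable_mult summable_geometric) auto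
    have "summable (\<lambda>k. a (Suc k) i - a k i)"
      by (rule summable_comparison_test'[OF sg, of 0]) (rule bnd)
    then have "convergent (\<lambda>n. \<Sum>k<n. a (Suc k) i - a k i)" by (simp add: summable_iff_convergent)
    then have "convergent (\<lambda>n. a n i - a 0 i)" by (simp only: sum_lessThan_telescope[of "\<lambda>k. a k i"])
    then have "convergent (\<lambda>n. a 0 i + (a n i - a 0 i))" by (intro convergent_add convergent_const)
    then show ?thesis by simp
  qed
  define b where "b i = (if i \<in> I then lim (\<lambda>k. a k i) else 0)" for i
  have bE: "b \<in> coord_space I" by (simp add: b_def coord_space_def)
  have lim: "(\<lambda>k. a k i) \<longlonglongrightarrow> b i" if "i \<in> I" for i
    using conv[OF that] that by (simp add: b_def convergent_LIMSEQ_iff)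
  have lim2: "(\<lambda>k. dot I (a k - b) (a k - b)) \<longlonglongrightarrow> 0"
  proof -
    have "(\<lambda>k. \<Sum>i\<in>I. (a k i - b i) * (a k i - b i)) \<longlonglongrightarrow> (\<Sum>i\<in>I. (b i - b i) * (b i - b i))"
      by (intro tendsto_sum tendsto_mult tendsto_diff tendsto_const lim)
    then show ?thesis by (simp add: dot_def)
  qed
  have lim3: "(\<lambda>k. dot I (G (a k) - v) (G (a k) - v)) \<longlonglongrightarrow> 0"
  proof -
    have bnd: "dot I (G (a k) - v) (G (a k) - v) \<le> (1/\<eta>\<^sup>2) * (\<rho> ^ k * C)" for k
    proof -
      \<comment> \<open>Up to the factor -1/\<eta> the residual is the increment of the
        iteration.\<close>
      have "a (Suc k) - a k = (- \<eta>) *\<^sub>R (G (a k) - v)" by (simp add: aS \<Phi>_def)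
      then have "\<eta>\<^sup>2 * dot I (G (a k) - v) (G (a k) - v) \<le> \<rho> ^ k * C"
        using step[of k] by (simp only: dot_simps) (simp add: power2_eq_square algebra_simps)
      then show ?thesis using \<eta> by (simp add: field_simps)
    qed
    have lg: "(\<lambda>k. (1/\<eta>\<^sup>2) * (\<rho> ^ k * C)) \<longlonglongrightarrow> (1/\<eta>\<^sup>2) * (0 * C)"
      using \<rho> by (intro tendsto_mult tendsto_const LIMSEQ_power_zero) auto
    then have "(\<lambda>k. (1/\<eta>\<^sup>2) * (\<rho> ^ k * C)) \<longlonglongrightarrow> 0" by simp
    then show ?thesis
      by (rule tendsto_sandwich[OF always_eventually always_eventually tendsto_const, rotated 2])
         (use bnd in \<open>auto simp only: dot_nonneg\<close>)
  qed
  have "dot I (G b - v) (G b - v) \<le> 2 * (\<Lambda> * dot I (a k - b) (a k - b)) + 2 * dot I (G (a k) - v) (G (a k) - v)" for k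
  proof -
    define p q where "p = G (a k) - G b" and "q = G (a k) - v"
    have "G b - v = q - p" by (simp add: p_def q_def)
    then have "dot I (G b - v) (G b - v) = dot I q q - 2 * dot I p q + dot I p p"
      by (simp add: dot_simps dot_commute[of I q p])
    also have "\<dots> \<le> 2 * dot I p p + 2 * dot I q q" using dot_AM_GM[of I p q] by linarith
    also have "dot I p p \<le> \<Lambda> * dot I (a k - b) (a k - b)" unfolding p_def by (rule lip[OF aE bE])
    finally show ?thesis unfolding q_def by linarith
  qed
  moreover have "(\<lambda>k. 2 * (\<Lambda> * dot I (a k - b) (a k - b)) + 2 * dot I (G (a k) - v) (G (a k) - v)) \<longlonglongrightarrow> 2 * (\<Lambda> * 0) + 2 * 0"
    by (intro tendsto_add tendsto_mult tendsto_const lim2 lim3)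
  ultimately have "dot I (G b - v) (G b - v) \<le> 2 * (\<Lambda> * 0) + 2 * 0"
    by (intro LIMSEQ_le_const) auto
  then have "dot I (G b - v) (G b - v) = 0" using dot_nonneg[of I "G b - v"] by simp
  then have "G b = v" using dot_eq_0_iff[OF I, of "G b - v"] bE GE v by simp
  then show ?thesis using bE by blast
qed

section \<open>Lebesgue measure on pairs of vectors\<close>

lemma borel_measurable_fst_comp [measurable (raw)]:
  fixes f :: "'a \<Rightarrow> vec \<times> vec"
  assumes "f \<in> borel_measurable M" shows "(\<lambda>x. fst (f x)) \<in> borel_measurable M"
  by (rule measurable_compose[OF assms borel_measurable_continuous_onI]) (intro continuous_intros)

lemma borel_measurable_snd_comp [measurable (raw)]:
  fixes f :: "'a \<Rightarrow> vec \<times> vec"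
  assumes "f \<in> borel_measurable M" shows "(\<lambda>x. snd (f x)) \<in> borel_measurable M"
  by (rule measurable_compose[OF assms borel_measurable_continuous_onI]) (intro continuous_intros)

lemma measurable_vec2_add [measurable (raw)]:
  fixes f g :: "'a \<Rightarrow> vec \<times> vec"
  assumes [measurable]: "f \<in> borel_measurable M" "g \<in> borel_measurable M"
  shows "(\<lambda>x. f x + g x) \<in> borel_measurable M"
  unfolding plus_prod_def by measurable

lemma measurable_vec2_diff [measurable (raw)]:
  fixes f g :: "'a \<Rightarrow> vec \<times> vec"
  assumes [measurable]: "f \<in> borel_measurable M" "g \<in> borel_measurable M"
  shows "(\<lambda>x. f x - g x) \<in> borel_measurable M"
  unfolding minus_prod_def by measurable

definition leb2 :: "nat set \<Rightarrow> (vec \<times> vec) measure" where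
  "leb2 I = leb I \<Otimes>\<^sub>M leb I"

lemma sets_leb2 [simp, measurable_cong]: "sets (leb2 I) = sets borel"
  unfolding leb2_def by (simp add: borel_prod[symmetric] cong: sets_pair_measure_cong)

lemma space_leb2 [simp]: "space (leb2 I) = UNIV"
  by (simp add: leb2_def space_pair_measure)

lemma sigma_finite_leb2: "finite I \<Longrightarrow> sigma_finite_measure (leb2 I)"
proof -
  assume "finite I"
  then interpret sigma_finite_measure "leb I" by (rule sigma_finite_leb)
  interpret pair_sigma_finite "leb I" "leb I" ..
  show ?thesis unfolding leb2_def by (rule P.sigma_finite_measure_axioms)
qed

lemma nn_integral_leb2:
  assumes "finite I" and [measurable]: "f \<in> borel_measurable borel"
  shows "(\<integral>\<^sup>+z. f z \<partial>leb2 I) = (\<integral>\<^sup>+a. (\<integral>\<^sup>+b. f (a, b) \<partial>leb I) \<partial>leb I)"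
proof -
  interpret sigma_finite_measure "leb I" by (rule sigma_finite_leb) fact
  have "f \<in> borel_measurable (leb2 I)" by measurable
  then have "f \<in> borel_measurable (leb I \<Otimes>\<^sub>M leb I)" by (simp only: leb2_def)
  from nn_integral_fst[OF this] show ?thesis by (simp add: leb2_def)
qed

lemma AE_leb2_coord_space: "finite I \<Longrightarrow> AE z in leb2 I. fst z \<in> coord_space I \<and> snd z \<in> coord_space I"
proof -
  assume "finite I"
  then interpret sigma_finite_measure "leb I" by (rule sigma_finite_leb)
  interpret pair_sigma_finite "leb I" "leb I" ..
  have "AE z in leb I \<Otimes>\<^sub>M leb I. fst z \<in> coord_space I \<and> snd z \<in> coord_space I"
  proof (rule AE_pair_measure)
    show "{x \<in> space (leb I \<Otimes>\<^sub>M leb I). fst x \<in> coord_space I \<and> snd x \<in> coord_space I} \<in> sets (leb I \<Otimes>\<^sub>M leb I)"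
      by measurable
    show "AE x in leb I. AE y in leb I. fst (x, y) \<in> coord_space I \<and> snd (x, y) \<in> coord_space I"
      using AE_leb_coord_space[of I] by auto
  qed
  then show ?thesis by (simp only: leb2_def)
qed

lemma nn_integral_leb2_translate:
  assumes I: "finite I" and v: "fst v \<in> coord_space I" "snd v \<in> coord_space I"
    and [measurable]: "f \<in> borel_measurable borel"
  shows "(\<integral>\<^sup>+z. f (z + v) \<partial>leb2 I) = (\<integral>\<^sup>+z. f z \<partial>leb2 I)"
proof -
  interpret sigma_finite_measure "leb I" by (rule sigma_finite_leb) fact
  have "(\<integral>\<^sup>+z. f (z + v) \<partial>leb2 I) = (\<integral>\<^sup>+a. (\<integral>\<^sup>+b. f ((a, b) + v) \<partial>leb I) \<partial>leb I)"
    by (rule nn_integral_leb2[OF I]) measurable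
  also have "\<dots> = (\<integral>\<^sup>+a. (\<integral>\<^sup>+b. f (a + fst v, b + snd v) \<partial>leb I) \<partial>leb I)"
    by (simp add: plus_prod_def)
  also have "\<dots> = (\<integral>\<^sup>+a. (\<integral>\<^sup>+b. f (a + fst v, b) \<partial>leb I) \<partial>leb I)"
  proof (rule nn_integral_cong)
    fix a
    show "(\<integral>\<^sup>+b. f (a + fst v, b + snd v) \<partial>leb I) = (\<integral>\<^sup>+b. f (a + fst v, b) \<partial>leb I)"
      by (rule nn_integral_leb_translate[OF I v(2), where f="\<lambda>b. f (a + fst v, b)"]) measurable
  qed
  also have "\<dots> = (\<integral>\<^sup>+a. (\<integral>\<^sup>+b. f (a, b) \<partial>leb I) \<partial>leb I)"
    by (rule nn_integral_leb_translate[OF I v(1), where f="\<lambda>a. \<integral>\<^sup>+b. f (a, b) \<partial>leb I"]) measurable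
  also have "\<dots> = (\<integral>\<^sup>+z. f z \<partial>leb2 I)"
    by (rule nn_integral_leb2[OF I, symmetric]) measurable
  finally show ?thesis .
qed

definition nrm2 :: "nat set \<Rightarrow> vec \<times> vec \<Rightarrow> real" where
  "nrm2 I z = dot I (fst z) (fst z) + dot I (snd z) (snd z)"

lemma nrm2_nonneg [simp]: "nrm2 I z \<ge> 0"
  by (simp add: nrm2_def)

lemma measurable_nrm2 [measurable (raw)]:
  assumes [measurable]: "f \<in> borel_measurable M"
  shows "(\<lambda>x. nrm2 I (f x)) \<in> borel_measurable M"
  unfolding nrm2_def by measurable

section \<open>Gaussian integrals\<close>

lemma nn_integral_gauss_line:
  assumes "t > 0"
  shows "(\<integral>\<^sup>+x. ennreal (exp (- t * x\<^sup>2)) \<partial>lborel) = ennreal (sqrt (pi / t))"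
proof -
  define \<sigma> where "\<sigma> = sqrt (1 / (2 * t))"
  have \<sigma>: "\<sigma> > 0" "2 * \<sigma>\<^sup>2 = 1 / t" using assms by (auto simp: \<sigma>_def)
  have "exp (- t * x\<^sup>2) = sqrt (pi / t) * normal_density 0 \<sigma> x" for x
  proof -
    have "2 * pi * \<sigma>\<^sup>2 = pi / t" using \<sigma>(2) by (simp add: field_simps)
    moreover have "x\<^sup>2 / (2 * \<sigma>\<^sup>2) = t * x\<^sup>2" unfolding \<sigma>(2) by simp
    moreover have "sqrt (pi / t) > 0" using assms by simp
    ultimately show ?thesis using assms unfolding normal_density_def by simp
  qed
  then have "(\<integral>\<^sup>+x. ennreal (exp (- t * x\<^sup>2)) \<partial>lborel) = (\<integral>\<^sup>+x. ennreal (sqrt (pi / t)) * ennreal (normal_density 0 \<sigma> x) \<partial>lborel)"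
    using assms by (simp add: ennreal_mult)
  also have "\<dots> = ennreal (sqrt (pi / t)) * (\<integral>\<^sup>+x. ennreal (normal_density 0 \<sigma> x) \<partial>lborel)"
    by (rule nn_integral_cmult) simp
  also have "(\<integral>\<^sup>+x. ennreal (normal_density 0 \<sigma> x) \<partial>lborel) = 1"
    using \<sigma> integrable_normal_density integral_normal_density
    by (subst nn_integral_eq_integral) auto
  finally show ?thesis by simp
qed

lemma nn_integral_gauss_leb:
  assumes "finite I" "t > 0"
  shows "(\<integral>\<^sup>+x. ennreal (exp (- t * dot I x x)) \<partial>leb I) = ennreal (sqrt (pi / t) ^ card I)"
  using assms(1)
proof (induction I)
  case empty
  have "(\<integral>\<^sup>+x. ennreal (exp (- t * dot {} x x)) \<partial>leb {}) = ennreal (exp (- t * dot {} 0 0))"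
    by (rule nn_integral_leb_empty) measurable
  then show ?case by (simp add: dot_def)
next
  case (insert i I)
  have eq: "ennreal (exp (- t * dot (insert i I) (x(i := s)) (x(i := s)))) = ennreal (exp (- t * dot I x x)) * ennreal (exp (- t * s\<^sup>2))" for x s
  proof -
    have "(\<Sum>k\<in>I. (x(i := s)) k * (x(i := s)) k) = (\<Sum>k\<in>I. x k * x k)"
      using insert.hyps by (intro sum.cong) auto
    then have "dot (insert i I) (x(i := s)) (x(i := s)) = s\<^sup>2 + dot I x x"
      unfolding dot_def using insert.hyps by (simp add: power2_eq_square)
    then show ?thesis by (simp add: distrib_left exp_add[symmetric] mult.commute flip: ennreal_mult exp_add)
  qed
  have "(\<integral>\<^sup>+x. ennreal (exp (- t * dot (insert i I) x x)) \<partial>leb (insert i I)) =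
    (\<integral>\<^sup>+x. (\<integral>\<^sup>+s. ennreal (exp (- t * dot (insert i I) (x(i := s)) (x(i := s)))) \<partial>lborel) \<partial>leb I)"
    by (rule nn_integral_leb_insert[OF insert.hyps(1,2)]) measurable
  also have "\<dots> = (\<integral>\<^sup>+x. (\<integral>\<^sup>+s. ennreal (exp (- t * dot I x x)) * ennreal (exp (- t * s\<^sup>2)) \<partial>lborel) \<partial>leb I)"
    by (simp only: eq)
  also have "\<dots> = (\<integral>\<^sup>+x. ennreal (exp (- t * dot I x x)) * ennreal (sqrt (pi / t)) \<partial>leb I)"
  proof (rule nn_integral_cong)
    fix x
    have "(\<integral>\<^sup>+s. ennreal (exp (- t * dot I x x)) * ennreal (exp (- t * s\<^sup>2)) \<partial>lborel) =
       ennreal (exp (- t * dot I x x)) * (\<integral>\<^sup>+s. ennreal (exp (- t * s\<^sup>2)) \<partial>lborel)"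
      by (rule nn_integral_cmult) simp
    then show "(\<integral>\<^sup>+s. ennreal (exp (- t * dot I x x)) * ennreal (exp (- t * s\<^sup>2)) \<partial>lborel) =
       ennreal (exp (- t * dot I x x)) * ennreal (sqrt (pi / t))"
      by (simp only: nn_integral_gauss_line[OF assms(2)])
  qed
  also have "\<dots> = (\<integral>\<^sup>+x. ennreal (exp (- t * dot I x x)) \<partial>leb I) * ennreal (sqrt (pi / t))"
    by (rule nn_integral_multc) measurable
  also have "\<dots> = ennreal (sqrt (pi / t) ^ card (insert i I))"
    using insert assms(2) by (simp add: ennreal_mult[symmetric] mult.commute)
  finally show ?case .
qed

lemma nn_integral_gauss_leb2:
  assumes I: "finite I" and t: "t > 0"
  shows "(\<integral>\<^sup>+z. ennreal (exp (- t * nrm2 I z)) \<partial>leb2 I) = ennreal ((pi / t) ^ card I)"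
proof -
  have "(\<integral>\<^sup>+z. ennreal (exp (- t * nrm2 I z)) \<partial>leb2 I) = (\<integral>\<^sup>+a. (\<integral>\<^sup>+b. ennreal (exp (- t * nrm2 I (a, b))) \<partial>leb I) \<partial>leb I)"
    by (rule nn_integral_leb2[OF I]) measurable
  also have "\<dots> = (\<integral>\<^sup>+a. (\<integral>\<^sup>+b. ennreal (exp (- t * dot I a a)) * ennreal (exp (- t * dot I b b)) \<partial>leb I) \<partial>leb I)"
  proof -
    have "exp (- t * nrm2 I (a, b)) = exp (- t * dot I a a) * exp (- t * dot I b b)" for a b
      unfolding exp_add[symmetric] by (simp add: nrm2_def algebra_simps)
    then show ?thesis by (simp only: ennreal_mult exp_ge_zero)
  qed
  also have "\<dots> = (\<integral>\<^sup>+a. ennreal (exp (- t * dot I a a)) * ennreal (sqrt (pi / t) ^ card I) \<partial>leb I)"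
  proof (rule nn_integral_cong)
    fix a
    have "(\<integral>\<^sup>+b. ennreal (exp (- t * dot I a a)) * ennreal (exp (- t * dot I b b)) \<partial>leb I) =
       ennreal (exp (- t * dot I a a)) * (\<integral>\<^sup>+b. ennreal (exp (- t * dot I b b)) \<partial>leb I)"
      by (rule nn_integral_cmult) measurable
    then show "(\<integral>\<^sup>+b. ennreal (exp (- t * dot I a a)) * ennreal (exp (- t * dot I b b)) \<partial>leb I) =
       ennreal (exp (- t * dot I a a)) * ennreal (sqrt (pi / t) ^ card I)"
      by (simp only: nn_integral_gauss_leb[OF I t])
  qed
  also have "\<dots> = (\<integral>\<^sup>+a. ennreal (exp (- t * dot I a a)) \<partial>leb I) * ennreal (sqrt (pi / t) ^ card I)"
    by (rule nn_integral_multc) measurable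
  also have "\<dots> = ennreal ((pi / t) ^ card I)"
    using t unfolding nn_integral_gauss_leb[OF I t] by (simp flip: ennreal_mult power_mult_distrib)
  finally show ?thesis .
qed

text \<open>The pull-back of Lebesgue measure under a linear bijection is translation invariant; testing
  it against the even function \<open>g\<close> and using Fubini twice shows that it is a multiple of Lebesgue measure.\<close>
lemma linear_image_leb2:
  fixes M :: "vec \<times> vec \<Rightarrow> vec \<times> vec"
  assumes I: "finite I" and [measurable]: "M \<in> borel_measurable borel"
    and add: "\<And>z w. M (z + w) = M z + M w"
    and ME: "\<And>z. fst z \<in> coord_space I \<Longrightarrow> snd z \<in> coord_space I \<Longrightarrow> fst (M z) \<in> coord_space I \<and> snd (M z) \<in> coord_space I"
    and surj: "\<And>w. fst w \<in> coord_space I \<Longrightarrow> snd w \<in> coord_space I \<Longrightarrow>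
       \<exists>z. fst z \<in> coord_space I \<and> snd z \<in> coord_space I \<and> M z = w"
    and C: "C > 0" "\<And>z. fst z \<in> coord_space I \<Longrightarrow> snd z \<in> coord_space I \<Longrightarrow> nrm2 I z \<le> C * nrm2 I (M z)"
  shows "\<exists>c::ennreal. \<forall>f\<in>borel_measurable borel. (\<integral>\<^sup>+w. f w \<partial>leb2 I) = c * (\<integral>\<^sup>+z. f (M z) \<partial>leb2 I)"
proof -
  interpret sigma_finite_measure "leb2 I" by (rule sigma_finite_leb2[OF I])
  interpret pair_sigma_finite "leb2 I" "leb2 I" ..
  \<comment> \<open>A Gaussian has a finite and positive integral, both by itself and after
    composition with \<open>M\<close>, so the ratio of the two is a usable constant.\<close>
  define g where "g w = ennreal (exp (- 1 * nrm2 I w))" for w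
  have [measurable]: "g \<in> borel_measurable borel" unfolding g_def by measurable
  have geven: "g (v - w) = g (w - v)" for v w
  proof -
    have "nrm2 I (v - w) = nrm2 I (w - v)" by (simp add: nrm2_def dot_simps)
    then show ?thesis by (simp add: g_def)
  qed
  define \<mu> where "\<mu> f = (\<integral>\<^sup>+z. f (M z) \<partial>leb2 I)" for f :: "vec \<times> vec \<Rightarrow> ennreal"
  define lam where "lam f = (\<integral>\<^sup>+z. f z \<partial>leb2 I)" for f :: "vec \<times> vec \<Rightarrow> ennreal"
  have Msub: "M (z - u) = M z - M u" for z u
    using add[of "z - u" u] by (metis add_diff_cancel_right' diff_add_cancel)
  have key: "lam g * \<mu> f = lam f * \<mu> g" if [measurable]: "f \<in> borel_measurable borel" for f
  proof -
    have "lam g * \<mu> f = (\<integral>\<^sup>+w. g w * \<mu> f \<partial>leb2 I)"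
      unfolding lam_def by (rule nn_integral_multc[symmetric]) measurable
    also have "\<dots> = (\<integral>\<^sup>+w. (\<integral>\<^sup>+z. g w * f (M z + w) \<partial>leb2 I) \<partial>leb2 I)"
    proof (rule nn_integral_cong_AE, use AE_leb2_coord_space[OF I] in eventually_elim)
      fix w :: "vec \<times> vec" assume "fst w \<in> coord_space I \<and> snd w \<in> coord_space I"
      then obtain u where u: "fst u \<in> coord_space I" "snd u \<in> coord_space I" "M u = w" using surj by blast
      have "\<mu> f = (\<integral>\<^sup>+z. f (M (z + u)) \<partial>leb2 I)"
        unfolding \<mu>_def by (rule nn_integral_leb2_translate[OF I u(1,2), where f="\<lambda>z. f (M z)", symmetric]) measurable
      also have "\<dots> = (\<integral>\<^sup>+z. f (M z + w) \<partial>leb2 I)" by (simp only: add u(3))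
      finally have "\<mu> f = (\<integral>\<^sup>+z. f (M z + w) \<partial>leb2 I)" .
      moreover have "(\<integral>\<^sup>+z. g w * f (M z + w) \<partial>leb2 I) = g w * (\<integral>\<^sup>+z. f (M z + w) \<partial>leb2 I)"
        by (rule nn_integral_cmult) measurable
      ultimately show "g w * \<mu> f = (\<integral>\<^sup>+z. g w * f (M z + w) \<partial>leb2 I)" by simp
    qed
    also have "\<dots> = (\<integral>\<^sup>+z. (\<integral>\<^sup>+w. g w * f (M z + w) \<partial>leb2 I) \<partial>leb2 I)"
      by (rule Fubini') measurable
    also have "\<dots> = (\<integral>\<^sup>+z. (\<integral>\<^sup>+w. g (w - M z) * f w \<partial>leb2 I) \<partial>leb2 I)"
    proof (rule nn_integral_cong_AE, use AE_leb2_coord_space[OF I] in eventually_elim)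
      fix z :: "vec \<times> vec" assume z: "fst z \<in> coord_space I \<and> snd z \<in> coord_space I"
      have "(\<integral>\<^sup>+w. g (w + M z - M z) * f (w + M z) \<partial>leb2 I) = (\<integral>\<^sup>+w. g (w - M z) * f w \<partial>leb2 I)"
        by (rule nn_integral_leb2_translate[OF I, where f="\<lambda>w. g (w - M z) * f w"]) (use ME z in \<open>auto | measurable\<close>)
      then show "(\<integral>\<^sup>+w. g w * f (M z + w) \<partial>leb2 I) = (\<integral>\<^sup>+w. g (w - M z) * f w \<partial>leb2 I)"
        by (simp add: add.commute)
    qed
    also have "\<dots> = (\<integral>\<^sup>+w. (\<integral>\<^sup>+z. g (w - M z) * f w \<partial>leb2 I) \<partial>leb2 I)"
      by (rule Fubini') measurable
    also have "\<dots> = (\<integral>\<^sup>+w. f w * \<mu> g \<partial>leb2 I)"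
    proof (rule nn_integral_cong_AE, use AE_leb2_coord_space[OF I] in eventually_elim)
      fix w :: "vec \<times> vec" assume "fst w \<in> coord_space I \<and> snd w \<in> coord_space I"
      then obtain u where u: "fst u \<in> coord_space I" "snd u \<in> coord_space I" "M u = w" using surj by blast
      have "(\<integral>\<^sup>+z. g (w - M z) * f w \<partial>leb2 I) = (\<integral>\<^sup>+z. g (w - M z) \<partial>leb2 I) * f w"
        by (rule nn_integral_multc) measurable
      also have "(\<integral>\<^sup>+z. g (w - M z) \<partial>leb2 I) = (\<integral>\<^sup>+z. g (M (z + (- u))) \<partial>leb2 I)"
        using geven[of w] Msub[of _ u] u(3) by simp
      also have "\<dots> = \<mu> g" unfolding \<mu>_def
        by (rule nn_integral_leb2_translate[OF I, where f="\<lambda>z. g (M z)"]) (use u in \<open>auto | measurable\<close>)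
      finally show "(\<integral>\<^sup>+z. g (w - M z) * f w \<partial>leb2 I) = f w * \<mu> g" by (simp add: mult.commute)
    qed
    also have "\<dots> = lam f * \<mu> g" unfolding lam_def by (rule nn_integral_multc) measurable
    finally show ?thesis .
  qed
  have lamg: "lam g = ennreal (pi ^ card I)"
    unfolding lam_def g_def using nn_integral_gauss_leb2[OF I, of 1] by simp
  have fin: "\<mu> g \<noteq> \<infinity>"
  proof -
    \<comment> \<open>The lower bound on the size of M z dominates the Gaussian of M z by a wider
      Gaussian in z.\<close>
    have "\<mu> g \<le> (\<integral>\<^sup>+z. ennreal (exp (- (1/C) * nrm2 I z)) \<partial>leb2 I)"
      unfolding \<mu>_def g_def
    proof (rule nn_integral_mono_AE, use AE_leb2_coord_space[OF I] in eventually_elim)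
      fix z :: "vec \<times> vec" assume "fst z \<in> coord_space I \<and> snd z \<in> coord_space I"
      then have "nrm2 I z \<le> C * nrm2 I (M z)" using C(2) by simp
      then show "ennreal (exp (- 1 * nrm2 I (M z))) \<le> ennreal (exp (- (1/C) * nrm2 I z))"
        using C(1) by (intro ennreal_leI) (simp add: field_simps)
    qed
    also have "\<dots> < \<infinity>" using C(1) by (subst nn_integral_gauss_leb2[OF I]) auto
    finally show ?thesis by simp
  qed
  have nz: "\<mu> g \<noteq> 0"
  proof
    assume "\<mu> g = 0"
    then have "AE z in leb2 I. g (M z) = 0"
      unfolding \<mu>_def using nn_integral_0_iff_AE[of "\<lambda>z. g (M z)" "leb2 I"] by simp
    then have "AE z in leb2 I. False" by eventually_elim (simp add: g_def)
    then have "lam g = (\<integral>\<^sup>+z. 0 \<partial>leb2 I)" unfolding lam_def by (intro nn_integral_cong_AE) auto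
    then show False using lamg by simp
  qed
  show ?thesis
  \<comment> \<open>The constant is the absolute determinant of \<open>M\<close>, obtained as a
    ratio of two integrals.\<close>
  proof (intro exI[of _ "lam g / \<mu> g"] ballI)
    fix f :: "vec \<times> vec \<Rightarrow> ennreal" assume "f \<in> borel_measurable borel"
    then have "lam f * \<mu> g = lam g * \<mu> f" using key by simp
    then have "lam f = lam g * \<mu> f / \<mu> g"
      using nz fin by (metis ennreal_mult_divide_eq infinity_ennreal_def mult.commute)
    then have "lam f = lam g / \<mu> g * \<mu> f" by (simp add: divide_ennreal_def ac_simps)
    then show "(\<integral>\<^sup>+w. f w \<partial>leb2 I) = lam g / \<mu> g * (\<integral>\<^sup>+z. f (M z) \<partial>leb2 I)"
      by (simp only: lam_def[of f] \<mu>_def[of f])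
  qed
qed

section \<open>Strongly monotone fields and the coordinate map\<close>

lemma dot_zext: "dot I (zext I x) (zext I y) = dot I x y"
  by (simp add: dot_def zext_def)

lemma zext_diff: "zext I x - zext I y = zext I (x - y)"
  by (auto simp: zext_def fun_eq_iff)

lemma isCont_component2: "isCont (\<lambda>z::vec \<times> vec. fst z i) w" "isCont (\<lambda>z::vec \<times> vec. snd z i) w"
  using continuous_on_fst_component[of UNIV i] continuous_on_snd_component[of UNIV i]
  unfolding continuous_on_eq_continuous_at[OF open_UNIV] by (blast, blast)

text \<open>Serves the inverse of the nonlinear map \<open>T\<close>, about which only a Lipschitz
  estimate in \<open>nrm2\<close> is known. Since \<open>nrm2\<close> involves finitely many
  coordinates, such an estimate implies continuity in the product topology.\<close>

lemma nrm2_Lipschitz_imp_measurable: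
  fixes F :: "vec \<times> vec \<Rightarrow> real"
  assumes lip: "\<And>z w. (F z - F w)\<^sup>2 \<le> C * nrm2 I (z - w)"
  shows "F \<in> borel_measurable borel"
proof (rule borel_measurable_continuous_onI)
  show "continuous_on UNIV F"
    unfolding continuous_on_eq_continuous_at[OF open_UNIV]
  proof
    fix w
    have cont: "isCont (\<lambda>z. nrm2 I (z - w)) w"
      unfolding nrm2_def dot_def fst_diff snd_diff minus_apply
      by (intro continuous_intros isCont_component2)
    then have "((\<lambda>z. nrm2 I (z - w)) \<longlongrightarrow> nrm2 I (w - w)) (at w)" by (rule isContD)
    then have "((\<lambda>z. nrm2 I (z - w)) \<longlongrightarrow> 0) (at w)" by (simp add: nrm2_def dot_simps)
    then have lim: "((\<lambda>z. sqrt (C * nrm2 I (z - w))) \<longlongrightarrow> sqrt (C * 0)) (at w)"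
      by (intro tendsto_intros)
    have "norm (F z - F w) \<le> sqrt (C * nrm2 I (z - w))" for z
      using real_sqrt_le_mono[OF lip[of z w]] by simp
    then have "((\<lambda>z. F z - F w) \<longlongrightarrow> 0) (at w)"
      using lim by (intro Lim_null_comparison[of "\<lambda>z. F z - F w" "\<lambda>z. sqrt (C * nrm2 I (z - w))"] always_eventually) auto
    then show "isCont F w" unfolding isCont_def by (simp add: LIM_zero_iff)
  qed
qed

text \<open>Both bounds concern squared norms: \<Lambda> is the square of a Lipschitz constant,
  while \<delta> is the modulus of strong monotonicity itself.\<close>

definition mono_lip :: "nat set \<Rightarrow> real \<Rightarrow> real \<Rightarrow> (vec \<Rightarrow> vec) \<Rightarrow> bool" where
  "mono_lip I \<delta> \<Lambda> A \<longleftrightarrow> (\<forall>x\<in>coord_space I. A x \<in> coord_space I) \<and>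
     (\<forall>x\<in>coord_space I. \<forall>y\<in>coord_space I. \<delta> * dot I (x - y) (x - y) \<le> dot I (A x - A y) (x - y)) \<and>
     (\<forall>x\<in>coord_space I. \<forall>y\<in>coord_space I. dot I (A x - A y) (A x - A y) \<le> \<Lambda> * dot I (x - y) (x - y))"

lemma mono_lipD:
  assumes "mono_lip I \<delta> \<Lambda> A"
  shows "x \<in> coord_space I \<Longrightarrow> A x \<in> coord_space I"
    "x \<in> coord_space I \<Longrightarrow> y \<in> coord_space I \<Longrightarrow> \<delta> * dot I (x - y) (x - y) \<le> dot I (A x - A y) (x - y)"
    "x \<in> coord_space I \<Longrightarrow> y \<in> coord_space I \<Longrightarrow> dot I (A x - A y) (A x - A y) \<le> \<Lambda> * dot I (x - y) (x - y)"
  using assms unfolding mono_lip_def by - (elim conjE, (erule (1) bspec | (drule (1) bspec, erule (1) bspec)))+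

text \<open>Two fields occur because a and b may lie in different cones, on which \<open>J\<close>
  is given by different linear maps.\<close>

definition pair_map :: "(vec \<Rightarrow> vec) \<Rightarrow> (vec \<Rightarrow> vec) \<Rightarrow> vec \<times> vec \<Rightarrow> vec \<times> vec" where
  "pair_map A B z = (fst z + snd z, A (fst z) - B (snd z))"

definition E2 :: "nat set \<Rightarrow> (vec \<times> vec) set" where
  "E2 I = {z. fst z \<in> coord_space I \<and> snd z \<in> coord_space I}"

lemma pair_map_E2: "mono_lip I \<delta> \<Lambda> A \<Longrightarrow> mono_lip I \<delta> \<Lambda> B \<Longrightarrow> z \<in> E2 I \<Longrightarrow> pair_map A B z \<in> E2 I"
proof -
  assume "mono_lip I \<delta> \<Lambda> A" "mono_lip I \<delta> \<Lambda> B" "z \<in> E2 I"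
  moreover note this(1,2)[THEN mono_lipD(1)]
  ultimately show ?thesis by (simp add: E2_def pair_map_def)
qed

lemma dot_Young: "0 < t \<Longrightarrow> dot I x y \<le> (t / 2) * dot I x x + (1 / (2 * t)) * dot I y y"
proof -
  assume t: "0 < t"
  have "2 * \<bar>dot I (t *\<^sub>R x) y\<bar> \<le> dot I (t *\<^sub>R x) (t *\<^sub>R x) + dot I y y" by (rule dot_AM_GM)
  then have "2 * (t * dot I x y) \<le> t * t * dot I x x + dot I y y" by (simp add: dot_simps)
  then show ?thesis using t by (simp add: field_simps)
qed

text \<open>For differences d, e of the arguments and p, q of the values, <p - q, d> + <q, d + e> =
  <p, d> + <q, e>, and strong monotonicity bounds the right side below by \<delta>(|d|^2 + |e|^2).
  On the left each term contains a component of the image difference; Young's inequality absorbs the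
  other factor.\<close>

lemma pair_map_expansive:
  assumes A: "mono_lip I \<delta> \<Lambda> A" and B: "mono_lip I \<delta> \<Lambda> B" and pos: "\<delta> > 0" "\<Lambda> > 0"
    and z: "z \<in> E2 I" and w: "w \<in> E2 I"
  shows "nrm2 I (z - w) \<le> ((1 + \<Lambda>) / \<delta>\<^sup>2) * nrm2 I (pair_map A B z - pair_map A B w)"
proof -
  define d e p q where "d = fst z - fst w" and "e = snd z - snd w"
    and "p = A (fst z) - A (fst w)" and "q = B (snd z) - B (snd w)"
  have zw: "fst z \<in> coord_space I" "snd z \<in> coord_space I" "fst w \<in> coord_space I" "snd w \<in> coord_space I"
    using z w by (auto simp: E2_def)
  have p: "\<delta> * dot I d d \<le> dot I p d" unfolding d_def p_def by (rule mono_lipD(2)[OF A zw(1,3)])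
  have q: "\<delta> * dot I e e \<le> dot I q e" unfolding e_def q_def by (rule mono_lipD(2)[OF B zw(2,4)])
  have ql: "dot I q q \<le> \<Lambda> * dot I e e" unfolding e_def q_def by (rule mono_lipD(3)[OF B zw(2,4)])
  have X: "fst (pair_map A B z - pair_map A B w) = d + e" by (simp add: pair_map_def d_def e_def)
  have Y: "snd (pair_map A B z - pair_map A B w) = p - q" by (simp add: pair_map_def p_def q_def)
  have "dot I (p - q) d + dot I q (d + e) = dot I p d + dot I q e" by (simp add: dot_simps)
  moreover have "dot I (p - q) d \<le> (1 / (2 * \<delta>)) * dot I (p - q) (p - q) + (\<delta> / 2) * dot I d d"
    using dot_Young[of "1/\<delta>" I "p - q" d] pos by simp
  moreover have ey: "dot I q y \<le> (\<delta> / 2) * dot I e e + (\<Lambda> / (2 * \<delta>)) * dot I y y" for y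
  proof -
    have "dot I q y \<le> (\<delta> / \<Lambda> / 2) * dot I q q + (1 / (2 * (\<delta> / \<Lambda>))) * dot I y y"
      by (rule dot_Young) (use pos in simp)
    also have "(\<delta> / \<Lambda> / 2) * dot I q q \<le> (\<delta> / \<Lambda> / 2) * (\<Lambda> * dot I e e)"
      using ql pos by (intro mult_left_mono) auto
    finally show ?thesis using pos by (simp add: mult.commute)
  qed
  moreover note ey[of "d + e"]
  moreover have "\<delta> / 2 * dot I d d + \<delta> / 2 * dot I d d = \<delta> * dot I d d" "\<delta> / 2 * dot I e e + \<delta> / 2 * dot I e e = \<delta> * dot I e e"
    by simp_all
  ultimately have "(\<delta> / 2) * (dot I d d + dot I e e) \<le> (1 / (2 * \<delta>)) * dot I (p - q) (p - q) + (\<Lambda> / (2 * \<delta>)) * dot I (d + e) (d + e)"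
    using p q unfolding distrib_left by linarith
  also have "\<dots> \<le> ((1 + \<Lambda>) / (2 * \<delta>)) * dot I (p - q) (p - q) + ((1 + \<Lambda>) / (2 * \<delta>)) * dot I (d + e) (d + e)"
    using pos by (intro add_mono mult_right_mono divide_right_mono) auto
  finally have h: "(\<delta> / 2) * (dot I d d + dot I e e) \<le> ((1 + \<Lambda>) / (2 * \<delta>)) * dot I (p - q) (p - q) + ((1 + \<Lambda>) / (2 * \<delta>)) * dot I (d + e) (d + e)" .
  have "N \<le> ((1 + \<Lambda>) / \<delta>\<^sup>2) * (Q + P)" if "(\<delta> / 2) * N \<le> ((1 + \<Lambda>) / (2 * \<delta>)) * P + ((1 + \<Lambda>) / (2 * \<delta>)) * Q" for N P Q
  proof -
    have "(2 / \<delta>) * ((\<delta> / 2) * N) \<le> (2 / \<delta>) * (((1 + \<Lambda>) / (2 * \<delta>)) * P + ((1 + \<Lambda>) / (2 * \<delta>)) * Q)"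
      using that pos by (intro mult_left_mono) auto
    also have "\<dots> = ((1 + \<Lambda>) / \<delta>\<^sup>2) * (Q + P)" using pos by (simp add: field_simps power2_eq_square)
    finally show ?thesis using pos by simp
  qed
  from this[OF h] have "dot I d d + dot I e e \<le> ((1 + \<Lambda>) / \<delta>\<^sup>2) * (dot I (d + e) (d + e) + dot I (p - q) (p - q))" .
  then show ?thesis unfolding nrm2_def X Y by (simp only: fst_diff snd_diff d_def[symmetric] e_def[symmetric])
qed

lemma pair_map_inj:
  assumes I: "finite I" and A: "mono_lip I \<delta> \<Lambda> A" and B: "mono_lip I \<delta> \<Lambda> B" and pos: "\<delta> > 0" "\<Lambda> > 0"
    and z: "z \<in> E2 I" and w: "w \<in> E2 I" and eq: "pair_map A B z = pair_map A B w"
  shows "z = w"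
proof -
  have "nrm2 I (z - w) \<le> 0"
    using pair_map_expansive[OF A B pos z w] eq by (simp add: nrm2_def dot_simps)
  then have "dot I (fst z - fst w) (fst z - fst w) = 0" "dot I (snd z - snd w) (snd z - snd w) = 0"
    unfolding nrm2_def fst_diff snd_diff
    using dot_nonneg[of I "fst z - fst w"] dot_nonneg[of I "snd z - snd w"] by linarith+
  then have "fst z - fst w = 0" "snd z - snd w = 0"
    using z w by (auto simp: E2_def dot_eq_0_iff[OF I])
  then show ?thesis by (simp add: prod_eq_iff)
qed

text \<open>Fixing the sum X = a + b leaves one equation A a - B (X - a) = Y. Its left side is
  strongly monotone in a with modulus 2\<delta>, since both terms pull in the same
  direction.\<close>

lemma pair_map_surj:
  assumes I: "finite I" and A: "mono_lip I \<delta> \<Lambda> A" and B: "mono_lip I \<delta> \<Lambda> B" and pos: "\<delta> > 0" "\<Lambda> > 0"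
    and w: "w \<in> E2 I"
  shows "\<exists>z\<in>E2 I. pair_map A B z = w"
proof -
  define X where "X = fst w"
  have X: "X \<in> coord_space I" "snd w \<in> coord_space I" using w by (auto simp: E2_def X_def)
  define G where "G a = A a - B (X - a)" for a
  have "\<exists>a\<in>coord_space I. G a = snd w"
  proof (rule strongly_monotone_surjective[OF I, of G "2 * \<delta>" "4 * \<Lambda>"])
    fix x y assume xy: "x \<in> coord_space I" "y \<in> coord_space I"
    define p q where "p = A x - A y" and "q = B (X - x) - B (X - y)"
    have G: "G x - G y = p - q" by (simp add: G_def p_def q_def)
    have E: "X - x \<in> coord_space I" "X - y \<in> coord_space I" using xy X by simp_all
    have e: "(X - x) - (X - y) = - (x - y)" by simp
    have "\<delta> * dot I (- (x - y)) (- (x - y)) \<le> dot I q (- (x - y))"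
      unfolding q_def using mono_lipD(2)[OF B E] by (simp only: e)
    then have q: "\<delta> * dot I (x - y) (x - y) \<le> - dot I q (x - y)" by (simp only: dot_simps(7,8) minus_minus)
    have "dot I q q \<le> \<Lambda> * dot I (- (x - y)) (- (x - y))"
      unfolding q_def using mono_lipD(3)[OF B E] by (simp only: e)
    then have ql: "dot I q q \<le> \<Lambda> * dot I (x - y) (x - y)" by (simp only: dot_simps(7,8) minus_minus)
    have p: "\<delta> * dot I (x - y) (x - y) \<le> dot I p (x - y)" unfolding p_def by (rule mono_lipD(2)[OF A xy])
    have pl: "dot I p p \<le> \<Lambda> * dot I (x - y) (x - y)" unfolding p_def by (rule mono_lipD(3)[OF A xy])
    show "2 * \<delta> * dot I (x - y) (x - y) \<le> dot I (G x - G y) (x - y)"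
      unfolding G dot_simps(3)[of I p q "x - y"] using p q by linarith
    have "dot I (p - q) (p - q) = dot I p p - 2 * dot I p q + dot I q q"
      by (simp add: dot_simps dot_commute[of I q p])
    then have "dot I (p - q) (p - q) \<le> 2 * dot I p p + 2 * dot I q q" using dot_AM_GM[of I p q] by linarith
    then show "dot I (G x - G y) (G x - G y) \<le> 4 * \<Lambda> * dot I (x - y) (x - y)"
      unfolding G using pl ql by linarith
  next
    fix x assume "x \<in> coord_space I"
    then show "G x \<in> coord_space I" unfolding G_def using X mono_lipD(1)[OF A] mono_lipD(1)[OF B] by simp
  qed (use pos X in auto)
  then obtain a where a: "a \<in> coord_space I" "G a = snd w" by blast
  have "pair_map A B (a, X - a) = w" using a(2) by (simp add: pair_map_def G_def X_def prod_eq_iff)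
  moreover have "(a, X - a) \<in> E2 I" using a X by (simp add: E2_def)
  ultimately show ?thesis by blast
qed

section \<open>Pulling Lebesgue measure back along a piecewise linear map\<close>

lemma nn_integral_leb2_scale:
  assumes I: "finite I" and s: "s > 0" and t: "t > 0" and [measurable]: "f \<in> borel_measurable borel"
  shows "(\<integral>\<^sup>+z. f z \<partial>leb2 I) = ennreal (s ^ card I * t ^ card I) * (\<integral>\<^sup>+z. f (s *\<^sub>R fst z, t *\<^sub>R snd z) \<partial>leb2 I)"
proof -
  interpret sigma_finite_measure "leb I" by (rule sigma_finite_leb) fact
  have m: "(\<lambda>a. \<integral>\<^sup>+b. f (a, b) \<partial>leb I) \<in> borel_measurable borel" by measurable
  have "(\<integral>\<^sup>+z. f z \<partial>leb2 I) = (\<integral>\<^sup>+a. (\<integral>\<^sup>+b. f (a, b) \<partial>leb I) \<partial>leb I)"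
    by (rule nn_integral_leb2[OF I]) measurable
  also have "\<dots> = ennreal (\<bar>s\<bar> ^ card I) * (\<integral>\<^sup>+a. (\<integral>\<^sup>+b. f (s *\<^sub>R a, b) \<partial>leb I) \<partial>leb I)"
    by (rule nn_integral_leb_scale[OF I, where f="\<lambda>a. \<integral>\<^sup>+b. f (a, b) \<partial>leb I"]) (use s m in simp_all)
  also have "(\<integral>\<^sup>+a. (\<integral>\<^sup>+b. f (s *\<^sub>R a, b) \<partial>leb I) \<partial>leb I) =
     (\<integral>\<^sup>+a. ennreal (\<bar>t\<bar> ^ card I) * (\<integral>\<^sup>+b. f (s *\<^sub>R a, t *\<^sub>R b) \<partial>leb I) \<partial>leb I)"
  proof (rule nn_integral_cong)
    fix a :: vec
    have "(\<lambda>b. f (s *\<^sub>R a, b)) \<in> borel_measurable borel" by measurable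
    then show "(\<integral>\<^sup>+b. f (s *\<^sub>R a, b) \<partial>leb I) = ennreal (\<bar>t\<bar> ^ card I) * (\<integral>\<^sup>+b. f (s *\<^sub>R a, t *\<^sub>R b) \<partial>leb I)"
      by (rule nn_integral_leb_scale[OF I, where f="\<lambda>b. f (s *\<^sub>R a, b)", rotated]) (use t in simp)
  qed
  also have "\<dots> = ennreal (\<bar>t\<bar> ^ card I) * (\<integral>\<^sup>+a. (\<integral>\<^sup>+b. f (s *\<^sub>R a, t *\<^sub>R b) \<partial>leb I) \<partial>leb I)"
    by (rule nn_integral_cmult) measurable
  also have "(\<integral>\<^sup>+a. (\<integral>\<^sup>+b. f (s *\<^sub>R a, t *\<^sub>R b) \<partial>leb I) \<partial>leb I) = (\<integral>\<^sup>+z. f (s *\<^sub>R fst z, t *\<^sub>R snd z) \<partial>leb2 I)"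
  proof -
    have m2: "(\<lambda>z. f (s *\<^sub>R fst z, t *\<^sub>R snd z)) \<in> borel_measurable borel" by measurable
    show ?thesis unfolding nn_integral_leb2[OF I m2] fst_conv snd_conv ..
  qed
  finally show ?thesis using s t by (simp add: ennreal_mult mult.assoc)
qed

text \<open>The cones \<open>R \<sigma>\<close> partition the space and \<open>J\<close> agrees with
  \<open>Jl \<sigma>\<close> on each. The linear maps are required to be strongly monotone on the
  whole space, not only on their cones, because each pair of them has to give a global bijection for
  \<open>linear_image_leb2\<close>.\<close>

locale piecewise_linear_field =
  fixes I :: "nat set" and Sg :: "'s set" and R :: "'s \<Rightarrow> vec set" and Jl :: "'s \<Rightarrow> vec \<Rightarrow> vec"
    and J :: "vec \<Rightarrow> vec" and \<delta> \<Lambda> :: real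
  assumes I: "finite I" and Sg: "finite Sg" and pos: "\<delta> > 0" "\<Lambda> > 0"
    and Rm: "\<And>\<sigma>. \<sigma> \<in> Sg \<Longrightarrow> R \<sigma> \<in> sets borel"
    and Jlm: "\<And>\<sigma>. \<sigma> \<in> Sg \<Longrightarrow> Jl \<sigma> \<in> borel_measurable borel"
    and Jm [measurable]: "J \<in> borel_measurable borel"
    and Jl_add: "\<And>\<sigma> x y. \<sigma> \<in> Sg \<Longrightarrow> Jl \<sigma> (x + y) = Jl \<sigma> x + Jl \<sigma> y"
    and Jl_mono_lip: "\<And>\<sigma>. \<sigma> \<in> Sg \<Longrightarrow> mono_lip I \<delta> \<Lambda> (Jl \<sigma>)"
    and J_mono_lip: "mono_lip I \<delta> \<Lambda> J"
    and R_ex: "\<And>x. x \<in> coord_space I \<Longrightarrow> \<exists>\<sigma>\<in>Sg. x \<in> R \<sigma>"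
    and R_disj: "\<And>x \<sigma> \<tau>. x \<in> coord_space I \<Longrightarrow> \<sigma> \<in> Sg \<Longrightarrow> \<tau> \<in> Sg \<Longrightarrow> x \<in> R \<sigma> \<Longrightarrow> x \<in> R \<tau> \<Longrightarrow> \<sigma> = \<tau>"
    and J_eq: "\<And>x \<sigma>. x \<in> coord_space I \<Longrightarrow> \<sigma> \<in> Sg \<Longrightarrow> x \<in> R \<sigma> \<Longrightarrow> J x = Jl \<sigma> x"
    and R_cone: "\<And>x \<sigma> t. \<sigma> \<in> Sg \<Longrightarrow> t > 0 \<Longrightarrow> t *\<^sub>R x \<in> R \<sigma> \<longleftrightarrow> x \<in> R \<sigma>"
    and J_scale: "\<And>x t. x \<in> coord_space I \<Longrightarrow> t > 0 \<Longrightarrow> J (t *\<^sub>R x) = t *\<^sub>R J x"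
begin

definition T :: "vec \<times> vec \<Rightarrow> vec \<times> vec" where
  "T = pair_map J J"

lemma measurable_T [measurable]: "T \<in> borel_measurable borel"
  unfolding T_def pair_map_def[abs_def] by measurable

definition piece :: "'s \<times> 's \<Rightarrow> (vec \<times> vec) set" where
  "piece p = {z. fst z \<in> R (fst p) \<and> snd z \<in> R (snd p)}"

lemma measurable_piece: "p \<in> Sg \<times> Sg \<Longrightarrow> piece p \<in> sets borel"
proof -
  assume p: "p \<in> Sg \<times> Sg"
  then have [measurable]: "R (fst p) \<in> sets borel" "R (snd p) \<in> sets borel" by (auto intro: Rm)
  show ?thesis unfolding piece_def by measurable
qed

text \<open>On a product of two cones \<open>T\<close> agrees with a linear map, for which the
  change of variables holds with a constant. Splitting the integrand according to the product that
  contains the preimage and adding up gives a density that is constant on each product, hence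
  invariant under separate dilations of the two components.\<close>

lemma change_of_variables:
  "\<exists>D. D \<in> borel_measurable borel \<and> (\<forall>s t z. 0 < s \<longrightarrow> 0 < t \<longrightarrow> D (s *\<^sub>R fst z, t *\<^sub>R snd z) = D z) \<and>
    (\<forall>f\<in>borel_measurable borel. (\<integral>\<^sup>+w. f w \<partial>leb2 I) = (\<integral>\<^sup>+z. D z * f (T z) \<partial>leb2 I))"
proof -
  \<comment> \<open>\<open>Z\<close> projects onto \<open>E2 I\<close>, which makes the inverse
    \<open>Ti\<close> of \<open>T\<close> total and Lipschitz everywhere, hence measurable.\<close>
  define Z where "Z w = (zext I (fst w), zext I (snd w))" for w :: "vec \<times> vec"
  have ZE: "Z w \<in> E2 I" for w by (simp add: Z_def E2_def)
  have Zid: "Z w = w" if "w \<in> E2 I" for w using that by (simp add: Z_def E2_def zext_id)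
  have "\<exists>z\<in>E2 I. T z = Z w" for w
    unfolding T_def by (rule pair_map_surj[OF I J_mono_lip J_mono_lip pos ZE])
  then obtain Ti where Ti: "\<And>w. Ti w \<in> E2 I" "\<And>w. T (Ti w) = Z w" by metis
  have TiT: "Ti (T z) = z" if z: "z \<in> E2 I" for z
  proof -
    have "T z \<in> E2 I" unfolding T_def by (rule pair_map_E2[OF J_mono_lip J_mono_lip z])
    then have "T (Ti (T z)) = T z" using Ti(2) Zid by simp
    then show ?thesis unfolding T_def by (rule pair_map_inj[OF I J_mono_lip J_mono_lip pos Ti(1)[unfolded T_def] z])
  qed
  have Ti_lip: "nrm2 I (Ti z - Ti w) \<le> ((1 + \<Lambda>) / \<delta>\<^sup>2) * nrm2 I (z - w)" for z w
  proof -
    have "nrm2 I (Ti z - Ti w) \<le> ((1 + \<Lambda>) / \<delta>\<^sup>2) * nrm2 I (T (Ti z) - T (Ti w))"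
      unfolding T_def by (rule pair_map_expansive[OF J_mono_lip J_mono_lip pos Ti(1) Ti(1)])
    moreover have "nrm2 I (Z z - Z w) = nrm2 I (z - w)"
      unfolding nrm2_def Z_def fst_diff snd_diff fst_conv snd_conv zext_diff dot_zext ..
    ultimately show ?thesis by (simp only: Ti(2))
  qed
  have [measurable]: "Ti \<in> borel_measurable borel"
  proof -
    have c: "(fst (Ti z) i - fst (Ti w) i)\<^sup>2 \<le> ((1 + \<Lambda>) / \<delta>\<^sup>2) * nrm2 I (z - w)"
         "(snd (Ti z) i - snd (Ti w) i)\<^sup>2 \<le> ((1 + \<Lambda>) / \<delta>\<^sup>2) * nrm2 I (z - w)" for z w i
    proof -
      have nn: "0 \<le> ((1 + \<Lambda>) / \<delta>\<^sup>2) * nrm2 I (z - w)" using pos by simp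
      have "(fst (Ti z) i - fst (Ti w) i)\<^sup>2 \<le> nrm2 I (Ti z - Ti w) \<and> (snd (Ti z) i - snd (Ti w) i)\<^sup>2 \<le> nrm2 I (Ti z - Ti w)" if i: "i \<in> I"
        using component_le_dot[OF I i, of "fst (Ti z) - fst (Ti w)"] component_le_dot[OF I i, of "snd (Ti z) - snd (Ti w)"]
          dot_nonneg[of I "fst (Ti z) - fst (Ti w)"] dot_nonneg[of I "snd (Ti z) - snd (Ti w)"]
        unfolding nrm2_def fst_diff snd_diff minus_apply by linarith
      moreover have "fst (Ti z) i = 0 \<and> fst (Ti w) i = 0 \<and> snd (Ti z) i = 0 \<and> snd (Ti w) i = 0" if "i \<notin> I"
        using Ti(1)[of z] Ti(1)[of w] that by (auto simp: E2_def coord_space_def)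
      ultimately show "(fst (Ti z) i - fst (Ti w) i)\<^sup>2 \<le> ((1 + \<Lambda>) / \<delta>\<^sup>2) * nrm2 I (z - w)"
         "(snd (Ti z) i - snd (Ti w) i)\<^sup>2 \<le> ((1 + \<Lambda>) / \<delta>\<^sup>2) * nrm2 I (z - w)"
        using Ti_lip[of z w] nn by (cases "i \<in> I"; fastforce)+
    qed
    have "(\<lambda>w. fst (Ti w)) \<in> borel_measurable borel" "(\<lambda>w. snd (Ti w)) \<in> borel_measurable borel"
      by (rule borel_measurable_vecI, rule nrm2_Lipschitz_imp_measurable, rule c)+
    then have "(\<lambda>w. (fst (Ti w), snd (Ti w))) \<in> borel_measurable borel" by (rule borel_measurable_Pair)
    then show ?thesis by simp
  qed
  define M where "M p = pair_map (Jl (fst p)) (Jl (snd p))" for p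
  have "\<exists>c::ennreal. \<forall>f\<in>borel_measurable borel. (\<integral>\<^sup>+w. f w \<partial>leb2 I) = c * (\<integral>\<^sup>+z. f (M p z) \<partial>leb2 I)" if p: "p \<in> Sg \<times> Sg" for p
  proof -
    have S: "fst p \<in> Sg" "snd p \<in> Sg" using p by auto
    note ml = Jl_mono_lip[OF S(1)] Jl_mono_lip[OF S(2)]
    note [measurable] = Jlm[OF S(1)] Jlm[OF S(2)]
    have z0: "Jl \<sigma> 0 = 0" if "\<sigma> \<in> Sg" for \<sigma> using Jl_add[OF that, of 0 0] by simp
    have M0: "M p 0 = 0" by (simp add: M_def pair_map_def z0 S zero_prod_def)
    show ?thesis
    proof (rule linear_image_leb2[OF I])
      show "M p \<in> borel_measurable borel" unfolding M_def pair_map_def[abs_def] by measurable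
      show "M p (z + w) = M p z + M p w" for z w
        unfolding M_def pair_map_def by (simp add: Jl_add S prod_eq_iff)
      show "fst (M p z) \<in> coord_space I \<and> snd (M p z) \<in> coord_space I" if "fst z \<in> coord_space I" "snd z \<in> coord_space I" for z
        using pair_map_E2[OF ml, of z] that by (simp add: E2_def M_def)
      show "\<exists>z. fst z \<in> coord_space I \<and> snd z \<in> coord_space I \<and> M p z = w" if "fst w \<in> coord_space I" "snd w \<in> coord_space I" for w
        using pair_map_surj[OF I ml pos, of w] that by (auto simp: E2_def M_def)
      show "0 < (1 + \<Lambda>) / \<delta>\<^sup>2" using pos by simp
      show "nrm2 I z \<le> ((1 + \<Lambda>) / \<delta>\<^sup>2) * nrm2 I (M p z)" if "fst z \<in> coord_space I" "snd z \<in> coord_space I" for z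
        using pair_map_expansive[OF ml pos, of z 0] that M0 by (simp add: E2_def M_def)
    qed
  qed
  then obtain c :: "'s \<times> 's \<Rightarrow> ennreal" where c: "\<And>p f. p \<in> Sg \<times> Sg \<Longrightarrow> f \<in> borel_measurable borel \<Longrightarrow>
      (\<integral>\<^sup>+w. f w \<partial>leb2 I) = c p * (\<integral>\<^sup>+z. f (M p z) \<partial>leb2 I)" by metis
  have TM: "T z = M p z" if "z \<in> E2 I" "p \<in> Sg \<times> Sg" "z \<in> piece p" for z p
    using that J_eq[of "fst z" "fst p"] J_eq[of "snd z" "snd p"]
    by (auto simp: T_def M_def pair_map_def piece_def E2_def)
  define D where "D z = (\<Sum>p\<in>Sg \<times> Sg. c p * indicator (piece p) z)" for z
  note [measurable] = measurable_piece
  have Dm: "D \<in> borel_measurable borel" unfolding D_def by measurable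
  have "(s *\<^sub>R fst z, t *\<^sub>R snd z) \<in> piece p \<longleftrightarrow> z \<in> piece p" if "0 < s" "0 < t" "p \<in> Sg \<times> Sg" for s t z p
    using that R_cone[of "fst p" s "fst z"] R_cone[of "snd p" t "snd z"] by (auto simp: piece_def)
  then have "D (s *\<^sub>R fst z, t *\<^sub>R snd z) = D z" if "0 < s" "0 < t" for s t z
    using that unfolding D_def by (intro sum.cong) (auto simp: indicator_def)
  moreover have "(\<integral>\<^sup>+w. f w \<partial>leb2 I) = (\<integral>\<^sup>+z. D z * f (T z) \<partial>leb2 I)" if fm[measurable]: "f \<in> borel_measurable borel" for f
  proof -
    have one: "(\<Sum>p\<in>Sg \<times> Sg. indicator (piece p) z) = (1::ennreal)" if z: "z \<in> E2 I" for z
    proof -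
      have zE: "fst z \<in> coord_space I" "snd z \<in> coord_space I" using z by (auto simp: E2_def)
      obtain \<sigma> \<tau> where st: "\<sigma> \<in> Sg" "\<tau> \<in> Sg" "fst z \<in> R \<sigma>" "snd z \<in> R \<tau>" using R_ex zE by metis
      have "indicator (piece p) z = (if p = (\<sigma>, \<tau>) then 1 else (0::ennreal))" if "p \<in> Sg \<times> Sg" for p
      proof -
        have "fst p \<in> Sg" "snd p \<in> Sg" using that by auto
        note R_disj[OF zE(1) this(1) st(1) _ st(3)] R_disj[OF zE(2) this(2) st(2) _ st(4)]
        then have "z \<in> piece p \<longleftrightarrow> p = (\<sigma>, \<tau>)"
          using st(3,4) unfolding piece_def prod_eq_iff fst_conv snd_conv mem_Collect_eq by blast
        then show ?thesis by (simp add: indicator_def)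
      qed
      then have "(\<Sum>p\<in>Sg \<times> Sg. indicator (piece p) z) = (\<Sum>p\<in>Sg \<times> Sg. if p = (\<sigma>, \<tau>) then 1 else (0::ennreal))"
        by (intro sum.cong) auto
      also have "\<dots> = 1" using st Sg by simp
      finally show ?thesis .
    qed
    have "(\<integral>\<^sup>+w. f w \<partial>leb2 I) = (\<integral>\<^sup>+w. (\<Sum>p\<in>Sg \<times> Sg. f w * indicator (piece p) (Ti w)) \<partial>leb2 I)"
      by (simp add: sum_distrib_left[symmetric] one Ti(1))
    also have "\<dots> = (\<Sum>p\<in>Sg \<times> Sg. \<integral>\<^sup>+w. f w * indicator (piece p) (Ti w) \<partial>leb2 I)"
      by (rule nn_integral_sum) measurable
    also have "\<dots> = (\<Sum>p\<in>Sg \<times> Sg. \<integral>\<^sup>+z. c p * indicator (piece p) z * f (T z) \<partial>leb2 I)"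
    proof (rule sum.cong[OF refl])
      fix p assume p: "p \<in> Sg \<times> Sg"
      have ml: "mono_lip I \<delta> \<Lambda> (Jl (fst p))" "mono_lip I \<delta> \<Lambda> (Jl (snd p))" using p by (auto intro: Jl_mono_lip)
      have [measurable]: "piece p \<in> sets borel" using p by (rule measurable_piece)
      have "(\<integral>\<^sup>+w. f w * indicator (piece p) (Ti w) \<partial>leb2 I) = c p * (\<integral>\<^sup>+z. f (M p z) * indicator (piece p) (Ti (M p z)) \<partial>leb2 I)"
        by (rule c[OF p, of "\<lambda>w. f w * indicator (piece p) (Ti w)"]) measurable
      also have "(\<integral>\<^sup>+z. f (M p z) * indicator (piece p) (Ti (M p z)) \<partial>leb2 I) = (\<integral>\<^sup>+z. indicator (piece p) z * f (T z) \<partial>leb2 I)"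
      proof (rule nn_integral_cong_AE, use AE_leb2_coord_space[OF I] in eventually_elim)
        fix z assume "fst z \<in> coord_space I \<and> snd z \<in> coord_space I"
        then have z: "z \<in> E2 I" by (simp add: E2_def)
        show "f (M p z) * indicator (piece p) (Ti (M p z)) = indicator (piece p) z * f (T z)"
        proof (cases "z \<in> piece p")
          case True
          then show ?thesis using TM[OF z p True] TiT[OF z] by (simp add: mult.commute)
        next
          case False
          \<comment> \<open>A preimage in the same product of cones would have the same image as z
            under \<open>M p\<close>, and \<open>M p\<close> is injective on
            \<open>E2 I\<close>.\<close>
          have "Ti (M p z) \<notin> piece p"
          proof
            assume in_p: "Ti (M p z) \<in> piece p"
            have ME: "M p z \<in> E2 I" unfolding M_def by (rule pair_map_E2[OF ml z])
            have "M p (Ti (M p z)) = M p z"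
              using TM[OF Ti(1) p in_p] Ti(2)[of "M p z"] Zid[OF ME] by simp
            then have "Ti (M p z) = z"
              unfolding M_def by (rule pair_map_inj[OF I ml pos Ti(1)[unfolded M_def] z])
            then show False using in_p False by simp
          qed
          then show ?thesis using False by simp
        qed
      qed
      also have "c p * (\<integral>\<^sup>+z. indicator (piece p) z * f (T z) \<partial>leb2 I) = (\<integral>\<^sup>+z. c p * (indicator (piece p) z * f (T z)) \<partial>leb2 I)"
        by (rule nn_integral_cmult[symmetric]) measurable
      finally show "(\<integral>\<^sup>+w. f w * indicator (piece p) (Ti w) \<partial>leb2 I) = (\<integral>\<^sup>+z. c p * indicator (piece p) z * f (T z) \<partial>leb2 I)"
        by (simp add: mult.assoc)
    qed
    also have "\<dots> = (\<integral>\<^sup>+z. (\<Sum>p\<in>Sg \<times> Sg. c p * indicator (piece p) z * f (T z)) \<partial>leb2 I)"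
      by (rule nn_integral_sum[symmetric]) measurable
    also have "\<dots> = (\<integral>\<^sup>+z. D z * f (T z) \<partial>leb2 I)" unfolding D_def by (simp only: sum_distrib_right)
    finally show ?thesis .
  qed
  ultimately show ?thesis using Dm by blast
qed

text \<open>Weighting Lebesgue measure with the density of \<open>change_of_variables\<close>
  preserves its scaling in each component, because both dilations leave the density
  unchanged.\<close>

lemma pull_back_measure:
  obtains \<nu> :: "(vec \<times> vec) measure" where "sets \<nu> = sets borel" "distr \<nu> borel T = leb2 I"
    "AE z in \<nu>. z \<in> E2 I"
    "\<And>s t f. 0 < s \<Longrightarrow> 0 < t \<Longrightarrow> f \<in> borel_measurable borel \<Longrightarrow>
      (\<integral>\<^sup>+z. f z \<partial>\<nu>) = ennreal (s ^ card I * t ^ card I) * (\<integral>\<^sup>+z. f (s *\<^sub>R fst z, t *\<^sub>R snd z) \<partial>\<nu>)"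
proof -
  from change_of_variables obtain D where D0: "D \<in> borel_measurable borel \<and>
    (\<forall>s t z. 0 < s \<longrightarrow> 0 < t \<longrightarrow> D (s *\<^sub>R fst z, t *\<^sub>R snd z) = D z) \<and>
    (\<forall>f\<in>borel_measurable borel. (\<integral>\<^sup>+w. f w \<partial>leb2 I) = (\<integral>\<^sup>+z. D z * f (T z) \<partial>leb2 I))" by (elim exE)
  have [measurable]: "D \<in> borel_measurable borel" using D0 by (rule conjunct1)
  have D: "D (s *\<^sub>R fst z, t *\<^sub>R snd z) = D z" if "0 < s" "0 < t" for s t z
    using conjunct1[OF conjunct2[OF D0]] that by (simp only: simp_thms)
  have cv: "(\<integral>\<^sup>+w. f w \<partial>leb2 I) = (\<integral>\<^sup>+z. D z * f (T z) \<partial>leb2 I)" if "f \<in> borel_measurable borel" for f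
    by (rule bspec[OF conjunct2[OF conjunct2[OF D0]] that])
  show thesis
  proof (rule that[of "density (leb2 I) D"])
    show "distr (density (leb2 I) D) borel T = leb2 I"
    proof (rule measure_eqI)
      fix A assume "A \<in> sets (distr (density (leb2 I) D) borel T)"
      then have A[measurable]: "A \<in> sets borel" by simp
      have [measurable]: "T -` A \<in> sets borel" using measurable_sets[OF measurable_T A] by simp
      have "emeasure (leb2 I) A = (\<integral>\<^sup>+w. indicator A w \<partial>leb2 I)" by simp
      also have "\<dots> = (\<integral>\<^sup>+z. D z * indicator A (T z) \<partial>leb2 I)" by (rule cv) measurable
      also have "\<dots> = (\<integral>\<^sup>+z. D z * indicator (T -` A) z \<partial>leb2 I)"
        by (intro nn_integral_cong) (simp add: indicator_def)
      also have "\<dots> = emeasure (density (leb2 I) D) (T -` A)" by (simp add: emeasure_density)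
      also have "\<dots> = emeasure (distr (density (leb2 I) D) borel T) A" by (simp add: emeasure_distr)
      finally show "emeasure (distr (density (leb2 I) D) borel T) A = emeasure (leb2 I) A" by simp
    qed simp
    show "AE z in density (leb2 I) D. z \<in> E2 I"
      using AE_leb2_coord_space[OF I] by (subst AE_density) (auto simp: E2_def)
    fix s t :: real and f :: "vec \<times> vec \<Rightarrow> ennreal"
    assume st: "0 < s" "0 < t" and [measurable]: "f \<in> borel_measurable borel"
    have "(\<integral>\<^sup>+z. f z \<partial>density (leb2 I) D) = (\<integral>\<^sup>+z. D z * f z \<partial>leb2 I)" by (rule nn_integral_density) measurable
    also have "\<dots> = ennreal (s ^ card I * t ^ card I) *
       (\<integral>\<^sup>+z. D (s *\<^sub>R fst z, t *\<^sub>R snd z) * f (s *\<^sub>R fst z, t *\<^sub>R snd z) \<partial>leb2 I)"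
      by (rule nn_integral_leb2_scale[OF I st]) measurable
    also have "(\<integral>\<^sup>+z. D (s *\<^sub>R fst z, t *\<^sub>R snd z) * f (s *\<^sub>R fst z, t *\<^sub>R snd z) \<partial>leb2 I) =
      (\<integral>\<^sup>+z. D z * f (s *\<^sub>R fst z, t *\<^sub>R snd z) \<partial>leb2 I)" by (simp only: D[OF st])
    also have "\<dots> = (\<integral>\<^sup>+z. f (s *\<^sub>R fst z, t *\<^sub>R snd z) \<partial>density (leb2 I) D)"
      by (rule nn_integral_density[symmetric]) measurable
    finally show "(\<integral>\<^sup>+z. f z \<partial>density (leb2 I) D) = ennreal (s ^ card I * t ^ card I) * (\<integral>\<^sup>+z. f (s *\<^sub>R fst z, t *\<^sub>R snd z) \<partial>density (leb2 I) D)" .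
  qed simp
qed

end

section \<open>Rotating the phase of a Fresnel integral\<close>

text \<open>The mean value inequality on the ball bounds the difference quotients by
  \<open>g\<close>, so dominated convergence applies along every sequence tending to
  \<open>w0\<close>.\<close>

lemma has_field_derivative_lebesgue_integral:
  fixes f f' :: "complex \<Rightarrow> 'a \<Rightarrow> complex"
  assumes d: "d > 0"
    and der: "\<And>w x. w \<in> ball w0 d \<Longrightarrow> ((\<lambda>w. f w x) has_field_derivative f' w x) (at w)"
    and int: "\<And>w. w \<in> ball w0 d \<Longrightarrow> integrable M (f w)"
    and m: "f' w0 \<in> borel_measurable M" and g: "integrable M g"
    and bnd: "AE x in M. \<forall>w\<in>ball w0 d. norm (f' w x) \<le> g x"
  shows "((\<lambda>w. \<integral>x. f w x \<partial>M) has_field_derivative (\<integral>x. f' w0 x \<partial>M)) (at w0)"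
  unfolding has_field_derivative_iff
proof (subst tendsto_at_iff_sequentially, intro allI impI)
  fix w :: "nat \<Rightarrow> complex"
  assume ne: "\<forall>k. w k \<in> UNIV - {w0}" and lim: "w \<longlonglongrightarrow> w0"
  have "eventually (\<lambda>k. w k \<in> ball w0 d) sequentially"
    using lim d by (intro topological_tendstoD) auto
  then obtain N where N: "\<And>k. k \<ge> N \<Longrightarrow> w k \<in> ball w0 d" by (auto simp: eventually_sequentially)
  define v where "v k = w (k + N)" for k
  have v: "v k \<in> ball w0 d" "v k \<noteq> w0" for k using N ne by (auto simp: v_def)
  have vlim: "v \<longlonglongrightarrow> w0" unfolding v_def using lim by (rule LIMSEQ_ignore_initial_segment)
  let ?u = "\<lambda>k x. (f (v k) x - f w0 x) / (v k - w0)"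
  have "(\<lambda>k. \<integral>x. ?u k x \<partial>M) \<longlonglongrightarrow> (\<integral>x. f' w0 x \<partial>M)"
  proof (rule integral_dominated_convergence[OF m _ g])
    show "?u k \<in> borel_measurable M" for k
      using int[OF v(1)] int[of w0] d by (intro borel_measurable_divide borel_measurable_diff) auto
    show "AE x in M. (\<lambda>k. ?u k x) \<longlonglongrightarrow> f' w0 x"
    proof (rule AE_I2)
      fix x
      have "((\<lambda>y. (f y x - f w0 x) / (y - w0)) \<longlongrightarrow> f' w0 x) (at w0)"
        using der[of w0 x] d by (simp add: has_field_derivative_iff)
      then show "(\<lambda>k. ?u k x) \<longlonglongrightarrow> f' w0 x"
        using v(2) vlim by (auto simp: tendsto_at_iff_sequentially comp_def)
    qed
    show "AE x in M. norm (?u k x) \<le> g x" for k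
      using bnd
    proof eventually_elim
      case (elim x)
      have "norm (f (v k) x - f w0 x) \<le> g x * norm (v k - w0)"
        by (rule field_differentiable_bound[of "ball w0 d" "\<lambda>w. f w x" "\<lambda>w. f' w x"])
           (use v d elim der in \<open>auto intro: has_field_derivative_at_within\<close>)
      then show ?case using v(2)[of k] by (simp add: norm_divide divide_le_eq)
    qed
  qed
  moreover have "(\<integral>x. ?u k x \<partial>M) = ((\<integral>x. f (v k) x \<partial>M) - (\<integral>x. f w0 x \<partial>M)) / (v k - w0)" for k
    using int[OF v(1)[of k]] int[of w0] d by simp
  ultimately have "(\<lambda>k. ((\<integral>x. f (v k) x \<partial>M) - (\<integral>x. f w0 x \<partial>M)) / (v k - w0)) \<longlonglongrightarrow> (\<integral>x. f' w0 x \<partial>M)"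
    by (simp only:)
  then have "(\<lambda>k. ((\<lambda>y. ((\<integral>x. f y x \<partial>M) - (\<integral>x. f w0 x \<partial>M)) / (y - w0)) \<circ> w) (k + N)) \<longlonglongrightarrow> (\<integral>x. f' w0 x \<partial>M)"
    by (simp add: v_def comp_def)
  then show "((\<lambda>y. ((\<integral>x. f y x \<partial>M) - (\<integral>x. f w0 x \<partial>M)) / (y - w0)) \<circ> w) \<longlonglongrightarrow> (\<integral>x. f' w0 x \<partial>M)"
    by (rule LIMSEQ_offset)
qed

section \<open>The Fourier transform of a Gaussian and the Fresnel integral\<close>

lemma gauss_fourier_line:
  assumes e: "e > 0"
  shows "integrable lborel (\<lambda>y. exp (Complex (- (e / 2) * y\<^sup>2) (x * y)))"
    "(\<integral>y. exp (Complex (- (e / 2) * y\<^sup>2) (x * y)) \<partial>lborel) = complex_of_real (sqrt (2 * pi / e) * exp (- x\<^sup>2 / (2 * e)))"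
proof -
  let ?F = "\<lambda>y. exp (Complex (- (e / 2) * y\<^sup>2) (x * y))"
  have nrm: "norm (?F y) = exp (- (e / 2) * y\<^sup>2)" for y by (simp only: norm_exp_eq_Re complex.sel)
  have meas: "?F \<in> borel_measurable lborel"
    unfolding Complex_eq by simp
  have "(\<integral>\<^sup>+y. ennreal (norm (?F y)) \<partial>lborel) < \<infinity>"
    unfolding nrm using nn_integral_gauss_line[of "e / 2"] e by simp
  then show int: "integrable lborel ?F" using meas by (intro integrableI_bounded)
  \<comment> \<open>Substituting y = u / sqrt e reduces the integral to the characteristic function
    of the standard normal distribution at t.\<close>
  define t where "t = x / sqrt e"
  have "(\<integral>u. iexp (t * u) \<partial>std_normal_distribution) = complex_of_real (exp (- (t\<^sup>2) / 2))"
    using char_std_normal_distribution by (simp add: char_def fun_eq_iff)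
  then have "(\<integral>u. std_normal_density u *\<^sub>R iexp (t * u) \<partial>lborel) = complex_of_real (exp (- (t\<^sup>2) / 2))"
    by (subst (asm) integral_density) (auto simp: std_normal_density_def)
  moreover have "std_normal_density u *\<^sub>R iexp (t * u) = complex_of_real (1 / sqrt (2 * pi)) * ?F (0 + (1 / sqrt e) * u)" for u
  proof -
    have "?F (0 + (1 / sqrt e) * u) = exp (complex_of_real (- u\<^sup>2 / 2) + \<i> * complex_of_real (t * u))"
      using e by (simp add: Complex_eq t_def power_mult_distrib power_divide)
    also have "\<dots> = complex_of_real (exp (- u\<^sup>2 / 2)) * iexp (t * u)"
      by (simp only: exp_add exp_of_real)
    finally show ?thesis by (simp add: std_normal_density_def scaleR_conv_of_real)
  qed
  ultimately have "complex_of_real (1 / sqrt (2 * pi)) * (\<integral>u. ?F (0 + (1 / sqrt e) * u) \<partial>lborel) = complex_of_real (exp (- (t\<^sup>2) / 2))"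
    by (simp only: integral_mult_right_zero)
  then have "(\<integral>u. ?F (0 + (1 / sqrt e) * u) \<partial>lborel) = complex_of_real (sqrt (2 * pi) * exp (- (t\<^sup>2) / 2))"
    by (simp add: field_simps)
  moreover have "(\<integral>y. ?F y \<partial>lborel) = \<bar>1 / sqrt e\<bar> *\<^sub>R (\<integral>u. ?F (0 + (1 / sqrt e) * u) \<partial>lborel)"
    by (rule lborel_integral_real_affine) (use e in simp)
  ultimately have "(\<integral>y. ?F y \<partial>lborel) = complex_of_real ((1 / sqrt e) * (sqrt (2 * pi) * exp (- (t\<^sup>2) / 2)))"
    using e by (simp add: scaleR_conv_of_real)
  also have "(1 / sqrt e) * (sqrt (2 * pi) * exp (- (t\<^sup>2) / 2)) = sqrt (2 * pi / e) * exp (- x\<^sup>2 / (2 * e))"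
    using e by (simp add: t_def power_divide real_sqrt_divide)
  finally show "(\<integral>y. ?F y \<partial>lborel) = complex_of_real (sqrt (2 * pi / e) * exp (- x\<^sup>2 / (2 * e)))" .
qed

lemma gauss_fourier_leb:
  assumes I: "finite I" and e: "e > 0"
  shows "(\<integral>y. exp (Complex (- (e / 2) * dot I y y) (dot I x y)) \<partial>leb I) =
    complex_of_real (sqrt (2 * pi / e) ^ card I * exp (- dot I x x / (2 * e)))"
proof -
  have m: "(\<lambda>y. exp (Complex (- (e / 2) * dot I y y) (dot I x y))) \<in> borel_measurable borel"
    unfolding Complex_eq by measurable
  have pr: "exp (Complex (- (e / 2) * dot I (zext I y) (zext I y)) (dot I x (zext I y))) =
     (\<Prod>i\<in>I. exp (Complex (- (e / 2) * (y i)\<^sup>2) (x i * y i)))" for y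
  proof -
    have "Complex (- (e / 2) * dot I (zext I y) (zext I y)) (dot I x (zext I y)) = (\<Sum>i\<in>I. Complex (- (e / 2) * (y i)\<^sup>2) (x i * y i))"
      unfolding complex_eq_iff by (simp add: dot_def zext_def sum_distrib_left power2_eq_square)
    then show ?thesis by (simp add: exp_sum[OF I])
  qed
  have "(\<integral>y. exp (Complex (- (e / 2) * dot I y y) (dot I x y)) \<partial>leb I) =
     (\<integral>y. exp (Complex (- (e / 2) * dot I (zext I y) (zext I y)) (dot I x (zext I y))) \<partial>PiM I (\<lambda>_. lborel))"
    unfolding leb_def by (rule integral_distr[OF measurable_zext m])
  also have "\<dots> = (\<integral>y. (\<Prod>i\<in>I. exp (Complex (- (e / 2) * (y i)\<^sup>2) (x i * y i))) \<partial>PiM I (\<lambda>_. lborel))"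
    by (simp only: pr)
  also have "\<dots> = (\<Prod>i\<in>I. \<integral>t. exp (Complex (- (e / 2) * t\<^sup>2) (x i * t)) \<partial>lborel)"
    by (rule lborel_product.product_integral_prod[OF I]) (rule gauss_fourier_line(1)[OF e])
  also have "\<dots> = (\<Prod>i\<in>I. complex_of_real (sqrt (2 * pi / e) * exp (- (x i)\<^sup>2 / (2 * e))))"
    by (simp only: gauss_fourier_line(2)[OF e])
  also have "\<dots> = complex_of_real (\<Prod>i\<in>I. sqrt (2 * pi / e) * exp (- (x i)\<^sup>2 / (2 * e)))"
    by (simp only: of_real_prod)
  also have "(\<Prod>i\<in>I. sqrt (2 * pi / e) * exp (- (x i)\<^sup>2 / (2 * e))) = sqrt (2 * pi / e) ^ card I * exp (\<Sum>i\<in>I. - (x i)\<^sup>2 / (2 * e))"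
    by (simp add: prod.distrib exp_sum[OF I])
  also have "(\<Sum>i\<in>I. - (x i)\<^sup>2 / (2 * e)) = - dot I x x / (2 * e)"
    by (simp add: dot_def power2_eq_square sum_negf sum_divide_distrib)
  finally show ?thesis .
qed

text \<open>The oscillating kernel exp (i<x,y>) with a Gaussian factor that makes it absolutely
  integrable.\<close>

definition osc :: "nat set \<Rightarrow> real \<Rightarrow> vec \<times> vec \<Rightarrow> complex" where
  "osc I e z = exp (Complex (- (e / 2) * nrm2 I z) (dot I (fst z) (snd z)))"

lemma measurable_osc [measurable]: "osc I e \<in> borel_measurable borel"
  unfolding osc_def[abs_def] Complex_eq by measurable

text \<open>Integrating over y leaves a Gaussian in x, and the exact value is (2 pi / sqrt (1 +
  e^2))^n with n = \<open>card I\<close>; for e at most 1 the factor 2 absorbs the square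
  root.\<close>

lemma integral_osc:
  assumes I: "finite I" and e: "0 < e" "e \<le> 1"
  shows "norm (\<integral>z. osc I e z \<partial>leb2 I) \<ge> pi ^ card I"
proof -
  interpret sigma_finite_measure "leb I" by (rule sigma_finite_leb[OF I])
  interpret pair_sigma_finite "leb I" "leb I" ..
  have nrm: "norm (osc I e z) = exp (- (e / 2) * nrm2 I z)" for z
    unfolding osc_def by (simp only: norm_exp_eq_Re complex.sel)
  have int: "integrable (leb2 I) (osc I e)"
  proof (rule integrableI_bounded)
    show "(\<integral>\<^sup>+z. ennreal (norm (osc I e z)) \<partial>leb2 I) < \<infinity>"
      unfolding nrm using nn_integral_gauss_leb2[OF I, of "e / 2"] e by simp
  qed measurable
  have "(\<integral>z. osc I e z \<partial>leb2 I) = (\<integral>x. (\<integral>y. osc I e (x, y) \<partial>leb I) \<partial>leb I)"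
    using integral_fst'[OF int[unfolded leb2_def]] by (simp add: leb2_def)
  also have "\<dots> = (\<integral>x. complex_of_real (sqrt (2 * pi / e) ^ card I * exp (- (e / 2 + 1 / (2 * e)) * dot I x x)) \<partial>leb I)"
  proof (rule Bochner_Integration.integral_cong[OF refl])
    fix x
    have "osc I e (x, y) = complex_of_real (exp (- (e / 2) * dot I x x)) * exp (Complex (- (e / 2) * dot I y y) (dot I x y))" for y
    proof -
      have "Complex (- (e / 2) * nrm2 I (x, y)) (dot I x y) = complex_of_real (- (e / 2) * dot I x x) + Complex (- (e / 2) * dot I y y) (dot I x y)"
        unfolding complex_eq_iff by (simp add: nrm2_def algebra_simps)
      then show ?thesis unfolding osc_def by (simp only: fst_conv snd_conv exp_add exp_of_real)
    qed
    then have "(\<integral>y. osc I e (x, y) \<partial>leb I) = complex_of_real (exp (- (e / 2) * dot I x x)) * complex_of_real (sqrt (2 * pi / e) ^ card I * exp (- dot I x x / (2 * e)))"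
      by (simp only: integral_mult_right_zero gauss_fourier_leb[OF I e(1)])
    also have "\<dots> = complex_of_real (sqrt (2 * pi / e) ^ card I * (exp (- (e / 2) * dot I x x) * exp (- dot I x x / (2 * e))))"
      by simp
    also have "exp (- (e / 2) * dot I x x) * exp (- dot I x x / (2 * e)) = exp (- (e / 2 + 1 / (2 * e)) * dot I x x)"
      unfolding exp_add[symmetric] by (simp add: algebra_simps)
    finally show "(\<integral>y. osc I e (x, y) \<partial>leb I) = complex_of_real (sqrt (2 * pi / e) ^ card I * exp (- (e / 2 + 1 / (2 * e)) * dot I x x))" .
  qed
  also have "\<dots> = complex_of_real (sqrt (2 * pi / e) ^ card I * (\<integral>x. exp (- (e / 2 + 1 / (2 * e)) * dot I x x) \<partial>leb I))"
    by (simp only: integral_complex_of_real integral_mult_right_zero)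
  also have "(\<integral>x. exp (- (e / 2 + 1 / (2 * e)) * dot I x x) \<partial>leb I) = sqrt (pi / (e / 2 + 1 / (2 * e))) ^ card I"
  proof (rule integral_eq_nn_integral[THEN trans])
    show "enn2real (\<integral>\<^sup>+x. ennreal (exp (- (e / 2 + 1 / (2 * e)) * dot I x x)) \<partial>leb I) = sqrt (pi / (e / 2 + 1 / (2 * e))) ^ card I"
      by (subst nn_integral_gauss_leb[OF I]) (use e in \<open>auto simp: add_pos_pos intro!: enn2real_ennreal zero_le_power\<close>)
    show "(\<lambda>x. exp (- (e / 2 + 1 / (2 * e)) * dot I x x)) \<in> borel_measurable (leb I)" by measurable
  qed simp
  also have "norm (complex_of_real (sqrt (2 * pi / e) ^ card I * sqrt (pi / (e / 2 + 1 / (2 * e))) ^ card I)) =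
     (sqrt (2 * pi / e) * sqrt (pi / (e / 2 + 1 / (2 * e)))) ^ card I"
    using e by (simp add: norm_mult norm_power power_mult_distrib abs_mult)
  also have "\<dots> \<ge> pi ^ card I"
  proof (rule power_mono)
    have "pi\<^sup>2 * (1 + e\<^sup>2) \<le> pi\<^sup>2 * 4"
      using e power_mono[of e 1 2] by (intro mult_left_mono) auto
    then have "pi\<^sup>2 \<le> 4 * pi\<^sup>2 / (1 + e\<^sup>2)" by (subst pos_le_divide_eq) (auto simp: add_pos_nonneg)
    also have "\<dots> = (2 * pi / e) * (pi / (e / 2 + 1 / (2 * e)))"
      using e by (simp add: field_simps power2_eq_square add_pos_pos)
    finally have "sqrt (pi\<^sup>2) \<le> sqrt ((2 * pi / e) * (pi / (e / 2 + 1 / (2 * e))))" by (rule real_sqrt_le_mono)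
    then show "pi \<le> sqrt (2 * pi / e) * sqrt (pi / (e / 2 + 1 / (2 * e)))" by (simp only: real_sqrt_mult) simp
  qed simp
  finally show ?thesis .
qed

section \<open>Layer cake for separately homogeneous measures\<close>

lemma nn_integral_exp_tail:
  assumes c: "c \<ge> 0"
  shows "(\<integral>\<^sup>+y. ennreal (exp (- y)) * indicator {0<..} y * (if c \<le> y then 1 else 0) \<partial>lborel) = ennreal (exp (- c))"
proof -
  let ?e = "\<lambda>y. ennreal (exp (- y)) * indicator {0<..} y"
  have "(\<integral>\<^sup>+y. ?e y * (if c \<le> y then 1 else 0) \<partial>lborel) = (\<integral>\<^sup>+y. ennreal (exp (- y)) * indicator {c..} y \<partial>lborel)"
  proof (rule nn_integral_cong_AE)
    show "AE y in lborel. ?e y * (if c \<le> y then 1 else 0) = ennreal (exp (- y)) * indicator {c..} y"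
      using AE_lborel_singleton[of 0] by eventually_elim (use c in \<open>auto simp: indicator_def\<close>)
  qed
  also have "\<dots> = ennreal (0 - (- exp (- c)))"
  proof (rule nn_integral_FTC_atLeast)
    show "((\<lambda>y. - exp (- y)) has_real_derivative exp (- x)) (at x)" for x :: real
      by (auto intro!: derivative_eq_intros)
    show "((\<lambda>y. - exp (- y)) \<longlongrightarrow> 0) (at_top :: real filter)"
      using tendsto_minus[OF filterlim_compose[OF exp_at_bot filterlim_uminus_at_bot_at_top]] by simp
  qed auto
  finally show ?thesis by simp
qed

text \<open>After writing exp (-q) as an integral over levels, the set with q(a) at most y and q(b)
  at most y' has (y y')^(n/2) times the measure of the set at levels 1 and 1, by scaling each
  component with the root of its level. The remaining factor is Gamma(1 + n/2)^2; it is left as an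
  integral because it cancels when two such formulas are compared.\<close>

lemma bihomogeneous_layer_cake:
  fixes \<nu> :: "(vec \<times> vec) measure"
  assumes sf: "sigma_finite_measure \<nu>" and sets[measurable_cong]: "sets \<nu> = sets borel"
    and E: "AE z in \<nu>. z \<in> E2 I"
    and sc: "\<And>s t f. 0 < s \<Longrightarrow> 0 < t \<Longrightarrow> f \<in> borel_measurable borel \<Longrightarrow>
      (\<integral>\<^sup>+z. f z \<partial>\<nu>) = ennreal (s ^ n * t ^ n) * (\<integral>\<^sup>+z. f (s *\<^sub>R fst z, t *\<^sub>R snd z) \<partial>\<nu>)"
    and [measurable]: "q \<in> borel_measurable borel"
    and q0: "\<And>a. a \<in> coord_space I \<Longrightarrow> q a \<ge> 0"
    and q: "\<And>a s. a \<in> coord_space I \<Longrightarrow> s > 0 \<Longrightarrow> q (s *\<^sub>R a) = s\<^sup>2 * q a"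
  shows "(\<integral>\<^sup>+z. ennreal (exp (- (q (fst z) + q (snd z)))) \<partial>\<nu>) =
    emeasure \<nu> {z. q (fst z) \<le> 1 \<and> q (snd z) \<le> 1} * (\<integral>\<^sup>+y. ennreal (sqrt y ^ n * exp (- y)) * indicator {0<..} y \<partial>lborel)\<^sup>2"
proof -
  interpret sigma_finite_measure \<nu> by fact
  interpret pair_sigma_finite \<nu> lborel ..
  have [simp]: "space \<nu> = UNIV" using sets_eq_imp_space_eq[OF sets] by simp
  let ?G = "\<integral>\<^sup>+y. ennreal (sqrt y ^ n * exp (- y)) * indicator {0<..} y \<partial>lborel"
  let ?e = "\<lambda>y. ennreal (exp (- y)) * indicator {0<..} y"
  let ?L = "\<lambda>y y'. emeasure \<nu> {z. q (fst z) \<le> y \<and> q (snd z) \<le> y'}"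
  have L: "?L y y' = ennreal (sqrt y ^ n * sqrt y' ^ n) * ?L 1 1" if y: "0 < y" "0 < y'" for y y'
  proof -
    have "?L y y' = (\<integral>\<^sup>+z. indicator {z. q (fst z) \<le> y \<and> q (snd z) \<le> y'} z \<partial>\<nu>)" by simp
    also have "\<dots> = ennreal (sqrt y ^ n * sqrt y' ^ n) *
       (\<integral>\<^sup>+z. indicator {z. q (fst z) \<le> y \<and> q (snd z) \<le> y'} (sqrt y *\<^sub>R fst z, sqrt y' *\<^sub>R snd z) \<partial>\<nu>)"
      using y by (intro sc) auto
    also have "(\<integral>\<^sup>+z. indicator {z. q (fst z) \<le> y \<and> q (snd z) \<le> y'} (sqrt y *\<^sub>R fst z, sqrt y' *\<^sub>R snd z) \<partial>\<nu>) =
      (\<integral>\<^sup>+z. indicator {z. q (fst z) \<le> 1 \<and> q (snd z) \<le> 1} z \<partial>\<nu>)"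
    proof (rule nn_integral_cong_AE, use E in eventually_elim)
      fix z assume "z \<in> E2 I"
      then have "q (sqrt y *\<^sub>R fst z) = y * q (fst z)" "q (sqrt y' *\<^sub>R snd z) = y' * q (snd z)"
        using q[of "fst z" "sqrt y"] q[of "snd z" "sqrt y'"] y by (auto simp: E2_def)
      then show "indicator {z. q (fst z) \<le> y \<and> q (snd z) \<le> y'} (sqrt y *\<^sub>R fst z, sqrt y' *\<^sub>R snd z) =
         (indicator {z. q (fst z) \<le> 1 \<and> q (snd z) \<le> 1} z :: ennreal)"
        using y by (simp add: indicator_def)
    qed
    finally show ?thesis by simp
  qed
  have "(\<integral>\<^sup>+z. ennreal (exp (- (q (fst z) + q (snd z)))) \<partial>\<nu>) =
    (\<integral>\<^sup>+z. (\<integral>\<^sup>+y. ?e y * (if q (fst z) \<le> y then 1 else 0) * (\<integral>\<^sup>+y'. ?e y' * (if q (snd z) \<le> y' then 1 else 0) \<partial>lborel) \<partial>lborel) \<partial>\<nu>)"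
  proof (rule nn_integral_cong_AE, use E in eventually_elim)
    fix z assume "z \<in> E2 I"
    then have nn: "0 \<le> q (fst z)" "0 \<le> q (snd z)" using q0 by (auto simp: E2_def)
    have "(\<integral>\<^sup>+y. ?e y * (if q (fst z) \<le> y then 1 else 0) * ennreal (exp (- q (snd z))) \<partial>lborel) =
        (\<integral>\<^sup>+y. ?e y * (if q (fst z) \<le> y then 1 else 0) \<partial>lborel) * ennreal (exp (- q (snd z)))"
      by (rule nn_integral_multc) simp
    then show "ennreal (exp (- (q (fst z) + q (snd z)))) =
      (\<integral>\<^sup>+y. ?e y * (if q (fst z) \<le> y then 1 else 0) * (\<integral>\<^sup>+y'. ?e y' * (if q (snd z) \<le> y' then 1 else 0) \<partial>lborel) \<partial>lborel)"
      unfolding nn_integral_exp_tail[OF nn(1)] nn_integral_exp_tail[OF nn(2)] by (simp add: exp_add[symmetric] flip: ennreal_mult)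
  qed
  also have "\<dots> = (\<integral>\<^sup>+z. (\<integral>\<^sup>+y. (\<integral>\<^sup>+y'. (?e y * ?e y') * (if q (fst z) \<le> y \<and> q (snd z) \<le> y' then 1 else 0) \<partial>lborel) \<partial>lborel) \<partial>\<nu>)"
  proof (intro nn_integral_cong)
    fix z y
    have "?e y * (if q (fst z) \<le> y then 1 else 0) * (\<integral>\<^sup>+y'. ?e y' * (if q (snd z) \<le> y' then 1 else 0) \<partial>lborel) =
       (\<integral>\<^sup>+y'. ?e y * (if q (fst z) \<le> y then 1 else 0) * (?e y' * (if q (snd z) \<le> y' then 1 else 0)) \<partial>lborel)"
      by (rule nn_integral_cmult[symmetric]) simp
    also have "\<dots> = (\<integral>\<^sup>+y'. (?e y * ?e y') * (if q (fst z) \<le> y \<and> q (snd z) \<le> y' then 1 else 0) \<partial>lborel)"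
      by (intro nn_integral_cong) (auto simp: ac_simps)
    finally show "?e y * (if q (fst z) \<le> y then 1 else 0) * (\<integral>\<^sup>+y'. ?e y' * (if q (snd z) \<le> y' then 1 else 0) \<partial>lborel) =
      (\<integral>\<^sup>+y'. (?e y * ?e y') * (if q (fst z) \<le> y \<and> q (snd z) \<le> y' then 1 else 0) \<partial>lborel)" .
  qed
  also have "\<dots> = (\<integral>\<^sup>+y. (\<integral>\<^sup>+z. (\<integral>\<^sup>+y'. (?e y * ?e y') * (if q (fst z) \<le> y \<and> q (snd z) \<le> y' then 1 else 0) \<partial>lborel) \<partial>\<nu>) \<partial>lborel)"
    by (rule Fubini'[symmetric]) measurable
  also have "\<dots> = (\<integral>\<^sup>+y. (\<integral>\<^sup>+y'. (\<integral>\<^sup>+z. (?e y * ?e y') * (if q (fst z) \<le> y \<and> q (snd z) \<le> y' then 1 else 0) \<partial>\<nu>) \<partial>lborel) \<partial>lborel)"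
    by (intro nn_integral_cong Fubini'[symmetric]) measurable
  also have "\<dots> = (\<integral>\<^sup>+y. (\<integral>\<^sup>+y'. (?e y * ?e y') * ?L y y' \<partial>lborel) \<partial>lborel)"
  proof (intro nn_integral_cong)
    fix y y'
    have "(\<integral>\<^sup>+z. (?e y * ?e y') * (if q (fst z) \<le> y \<and> q (snd z) \<le> y' then 1 else 0) \<partial>\<nu>) =
      (?e y * ?e y') * (\<integral>\<^sup>+z. (if q (fst z) \<le> y \<and> q (snd z) \<le> y' then 1 else 0) \<partial>\<nu>)"
      by (rule nn_integral_cmult) measurable
    also have "(\<integral>\<^sup>+z. (if q (fst z) \<le> y \<and> q (snd z) \<le> y' then 1 else 0) \<partial>\<nu>) = (\<integral>\<^sup>+z. indicator {z. q (fst z) \<le> y \<and> q (snd z) \<le> y'} z \<partial>\<nu>)"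
      by (intro nn_integral_cong) (simp add: indicator_def)
    also have "\<dots> = ?L y y'" by simp
    finally show "(\<integral>\<^sup>+z. (?e y * ?e y') * (if q (fst z) \<le> y \<and> q (snd z) \<le> y' then 1 else 0) \<partial>\<nu>) = (?e y * ?e y') * ?L y y'" .
  qed
  also have "\<dots> = (\<integral>\<^sup>+y. (\<integral>\<^sup>+y'. (ennreal (sqrt y ^ n * exp (- y)) * indicator {0<..} y * ?L 1 1) * (ennreal (sqrt y' ^ n * exp (- y')) * indicator {0<..} y') \<partial>lborel) \<partial>lborel)"
  proof (intro nn_integral_cong)
    fix y y' :: real
    define l where "l = ?L 1 1"
    show "(?e y * ?e y') * ?L y y' = (ennreal (sqrt y ^ n * exp (- y)) * indicator {0<..} y * ?L 1 1) * (ennreal (sqrt y' ^ n * exp (- y')) * indicator {0<..} y')"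
    proof (cases "0 < y \<and> 0 < y'")
      case True
      then have Ly: "?L y y' = ennreal (sqrt y ^ n * sqrt y' ^ n) * l" unfolding l_def by (intro L) auto
      show ?thesis unfolding Ly l_def[symmetric] using True by (simp add: ennreal_mult ac_simps)
    next
      case False
      then show ?thesis by (auto simp: indicator_def)
    qed
  qed
  also have "\<dots> = (\<integral>\<^sup>+y. (ennreal (sqrt y ^ n * exp (- y)) * indicator {0<..} y * ?L 1 1) * ?G \<partial>lborel)"
    by (intro nn_integral_cong nn_integral_cmult) simp
  also have "\<dots> = (\<integral>\<^sup>+y. ennreal (sqrt y ^ n * exp (- y)) * indicator {0<..} y * ?L 1 1 \<partial>lborel) * ?G"
    by (rule nn_integral_multc) simp
  also have "(\<integral>\<^sup>+y. ennreal (sqrt y ^ n * exp (- y)) * indicator {0<..} y * ?L 1 1 \<partial>lborel) = ?G * ?L 1 1"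
    by (rule nn_integral_multc) simp
  finally show ?thesis by (simp add: power2_eq_square ac_simps)
qed

section \<open>The rotated phase and its decay along the quarter circle\<close>

context piecewise_linear_field
begin

definition q :: "vec \<Rightarrow> real" where
  "q a = dot I a (J a)"

lemma J_0: "J 0 = 0"
  using J_scale[of 0 2] by (simp add: scaleR_2)

lemma J_bound: "a \<in> coord_space I \<Longrightarrow> dot I (J a) (J a) \<le> \<Lambda> * dot I a a"
  using mono_lipD(3)[OF J_mono_lip, of a 0] by (simp add: J_0)

lemma q_lower: "a \<in> coord_space I \<Longrightarrow> \<delta> * dot I a a \<le> q a"
  using mono_lipD(2)[OF J_mono_lip, of a 0] by (simp add: J_0 q_def dot_commute)

lemma q_upper: "q a \<le> (dot I a a + dot I (J a) (J a)) / 2"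
  using dot_AM_GM[of I a "J a"] by (simp add: q_def)

lemma q_nonneg: "a \<in> coord_space I \<Longrightarrow> 0 \<le> q a"
  using q_lower[of a] pos dot_nonneg[of I a] by (meson less_imp_le mult_nonneg_nonneg order_trans)

lemma q_scale: "a \<in> coord_space I \<Longrightarrow> s > 0 \<Longrightarrow> q (s *\<^sub>R a) = s\<^sup>2 * q a"
  by (simp add: q_def J_scale dot_simps power2_eq_square)

lemma measurable_q [measurable]: "q \<in> borel_measurable borel"
  unfolding q_def[abs_def] by measurable

lemma T_bound: "z \<in> E2 I \<Longrightarrow> nrm2 I (T z) \<le> (2 + 2 * \<Lambda>) * nrm2 I z"
proof -
  assume "z \<in> E2 I"
  then have z: "fst z \<in> coord_space I" "snd z \<in> coord_space I" by (auto simp: E2_def)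
  have par: "dot I (x + y) (x + y) \<le> 2 * dot I x x + 2 * dot I y y" "dot I (x - y) (x - y) \<le> 2 * dot I x x + 2 * dot I y y" for x y
    using dot_AM_GM[of I x y] by (simp_all add: dot_simps dot_commute[of I y x])
  have "nrm2 I (T z) \<le> (2 * dot I (fst z) (fst z) + 2 * dot I (snd z) (snd z)) + (2 * dot I (J (fst z)) (J (fst z)) + 2 * dot I (J (snd z)) (J (snd z)))"
    unfolding T_def pair_map_def nrm2_def fst_conv snd_conv by (intro add_mono par)
  also have "\<dots> \<le> (2 * dot I (fst z) (fst z) + 2 * dot I (snd z) (snd z)) + (2 * (\<Lambda> * dot I (fst z) (fst z)) + 2 * (\<Lambda> * dot I (snd z) (snd z)))"
    by (intro add_mono mult_left_mono J_bound z) auto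
  also have "\<dots> = (2 + 2 * \<Lambda>) * nrm2 I z" by (simp add: nrm2_def algebra_simps)
  finally show ?thesis .
qed

lemma T_expansive: "z \<in> E2 I \<Longrightarrow> \<delta>\<^sup>2 / (1 + \<Lambda>) * nrm2 I z \<le> nrm2 I (T z)"
proof -
  assume z: "z \<in> E2 I"
  have "T 0 = 0" by (simp add: T_def pair_map_def J_0 zero_prod_def)
  moreover have "0 \<in> E2 I" by (simp add: E2_def)
  ultimately have "nrm2 I z \<le> ((1 + \<Lambda>) / \<delta>\<^sup>2) * nrm2 I (T z)"
    using pair_map_expansive[OF J_mono_lip J_mono_lip pos z, of 0] by (simp add: T_def)
  then have "\<delta>\<^sup>2 / (1 + \<Lambda>) * nrm2 I z \<le> \<delta>\<^sup>2 / (1 + \<Lambda>) * (((1 + \<Lambda>) / \<delta>\<^sup>2) * nrm2 I (T z))"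
    using pos by (intro mult_left_mono) auto
  then show ?thesis using pos by simp
qed

text \<open>Strength of the Gaussian regularisation, so small that by \<open>B_bound\<close> the
  mixed term eps times \<open>B\<close> is dominated by half of the strong monotonicity of
  \<open>q\<close>.\<close>

definition eps :: real where
  "eps = min 1 (\<delta> / (1 + \<Lambda>))"

text \<open>A decay rate valid along the whole quarter circle: the first bound governs the end w =
  i, the second the end w = 1.\<close>

definition kap :: real where
  "kap = min (\<delta> / 2) (eps * \<delta>\<^sup>2 / (2 * (1 + \<Lambda>)))"

lemma eps: "0 < eps" "eps \<le> 1" "eps * (1 + \<Lambda>) \<le> \<delta>"
proof -
  have "eps * (1 + \<Lambda>) \<le> \<delta> / (1 + \<Lambda>) * (1 + \<Lambda>)"
    using pos by (intro mult_right_mono) (auto simp: eps_def)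
  then show "eps * (1 + \<Lambda>) \<le> \<delta>" using pos by simp
qed (use pos in \<open>auto simp: eps_def\<close>)

lemma kap: "0 < kap" using pos eps(1) by (simp add: kap_def)

text \<open>The pure part of the quadratic form |T z|^2, whose mixed part is 2 \<open>B\<close>; see
  \<open>nrm2_T\<close>.\<close>

definition A :: "vec \<Rightarrow> real" where
  "A a = dot I a a + dot I (J a) (J a)"

definition p :: "vec \<Rightarrow> complex" where
  "p a = Complex (- (eps / 2) * A a) (q a)"

definition p' :: "vec \<Rightarrow> complex" where
  "p' b = Complex (- (eps / 2) * A b) (- q b)"

definition B :: "vec \<times> vec \<Rightarrow> real" where
  "B z = dot I (fst z) (snd z) - dot I (J (fst z)) (J (snd z))"

text \<open>The terms of the exponent of degree one in a and in b. Reciprocal dilations of a and b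
  leave them fixed, which is why they carry no factor w in \<open>ph\<close>.\<close>

definition m :: "vec \<times> vec \<Rightarrow> complex" where
  "m z = Complex (- eps * B z) (dot I (snd z) (J (fst z)) - dot I (fst z) (J (snd z)))"

text \<open>For \<open>w = 1\<close> this is the exponent of \<open>osc\<close> in the coordinates \<open>T\<close>. Scaling \<open>a\<close> by \<open>s\<close> and \<open>b\<close> by \<open>1/s\<close>
  multiplies \<open>w\<close> by \<open>s\<^sup>2\<close> and preserves \<open>\<nu>\<close>, so the integral of \<open>exp (ph w)\<close> is holomorphic in \<open>w\<close> and constant
  along rays.\<close>
definition ph :: "complex \<Rightarrow> vec \<times> vec \<Rightarrow> complex" where
  "ph w z = w * p (fst z) + inverse w * p' (snd z) + m z"

definition F :: "complex \<Rightarrow> vec \<times> vec \<Rightarrow> complex" where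
  "F w z = exp (ph w z)"

definition F' :: "complex \<Rightarrow> vec \<times> vec \<Rightarrow> complex" where
  "F' w z = exp (ph w z) * (p (fst z) - inverse w * p' (snd z) * inverse w)"

lemma measurable_parts [measurable]:
  "p \<in> borel_measurable borel" "p' \<in> borel_measurable borel" "m \<in> borel_measurable borel"
  unfolding p_def[abs_def] p'_def[abs_def] m_def[abs_def] A_def B_def Complex_eq by measurable

lemma measurable_F [measurable]: "F w \<in> borel_measurable borel" "F' w \<in> borel_measurable borel"
  unfolding F_def[abs_def] F'_def[abs_def] ph_def by measurable

lemma A_bound: "a \<in> coord_space I \<Longrightarrow> A a \<le> (1 + \<Lambda>) * dot I a a"
  using J_bound[of a] by (simp add: A_def algebra_simps)

lemma A_nonneg: "0 \<le> A a" by (simp add: A_def)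

lemma p_bound:
  assumes "a \<in> coord_space I"
  shows "norm (p a) \<le> (1 + \<Lambda>) * dot I a a" "norm (p' a) \<le> (1 + \<Lambda>) * dot I a a"
proof -
  have e: "\<bar>(eps / 2) * A a\<bar> \<le> A a / 2"
    using eps A_nonneg[of a] mult_right_mono[of eps 1 "A a"] by (simp add: abs_mult)
  have qq: "\<bar>q a\<bar> \<le> A a / 2" using q_upper[of a] q_nonneg[OF assms] by (simp add: A_def)
  have "norm (p a) \<le> \<bar>(eps / 2) * A a\<bar> + \<bar>q a\<bar>" using cmod_le[of "p a"] by (simp add: p_def)
  then show "norm (p a) \<le> (1 + \<Lambda>) * dot I a a" using e qq A_bound[OF assms] by linarith
  have "norm (p' a) \<le> \<bar>(eps / 2) * A a\<bar> + \<bar>q a\<bar>" using cmod_le[of "p' a"] by (simp add: p'_def)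
  then show "norm (p' a) \<le> (1 + \<Lambda>) * dot I a a" using e qq A_bound[OF assms] by linarith
qed

lemma B_bound: "z \<in> E2 I \<Longrightarrow> \<bar>B z\<bar> \<le> (1 + \<Lambda>) / 2 * nrm2 I z"
proof -
  assume "z \<in> E2 I"
  then have "A (fst z) + A (snd z) \<le> (1 + \<Lambda>) * nrm2 I z"
    using A_bound[of "fst z"] A_bound[of "snd z"] by (simp add: E2_def nrm2_def distrib_left)
  moreover have "2 * \<bar>B z\<bar> \<le> A (fst z) + A (snd z)"
  proof -
    have "2 * \<bar>dot I (fst z) (snd z)\<bar> \<le> dot I (fst z) (fst z) + dot I (snd z) (snd z)"
      "2 * \<bar>dot I (J (fst z)) (J (snd z))\<bar> \<le> dot I (J (fst z)) (J (fst z)) + dot I (J (snd z)) (J (snd z))"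
      by (rule dot_AM_GM)+
    moreover have "2 * \<bar>x\<bar> \<le> a + b \<Longrightarrow> 2 * \<bar>y\<bar> \<le> c + d \<Longrightarrow> 2 * \<bar>x - y\<bar> \<le> a + c + (b + d)" for x y a b c d :: real
      using abs_triangle_ineq4[of x y] by simp
    ultimately show ?thesis unfolding B_def A_def by blast
  qed
  ultimately show ?thesis by simp
qed

lemma nrm2_T: "nrm2 I (T z) = A (fst z) + A (snd z) + 2 * B z"
  by (simp add: T_def pair_map_def nrm2_def A_def B_def dot_simps dot_commute[of I "snd z" "fst z"]
      dot_commute[of I "J (snd z)" "J (fst z)"])

lemma dot_T: "dot I (fst (T z)) (snd (T z)) = q (fst z) - q (snd z) + (dot I (snd z) (J (fst z)) - dot I (fst z) (J (snd z)))"
  by (simp add: T_def pair_map_def q_def dot_simps)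

lemma F_1: "F 1 z = osc I eps (T z)"
proof -
  have "ph 1 z = Complex (- (eps / 2) * nrm2 I (T z)) (dot I (fst (T z)) (snd (T z)))"
    unfolding nrm2_T dot_T by (simp add: complex_eq_iff ph_def p_def p'_def m_def algebra_simps)
  then show ?thesis by (simp add: F_def osc_def)
qed

text \<open>Rotation moves weight from the regularisation, with factor cos t, to the decay in
  \<open>q\<close>, with factor sin t. Since the mixed part of the regularisation is not rotated, a
  defect with factor 1 - cos t is left over.\<close>

lemma Re_ph_arc:
  "Re (ph (cis t) z) = - sin t * (q (fst z) + q (snd z)) - eps * cos t * (nrm2 I (T z) / 2) - eps * (1 - cos t) * B z"
proof -
  have "inverse (cis t) = cis (- t)" by simp
  then show ?thesis unfolding ph_def nrm2_T
    by (simp add: p_def p'_def m_def algebra_simps add_divide_distrib)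
qed

text \<open>On the quarter circle 1 - cos t is at most sin t, so the defect costs no more than half
  of the decay from \<open>q\<close>. What remains has weights sin t and cos t, whose sum is at
  least 1; hence the rate is uniform in t.\<close>

lemma Re_ph_arc_le:
  assumes z: "z \<in> E2 I" and t: "0 \<le> t" "t \<le> pi / 2"
  shows "Re (ph (cis t) z) \<le> - kap * nrm2 I z"
proof -
  have sc: "0 \<le> sin t" "0 \<le> cos t" using t by (auto intro: sin_ge_zero cos_ge_zero)
  have sc1: "1 \<le> sin t + cos t"
  proof (rule power2_le_imp_le)
    have "(sin t + cos t)\<^sup>2 = (sin t)\<^sup>2 + (cos t)\<^sup>2 + 2 * (sin t * cos t)" by (simp add: power2_eq_square algebra_simps)
    also have "\<dots> = 1 + 2 * (sin t * cos t)" by simp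
    finally show "1\<^sup>2 \<le> (sin t + cos t)\<^sup>2" using sc by simp
  qed (use sc in simp)
  define N where "N = nrm2 I z"
  have N: "0 \<le> N" by (simp add: N_def)
  have zE: "fst z \<in> coord_space I" "snd z \<in> coord_space I" using z by (auto simp: E2_def)
  have qN: "\<delta> * N \<le> q (fst z) + q (snd z)"
    using q_lower[OF zE(1)] q_lower[OF zE(2)] by (simp add: N_def nrm2_def distrib_left)
  have 1: "sin t * (\<delta> * N) \<le> sin t * (q (fst z) + q (snd z))" using sc qN by (intro mult_left_mono)
  have 2: "eps * cos t * (\<delta>\<^sup>2 / (1 + \<Lambda>) * N / 2) \<le> eps * cos t * (nrm2 I (T z) / 2)"
    using T_expansive[OF z] sc eps unfolding N_def by (intro mult_left_mono divide_right_mono) auto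
  have 3: "- (eps * (1 - cos t) * B z) \<le> sin t * (\<delta> / 2 * N)"
  proof -
    have "- (eps * (1 - cos t) * B z) \<le> eps * (1 - cos t) * \<bar>B z\<bar>"
    proof -
      have "0 \<le> eps * (1 - cos t)" using eps cos_le_one[of t] by simp
      then have "eps * (1 - cos t) * (- B z) \<le> eps * (1 - cos t) * \<bar>B z\<bar>" by (intro mult_left_mono) auto
      then show ?thesis by simp
    qed
    also have "\<dots> \<le> eps * sin t * ((1 + \<Lambda>) / 2 * N)"
    proof (rule mult_mono)
      show "eps * (1 - cos t) \<le> eps * sin t" using eps sc1 by (intro mult_left_mono) auto
      show "\<bar>B z\<bar> \<le> (1 + \<Lambda>) / 2 * N" unfolding N_def by (rule B_bound[OF z])
      show "0 \<le> eps * sin t" using less_imp_le[OF eps(1)] sc(1) by (rule mult_nonneg_nonneg)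
    qed simp
    also have "\<dots> = sin t * (eps * (1 + \<Lambda>) / 2 * N)" by simp
    also have "\<dots> \<le> sin t * (\<delta> / 2 * N)" using eps sc N by (intro mult_left_mono mult_right_mono divide_right_mono) auto
    finally show ?thesis .
  qed
  have "Re (ph (cis t) z) \<le> - (sin t * (\<delta> / 2 * N)) - cos t * (eps * \<delta>\<^sup>2 / (2 * (1 + \<Lambda>)) * N)"
  proof -
    have e1: "eps * cos t * (\<delta>\<^sup>2 / (1 + \<Lambda>) * N / 2) = cos t * (eps * \<delta>\<^sup>2 / (2 * (1 + \<Lambda>)) * N)" by (simp add: ac_simps)
    have e2: "sin t * (\<delta> * N) = sin t * (\<delta> / 2 * N) + sin t * (\<delta> / 2 * N)" by simp
    show ?thesis using 1 2 3 unfolding Re_ph_arc e1 e2 by linarith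
  qed
  also have "\<dots> \<le> - (sin t * (kap * N)) - cos t * (kap * N)"
  proof -
    have "kap \<le> \<delta> / 2" "kap \<le> eps * \<delta>\<^sup>2 / (2 * (1 + \<Lambda>))"
      unfolding kap_def by (rule min.cobounded1, rule min.cobounded2)
    then show ?thesis using sc N by (intro diff_mono le_imp_neg_le mult_left_mono mult_right_mono)
  qed
  also have "\<dots> = - ((sin t + cos t) * (kap * N))" by (simp add: algebra_simps)
  also have "\<dots> \<le> - (1 * (kap * N))" using sc1 kap N by (intro le_imp_neg_le mult_right_mono) auto
  finally show ?thesis by (simp add: N_def)
qed

text \<open>Radius of a disc around each point of the arc on which the decay rate drops by at most
  half: w moves by rad, its inverse by at most 2 rad, and 3 rad (1 + \<Lambda>) is at most
  kap/2.\<close>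

definition rad :: real where
  "rad = min (1 / 2) (kap / (6 * (1 + \<Lambda>)))"

lemma rad: "0 < rad" "rad \<le> 1 / 2" "rad * (6 * (1 + \<Lambda>)) \<le> kap"
proof -
  have "rad * (6 * (1 + \<Lambda>)) \<le> kap / (6 * (1 + \<Lambda>)) * (6 * (1 + \<Lambda>))"
    using pos by (intro mult_right_mono) (auto simp: rad_def)
  then show "rad * (6 * (1 + \<Lambda>)) \<le> kap" using pos by simp
  show "rad \<le> 1 / 2" unfolding rad_def by (rule min.cobounded1)
qed (use pos kap in \<open>auto simp: rad_def\<close>)

lemma near_arc:
  assumes w: "w \<in> ball (cis t) rad"
  shows "1 / 2 \<le> norm w" "w \<noteq> 0" "norm (inverse w) \<le> 2" "norm (inverse w - inverse (cis t)) \<le> 2 * rad"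
proof -
  have d: "norm (w - cis t) < rad" using w by (simp add: dist_norm norm_minus_commute)
  have "norm (cis t) \<le> norm w + norm (w - cis t)" by (metis add.commute norm_triangle_sub norm_minus_commute)
  then show h: "1 / 2 \<le> norm w" using d rad by simp
  then show nz: "w \<noteq> 0" by auto
  have i: "inverse (norm w) \<le> 2" using h le_imp_inverse_le[of "1/2" "norm w"] by simp
  then show "norm (inverse w) \<le> 2" by (simp add: norm_inverse)
  have "inverse w - inverse (cis t) = inverse w * (cis t - w) * inverse (cis t)" using nz by (simp add: field_simps)
  then have "norm (inverse w - inverse (cis t)) = inverse (norm w) * norm (w - cis t)"
    by (simp add: norm_mult norm_inverse norm_minus_commute)
  also have "\<dots> \<le> 2 * rad" using i d by (intro mult_mono) auto
  finally show "norm (inverse w - inverse (cis t)) \<le> 2 * rad" .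
qed

lemma Re_ph_near_arc:
  assumes z: "z \<in> E2 I" and t: "0 \<le> t" "t \<le> pi / 2" and w: "w \<in> ball (cis t) rad"
  shows "Re (ph w z) \<le> - (kap / 2) * nrm2 I z"
proof -
  have zE: "fst z \<in> coord_space I" "snd z \<in> coord_space I" using z by (auto simp: E2_def)
  have d: "norm (w - cis t) \<le> rad" using w by (simp add: dist_norm norm_minus_commute)
  have "ph w z - ph (cis t) z = (w - cis t) * p (fst z) + (inverse w - inverse (cis t)) * p' (snd z)"
    by (simp add: ph_def algebra_simps)
  then have "Re (ph w z) - Re (ph (cis t) z) \<le> norm ((w - cis t) * p (fst z)) + norm ((inverse w - inverse (cis t)) * p' (snd z))"
    using complex_Re_le_cmod[of "ph w z - ph (cis t) z"] norm_triangle_ineq[of "(w - cis t) * p (fst z)" "(inverse w - inverse (cis t)) * p' (snd z)"]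
    unfolding minus_complex.sel[symmetric] by simp
  also have "\<dots> \<le> rad * ((1 + \<Lambda>) * dot I (fst z) (fst z)) + 2 * rad * ((1 + \<Lambda>) * dot I (snd z) (snd z))"
    unfolding norm_mult using d near_arc(4)[OF w] p_bound(1)[OF zE(1)] p_bound(2)[OF zE(2)] rad
    by (intro add_mono mult_mono) auto
  also have "\<dots> \<le> 3 * rad * (1 + \<Lambda>) * nrm2 I z"
  proof -
    have "0 \<le> rad * (1 + \<Lambda>)" using rad pos by simp
    then have "0 \<le> rad * (1 + \<Lambda>) * dot I (fst z) (fst z)" "0 \<le> rad * (1 + \<Lambda>) * dot I (snd z) (snd z)" by simp_all
    then show ?thesis by (simp add: nrm2_def algebra_simps)
  qed
  also have "\<dots> = (rad * (6 * (1 + \<Lambda>))) / 2 * nrm2 I z" by simp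
  also have "\<dots> \<le> kap / 2 * nrm2 I z" using rad by (intro mult_right_mono divide_right_mono) auto
  finally have "Re (ph w z) - Re (ph (cis t) z) \<le> kap / 2 * nrm2 I z" .
  moreover have "kap * nrm2 I z = kap / 2 * nrm2 I z + kap / 2 * nrm2 I z" by simp
  ultimately show ?thesis using Re_ph_arc_le[OF z t] unfolding minus_mult_left[symmetric] by linarith
qed

lemma F'_bound:
  assumes z: "z \<in> E2 I" and t: "0 \<le> t" "t \<le> pi / 2" and w: "w \<in> ball (cis t) rad"
  shows "norm (F' w z) \<le> 20 * (1 + \<Lambda>) / kap * exp (- (kap / 4) * nrm2 I z)"
proof -
  define N where "N = nrm2 I z"
  have N: "0 \<le> N" by (simp add: N_def)
  have zE: "fst z \<in> coord_space I" "snd z \<in> coord_space I" using z by (auto simp: E2_def)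
  have "norm (p (fst z) - inverse w * p' (snd z) * inverse w) \<le> norm (p (fst z)) + norm (inverse w) * norm (p' (snd z)) * norm (inverse w)"
    by (metis norm_mult norm_triangle_ineq4)
  also have "\<dots> \<le> (1 + \<Lambda>) * dot I (fst z) (fst z) + 2 * ((1 + \<Lambda>) * dot I (snd z) (snd z)) * 2"
    using near_arc(3)[OF w] p_bound(1)[OF zE(1)] p_bound(2)[OF zE(2)] pos by (intro add_mono mult_mono) auto
  also have "\<dots> \<le> 5 * (1 + \<Lambda>) * N"
  proof -
    have "0 \<le> (1 + \<Lambda>) * dot I (fst z) (fst z)" "0 \<le> (1 + \<Lambda>) * dot I (snd z) (snd z)" using pos by simp_all
    then show ?thesis by (simp add: N_def nrm2_def algebra_simps)
  qed
  finally have 1: "norm (p (fst z) - inverse w * p' (snd z) * inverse w) \<le> 5 * (1 + \<Lambda>) * N" .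
  have "norm (exp (ph w z)) \<le> exp (- (kap / 2) * N)"
    unfolding norm_exp_eq_Re N_def using Re_ph_near_arc[OF z t w] by simp
  then have "norm (F' w z) \<le> exp (- (kap / 2) * N) * (5 * (1 + \<Lambda>) * N)"
    unfolding F'_def norm_mult using 1 by (intro mult_mono) auto
  \<comment> \<open>One half of the exponential absorbs the factor N through x exp (-x) \<le> 1 with
    x = kap N/4, which turns the constant 5 into 20/kap.\<close>
  also have "exp (- (kap / 2) * N) = exp (- (kap / 4) * N) * exp (- (kap / 4) * N)"
    unfolding exp_add[symmetric] by simp
  also have "\<dots> * (5 * (1 + \<Lambda>) * N) = 20 * (1 + \<Lambda>) / kap * exp (- (kap / 4) * N) * ((kap / 4 * N) * exp (- (kap / 4) * N))"
    using kap by simp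
  also have "\<dots> \<le> 20 * (1 + \<Lambda>) / kap * exp (- (kap / 4) * N) * 1"
  proof (rule mult_left_mono)
    have "kap / 4 * N \<le> exp (kap / 4 * N)" using exp_ge_add_one_self[of "kap / 4 * N"] by linarith
    then have "(kap / 4 * N) * exp (- (kap / 4) * N) \<le> exp (kap / 4 * N) * exp (- (kap / 4) * N)" by (rule mult_right_mono) simp
    then show "(kap / 4 * N) * exp (- (kap / 4) * N) \<le> 1" by (simp add: exp_add[symmetric])
  qed (use pos kap in simp)
  finally show ?thesis by (simp add: N_def)
qed

theorem polar_product_lower_bound:
  assumes Q[measurable]: "Q \<in> sets borel"
    and sub: "\<And>z. z \<in> E2 I \<Longrightarrow> q (fst z) \<le> 1 \<Longrightarrow> q (snd z) \<le> 1 \<Longrightarrow> T z \<in> Q"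
  shows "(emeasure (leb I) (uball I))\<^sup>2 \<le> 2 ^ card I * emeasure (leb2 I) Q"
proof -
  obtain \<nu> :: "(vec \<times> vec) measure" where sets[measurable_cong]: "sets \<nu> = sets borel" and dist: "distr \<nu> borel T = leb2 I"
    and E: "AE z in \<nu>. z \<in> E2 I"
    and sc: "\<And>s t f. 0 < s \<Longrightarrow> 0 < t \<Longrightarrow> f \<in> borel_measurable borel \<Longrightarrow>
      (\<integral>\<^sup>+z. f z \<partial>\<nu>) = ennreal (s ^ card I * t ^ card I) * (\<integral>\<^sup>+z. f (s *\<^sub>R fst z, t *\<^sub>R snd z) \<partial>\<nu>)"
    by (rule pull_back_measure) (assumption | rule that)+
  have sp[simp]: "space \<nu> = UNIV" using sets_eq_imp_space_eq[OF sets] by simp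
  have Tm: "T \<in> measurable \<nu> borel" by measurable
  have sf: "sigma_finite_measure \<nu>"
    using sigma_finite_leb2[OF I] sigma_finite_measure_distr[OF _ Tm] dist by simp
  have gint: "integrable \<nu> (\<lambda>z. exp (- s * nrm2 I z))" if s: "s > 0" for s
  proof (rule integrableI_bounded)
    have "(\<integral>\<^sup>+z. ennreal (norm (exp (- s * nrm2 I z))) \<partial>\<nu>) \<le> (\<integral>\<^sup>+z. ennreal (exp (- (s / (2 + 2 * \<Lambda>)) * nrm2 I (T z))) \<partial>\<nu>)"
    proof (rule nn_integral_mono_AE, use E in eventually_elim)
      fix z assume z: "z \<in> E2 I"
      have "s / (2 + 2 * \<Lambda>) * nrm2 I (T z) \<le> s / (2 + 2 * \<Lambda>) * ((2 + 2 * \<Lambda>) * nrm2 I z)"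
        using T_bound[OF z] s pos by (intro mult_left_mono) auto
      then have "s / (2 + 2 * \<Lambda>) * nrm2 I (T z) \<le> s * nrm2 I z" using pos by simp
      then show "ennreal (norm (exp (- s * nrm2 I z))) \<le> ennreal (exp (- (s / (2 + 2 * \<Lambda>)) * nrm2 I (T z)))"
        by (intro ennreal_leI) simp
    qed
    also have "\<dots> = (\<integral>\<^sup>+w. ennreal (exp (- (s / (2 + 2 * \<Lambda>)) * nrm2 I w)) \<partial>distr \<nu> borel T)"
      by (rule nn_integral_distr[OF Tm, symmetric]) measurable
    also have "\<dots> < \<infinity>" unfolding dist by (subst nn_integral_gauss_leb2[OF I]) (use s pos in auto)
    finally show "(\<integral>\<^sup>+z. ennreal (norm (exp (- s * nrm2 I z))) \<partial>\<nu>) < \<infinity>" .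
  qed measurable
  have Fint: "integrable \<nu> (F w)" if w: "w \<in> ball (cis t) rad" and t: "0 \<le> t" "t \<le> pi / 2" for w t
  proof (rule Bochner_Integration.integrable_bound[OF gint[of "kap / 2"]])
    show "AE z in \<nu>. norm (F w z) \<le> norm (exp (- (kap / 2) * nrm2 I z))"
      using E
    proof eventually_elim
      case (elim z)
      have "norm (F w z) = exp (Re (ph w z))" by (simp add: F_def)
      then show ?case using Re_ph_near_arc[OF elim t w] by simp
    qed
    show "F w \<in> borel_measurable \<nu>" by measurable
    show "0 < kap / 2" using kap by simp
  qed
  define G where "G w = (\<integral>z. F w z \<partial>\<nu>)" for w
  have der: "(G has_field_derivative (\<integral>z. F' (cis t) z \<partial>\<nu>)) (at (cis t))" if t: "0 \<le> t" "t \<le> pi / 2" for t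
    unfolding G_def
  proof (rule has_field_derivative_lebesgue_integral[OF rad(1)])
    fix w z assume w: "w \<in> ball (cis t) rad"
    have "w \<noteq> 0" using near_arc(2)[OF w] .
    then show "((\<lambda>w. F w z) has_field_derivative F' w z) (at w)"
      unfolding F_def F'_def ph_def by (auto intro!: derivative_eq_intros simp: algebra_simps)
  next
    show "integrable \<nu> (\<lambda>z. 20 * (1 + \<Lambda>) / kap * exp (- (kap / 4) * nrm2 I z))"
      using gint[of "kap / 4"] kap by (intro integrable_mult_right) auto
    show "AE z in \<nu>. \<forall>w\<in>ball (cis t) rad. norm (F' w z) \<le> 20 * (1 + \<Lambda>) / kap * exp (- (kap / 4) * nrm2 I z)"
      using E by eventually_elim (use F'_bound[OF _ t] in blast)
  qed (use Fint t in \<open>auto\<close>)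
  have radial: "G (complex_of_real r * w) = G w" if r: "r > 0" and w: "w \<noteq> 0" for r w
  proof -
    define S where "S z = (sqrt r *\<^sub>R fst z, (1 / sqrt r) *\<^sub>R snd z)" for z :: "vec \<times> vec"
    have Sm[measurable]: "S \<in> measurable \<nu> borel" unfolding S_def[abs_def] by measurable
    have "distr \<nu> borel S = \<nu>"
    proof (rule measure_eqI)
      fix X assume "X \<in> sets (distr \<nu> borel S)"
      then have X[measurable]: "X \<in> sets borel" by simp
      have "sqrt r ^ card I * (1 / sqrt r) ^ card I = 1" using r by (simp add: power_mult_distrib[symmetric])
      then have "(\<integral>\<^sup>+z. indicator X z \<partial>\<nu>) = (\<integral>\<^sup>+z. indicator X (S z) \<partial>\<nu>)"
        using sc[of "sqrt r" "1 / sqrt r" "indicator X"] r by (simp add: S_def)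
      also have "\<dots> = (\<integral>\<^sup>+z. indicator X z \<partial>distr \<nu> borel S)"
        by (rule nn_integral_distr[OF Sm, symmetric]) measurable
      finally show "emeasure (distr \<nu> borel S) X = emeasure \<nu> X" using X sets by simp
    qed (simp add: sets)
    then have "G w = (\<integral>z. F w z \<partial>distr \<nu> borel S)" by (simp add: G_def)
    also have "\<dots> = (\<integral>z. F w (S z) \<partial>\<nu>)" by (rule integral_distr[OF Sm]) measurable
    also have "\<dots> = (\<integral>z. F (complex_of_real r * w) z \<partial>\<nu>)"
    proof (rule integral_cong_AE, measurable, use E in eventually_elim)
      fix z assume "z \<in> E2 I"
      then have z: "fst z \<in> coord_space I" "snd z \<in> coord_space I" by (auto simp: E2_def)
      have sr: "sqrt r > 0" "1 / sqrt r > 0" using r by auto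
      have Asc: "A (s *\<^sub>R a) = s\<^sup>2 * A a" if "a \<in> coord_space I" "s > 0" for a s
        using that by (simp add: A_def J_scale dot_simps power2_eq_square algebra_simps)
      have "p (sqrt r *\<^sub>R fst z) = complex_of_real r * p (fst z)"
        using r by (simp add: p_def Asc[OF z(1) sr(1)] q_scale[OF z(1) sr(1)] complex_eq_iff)
      moreover have "p' ((1 / sqrt r) *\<^sub>R snd z) = complex_of_real (1 / r) * p' (snd z)"
        using r by (simp add: p'_def Asc[OF z(2) sr(2)] q_scale[OF z(2) sr(2)] complex_eq_iff power_divide)
      moreover have "m (S z) = m z"
        using r by (simp add: m_def B_def S_def J_scale[OF z(1) sr(1)] J_scale[OF z(2) sr(2)] dot_simps)
      ultimately have "ph w (S z) = ph (complex_of_real r * w) z"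
        unfolding ph_def using r w by (simp add: S_def field_simps)
      then show "F w (S z) = F (complex_of_real r * w) z" by (simp add: F_def)
    qed
    finally show ?thesis by (simp add: G_def)
  qed
  have der0: "(G has_field_derivative 0) (at (cis t))" if t: "0 \<le> t" "t \<le> pi / 2" for t
  proof -
    let ?D = "\<integral>z. F' (cis t) z \<partial>\<nu>"
    \<comment> \<open>Constancy along the ray through cis t makes the radial derivative vanish. One
      direction determines a complex derivative, so it vanishes along the arc as well.\<close>
    have "((\<lambda>\<zeta>. G (\<zeta> * cis t)) has_field_derivative ?D * cis t) (at (complex_of_real 1))"
      by (rule DERIV_chain2[where f=G]) (use der[OF t] in \<open>auto intro!: derivative_eq_intros\<close>)
    then have "((\<lambda>r. G (complex_of_real r * cis t)) has_vector_derivative ?D * cis t) (at 1)"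
      by (rule has_vector_derivative_real_field)
    moreover have "((\<lambda>r. G (complex_of_real r * cis t)) has_vector_derivative 0) (at 1)"
    proof (rule has_vector_derivative_transform_within_open[of "\<lambda>_. G (cis t)" _ _ "{0<..}"])
      show "G (cis t) = G (complex_of_real r * cis t)" if "r \<in> {0<..}" for r
        using radial[of r "cis t"] that by simp
    qed auto
    ultimately have "?D * cis t = 0" by (rule vector_derivative_unique_at)
    then have "?D = 0" by simp
    then show ?thesis using der[OF t] by simp
  qed
  have "\<exists>c. \<forall>t\<in>{0..pi/2}. G (cis t) = c"
  proof (rule has_vector_derivative_zero_constant[of "{0..pi/2}" "\<lambda>s. G (cis s)"])
    fix t assume "t \<in> {0..pi/2}"
    then have d: "(G has_field_derivative 0) (at (exp (\<i> * complex_of_real t)))"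
      using der0[of t] by (simp add: cis_conv_exp)
    have "((\<lambda>\<zeta>. G (exp (\<i> * \<zeta>))) has_field_derivative 0 * (exp (\<i> * complex_of_real t) * \<i>)) (at (complex_of_real t))"
      by (rule DERIV_chain2[where f=G and g="\<lambda>\<zeta>. exp (\<i> * \<zeta>)", OF d]) (auto intro!: derivative_eq_intros)
    then have "((\<lambda>s. G (exp (\<i> * complex_of_real s))) has_vector_derivative 0) (at t within {0..pi/2})"
      by (intro has_vector_derivative_real_field) simp
    then show "((\<lambda>s. G (cis s)) has_vector_derivative 0) (at t within {0..pi/2})" by (simp add: cis_conv_exp)
  next
    fix c assume "\<And>s. s \<in> {0..pi/2} \<Longrightarrow> G (cis s) = c"
    then show ?thesis by (intro exI[of _ c] ballI)
  qed simp
  then have G1i: "G 1 = G \<i>"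
    by (metis atLeastAtMost_iff cis_pi_half cis_zero order.refl pi_half_ge_zero)
  have "G 1 = (\<integral>z. osc I eps (T z) \<partial>\<nu>)" unfolding G_def F_1 ..
  also have "\<dots> = (\<integral>z. osc I eps z \<partial>leb2 I)" unfolding dist[symmetric] by (rule integral_distr[OF Tm, symmetric]) measurable
  finally have low: "pi ^ card I \<le> norm (G \<i>)" using integral_osc[OF I eps(1,2)] G1i by simp
  let ?qq = "\<lambda>z. q (fst z) + q (snd z)"
  have "ennreal (pi ^ card I) \<le> ennreal (norm (G \<i>))" using low by (rule ennreal_leI)
  also have "\<dots> \<le> (\<integral>\<^sup>+z. ennreal (norm (F \<i> z)) \<partial>\<nu>)"
    unfolding G_def using Fint[of \<i> "pi / 2"] rad(1) by (intro integral_norm_bound_ennreal) (simp add: cis_pi_half)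
  also have "\<dots> \<le> (\<integral>\<^sup>+z. ennreal (exp (- (1 / 2) * ?qq z)) \<partial>\<nu>)"
  proof (rule nn_integral_mono_AE, use E in eventually_elim)
    fix z assume z: "z \<in> E2 I"
    have zE: "fst z \<in> coord_space I" "snd z \<in> coord_space I" using z by (auto simp: E2_def)
    have "Re (ph \<i> z) = - ?qq z - eps * B z" using Re_ph_arc[of "pi / 2" z] by (simp add: cis_pi_half)
    moreover have "- (eps * B z) \<le> \<delta> / 2 * nrm2 I z"
    proof -
      have "- (eps * B z) \<le> eps * \<bar>B z\<bar>" using mult_left_mono[OF abs_ge_minus_self[of "B z"] less_imp_le[OF eps(1)]] by simp
      also have "\<dots> \<le> eps * ((1 + \<Lambda>) / 2 * nrm2 I z)" using eps B_bound[OF z] by (intro mult_left_mono) auto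
      also have "\<dots> = eps * (1 + \<Lambda>) / 2 * nrm2 I z" by simp
      also have "\<dots> \<le> \<delta> / 2 * nrm2 I z" using eps by (intro mult_right_mono divide_right_mono) auto
      finally show ?thesis .
    qed
    moreover have "\<delta> * nrm2 I z \<le> ?qq z" using q_lower[OF zE(1)] q_lower[OF zE(2)] by (simp add: nrm2_def distrib_left)
    moreover have "\<delta> * nrm2 I z = \<delta> / 2 * nrm2 I z + \<delta> / 2 * nrm2 I z" by simp
    ultimately have "Re (ph \<i> z) \<le> - (1 / 2) * ?qq z" by argo
    then show "ennreal (norm (F \<i> z)) \<le> ennreal (exp (- (1 / 2) * ?qq z))"
      unfolding F_def norm_exp_eq_Re by (intro ennreal_leI) (simp only: exp_le_cancel_iff)
  qed
  \<comment> \<open>Dilating both components by sqrt 2 removes the factor 1/2 in the exponent at the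
    price of \<open>2 ^ card I\<close>.\<close>
  also have "\<dots> = ennreal (sqrt 2 ^ card I * sqrt 2 ^ card I) * (\<integral>\<^sup>+z. ennreal (exp (- (1 / 2) * ?qq (sqrt 2 *\<^sub>R fst z, sqrt 2 *\<^sub>R snd z))) \<partial>\<nu>)"
    by (rule sc) (simp, simp, measurable)
  also have "sqrt 2 ^ card I * sqrt 2 ^ card I = (2::real) ^ card I" by (simp flip: power_mult_distrib)
  also have "(\<integral>\<^sup>+z. ennreal (exp (- (1 / 2) * ?qq (sqrt 2 *\<^sub>R fst z, sqrt 2 *\<^sub>R snd z))) \<partial>\<nu>) = (\<integral>\<^sup>+z. ennreal (exp (- ?qq z)) \<partial>\<nu>)"
  proof (rule nn_integral_cong_AE, use E in eventually_elim)
    fix z assume "z \<in> E2 I"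
    then have "q (sqrt 2 *\<^sub>R fst z) = 2 * q (fst z)" "q (sqrt 2 *\<^sub>R snd z) = 2 * q (snd z)"
      using q_scale[of "fst z" "sqrt 2"] q_scale[of "snd z" "sqrt 2"] by (auto simp: E2_def)
    then show "ennreal (exp (- (1 / 2) * ?qq (sqrt 2 *\<^sub>R fst z, sqrt 2 *\<^sub>R snd z))) = ennreal (exp (- ?qq z))" by (simp add: add_divide_distrib)
  qed
  finally have up: "ennreal (pi ^ card I) \<le> ennreal (2 ^ card I) * (\<integral>\<^sup>+z. ennreal (exp (- ?qq z)) \<partial>\<nu>)" .
  define gam where "gam = (\<integral>\<^sup>+y. ennreal (sqrt y ^ card I * exp (- y)) * indicator {0<..} y \<partial>lborel)\<^sup>2"
  define V where "V = emeasure \<nu> {z. q (fst z) \<le> 1 \<and> q (snd z) \<le> 1}"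
  define U where "U = (emeasure (leb I) (uball I))\<^sup>2"
  have lc1: "(\<integral>\<^sup>+z. ennreal (exp (- ?qq z)) \<partial>\<nu>) = V * gam"
    unfolding V_def gam_def
    by (rule bihomogeneous_layer_cake[OF sf sets E sc measurable_q q_nonneg q_scale])
  \<comment> \<open>The same formula for the Euclidean form and Lebesgue measure calibrates the
    constant: both integrals carry \<open>gam\<close>, and \<open>U * gam\<close> is pi^n, so
    neither \<open>gam\<close> nor the volume of the ball has to be evaluated.\<close>
  have lc2: "(\<integral>\<^sup>+z. ennreal (exp (- (dot I (fst z) (fst z) + dot I (snd z) (snd z)))) \<partial>leb2 I) =
      emeasure (leb2 I) {z. dot I (fst z) (fst z) \<le> 1 \<and> dot I (snd z) (snd z) \<le> 1} * gam"
    unfolding gam_def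
  proof (rule bihomogeneous_layer_cake[OF sigma_finite_leb2[OF I] sets_leb2 _ nn_integral_leb2_scale[OF I]])
    show "AE z in leb2 I. z \<in> E2 I" using AE_leb2_coord_space[OF I] by (simp add: E2_def)
  qed (simp_all add: dot_simps power2_eq_square)
  have UU: "emeasure (leb2 I) {z. dot I (fst z) (fst z) \<le> 1 \<and> dot I (snd z) (snd z) \<le> 1} = U"
  proof -
    interpret sigma_finite_measure "leb I" by (rule sigma_finite_leb[OF I])
    have "{z. dot I (fst z) (fst z) \<le> 1 \<and> dot I (snd z) (snd z) \<le> 1} = uball I \<times> uball I" by (auto simp: uball_def)
    moreover have "emeasure (leb I \<Otimes>\<^sub>M leb I) (uball I \<times> uball I) = emeasure (leb I) (uball I) * emeasure (leb I) (uball I)"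
      by (rule emeasure_pair_measure_Times) auto
    ultimately show ?thesis by (simp add: leb2_def U_def power2_eq_square)
  qed
  have Ug: "U * gam = ennreal (pi ^ card I)"
    using lc2 nn_integral_gauss_leb2[OF I, of 1] by (simp add: UU nrm2_def)
  have "gam \<noteq> 0" using Ug by auto
  moreover have "gam \<noteq> \<infinity>" using Ug by (cases "U = 0") (auto simp: ennreal_mult_top)
  moreover have "U * gam \<le> (2 ^ card I * V) * gam"
    using up unfolding Ug lc1 by (simp add: ennreal_power[symmetric] mult.assoc)
  ultimately have "U \<le> 2 ^ card I * V"
    by (metis ennreal_mult_le_mult_iff infinity_ennreal_def mult.commute)
  also have "V \<le> emeasure (leb2 I) Q"
  proof -
    have "V \<le> emeasure \<nu> (T -` Q \<inter> space \<nu>)"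
      unfolding V_def
    proof (rule emeasure_mono_AE)
      show "AE z in \<nu>. z \<in> {z. q (fst z) \<le> 1 \<and> q (snd z) \<le> 1} \<longrightarrow> z \<in> T -` Q \<inter> space \<nu>"
        using E by eventually_elim (use sub in auto)
    qed (rule measurable_sets[OF Tm Q])
    also have "\<dots> = emeasure (distr \<nu> borel T) Q" by (rule emeasure_distr[OF Tm Q, symmetric])
    finally show ?thesis by (simp add: dist)
  qed
  finally show ?thesis unfolding U_def by (simp add: mult_left_mono)
qed

end

section \<open>The field of a polytope\<close>

text \<open>\<open>soft_sol m z c \<tau>\<close> says that \<open>c\<close> maximises \<open>\<Sum>c\<^sub>jz\<^sub>j - (\<Sum>\<bar>c\<^sub>j\<bar>)\<^sup>2/2 - (\<Sum>c\<^sub>j\<^sup>2)/2\<close>, with \<open>\<tau> = \<Sum>\<bar>c\<^sub>j\<bar>\<close>.\<close>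
definition soft_sol :: "nat \<Rightarrow> (nat \<Rightarrow> real) \<Rightarrow> (nat \<Rightarrow> real) \<Rightarrow> real \<Rightarrow> bool" where
  "soft_sol m z c \<tau> \<longleftrightarrow> \<tau> = (\<Sum>j<m. \<bar>c j\<bar>) \<and> (\<forall>j<m. \<bar>z j - c j\<bar> \<le> \<tau> \<and> (z j - c j) * c j = \<tau> * \<bar>c j\<bar>)"

lemma soft_sol_nonneg: "soft_sol m z c \<tau> \<Longrightarrow> 0 \<le> \<tau>"
  by (simp add: soft_sol_def sum_nonneg)

text \<open>Soft thresholding of z at a level t satisfies all conditions except that the sum of the
  |c_j| equal t. The sum minus the level is nonnegative at 0 and nonpositive at the sum of the
  |z_j|, so the intermediate value theorem finds a level where they agree.\<close>

lemma soft_sol_exists: "\<exists>c \<tau>. soft_sol m z c \<tau>"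
proof -
  define g where "g t = (\<Sum>j<m. max (\<bar>z j\<bar> - t) 0) - t" for t
  define b where "b = (\<Sum>j<m. \<bar>z j\<bar>)"
  have b0: "0 \<le> b" by (simp add: b_def sum_nonneg)
  have gb: "g b \<le> 0"
  proof -
    have "max (\<bar>z j\<bar> - b) 0 = 0" if "j < m" for j
      using member_le_sum[of j "{..<m}" "\<lambda>j. \<bar>z j\<bar>"] that by (simp add: b_def)
    then show ?thesis using b0 by (simp add: g_def)
  qed
  have g0: "0 \<le> g 0" by (simp add: g_def sum_nonneg)
  have "continuous_on {0..b} g" unfolding g_def by (intro continuous_intros)
  then obtain t where t: "0 \<le> t" "t \<le> b" "g t = 0"
    using IVT2'[of g b 0 0] gb g0 b0 by blast
  define c where "c j = sgn (z j) * max (\<bar>z j\<bar> - t) 0" for j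
  have ac: "\<bar>c j\<bar> = max (\<bar>z j\<bar> - t) 0" for j
    using t(1) by (cases "z j = 0") (auto simp: c_def abs_mult)
  have "\<bar>z j - c j\<bar> \<le> t \<and> (z j - c j) * c j = t * \<bar>c j\<bar>" for j
  proof -
    consider "\<bar>z j\<bar> \<le> t" | "t < z j" | "z j < - t" by linarith
    then show ?thesis
    proof cases
      case 1
      then have "c j = 0" by (simp add: c_def)
      then show ?thesis using 1 by simp
    next
      case 2
      then have "c j = z j - t" using t by (simp add: c_def)
      then show ?thesis using 2 t by simp
    next
      case 3
      then have "c j = z j + t" using t by (simp add: c_def)
      then show ?thesis using 3 t by (simp add: algebra_simps)
    qed
  qed
  moreover have "t = (\<Sum>j<m. \<bar>c j\<bar>)" using t(3) by (simp add: ac g_def)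
  ultimately have "soft_sol m z c t" unfolding soft_sol_def by blast
  then show ?thesis by blast
qed

text \<open>The residual z - c is \<tau> times a subgradient of the l1 norm at c, that is, a
  subgradient of half its square. Subgradients are monotone: pairing the differences of c and of the
  residual gives at least (\<tau> - \<tau>')^2.\<close>

lemma soft_sol_mono:
  assumes s: "soft_sol m z c \<tau>" and s': "soft_sol m z' c' \<tau>'"
  shows "(\<Sum>j<m. (c j - c' j)\<^sup>2) \<le> (\<Sum>j<m. (c j - c' j) * (z j - z' j))"
proof -
  define r r' where "r j = z j - c j" and "r' j = z' j - c' j" for j
  have t: "\<tau> = (\<Sum>j<m. \<bar>c j\<bar>)" "\<tau>' = (\<Sum>j<m. \<bar>c' j\<bar>)" using s s' by (auto simp: soft_sol_def)
  have r: "\<bar>r j\<bar> \<le> \<tau>" "r j * c j = \<tau> * \<bar>c j\<bar>" "\<bar>r' j\<bar> \<le> \<tau>'" "r' j * c' j = \<tau>' * \<bar>c' j\<bar>" if "j < m" for j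
    using s s' that by (auto simp: soft_sol_def r_def r'_def)
  have "(\<Sum>j<m. c j * r j) = \<tau> * \<tau>"
    unfolding t(1) sum_distrib_left using r(2) t(1) by (intro sum.cong) (auto simp: mult.commute)
  moreover have "(\<Sum>j<m. c' j * r' j) = \<tau>' * \<tau>'"
    unfolding t(2) sum_distrib_left using r(4) t(2) by (intro sum.cong) (auto simp: mult.commute)
  moreover have "(\<Sum>j<m. c j * r' j) \<le> \<tau> * \<tau>'"
  proof -
    have "(\<Sum>j<m. c j * r' j) \<le> (\<Sum>j<m. \<bar>c j\<bar> * \<tau>')"
    proof (rule sum_mono)
      fix j assume "j \<in> {..<m}"
      then have "\<bar>c j\<bar> * \<bar>r' j\<bar> \<le> \<bar>c j\<bar> * \<tau>'" using r(3)[of j] by (intro mult_left_mono) auto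
      then show "c j * r' j \<le> \<bar>c j\<bar> * \<tau>'" using abs_ge_self[of "c j * r' j"] by (simp add: abs_mult)
    qed
    then show ?thesis by (simp add: t(1) sum_distrib_right)
  qed
  moreover have "(\<Sum>j<m. c' j * r j) \<le> \<tau>' * \<tau>"
  proof -
    have "(\<Sum>j<m. c' j * r j) \<le> (\<Sum>j<m. \<bar>c' j\<bar> * \<tau>)"
    proof (rule sum_mono)
      fix j assume "j \<in> {..<m}"
      then have "\<bar>c' j\<bar> * \<bar>r j\<bar> \<le> \<bar>c' j\<bar> * \<tau>" using r(1)[of j] by (intro mult_left_mono) auto
      then show "c' j * r j \<le> \<bar>c' j\<bar> * \<tau>" using abs_ge_self[of "c' j * r j"] by (simp add: abs_mult)
    qed
    then show ?thesis by (simp add: t(2) sum_distrib_right)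
  qed
  moreover have "(\<Sum>j<m. (c j - c' j) * (z j - z' j)) = (\<Sum>j<m. (c j - c' j)\<^sup>2) +
      ((\<Sum>j<m. c j * r j) - (\<Sum>j<m. c j * r' j) - (\<Sum>j<m. c' j * r j) + (\<Sum>j<m. c' j * r' j))"
    unfolding sum_subtractf[symmetric] sum.distrib[symmetric]
    by (intro sum.cong) (simp_all add: r_def r'_def power2_eq_square algebra_simps)
  moreover have "0 \<le> (\<tau> - \<tau>') * (\<tau> - \<tau>')" by simp
  then have "0 \<le> \<tau> * \<tau> - \<tau> * \<tau>' - \<tau>' * \<tau> + \<tau>' * \<tau>'" by (simp add: algebra_simps)
  ultimately show ?thesis by linarith
qed

lemma soft_sol_unique:
  assumes "soft_sol m z c \<tau>" "soft_sol m z c' \<tau>'" "j < m"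
  shows "c j = c' j"
proof -
  have "(\<Sum>j<m. (c j - c' j)\<^sup>2) \<le> 0" using soft_sol_mono[OF assms(1,2)] by simp
  then have "(\<Sum>j<m. (c j - c' j)\<^sup>2) = 0" by (simp add: sum_nonneg order_antisym)
  then have "(c j - c' j)\<^sup>2 = 0" using assms(3) by (subst (asm) sum_nonneg_eq_0_iff) auto
  then show ?thesis by simp
qed

text \<open>Evaluates the quadratic form of the field, so that a bound on it controls \<tau> and all
  coefficients.\<close>

lemma soft_sol_product:
  assumes "soft_sol m z c \<tau>"
  shows "(\<Sum>j<m. c j * z j) = \<tau>\<^sup>2 + (\<Sum>j<m. (c j)\<^sup>2)"
proof -
  have t: "\<tau> = (\<Sum>j<m. \<bar>c j\<bar>)" and r: "\<And>j. j < m \<Longrightarrow> (z j - c j) * c j = \<tau> * \<bar>c j\<bar>" using assms by (auto simp: soft_sol_def)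
  have "(\<Sum>j<m. c j * z j) = (\<Sum>j<m. \<tau> * \<bar>c j\<bar> + (c j)\<^sup>2)"
  proof (rule sum.cong[OF refl])
    fix j assume "j \<in> {..<m}"
    then show "c j * z j = \<tau> * \<bar>c j\<bar> + (c j)\<^sup>2" using r[of j] by (simp add: power2_eq_square algebra_simps)
  qed
  also have "\<dots> = \<tau> * \<tau> + (\<Sum>j<m. (c j)\<^sup>2)" by (simp add: sum.distrib sum_distrib_left[symmetric] t[symmetric])
  finally show ?thesis by (simp add: power2_eq_square)
qed

text \<open>The polytope is the set where all |<u_j, x>| are at most 1. The field is the gradient of
  \<delta>|x|^2/2 plus the conjugate of the penalty in \<open>soft_sol\<close> taken at the numbers
  <u_j, x>, a smoothing of half the squared polytope norm. The l2 part of the penalty makes the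
  coefficients unique and Lipschitz, the \<delta> term makes the field strongly monotone.\<close>

locale polytope_field =
  fixes I :: "nat set" and m :: nat and u :: "nat \<Rightarrow> vec" and \<delta> :: real
  assumes I: "finite I" and \<delta>: "\<delta> > 0" and uE: "\<And>j. j < m \<Longrightarrow> u j \<in> coord_space I"
begin

definition comb :: "(nat \<Rightarrow> real) \<Rightarrow> vec" where
  "comb c = (\<lambda>i. \<Sum>j<m. c j * u j i)"

definition zz :: "vec \<Rightarrow> nat \<Rightarrow> real" where
  "zz x j = dot I (u j) x"

definition Pat :: "(nat \<Rightarrow> real) set" where
  "Pat = PiE {..<m} (\<lambda>_. {-1, 0, 1})"

text \<open>\<open>\<sigma>\<close> is the sign pattern of \<open>c\<close>; solving the equations of \<open>soft_sol\<close> for a given pattern yields the linear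
  formulas for \<open>\<tau>\<close> and \<open>c\<close>.\<close>
definition tau :: "(nat \<Rightarrow> real) \<Rightarrow> vec \<Rightarrow> real" where
  "tau \<sigma> x = (\<Sum>j<m. \<sigma> j * zz x j) / (1 + (\<Sum>j<m. (\<sigma> j)\<^sup>2))"

definition cc :: "(nat \<Rightarrow> real) \<Rightarrow> vec \<Rightarrow> nat \<Rightarrow> real" where
  "cc \<sigma> x j = (\<sigma> j)\<^sup>2 * zz x j - \<sigma> j * tau \<sigma> x"

text \<open>Strict inequalities on the support of \<sigma> and weak ones off it make the cones
  disjoint while they still cover the space.\<close>

definition R :: "(nat \<Rightarrow> real) \<Rightarrow> vec set" where
  "R \<sigma> = {x. \<forall>j\<in>{..<m}. (\<sigma> j \<noteq> 0 \<longrightarrow> 0 < \<sigma> j * cc \<sigma> x j) \<and> (\<sigma> j = 0 \<longrightarrow> \<bar>zz x j\<bar> \<le> tau \<sigma> x)}"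

definition Jl :: "(nat \<Rightarrow> real) \<Rightarrow> vec \<Rightarrow> vec" where
  "Jl \<sigma> x = \<delta> *\<^sub>R x + comb (cc \<sigma> x)"

text \<open>Exactly one indicator is nonzero at each point, and measurability can be read off the
  sum.\<close>

definition J :: "vec \<Rightarrow> vec" where
  "J x = (\<lambda>i. \<Sum>\<sigma>\<in>Pat. indicator (R \<sigma>) x * Jl \<sigma> x i)"

definition S :: real where
  "S = (\<Sum>j<m. dot I (u j) (u j))"

text \<open>A squared Lipschitz constant, from |v + w|^2 \<le> 2|v|^2 + 2|w|^2 for the two parts of
  the field; one factor \<open>S\<close> comes from \<open>sum_zz_le\<close>, the other from
  \<open>comb_bound\<close>.\<close>

definition Lam :: real where
  "Lam = 2 * \<delta>\<^sup>2 + 2 * (S * S)"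

lemma Pat_cases: "\<sigma> \<in> Pat \<Longrightarrow> j < m \<Longrightarrow> \<sigma> j = -1 \<or> \<sigma> j = 0 \<or> \<sigma> j = 1"
  by (auto simp: Pat_def PiE_def Pi_def)

lemma finite_Pat: "finite Pat" by (simp add: Pat_def finite_PiE)

lemma S_nonneg: "0 \<le> S" by (simp add: S_def sum_nonneg)

lemma zz_lin: "zz (x + y) j = zz x j + zz y j" "zz (t *\<^sub>R x) j = t * zz x j" "zz (x - y) j = zz x j - zz y j"
  by (simp_all only: zz_def dot_simps)

lemma tau_lin: "tau \<sigma> (x + y) = tau \<sigma> x + tau \<sigma> y" "tau \<sigma> (t *\<^sub>R x) = t * tau \<sigma> x"
  by (simp_all add: tau_def zz_lin algebra_simps sum.distrib sum_distrib_left add_divide_distrib)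

lemma cc_lin: "cc \<sigma> (x + y) j = cc \<sigma> x j + cc \<sigma> y j" "cc \<sigma> (t *\<^sub>R x) j = t * cc \<sigma> x j"
  by (simp_all add: cc_def zz_lin tau_lin algebra_simps)

lemma comb_in: "comb c \<in> coord_space I"
  using uE by (auto simp: comb_def coord_space_def intro!: sum.neutral)

lemma comb_add: "comb (\<lambda>j. c j + d j) = comb c + comb d"
  by (auto simp: comb_def fun_eq_iff sum.distrib algebra_simps)

lemma comb_diff: "comb c - comb d = comb (\<lambda>j. c j - d j)"
  by (auto simp: comb_def fun_eq_iff sum_subtractf algebra_simps)

lemma comb_scale: "comb (\<lambda>j. t * c j) = t *\<^sub>R comb c"
  by (auto simp: comb_def fun_eq_iff scaleR_fun_apply sum_distrib_left mult.assoc)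

lemma dot_comb: "dot I (comb c) x = (\<Sum>j<m. c j * zz x j)"
proof -
  have "dot I (comb c) x = (\<Sum>i\<in>I. \<Sum>j<m. c j * (u j i * x i))"
    by (simp add: dot_def comb_def sum_distrib_right mult.assoc)
  also have "\<dots> = (\<Sum>j<m. \<Sum>i\<in>I. c j * (u j i * x i))" by (rule sum.swap)
  finally show ?thesis by (simp add: zz_def dot_def sum_distrib_left)
qed

lemma sum_zz_le: "(\<Sum>j<m. (zz x j)\<^sup>2) \<le> S * dot I x x"
  unfolding S_def sum_distrib_right zz_def by (intro sum_mono dot_Cauchy_Schwarz)

text \<open>For v = \<open>comb c\<close>, Cauchy-Schwarz is applied to |v|^2 = <comb c, v>, and a
  factor |v|^2 is divided out.\<close>

lemma comb_bound: "dot I (comb c) (comb c) \<le> S * (\<Sum>j<m. (c j)\<^sup>2)"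
proof -
  define v where "v = comb c"
  define s where "s = (\<Sum>j<m. (c j)\<^sup>2)"
  have s0: "0 \<le> s" by (simp add: s_def sum_nonneg)
  have "(dot I v v)\<^sup>2 = (\<Sum>j<m. c j * zz v j)\<^sup>2" unfolding v_def by (subst dot_comb) (rule refl)
  also have "\<dots> \<le> s * (\<Sum>j<m. (zz v j)\<^sup>2)" unfolding s_def by (rule Cauchy_Schwarz_ineq_sum)
  also have "\<dots> \<le> s * (S * dot I v v)" using sum_zz_le[of v] s0 by (rule mult_left_mono)
  finally have "dot I v v * dot I v v \<le> (S * s) * dot I v v" by (simp add: power2_eq_square ac_simps)
  then have "dot I v v \<le> S * s" if "dot I v v \<noteq> 0"
    using that dot_nonneg[of I v] by (simp add: mult_le_cancel_right)
  moreover have "0 \<le> S * s" using S_nonneg s0 by simp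
  ultimately show ?thesis unfolding v_def s_def by argo
qed

lemma field_bound:
  assumes "(\<Sum>j<m. (c j)\<^sup>2) \<le> (\<Sum>j<m. (zz d j)\<^sup>2)"
  shows "dot I (\<delta> *\<^sub>R d + comb c) (\<delta> *\<^sub>R d + comb c) \<le> Lam * dot I d d"
proof -
  define v where "v = comb c"
  have "dot I v v \<le> S * (\<Sum>j<m. (c j)\<^sup>2)" unfolding v_def by (rule comb_bound)
  also have "\<dots> \<le> S * (S * dot I d d)" using assms sum_zz_le[of d] S_nonneg by (intro mult_left_mono) auto
  finally have v: "dot I v v \<le> S * (S * dot I d d)" .
  define e where "e = \<delta> *\<^sub>R d"
  have e: "dot I e e = \<delta>\<^sup>2 * dot I d d" unfolding e_def by (simp only: dot_simps power2_eq_square mult.assoc)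
  have "dot I (e + v) (e + v) = dot I e e + 2 * dot I e v + dot I v v"
    by (simp add: dot_simps(1,2) dot_commute[of I v e])
  moreover have "2 * dot I e v \<le> dot I e e + dot I v v" using dot_AM_GM[of I e v] by argo
  ultimately have "dot I (e + v) (e + v) \<le> 2 * dot I e e + 2 * dot I v v" by argo
  also have "\<dots> \<le> 2 * (\<delta>\<^sup>2 * dot I d d) + 2 * (S * (S * dot I d d))" using v e by argo
  also have "\<dots> = Lam * dot I d d" by (simp add: Lam_def algebra_simps)
  finally show ?thesis unfolding e_def v_def .
qed

lemma field_pos: "dot I (\<delta> *\<^sub>R d + comb c) d = \<delta> * dot I d d + (\<Sum>j<m. c j * zz d j)"
  by (simp only: dot_simps dot_comb)

text \<open>Everything follows from \<sigma>_j^3 = \<sigma>_j, true for the entries -1, 0, 1, and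
  from the definition of \<open>tau\<close>.\<close>

lemma pattern_identities:
  assumes \<sigma>: "\<sigma> \<in> Pat"
  defines "s \<equiv> (\<Sum>j<m. (\<sigma> j)\<^sup>2)"
  shows "0 \<le> s" "(\<Sum>j<m. \<sigma> j * zz x j) = tau \<sigma> x * (1 + s)" "(\<Sum>j<m. \<sigma> j * cc \<sigma> x j) = tau \<sigma> x"
    "(\<Sum>j<m. cc \<sigma> x j * zz x j) = (\<Sum>j<m. (\<sigma> j)\<^sup>2 * (zz x j)\<^sup>2) - (tau \<sigma> x)\<^sup>2 * (1 + s)"
    "(\<Sum>j<m. (cc \<sigma> x j)\<^sup>2) = (\<Sum>j<m. (\<sigma> j)\<^sup>2 * (zz x j)\<^sup>2) - (tau \<sigma> x)\<^sup>2 * (2 + s)"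
proof -
  define t where "t = tau \<sigma> x"
  have pw: "\<sigma> j * \<sigma> j * \<sigma> j = \<sigma> j" if "j < m" for j using Pat_cases[OF \<sigma> that] by auto
  show s: "0 \<le> s" by (simp add: s_def sum_nonneg)
  show st: "(\<Sum>j<m. \<sigma> j * zz x j) = tau \<sigma> x * (1 + s)" using s by (simp add: tau_def s_def)
  have "(\<Sum>j<m. \<sigma> j * cc \<sigma> x j) = (\<Sum>j<m. \<sigma> j * zz x j - t * (\<sigma> j)\<^sup>2)"
  proof (rule sum.cong[OF refl])
    fix j assume "j \<in> {..<m}"
    then have "\<sigma> j * cc \<sigma> x j = (\<sigma> j * \<sigma> j * \<sigma> j) * zz x j - t * (\<sigma> j)\<^sup>2"
      by (simp add: cc_def t_def power2_eq_square algebra_simps)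
    then show "\<sigma> j * cc \<sigma> x j = \<sigma> j * zz x j - t * (\<sigma> j)\<^sup>2" using pw \<open>j \<in> {..<m}\<close> by simp
  qed
  also have "\<dots> = t * (1 + s) - t * s" unfolding sum_subtractf sum_distrib_left[symmetric] st s_def t_def ..
  finally show "(\<Sum>j<m. \<sigma> j * cc \<sigma> x j) = tau \<sigma> x" by (simp add: t_def algebra_simps)
  have "(\<Sum>j<m. cc \<sigma> x j * zz x j) = (\<Sum>j<m. (\<sigma> j)\<^sup>2 * (zz x j)\<^sup>2 - t * (\<sigma> j * zz x j))"
    by (intro sum.cong) (simp_all add: cc_def t_def power2_eq_square algebra_simps)
  also have "\<dots> = (\<Sum>j<m. (\<sigma> j)\<^sup>2 * (zz x j)\<^sup>2) - t * (t * (1 + s))"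
    unfolding sum_subtractf sum_distrib_left[symmetric] st t_def ..
  finally show "(\<Sum>j<m. cc \<sigma> x j * zz x j) = (\<Sum>j<m. (\<sigma> j)\<^sup>2 * (zz x j)\<^sup>2) - (tau \<sigma> x)\<^sup>2 * (1 + s)"
    by (simp add: t_def power2_eq_square mult.assoc)
  have "(\<Sum>j<m. (cc \<sigma> x j)\<^sup>2) = (\<Sum>j<m. (\<sigma> j)\<^sup>2 * (zz x j)\<^sup>2 - 2 * t * (\<sigma> j * zz x j) + t\<^sup>2 * (\<sigma> j)\<^sup>2)"
  proof (rule sum.cong[OF refl])
    fix j assume "j \<in> {..<m}"
    have "(cc \<sigma> x j)\<^sup>2 = \<sigma> j * (\<sigma> j * \<sigma> j * \<sigma> j) * (zz x j)\<^sup>2 - 2 * t * ((\<sigma> j * \<sigma> j * \<sigma> j) * zz x j) + t\<^sup>2 * (\<sigma> j)\<^sup>2"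
      by (simp add: cc_def t_def power2_eq_square algebra_simps)
    moreover have "\<sigma> j * \<sigma> j * \<sigma> j = \<sigma> j" using pw \<open>j \<in> {..<m}\<close> by simp
    ultimately show "(cc \<sigma> x j)\<^sup>2 = (\<sigma> j)\<^sup>2 * (zz x j)\<^sup>2 - 2 * t * (\<sigma> j * zz x j) + t\<^sup>2 * (\<sigma> j)\<^sup>2"
      by (simp only: power2_eq_square)
  qed
  also have "\<dots> = (\<Sum>j<m. (\<sigma> j)\<^sup>2 * (zz x j)\<^sup>2) - 2 * t * (t * (1 + s)) + t\<^sup>2 * s"
    unfolding sum.distrib sum_subtractf sum_distrib_left[symmetric] st s_def t_def ..
  finally show "(\<Sum>j<m. (cc \<sigma> x j)\<^sup>2) = (\<Sum>j<m. (\<sigma> j)\<^sup>2 * (zz x j)\<^sup>2) - (tau \<sigma> x)\<^sup>2 * (2 + s)"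
    by (simp add: t_def power2_eq_square algebra_simps)
qed

lemma soft_sol_R:
  assumes \<sigma>: "\<sigma> \<in> Pat" and x: "x \<in> R \<sigma>"
  shows "soft_sol m (zz x) (cc \<sigma> x) (tau \<sigma> x)"
proof -
  have RD: "(\<sigma> j \<noteq> 0 \<longrightarrow> 0 < \<sigma> j * cc \<sigma> x j) \<and> (\<sigma> j = 0 \<longrightarrow> \<bar>zz x j\<bar> \<le> tau \<sigma> x)" if "j < m" for j
    using x that by (simp add: R_def)
  have ab: "\<bar>cc \<sigma> x j\<bar> = \<sigma> j * cc \<sigma> x j" if j: "j < m" for j
    using Pat_cases[OF \<sigma> j] RD[OF j] by (auto simp: cc_def)
  have t: "tau \<sigma> x = (\<Sum>j<m. \<bar>cc \<sigma> x j\<bar>)" using pattern_identities(3)[OF \<sigma>, of x] ab by simp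
  then have t0: "0 \<le> tau \<sigma> x" by (simp add: sum_nonneg)
  have "\<bar>zz x j - cc \<sigma> x j\<bar> \<le> tau \<sigma> x \<and> (zz x j - cc \<sigma> x j) * cc \<sigma> x j = tau \<sigma> x * \<bar>cc \<sigma> x j\<bar>" if j: "j < m" for j
    using Pat_cases[OF \<sigma> j]
  proof (elim disjE)
    assume "\<sigma> j = 0"
    then show ?thesis using RD[OF j] by (simp add: cc_def)
  next
    assume s: "\<sigma> j = 1"
    then have "zz x j - cc \<sigma> x j = tau \<sigma> x" by (simp add: cc_def)
    then show ?thesis using ab[OF j] t0 s by simp
  next
    assume s: "\<sigma> j = -1"
    then have "zz x j - cc \<sigma> x j = - tau \<sigma> x" by (simp add: cc_def)
    then show ?thesis using ab[OF j] t0 s by simp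
  qed
  then show ?thesis using t by (simp add: soft_sol_def)
qed

text \<open>The sign pattern of a solution c, put into the linear formulas, returns c and \<tau>
  themselves.\<close>

lemma R_ex: "\<exists>\<sigma>\<in>Pat. x \<in> R \<sigma>"
proof -
  obtain c \<tau> where s: "soft_sol m (zz x) c \<tau>" using soft_sol_exists by blast
  have t0: "0 \<le> \<tau>" by (rule soft_sol_nonneg[OF s])
  have t: "\<tau> = (\<Sum>j<m. \<bar>c j\<bar>)" using s by (simp add: soft_sol_def)
  have r: "\<bar>zz x j - c j\<bar> \<le> \<tau>" "(zz x j - c j) * c j = \<tau> * \<bar>c j\<bar>" if "j < m" for j
    using s that by (auto simp: soft_sol_def)
  define \<sigma> where "\<sigma> = restrict (\<lambda>j. sgn (c j)) {..<m}"
  have \<sigma>j: "\<sigma> j = sgn (c j)" if "j < m" for j using that by (simp add: \<sigma>_def)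
  have \<sigma>: "\<sigma> \<in> Pat" unfolding Pat_def by (intro PiE_I) (auto simp: \<sigma>_def sgn_if)
  have act: "zz x j - c j = \<sigma> j * \<tau>" if "j < m" "c j \<noteq> 0" for j
  proof -
    have "(zz x j - c j) * c j = (\<sigma> j * \<tau>) * c j"
      using r(2)[OF that(1)] that by (simp add: \<sigma>j abs_sgn mult.commute)
    then show ?thesis using that(2) by simp
  qed
  have "(\<Sum>j<m. \<sigma> j * zz x j) = (\<Sum>j<m. \<bar>c j\<bar> + (\<sigma> j)\<^sup>2 * \<tau>)"
  proof (rule sum.cong[OF refl])
    fix j assume "j \<in> {..<m}"
    then have j: "j < m" by simp
    show "\<sigma> j * zz x j = \<bar>c j\<bar> + (\<sigma> j)\<^sup>2 * \<tau>"
    proof (cases "c j = 0")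
      case False
      have "zz x j = c j + \<sigma> j * \<tau>" using act[OF j False] by simp
      then show ?thesis by (simp add: \<sigma>j[OF j] power2_eq_square distrib_left abs_sgn mult.commute)
    qed (simp add: \<sigma>j[OF j])
  qed
  also have "\<dots> = \<tau> * (1 + (\<Sum>j<m. (\<sigma> j)\<^sup>2))"
    unfolding sum.distrib sum_distrib_right[symmetric] t[symmetric] by (simp add: algebra_simps)
  finally have "(\<Sum>j<m. \<sigma> j * zz x j) = \<tau> * (1 + (\<Sum>j<m. (\<sigma> j)\<^sup>2))" .
  moreover have "0 < 1 + (\<Sum>j<m. (\<sigma> j)\<^sup>2)" by (simp add: sum_nonneg add_pos_nonneg)
  ultimately have tt: "tau \<sigma> x = \<tau>" by (simp add: tau_def)
  have ccj: "cc \<sigma> x j = c j" if "j < m" for j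
  proof (cases "c j = 0")
    case True
    then show ?thesis using that by (simp add: cc_def \<sigma>j)
  next
    case False
    have "(\<sigma> j)\<^sup>2 = 1" using False by (simp add: \<sigma>j[OF that] sgn_if)
    then show ?thesis using act[OF that False] by (simp add: cc_def tt)
  qed
  have "x \<in> R \<sigma>"
    unfolding R_def
  proof (intro CollectI ballI conjI impI)
    fix j assume "j \<in> {..<m}" "\<sigma> j \<noteq> 0"
    then show "0 < \<sigma> j * cc \<sigma> x j" by (auto simp: \<sigma>j ccj sgn_if split: if_splits)
  next
    fix j assume "j \<in> {..<m}" "\<sigma> j = 0"
    then show "\<bar>zz x j\<bar> \<le> tau \<sigma> x" using r(1)[of j] by (auto simp: \<sigma>j tt sgn_if split: if_splits)
  qed
  then show ?thesis using \<sigma> by blast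
qed

lemma R_disj:
  assumes "\<sigma> \<in> Pat" "\<rho> \<in> Pat" "x \<in> R \<sigma>" "x \<in> R \<rho>"
  shows "\<sigma> = \<rho>"
proof (rule PiE_ext[OF assms(1,2)[unfolded Pat_def]])
  fix j assume "j \<in> {..<m}"
  then have j: "j < m" by simp
  have "cc \<sigma> x j = cc \<rho> x j"
    by (rule soft_sol_unique[OF soft_sol_R[OF assms(1,3)] soft_sol_R[OF assms(2,4)] j])
  moreover have "\<sigma>' j = sgn (cc \<sigma>' x j)" if "\<sigma>' \<in> Pat" "x \<in> R \<sigma>'" for \<sigma>'
  proof -
    have "\<sigma>' j \<noteq> 0 \<longrightarrow> 0 < \<sigma>' j * cc \<sigma>' x j" using that(2) j unfolding R_def by blast
    moreover have "\<sigma>' j = 0 \<longrightarrow> cc \<sigma>' x j = 0" by (simp add: cc_def)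
    ultimately show ?thesis using Pat_cases[OF that(1) j] by (auto simp: sgn_if)
  qed
  ultimately show "\<sigma> j = \<rho> j" using assms by metis
qed

lemma J_eq:
  assumes "\<sigma> \<in> Pat" "x \<in> R \<sigma>" shows "J x = Jl \<sigma> x"
proof
  fix i
  have "J x i = (\<Sum>\<rho>\<in>Pat. if \<rho> = \<sigma> then Jl \<sigma> x i else 0)"
    unfolding J_def
  proof (rule sum.cong[OF refl])
    fix \<rho> assume "\<rho> \<in> Pat"
    then have "x \<in> R \<rho> \<longleftrightarrow> \<rho> = \<sigma>" using R_disj[OF _ assms(1) _ assms(2)] assms(2) by blast
    then show "indicator (R \<rho>) x * Jl \<rho> x i = (if \<rho> = \<sigma> then Jl \<sigma> x i else 0)"
      by (simp add: indicator_def)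
  qed
  also have "\<dots> = Jl \<sigma> x i" using assms(1) finite_Pat by simp
  finally show "J x i = Jl \<sigma> x i" .
qed

lemma J_form: "\<exists>c \<tau>. soft_sol m (zz x) c \<tau> \<and> J x = \<delta> *\<^sub>R x + comb c"
proof -
  obtain \<sigma> where \<sigma>: "\<sigma> \<in> Pat" "x \<in> R \<sigma>" using R_ex by blast
  have "J x = \<delta> *\<^sub>R x + comb (cc \<sigma> x)" using J_eq[OF \<sigma>] by (simp only: Jl_def)
  with soft_sol_R[OF \<sigma>] show ?thesis by blast
qed

lemma measurable_zz [measurable]: "(\<lambda>x. zz x j) \<in> borel_measurable borel"
  unfolding zz_def by measurable

lemma measurable_tau [measurable]: "tau \<sigma> \<in> borel_measurable borel"
  unfolding tau_def[abs_def] by measurable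

lemma measurable_cc [measurable]: "(\<lambda>x. cc \<sigma> x j) \<in> borel_measurable borel"
  unfolding cc_def by measurable

lemma measurable_R [measurable]: "R \<sigma> \<in> sets borel"
proof -
  have "{x \<in> space borel. (\<sigma> j \<noteq> 0 \<longrightarrow> 0 < \<sigma> j * cc \<sigma> x j) \<and> (\<sigma> j = 0 \<longrightarrow> \<bar>zz x j\<bar> \<le> tau \<sigma> x)} \<in> sets borel" for j
  proof (cases "\<sigma> j = 0")
    case True
    have "{x \<in> space borel. \<bar>zz x j\<bar> \<le> tau \<sigma> x} \<in> sets borel"
      by (rule borel_measurable_le[OF borel_measurable_abs[OF measurable_zz] measurable_tau])
    then show ?thesis using True by simp
  next
    case False
    have "{x \<in> space borel. 0 < \<sigma> j * cc \<sigma> x j} \<in> sets borel"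
      by (rule borel_measurable_less[OF borel_measurable_const borel_measurable_times[OF borel_measurable_const measurable_cc]])
    then show ?thesis using False by simp
  qed
  then have "{x \<in> space borel. \<forall>j\<in>{..<m}. (\<sigma> j \<noteq> 0 \<longrightarrow> 0 < \<sigma> j * cc \<sigma> x j) \<and> (\<sigma> j = 0 \<longrightarrow> \<bar>zz x j\<bar> \<le> tau \<sigma> x)} \<in> sets borel"
    by (intro sets.sets_Collect_finite_All finite_lessThan)
  then show ?thesis unfolding R_def space_borel by (simp only: UNIV_I simp_thms)
qed

lemma measurable_Jl [measurable]: "Jl \<sigma> \<in> borel_measurable borel"
proof (rule borel_measurable_vecI)
  fix i
  have "(\<lambda>x. Jl \<sigma> x i) = (\<lambda>x. \<delta> * x i + (\<Sum>j<m. cc \<sigma> x j * u j i))"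
    by (simp add: Jl_def comb_def scaleR_fun_apply)
  then show "(\<lambda>x. Jl \<sigma> x i) \<in> borel_measurable borel" by simp
qed

lemma measurable_J: "J \<in> borel_measurable borel"
  unfolding J_def[abs_def] by (rule borel_measurable_vecI) measurable

text \<open>\<open>soft_sol_mono\<close> gives the sign needed for monotonicity. Combined with AM-GM
  it also shows that the squared differences of the coefficients add up to no more than those of the
  numbers <u_j, x>.\<close>

lemma mono_lip_J: "mono_lip I \<delta> (Lam + 1) J"
  unfolding mono_lip_def
proof (intro conjI ballI)
  fix x y assume xy: "x \<in> coord_space I" "y \<in> coord_space I"
  obtain c \<tau> where c: "soft_sol m (zz x) c \<tau>" "J x = \<delta> *\<^sub>R x + comb c" using J_form by blast
  obtain c' \<tau>' where c': "soft_sol m (zz y) c' \<tau>'" "J y = \<delta> *\<^sub>R y + comb c'" using J_form by blast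
  define d e where "d = x - y" and "e j = c j - c' j" for j
  have zd: "zz x j - zz y j = zz d j" for j unfolding d_def by (simp only: zz_lin)
  have diff: "J x - J y = \<delta> *\<^sub>R d + comb e"
    unfolding c(2) c'(2) d_def e_def comb_diff[symmetric] by (simp add: algebra_simps)
  have le: "(\<Sum>j<m. (e j)\<^sup>2) \<le> (\<Sum>j<m. e j * zz d j)"
    using soft_sol_mono[OF c(1) c'(1)] unfolding e_def zd .
  show "\<delta> * dot I (x - y) (x - y) \<le> dot I (J x - J y) (x - y)"
  proof -
    have "0 \<le> (\<Sum>j<m. (e j)\<^sup>2)" by (simp add: sum_nonneg)
    then show ?thesis unfolding diff d_def[symmetric] field_pos using le by argo
  qed
  have "(\<Sum>j<m. e j * zz d j) \<le> (\<Sum>j<m. ((e j)\<^sup>2 + (zz d j)\<^sup>2) / 2)"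
  proof (rule sum_mono)
    fix j
    have "0 \<le> (e j - zz d j)\<^sup>2" by simp
    then show "e j * zz d j \<le> ((e j)\<^sup>2 + (zz d j)\<^sup>2) / 2" by (simp add: power2_eq_square algebra_simps)
  qed
  also have "\<dots> = ((\<Sum>j<m. (e j)\<^sup>2) + (\<Sum>j<m. (zz d j)\<^sup>2)) / 2" by (simp add: sum.distrib sum_divide_distrib[symmetric])
  finally have "(\<Sum>j<m. (e j)\<^sup>2) \<le> (\<Sum>j<m. (zz d j)\<^sup>2)" using le by argo
  from field_bound[OF this] have "dot I (J x - J y) (J x - J y) \<le> Lam * dot I (x - y) (x - y)"
    unfolding diff d_def[symmetric] .
  then show "dot I (J x - J y) (J x - J y) \<le> (Lam + 1) * dot I (x - y) (x - y)"
    using dot_nonneg[of I "x - y"] unfolding distrib_right by argo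
next
  fix x assume x: "x \<in> coord_space I"
  obtain c \<tau> where "J x = \<delta> *\<^sub>R x + comb c" using J_form by blast
  then show "J x \<in> coord_space I" using x comb_in by simp
qed

lemma Jl_add: "Jl \<sigma> (x + y) = Jl \<sigma> x + Jl \<sigma> y"
  unfolding Jl_def cc_lin comb_add scaleR_add_right by (simp add: cc_lin comb_add[symmetric] ac_simps)

lemma Jl_diff: "Jl \<sigma> x - Jl \<sigma> y = Jl \<sigma> (x - y)"
  using Jl_add[of \<sigma> "x - y" y] by simp

text \<open>Away from its cone a linear piece does not come from \<open>soft_sol\<close>, so
  monotonicity is checked algebraically: the quadratic form of the pattern is W - t^2 (1 + s),
  nonnegative by Cauchy-Schwarz on the support of the pattern.\<close>

lemma mono_lip_Jl:
  assumes \<sigma>: "\<sigma> \<in> Pat" shows "mono_lip I \<delta> (Lam + 1) (Jl \<sigma>)"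
  unfolding mono_lip_def
proof (intro conjI ballI)
  fix x y assume xy: "x \<in> coord_space I" "y \<in> coord_space I"
  define d where "d = x - y"
  define s where "s = (\<Sum>j<m. (\<sigma> j)\<^sup>2)"
  define t where "t = tau \<sigma> d"
  define W where "W = (\<Sum>j<m. (\<sigma> j)\<^sup>2 * (zz d j)\<^sup>2)"
  note ids2 = pattern_identities(2)[OF \<sigma>, of d, folded s_def t_def W_def]
  note ids4 = pattern_identities(4)[OF \<sigma>, of d, folded s_def t_def W_def]
  note ids5 = pattern_identities(5)[OF \<sigma>, of d, folded s_def t_def W_def]
  have s: "0 \<le> s" by (simp add: s_def sum_nonneg)
  have one: "(\<sigma> j)\<^sup>2 \<le> 1" "(\<sigma> j)\<^sup>2 * \<sigma> j = \<sigma> j" "(\<sigma> j)\<^sup>2 * (\<sigma> j)\<^sup>2 = (\<sigma> j)\<^sup>2" if "j < m" for j using Pat_cases[OF \<sigma> that] by auto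
  have "(t * (1 + s))\<^sup>2 = (\<Sum>j<m. \<sigma> j * (\<sigma> j * \<sigma> j * zz d j))\<^sup>2"
  proof -
    have "(\<Sum>j<m. \<sigma> j * zz d j) = (\<Sum>j<m. \<sigma> j * (\<sigma> j * \<sigma> j * zz d j))"
    proof (rule sum.cong[OF refl])
      fix j assume "j \<in> {..<m}"
      then have "\<sigma> j * zz d j = ((\<sigma> j)\<^sup>2 * \<sigma> j) * zz d j" using one(2)[of j] by simp
      then show "\<sigma> j * zz d j = \<sigma> j * (\<sigma> j * \<sigma> j * zz d j)" by (simp add: power2_eq_square ac_simps)
    qed
    then show ?thesis using ids2 by simp
  qed
  also have "\<dots> \<le> s * (\<Sum>j<m. (\<sigma> j * \<sigma> j * zz d j)\<^sup>2)" unfolding s_def by (rule Cauchy_Schwarz_ineq_sum)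
  also have "(\<Sum>j<m. (\<sigma> j * \<sigma> j * zz d j)\<^sup>2) = W"
    unfolding W_def
  proof (rule sum.cong[OF refl])
    fix j assume "j \<in> {..<m}"
    then have "(\<sigma> j)\<^sup>2 * (\<sigma> j)\<^sup>2 * (zz d j)\<^sup>2 = (\<sigma> j)\<^sup>2 * (zz d j)\<^sup>2" using one(3)[of j] by simp
    then show "(\<sigma> j * \<sigma> j * zz d j)\<^sup>2 = (\<sigma> j)\<^sup>2 * (zz d j)\<^sup>2" by (simp add: power2_eq_square ac_simps)
  qed
  finally have "t\<^sup>2 * (1 + s) * (1 + s) \<le> s * W" by (simp add: power_mult_distrib power2_eq_square ac_simps)
  also have "\<dots> \<le> (1 + s) * W" by (rule mult_right_mono) (simp_all add: W_def sum_nonneg)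
  finally have "(1 + s) * (t\<^sup>2 * (1 + s)) \<le> (1 + s) * W" by (simp add: ac_simps)
  then have tW: "t\<^sup>2 * (1 + s) \<le> W" using s by (subst (asm) mult_le_cancel_left_pos) auto
  have "Jl \<sigma> x - Jl \<sigma> y = Jl \<sigma> d" unfolding d_def by (rule Jl_diff)
  then have diff: "Jl \<sigma> x - Jl \<sigma> y = \<delta> *\<^sub>R d + comb (cc \<sigma> d)" using Jl_def by (rule trans)
  show "\<delta> * dot I (x - y) (x - y) \<le> dot I (Jl \<sigma> x - Jl \<sigma> y) (x - y)"
    unfolding diff d_def[symmetric] field_pos using ids4 tW by argo
  have "(\<Sum>j<m. (cc \<sigma> d j)\<^sup>2) \<le> W"
    using ids5 mult_nonneg_nonneg[OF zero_le_power2[of t], of "2 + s"] s by argo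
  also have "W \<le> (\<Sum>j<m. (zz d j)\<^sup>2)"
    unfolding W_def
  proof (rule sum_mono)
    fix j assume "j \<in> {..<m}"
    then show "(\<sigma> j)\<^sup>2 * (zz d j)\<^sup>2 \<le> (zz d j)\<^sup>2" using mult_right_mono[OF one(1)[of j], of "(zz d j)\<^sup>2"] by simp
  qed
  finally have "dot I (Jl \<sigma> x - Jl \<sigma> y) (Jl \<sigma> x - Jl \<sigma> y) \<le> Lam * dot I (x - y) (x - y)"
    unfolding diff d_def[symmetric] by (rule field_bound)
  then show "dot I (Jl \<sigma> x - Jl \<sigma> y) (Jl \<sigma> x - Jl \<sigma> y) \<le> (Lam + 1) * dot I (x - y) (x - y)"
    using dot_nonneg[of I "x - y"] unfolding distrib_right by argo
next
  fix x assume "x \<in> coord_space I"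
  then show "Jl \<sigma> x \<in> coord_space I" using comb_in by (simp add: Jl_def)
qed

lemma R_cone: "t > 0 \<Longrightarrow> t *\<^sub>R x \<in> R \<sigma> \<longleftrightarrow> x \<in> R \<sigma>"
proof -
  assume t: "t > 0"
  have "(0 < \<sigma> j * (t * cc \<sigma> x j)) = (0 < \<sigma> j * cc \<sigma> x j)" for j
    using t by (simp add: mult.left_commute zero_less_mult_iff)
  moreover have "(\<bar>t * zz x j\<bar> \<le> t * tau \<sigma> x) = (\<bar>zz x j\<bar> \<le> tau \<sigma> x)" for j
    using t by (simp add: abs_mult)
  ultimately show ?thesis unfolding R_def mem_Collect_eq cc_lin zz_lin tau_lin by simp
qed

sublocale pl: piecewise_linear_field I Pat R Jl J \<delta> "Lam + 1"
proof
  show "0 < Lam + 1" using S_nonneg by (simp add: Lam_def add_nonneg_pos)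
  show "J (t *\<^sub>R x) = t *\<^sub>R J x" if t: "t > 0" for x t
  proof -
    obtain \<sigma> where \<sigma>: "\<sigma> \<in> Pat" "x \<in> R \<sigma>" using R_ex by blast
    have "J (t *\<^sub>R x) = Jl \<sigma> (t *\<^sub>R x)" using J_eq[OF \<sigma>(1)] R_cone[OF t] \<sigma>(2) by simp
    also have "\<dots> = t *\<^sub>R Jl \<sigma> x"
      unfolding Jl_def scaleR_add_right comb_scale[symmetric] cc_lin by (simp add: cc_lin mult.commute)
    finally show ?thesis using J_eq[OF \<sigma>] by simp
  qed
qed (use I \<delta> finite_Pat R_ex R_disj J_eq R_cone Jl_add mono_lip_J mono_lip_Jl measurable_J measurable_Jl measurable_R in auto)

text \<open>A value of the quadratic form at most 1 gives \<tau> \<le> 1 and |c_j| \<le> 1, hence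
  |<u_j, x>| \<le> |c_j| + \<tau> \<le> 2, and also \<delta>|x|^2 \<le> 1. Adding or subtracting two
  such points doubles the bounds to 4 and 2, and |\<delta>(x - y)|^2 is at most 4\<delta>.\<close>

theorem polytope_lower_bound:
  assumes Q: "Q \<in> sets borel"
    and sub: "\<And>X d c. X \<in> coord_space I \<Longrightarrow> (\<And>j. j < m \<Longrightarrow> \<bar>dot I (u j) X\<bar> \<le> 4) \<Longrightarrow> d \<in> coord_space I \<Longrightarrow>
       dot I d d \<le> 4 * \<delta> \<Longrightarrow> (\<Sum>j<m. \<bar>c j\<bar>) \<le> 2 \<Longrightarrow> (X, d + comb c) \<in> Q"
  shows "(emeasure (leb I) (uball I))\<^sup>2 \<le> 2 ^ card I * emeasure (leb2 I) Q"
proof (rule pl.polar_product_lower_bound[OF Q])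
  fix z assume z: "z \<in> E2 I" and q: "pl.q (fst z) \<le> 1" "pl.q (snd z) \<le> 1"
  have zE: "fst z \<in> coord_space I" "snd z \<in> coord_space I" using z by (auto simp: E2_def)
  have one: "\<exists>c. J x = \<delta> *\<^sub>R x + comb c \<and> (\<Sum>j<m. \<bar>c j\<bar>) \<le> 1 \<and> (\<forall>j<m. \<bar>dot I (u j) x\<bar> \<le> 2) \<and> \<delta> * dot I x x \<le> 1"
    if q1: "pl.q x \<le> 1" for x
  proof -
    obtain c \<tau> where c: "soft_sol m (zz x) c \<tau>" "J x = \<delta> *\<^sub>R x + comb c" using J_form by blast
    have t0: "0 \<le> \<tau>" by (rule soft_sol_nonneg[OF c(1)])
    have sq: "0 \<le> (\<Sum>j<m. (c j)\<^sup>2)" by (simp add: sum_nonneg)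
    have "pl.q x = \<delta> * dot I x x + (\<tau>\<^sup>2 + (\<Sum>j<m. (c j)\<^sup>2))"
    proof -
      have "pl.q x = dot I (\<delta> *\<^sub>R x + comb c) x" unfolding pl.q_def c(2) by (rule dot_commute)
      then show ?thesis unfolding field_pos soft_sol_product[OF c(1)] .
    qed
    moreover have "0 \<le> \<delta> * dot I x x" using \<delta> by simp
    ultimately have b: "\<delta> * dot I x x \<le> 1" "\<tau>\<^sup>2 \<le> 1" "(\<Sum>j<m. (c j)\<^sup>2) \<le> 1"
      using q1 sq zero_le_power2[of \<tau>] by argo+
    have t1: "\<tau> \<le> 1" using power2_le_imp_le[of \<tau> 1] b(2) by simp
    have "\<bar>dot I (u j) x\<bar> \<le> 2" if j: "j < m" for j
    proof -
      have "(c j)\<^sup>2 \<le> (\<Sum>j<m. (c j)\<^sup>2)" using j by (intro member_le_sum) auto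
      then have "\<bar>c j\<bar>\<^sup>2 \<le> 1\<^sup>2" using b(3) by simp
      then have "\<bar>c j\<bar> \<le> 1" by (rule power2_le_imp_le) simp
      moreover have "\<bar>zz x j - c j\<bar> \<le> 1" using c(1) j t1 by (auto simp: soft_sol_def)
      ultimately show ?thesis unfolding zz_def by argo
    qed
    moreover have "(\<Sum>j<m. \<bar>c j\<bar>) \<le> 1" using c(1) t1 by (simp add: soft_sol_def)
    ultimately show ?thesis using c(2) b(1) by blast
  qed
  obtain c where c: "J (fst z) = \<delta> *\<^sub>R fst z + comb c" "(\<Sum>j<m. \<bar>c j\<bar>) \<le> 1" "\<forall>j<m. \<bar>dot I (u j) (fst z)\<bar> \<le> 2" "\<delta> * dot I (fst z) (fst z) \<le> 1"
    using one[OF q(1)] by blast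
  obtain c' where c': "J (snd z) = \<delta> *\<^sub>R snd z + comb c'" "(\<Sum>j<m. \<bar>c' j\<bar>) \<le> 1" "\<forall>j<m. \<bar>dot I (u j) (snd z)\<bar> \<le> 2" "\<delta> * dot I (snd z) (snd z) \<le> 1"
    using one[OF q(2)] by blast
  define x y where "x = fst z" and "y = snd z"
  have "(x + y, \<delta> *\<^sub>R (x - y) + comb (\<lambda>j. c j - c' j)) \<in> Q"
  proof (rule sub)
    show "x + y \<in> coord_space I" "\<delta> *\<^sub>R (x - y) \<in> coord_space I" using zE by (simp_all add: x_def y_def)
    show "\<bar>dot I (u j) (x + y)\<bar> \<le> 4" if "j < m" for j
    proof -
      have "\<bar>dot I (u j) x\<bar> \<le> 2" "\<bar>dot I (u j) y\<bar> \<le> 2" using c(3) c'(3) that unfolding x_def y_def by blast+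
      then show ?thesis unfolding dot_simps(2) using abs_triangle_ineq[of "dot I (u j) x" "dot I (u j) y"] by argo
    qed
    have "dot I (\<delta> *\<^sub>R (x - y)) (\<delta> *\<^sub>R (x - y)) = \<delta> * (\<delta> * dot I (x - y) (x - y))" by (simp only: dot_simps(5,6))
    also have "\<dots> \<le> \<delta> * 4"
    proof (rule mult_left_mono)
      have "dot I (x - y) (x - y) = dot I x x - 2 * dot I x y + dot I y y" by (simp add: dot_simps dot_commute[of I y x])
      then have "dot I (x - y) (x - y) \<le> 2 * dot I x x + 2 * dot I y y" using dot_AM_GM[of I x y] by argo
      then have "\<delta> * dot I (x - y) (x - y) \<le> \<delta> * (2 * dot I x x + 2 * dot I y y)" using \<delta> by (intro mult_left_mono) auto
      also have "\<dots> = 2 * (\<delta> * dot I x x) + 2 * (\<delta> * dot I y y)" by (simp add: algebra_simps)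
      finally show "\<delta> * dot I (x - y) (x - y) \<le> 4" using c(4) c'(4) unfolding x_def y_def by argo
    qed (use \<delta> in simp)
    finally show "dot I (\<delta> *\<^sub>R (x - y)) (\<delta> *\<^sub>R (x - y)) \<le> 4 * \<delta>" by simp
    have "(\<Sum>j<m. \<bar>c j - c' j\<bar>) \<le> (\<Sum>j<m. \<bar>c j\<bar> + \<bar>c' j\<bar>)" by (intro sum_mono abs_triangle_ineq4)
    then show "(\<Sum>j<m. \<bar>c j - c' j\<bar>) \<le> 2" using c(2) c'(2) unfolding sum.distrib by argo
  qed
  moreover have "pl.T z = (x + y, \<delta> *\<^sub>R (x - y) + comb (\<lambda>j. c j - c' j))"
  proof -
    have "\<delta> *\<^sub>R x + comb c - (\<delta> *\<^sub>R y + comb c') = \<delta> *\<^sub>R (x - y) + (comb c - comb c')"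
      by (simp only: scaleR_diff_right add_diff_add)
    then show ?thesis unfolding pl.T_def pair_map_def x_def[symmetric] y_def[symmetric] c(1)[folded x_def] c'(1)[folded y_def] comb_diff[symmetric]
      by (simp only: prod.inject)
  qed
  ultimately show "pl.T z \<in> Q" by simp
qed

end

section \<open>The Bourgain-Milman inequality\<close>

definition unitv :: "nat \<Rightarrow> vec" where
  "unitv i = (\<lambda>k. if k = i then 1 else 0)"

lemma unitv_in: "i \<in> I \<Longrightarrow> unitv i \<in> coord_space I"
  by (auto simp: unitv_def coord_space_def)

lemma dot_unitv: "finite I \<Longrightarrow> i \<in> I \<Longrightarrow> dot I (unitv i) x = x i"
  by (simp add: dot_def unitv_def if_distrib[of "\<lambda>a. a * _"] cong: if_cong)

lemma sum_vec_apply: "(\<Sum>i\<in>A. f i) k = (\<Sum>i\<in>A. (f i :: vec) k)"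
  by (induction A rule: infinite_finite_induct) auto

lemma continuous_on_dot: "continuous_on UNIV (\<lambda>x::vec. dot I u x)"
  unfolding dot_def by (intro continuous_intros continuous_on_product_coordinates)

definition polar_set :: "nat set \<Rightarrow> vec set \<Rightarrow> real \<Rightarrow> vec set" where
  "polar_set I K t = {y. \<forall>x\<in>K. dot I x y \<le> t}"

lemma closed_polar_set: "closed (polar_set I K t)"
proof -
  have "polar_set I K t = (\<Inter>x\<in>K. {y. dot I x y \<le> t})" by (auto simp: polar_set_def)
  also have "closed \<dots>"
    by (intro closed_INT ballI closed_Collect_le continuous_on_dot continuous_on_const)
  finally show ?thesis .
qed

lemma emeasure_polar_set_scale:
  assumes "finite I" "t > 0"
  shows "emeasure (leb I) (polar_set I K t) = ennreal (t ^ card I) * emeasure (leb I) (polar_set I K 1)"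
proof -
  have "polar_set I K t = (\<lambda>x. t *\<^sub>R x) ` polar_set I K 1"
  proof (intro set_eqI iffI)
    fix y assume y: "y \<in> polar_set I K t"
    then have "(1/t) *\<^sub>R y \<in> polar_set I K 1"
      using assms(2) unfolding polar_set_def mem_Collect_eq dot_simps(6) by simp
    then show "y \<in> (\<lambda>x. t *\<^sub>R x) ` polar_set I K 1" using assms(2) by (intro image_eqI[of _ _ "(1/t) *\<^sub>R y"]) auto
  next
    fix y assume "y \<in> (\<lambda>x. t *\<^sub>R x) ` polar_set I K 1"
    then obtain x where x: "y = t *\<^sub>R x" "x \<in> polar_set I K 1" by blast
    then show "y \<in> polar_set I K t"
      using assms(2) unfolding polar_set_def mem_Collect_eq x(1) dot_simps(6) by simp
  qed
  then show ?thesis using emeasure_leb_scale[OF assms borel_closed[OF closed_polar_set]] by simp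
qed

text \<open>The size of \<open>K\<close> is assumed through its measure only. That the difference
  body \<open>D\<close> contains a cube and is bounded is derived from 0 < |K| < \<infinity> by
  packing translates.\<close>

locale convex_body =
  fixes I :: "nat set" and K :: "vec set"
  assumes I: "finite I" and Km [measurable]: "K \<in> sets borel" and KE: "K \<subseteq> coord_space I"
    and K0: "0 \<in> K" and Kc: "convex K" and Kpos: "0 < emeasure (leb I) K" and Kfin: "emeasure (leb I) K < \<infinity>"
begin

definition D :: "vec set" where
  "D = {x - y | x y. x \<in> K \<and> y \<in> K}"

lemma D_sym: "x \<in> D \<Longrightarrow> - x \<in> D"
proof -
  assume "x \<in> D"
  then obtain a b where "x = a - b" "a \<in> K" "b \<in> K" by (auto simp: D_def)
  moreover have "- (a - b) = b - a" by simp
  ultimately show ?thesis unfolding D_def by blast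
qed

lemma D_E: "D \<subseteq> coord_space I"
proof
  fix x assume "x \<in> D"
  then obtain a b where "x = a - b" "a \<in> K" "b \<in> K" by (auto simp: D_def)
  then show "x \<in> coord_space I" using KE coord_space_algebra(3)[of a I b] by blast
qed

lemma K_D: "K \<subseteq> D"
proof
  fix x assume "x \<in> K"
  moreover have "x = x - 0" by simp
  ultimately show "x \<in> D" unfolding D_def using K0 by blast
qed

lemma D_0: "0 \<in> D" using K_D K0 by auto

lemma D_convex: "convex D"
proof (rule convexI)
  fix x y :: vec and s t :: real assume "x \<in> D" "y \<in> D" and st: "0 \<le> s" "0 \<le> t" "s + t = 1"
  then obtain a b c d where x: "x = a - b" "a \<in> K" "b \<in> K" and y: "y = c - d" "c \<in> K" "d \<in> K"
    unfolding D_def by blast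
  have "s *\<^sub>R x + t *\<^sub>R y = (s *\<^sub>R a + t *\<^sub>R c) - (s *\<^sub>R b + t *\<^sub>R d)"
    unfolding x(1) y(1) scaleR_diff_right by (simp only: add_diff_add)
  moreover have "s *\<^sub>R a + t *\<^sub>R c \<in> K" "s *\<^sub>R b + t *\<^sub>R d \<in> K"
    using convexD[OF Kc] x y st by blast+
  ultimately show "s *\<^sub>R x + t *\<^sub>R y \<in> D" unfolding D_def by blast
qed

lemma D_scale: "x \<in> D \<Longrightarrow> \<bar>t\<bar> \<le> 1 \<Longrightarrow> t *\<^sub>R x \<in> D"
proof -
  assume x: "x \<in> D" and t: "\<bar>t\<bar> \<le> 1"
  have pos: "s *\<^sub>R y \<in> D" if "y \<in> D" "0 \<le> s" "s \<le> 1" for s y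
    using convexD[OF D_convex that(1) D_0 that(2), of "1 - s"] that(3) by simp
  show ?thesis
  proof (cases "0 \<le> t")
    case True then show ?thesis using pos[OF x, of t] t by simp
  next
    case False
    then have "(- t) *\<^sub>R (- x) \<in> D" using pos[OF D_sym[OF x], of "- t"] t by simp
    then show ?thesis by simp
  qed
qed

text \<open>The overlap \<open>K \<inter> (K + x)\<close> with \<open>x = (a - b)/2\<close> contains \<open>(a + K)/2\<close>, while the overlaps
  integrate to \<open>\<bar>K\<bar>\<^sup>2\<close>.\<close>
lemma half_D_measure:
  assumes [measurable]: "A \<in> sets borel" and A: "\<And>x. x \<in> A \<Longrightarrow> 2 *\<^sub>R x \<in> D"
  shows "emeasure (leb I) A \<le> ennreal (2 ^ card I) * emeasure (leb I) K"
proof -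
  interpret sigma_finite_measure "leb I" by (rule sigma_finite_leb[OF I])
  interpret pair_sigma_finite "leb I" "leb I" ..
  define k where "k = emeasure (leb I) K"
  define h where "h x = (\<integral>\<^sup>+w. indicator K w * indicator K (w - x) \<partial>leb I)" for x
  have hA: "ennreal ((1/2) ^ card I) * k \<le> h x" if x: "x \<in> A" for x
  proof -
    obtain a b where ab: "2 *\<^sub>R x = a - b" "a \<in> K" "b \<in> K" using A[OF x] unfolding D_def by blast
    have xeq: "x = (1/2) *\<^sub>R (a - b)" unfolding ab(1)[symmetric] by simp
    have aE: "a \<in> coord_space I" using ab KE by auto
    have m1: "(\<lambda>w. indicator K w * indicator K (w - x) :: ennreal) \<in> borel_measurable borel" by measurable
    have m2: "(\<lambda>v. indicator K ((1/2) *\<^sub>R v) * indicator K ((1/2) *\<^sub>R v - x) :: ennreal) \<in> borel_measurable borel" by measurable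
    have "h x = ennreal (\<bar>1/2\<bar> ^ card I) * (\<integral>\<^sup>+v. indicator K ((1/2) *\<^sub>R v) * indicator K ((1/2) *\<^sub>R v - x) \<partial>leb I)"
      unfolding h_def by (rule nn_integral_leb_scale[OF I _ m1]) simp
    also have "(\<integral>\<^sup>+v. indicator K ((1/2) *\<^sub>R v) * indicator K ((1/2) *\<^sub>R v - x) \<partial>leb I) =
       (\<integral>\<^sup>+v. indicator K ((1/2) *\<^sub>R (v + a)) * indicator K ((1/2) *\<^sub>R (v + a) - x) \<partial>leb I)"
      by (rule nn_integral_leb_translate[OF I aE m2, symmetric])
    finally have hx: "h x = ennreal (\<bar>1/2\<bar> ^ card I) *
       (\<integral>\<^sup>+v. indicator K ((1/2) *\<^sub>R (v + a)) * indicator K ((1/2) *\<^sub>R (v + a) - x) \<partial>leb I)" .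
    have "(\<integral>\<^sup>+v. indicator K v \<partial>leb I) \<le> (\<integral>\<^sup>+v. indicator K ((1/2) *\<^sub>R (v + a)) * indicator K ((1/2) *\<^sub>R (v + a) - x) \<partial>leb I)"
    proof (rule nn_integral_mono)
      fix v :: vec
      have mid: "(1/2) *\<^sub>R (v + c) \<in> K" if "v \<in> K" "c \<in> K" for c
        using convexD[OF Kc that, of "1/2" "1/2"] by (simp add: scaleR_add_right)
      have "(1/2) *\<^sub>R (v + a) - x = (1/2) *\<^sub>R (v + b)"
        unfolding xeq scaleR_diff_right[symmetric] by (simp only: add_diff_eq diff_diff_eq2 add_diff_cancel_left' diff_add_eq) (simp add: algebra_simps)
      then show "indicator K v \<le> (indicator K ((1/2) *\<^sub>R (v + a)) * indicator K ((1/2) *\<^sub>R (v + a) - x) :: ennreal)"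
        using mid[of a] mid[of b] ab by (cases "v \<in> K") auto
    qed
    then have "k \<le> (\<integral>\<^sup>+v. indicator K ((1/2) *\<^sub>R (v + a)) * indicator K ((1/2) *\<^sub>R (v + a) - x) \<partial>leb I)"
      unfolding k_def using nn_integral_indicator[of K "leb I"] by simp
    from mult_left_mono[OF this zero_le, of "ennreal (\<bar>1/2\<bar> ^ card I)"]
    show ?thesis unfolding hx by simp
  qed
  have hm[measurable]: "h \<in> borel_measurable borel" unfolding h_def by measurable
  have "(\<integral>\<^sup>+x. h x \<partial>leb I) = (\<integral>\<^sup>+w. (\<integral>\<^sup>+x. indicator K w * indicator K (w - x) \<partial>leb I) \<partial>leb I)"
    unfolding h_def by (rule Fubini') measurable
  also have "\<dots> = (\<integral>\<^sup>+w. indicator K w * k \<partial>leb I)"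
  proof (rule nn_integral_cong)
    fix w :: vec
    show "(\<integral>\<^sup>+x. indicator K w * indicator K (w - x) \<partial>leb I) = indicator K w * k"
    proof (cases "w \<in> K")
      case True
      then have wE: "w \<in> coord_space I" using KE by auto
      have "(\<integral>\<^sup>+x. indicator K (w - x) \<partial>leb I) = (\<integral>\<^sup>+x. indicator K (w + x) \<partial>leb I)"
        using nn_integral_leb_uminus[OF I, of "\<lambda>x. indicator K (w + x)"] by simp
      also have "\<dots> = (\<integral>\<^sup>+x. indicator K (x + w) \<partial>leb I)" by (simp only: add.commute)
      also have "\<dots> = (\<integral>\<^sup>+x. indicator K x \<partial>leb I)"
        by (rule nn_integral_leb_translate[OF I wE]) measurable
      finally show ?thesis using True by (simp add: k_def)
    qed simp
  qed
  also have "\<dots> = k * k" using nn_integral_multc[of "indicator K" "leb I" k] by (simp add: k_def)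
  finally have hk: "(\<integral>\<^sup>+x. h x \<partial>leb I) = k * k" .
  have "(ennreal ((1/2) ^ card I) * k) * emeasure (leb I) A = (\<integral>\<^sup>+x. (ennreal ((1/2) ^ card I) * k) * indicator A x \<partial>leb I)"
    by (simp add: nn_integral_cmult_indicator)
  also have "\<dots> \<le> (\<integral>\<^sup>+x. h x \<partial>leb I)"
    by (intro nn_integral_mono) (use hA in \<open>auto simp: indicator_def\<close>)
  finally have "k * (ennreal ((1/2) ^ card I) * emeasure (leb I) A) \<le> k * k" by (simp add: hk ac_simps)
  then have "ennreal ((1/2) ^ card I) * emeasure (leb I) A \<le> k"
    using Kpos Kfin by (subst (asm) ennreal_mult_le_mult_iff) (auto simp: k_def)
  then have "ennreal (2 ^ card I) * (ennreal ((1/2) ^ card I) * emeasure (leb I) A) \<le> ennreal (2 ^ card I) * k"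
    by (rule mult_left_mono) simp
  moreover have "ennreal (2 ^ card I) * ennreal ((1/2) ^ card I) = 1"
    by (simp flip: ennreal_mult power_mult_distrib)
  ultimately show ?thesis by (simp add: mult.assoc[symmetric] k_def)
qed

text \<open>Phrased for a Borel set inside s \<open>D\<close> because measurability of
  \<open>D\<close> itself, an image of pairs under subtraction, is not established. For s = 1 it is
  a bound of Rogers-Shephard type with constant 4^n.\<close>

lemma D_measure:
  assumes "A \<in> sets borel" and A: "\<And>x. x \<in> A \<Longrightarrow> (1/s) *\<^sub>R x \<in> D" and s: "s > 0"
  shows "emeasure (leb I) A \<le> ennreal ((2 * s) ^ card I * 2 ^ card I) * emeasure (leb I) K"
proof -
  have m: "(\<lambda>x. (1/(2 * s)) *\<^sub>R x) ` A \<in> sets borel"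
  proof -
    have "(\<lambda>x. (1/(2 * s)) *\<^sub>R x) ` A = (\<lambda>x. (2 * s) *\<^sub>R x) -` A \<inter> space borel"
    proof -
      have "x \<in> (\<lambda>x. (1/(2 * s)) *\<^sub>R x) ` A" if "(2 * s) *\<^sub>R x \<in> A" for x
        using that s by (intro image_eqI[of _ _ "(2 * s) *\<^sub>R x"]) auto
      then show ?thesis using s by auto
    qed
    moreover have "(\<lambda>x::vec. (2 * s) *\<^sub>R x) \<in> borel_measurable borel" by measurable
    ultimately show ?thesis using measurable_sets[OF _ assms(1)] by metis
  qed
  have "A = (\<lambda>x. (2 * s) *\<^sub>R x) ` ((\<lambda>x. (1/(2 * s)) *\<^sub>R x) ` A)" using s by (simp add: image_image)
  then have "emeasure (leb I) A = ennreal ((2 * s) ^ card I) * emeasure (leb I) ((\<lambda>x. (1/(2 * s)) *\<^sub>R x) ` A)"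
    using emeasure_leb_scale[OF I _ m, of "2 * s"] s by simp
  also have "\<dots> \<le> ennreal ((2 * s) ^ card I) * (ennreal (2 ^ card I) * emeasure (leb I) K)"
  proof (intro mult_left_mono half_D_measure m)
    fix x assume "x \<in> (\<lambda>x. (1/(2 * s)) *\<^sub>R x) ` A"
    then obtain y where y: "x = (1/(2 * s)) *\<^sub>R y" "y \<in> A" by blast
    then show "2 *\<^sub>R x \<in> D" using A[OF y(2)] by simp
  qed simp
  finally show ?thesis using s by (simp add: ennreal_mult mult.assoc)
qed

section \<open>Packing translates: a cube inside the difference body, and its boundedness\<close>

lemma emeasure_translate:
  assumes [measurable]: "A \<in> sets borel" and v: "v \<in> coord_space I"
  shows "{x. x - v \<in> A} \<in> sets borel" "emeasure (leb I) {x. x - v \<in> A} = emeasure (leb I) A"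
proof -
  have "(\<lambda>x. x - v) -` A \<inter> space borel \<in> sets borel" by measurable
  then show m: "{x. x - v \<in> A} \<in> sets borel" by (simp add: vimage_def)
  have "(\<integral>\<^sup>+x. indicator A (x + (- v)) \<partial>leb I) = (\<integral>\<^sup>+x. indicator A x \<partial>leb I)"
    by (rule nn_integral_leb_translate[OF I coord_space_algebra(4)[OF v]]) simp
  moreover have "(\<lambda>x. indicator A (x + (- v)) :: ennreal) = indicator {x. x - v \<in> A}"
    by (intro ext) (simp add: indicator_def)
  ultimately show "emeasure (leb I) {x. x - v \<in> A} = emeasure (leb I) A" using m by simp
qed

lemma disjoint_translates:
  assumes A: "A \<in> sets borel" and v: "\<And>j. j < N \<Longrightarrow> v j \<in> coord_space I"
    and B: "B \<in> sets borel" "\<And>x j. j < N \<Longrightarrow> x - v j \<in> A \<Longrightarrow> x \<in> B"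
    and disj: "\<And>x j l. j < l \<Longrightarrow> l < N \<Longrightarrow> x - v j \<in> A \<Longrightarrow> x - v l \<in> A \<Longrightarrow> False"
  shows "of_nat N * emeasure (leb I) A \<le> emeasure (leb I) B"
proof -
  let ?S = "\<lambda>j. {x. x - v j \<in> A}"
  have "of_nat N * emeasure (leb I) A = (\<Sum>j<N. emeasure (leb I) (?S j))"
    using emeasure_translate(2)[OF A v] by simp
  also have "\<dots> = emeasure (leb I) (\<Union>j<N. ?S j)"
  proof (rule sum_emeasure)
    show "disjoint_family_on ?S {..<N}"
      unfolding disjoint_family_on_def
    proof (intro ballI impI)
      fix j l assume "j \<in> {..<N}" "l \<in> {..<N}" "j \<noteq> l"
      then have "j < N" "l < N" "j < l \<or> l < j" by auto
      then show "?S j \<inter> ?S l = {}" using disj by blast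
    qed
    show "?S ` {..<N} \<subseteq> sets (leb I)" using emeasure_translate(1)[OF A v] by auto
  qed simp
  also have "\<dots> \<le> emeasure (leb I) B" using B by (intro emeasure_mono) auto
  finally show ?thesis .
qed

lemma box_measurable: "{x \<in> coord_space I. \<forall>i\<in>I. \<bar>x i\<bar> \<le> R} \<in> sets borel"
  by (rule borel_compact[OF compact_box])

lemma emeasure_box: "R \<ge> 0 \<Longrightarrow> emeasure (leb I) {x \<in> coord_space I. \<forall>i\<in>I. \<bar>x i\<bar> \<le> R} = ennreal ((2 * R) ^ card I)"
proof -
  assume R: "R \<ge> 0"
  have "emeasure (leb I) {x \<in> coord_space I. \<forall>i\<in>I. \<bar>x i\<bar> \<le> R} = emeasure (leb I) {x. \<forall>i\<in>I. \<bar>x i\<bar> \<le> R}"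
  proof (rule emeasure_eq_AE)
    show "AE x in leb I. (x \<in> {x \<in> coord_space I. \<forall>i\<in>I. \<bar>x i\<bar> \<le> R}) = (x \<in> {x. \<forall>i\<in>I. \<bar>x i\<bar> \<le> R})"
      using AE_leb_coord_space[of I] by eventually_elim simp
    have "closed (\<Inter>i\<in>I. {x::vec. \<bar>x i\<bar> \<le> R})"
      by (intro closed_INT ballI closed_Collect_le continuous_on_rabs continuous_on_product_coordinates continuous_on_const)
    moreover have "(\<Inter>i\<in>I. {x::vec. \<bar>x i\<bar> \<le> R}) = {x. \<forall>i\<in>I. \<bar>x i\<bar> \<le> R}" by blast
    ultimately show "{x. \<forall>i\<in>I. \<bar>x i\<bar> \<le> R} \<in> sets (leb I)" using borel_closed by simp
  qed (simp add: box_measurable)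
  then show ?thesis using emeasure_leb_box[OF I R] by simp
qed

lemma multiple_le_imp_zero:
  fixes a b :: ennreal
  assumes "\<And>N::nat. of_nat N * a \<le> b" "b < \<infinity>" shows "a = 0"
proof (rule ccontr)
  assume a: "a \<noteq> 0"
  have "a \<le> b" using assms(1)[of 1] by simp
  then obtain x y where xy: "a = ennreal x" "b = ennreal y" "x \<ge> 0" "y \<ge> 0"
    using assms(2) by (cases a; cases b) (auto simp: top_unique)
  with a have "x > 0" by (auto simp: less_le)
  obtain N :: nat where N: "y < real N * x" using ex_less_of_nat_mult[OF \<open>x > 0\<close>] by blast
  have "ennreal (real N * x) \<le> ennreal y"
    using assms(1)[of N] xy by (simp add: ennreal_mult ennreal_of_nat_eq_real_of_nat)
  then show False using N xy by (simp add: ennreal_le_iff)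
qed

text \<open>If no positive multiple of the axis vector is a difference of two points of
  \<open>K\<close>, then arbitrarily many translates of \<open>K\<close> along a unit segment of the
  axis are disjoint. For a bounded part of \<open>K\<close> they fit into one box, so every such
  part is null, contradicting |K| > 0.\<close>

lemma axis_in_D:
  assumes i: "i \<in> I" shows "\<exists>r>0. r *\<^sub>R unitv i \<in> D"
proof (rule ccontr)
  assume no: "\<not> (\<exists>r>0. r *\<^sub>R unitv i \<in> D)"
  have "emeasure (leb I) (K \<inter> {x \<in> coord_space I. \<forall>i\<in>I. \<bar>x i\<bar> \<le> real k}) = 0" for k :: nat
  proof (rule multiple_le_imp_zero)
    fix N :: nat
    let ?v = "\<lambda>j. (real j / real N) *\<^sub>R unitv i"
    show "of_nat N * emeasure (leb I) (K \<inter> {x \<in> coord_space I. \<forall>i\<in>I. \<bar>x i\<bar> \<le> real k}) \<le>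
        emeasure (leb I) {x \<in> coord_space I. \<forall>i\<in>I. \<bar>x i\<bar> \<le> real k + 1}"
    proof (rule disjoint_translates[where v="?v"])
      show "K \<inter> {x \<in> coord_space I. \<forall>i\<in>I. \<bar>x i\<bar> \<le> real k} \<in> sets borel" using box_measurable Km by blast
      show vE: "?v j \<in> coord_space I" for j using unitv_in[OF i] by simp
      fix x j assume j: "j < N" and x: "x - ?v j \<in> K \<inter> {x \<in> coord_space I. \<forall>i\<in>I. \<bar>x i\<bar> \<le> real k}"
      have xE: "x \<in> coord_space I"
      proof -
        have "x - ?v j + ?v j \<in> coord_space I" using x vE by (intro coord_space_algebra(2)) auto
        then show ?thesis by simp
      qed
      moreover have "\<bar>x l\<bar> \<le> real k + 1" if l: "l \<in> I" for l
      proof -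
        have "\<bar>(x - ?v j) l\<bar> \<le> real k" using x l by blast
        moreover have "\<bar>?v j l\<bar> \<le> 1" using j by (simp add: unitv_def scaleR_fun_apply)
        moreover have "x l = (x - ?v j) l + ?v j l" by simp
        ultimately show ?thesis by linarith
      qed
      ultimately show "x \<in> {x \<in> coord_space I. \<forall>i\<in>I. \<bar>x i\<bar> \<le> real k + 1}" by simp
    next
      fix x and j l :: nat assume jl: "j < l" "l < N"
        and x: "x - ?v j \<in> K \<inter> {x \<in> coord_space I. \<forall>i\<in>I. \<bar>x i\<bar> \<le> real k}" "x - ?v l \<in> K \<inter> {x \<in> coord_space I. \<forall>i\<in>I. \<bar>x i\<bar> \<le> real k}"
      have "(x - ?v j) - (x - ?v l) \<in> D" unfolding D_def using x by blast
      moreover have "(x - ?v j) - (x - ?v l) = (real l / real N - real j / real N) *\<^sub>R unitv i"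
        by (simp add: scaleR_diff_left)
      moreover have "0 < real l / real N - real j / real N" using jl by (simp add: divide_strict_right_mono)
      ultimately show False using no by metis
    qed (rule box_measurable)
  qed (simp add: emeasure_box)
  moreover have "emeasure (leb I) K = (SUP k::nat. emeasure (leb I) (K \<inter> {x \<in> coord_space I. \<forall>i\<in>I. \<bar>x i\<bar> \<le> real k}))"
  proof -
    let ?B = "\<lambda>k::nat. {x \<in> coord_space I. \<forall>i\<in>I. \<bar>x i\<bar> \<le> real k}"
    have "\<exists>k::nat. x \<in> ?B k" if x: "x \<in> coord_space I" for x
    proof -
      obtain k :: nat where k: "(\<Sum>i\<in>I. \<bar>x i\<bar>) \<le> real k" using real_arch_simple by blast
      have "\<bar>x i\<bar> \<le> (\<Sum>i\<in>I. \<bar>x i\<bar>)" if "i \<in> I" for i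
        using that I by (intro member_le_sum) auto
      then have "\<forall>i\<in>I. \<bar>x i\<bar> \<le> real k" using k by (meson order_trans)
      then show ?thesis using x by blast
    qed
    then have "K = (\<Union>k. K \<inter> ?B k)" using KE by blast
    then have "emeasure (leb I) K = emeasure (leb I) (\<Union>k. K \<inter> ?B k)" by metis
    also have "\<dots> = (SUP k. emeasure (leb I) (K \<inter> ?B k))"
      by (rule SUP_emeasure_incseq[symmetric]) (use box_measurable Km in \<open>auto simp: incseq_def intro: order_trans\<close>)
    finally show ?thesis .
  qed
  ultimately show False using Kpos by simp
qed

lemma cube_in_D: "\<exists>\<rho>>0. \<forall>x\<in>coord_space I. (\<forall>i\<in>I. \<bar>x i\<bar> \<le> \<rho>) \<longrightarrow> x \<in> D"
proof (cases "I = {}")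
  case True
  then have "x = 0" if "x \<in> coord_space I" for x using that by (auto simp: coord_space_def fun_eq_iff)
  then show ?thesis using D_0 by (intro exI[of _ 1]) auto
next
  case False
  obtain r where r: "\<And>i. i \<in> I \<Longrightarrow> r i > 0 \<and> r i *\<^sub>R unitv i \<in> D" using axis_in_D by metis
  define n where "n = real (card I)"
  have n: "n > 0" using False I by (simp add: n_def card_gt_0_iff)
  define \<rho> where "\<rho> = Min (r ` I) / n"
  have rmin: "0 < Min (r ` I)" using r False I by (subst Min_gr_iff) auto
  have "x \<in> D" if x: "x \<in> coord_space I" "\<forall>i\<in>I. \<bar>x i\<bar> \<le> \<rho>" for x
  proof -
    \<comment> \<open>x is the average of the n axis vectors n x_i e_i, each of which lies in
      \<open>D\<close> because n \<rho> is the smallest of the r_i.\<close>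
    have "(\<Sum>i\<in>I. (1/n) *\<^sub>R ((n * x i) *\<^sub>R unitv i)) \<in> D"
    proof (rule convex_sum[OF I D_convex])
      show "(\<Sum>i\<in>I. 1/n) = 1" using n by (simp add: n_def)
      fix i assume i: "i \<in> I"
      show "(n * x i) *\<^sub>R unitv i \<in> D"
      proof -
        have "n * \<bar>x i\<bar> \<le> n * \<rho>" using x(2) i n by (intro mult_left_mono) auto
        also have "\<dots> = Min (r ` I)" using n by (simp add: \<rho>_def)
        also have "\<dots> \<le> r i" using i I by (intro Min_le) auto
        finally have "\<bar>n * x i / r i\<bar> \<le> 1" using r[OF i] n by (simp add: abs_mult)
        from D_scale[OF conjunct2[OF r[OF i]] this] show ?thesis using r[OF i] by simp
      qed
    qed (use n in simp)
    moreover have "(\<Sum>i\<in>I. (1/n) *\<^sub>R ((n * x i) *\<^sub>R unitv i)) = x"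
    proof
      fix k
      have "(\<Sum>i\<in>I. (1/n) *\<^sub>R ((n * x i) *\<^sub>R unitv i)) k = (\<Sum>i\<in>I. if k = i then x k else 0)"
        unfolding sum_vec_apply by (intro sum.cong) (use n in \<open>auto simp: scaleR_fun_apply unitv_def\<close>)
      also have "\<dots> = x k" using I x(1) by (simp add: coord_space_def)
      finally show "(\<Sum>i\<in>I. (1/n) *\<^sub>R ((n * x i) *\<^sub>R unitv i)) k = x k" .
    qed
    ultimately show ?thesis by simp
  qed
  moreover have "\<rho> > 0" using rmin n by (simp add: \<rho>_def)
  ultimately show ?thesis by blast
qed

text \<open>A long vector x of \<open>D\<close> makes room for many disjoint cubes: midpoints of
  points of the segment from 0 to x with points of a cube inside \<open>D\<close> stay in
  \<open>D\<close> by convexity, while Borel subsets of \<open>D\<close> have volume at most a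
  multiple of |K|.\<close>

lemma D_bounded: "\<exists>B>0. \<forall>x\<in>D. \<forall>i\<in>I. \<bar>x i\<bar> \<le> B"
proof -
  obtain \<rho> where \<rho>: "\<rho> > 0" "\<And>x. x \<in> coord_space I \<Longrightarrow> (\<forall>i\<in>I. \<bar>x i\<bar> \<le> \<rho>) \<Longrightarrow> x \<in> D" using cube_in_D by blast
  define Q where "Q = {x \<in> coord_space I. \<forall>i\<in>I. \<bar>x i\<bar> \<le> \<rho> / 2}"
  have Qm: "emeasure (leb I) Q = ennreal (\<rho> ^ card I)" using emeasure_box[of "\<rho> / 2"] \<rho> by (simp add: Q_def)
  define b where "b = ennreal ((2 * 1) ^ card I * 2 ^ card I) * emeasure (leb I) K"
  have "b < \<infinity>" using Kfin by (simp add: b_def ennreal_mult_less_top)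
  \<comment> \<open>N cubes exceed the volume available in \<open>D\<close>. Once some |x_i| > 4 N
    \<rho>, neighbouring centres differ by |x_i|/(2N) > 2\<rho> in that coordinate, so the cubes of
    side \<rho> are disjoint.\<close>
  then have "\<exists>N::nat. \<not> of_nat N * emeasure (leb I) Q \<le> b"
    using multiple_le_imp_zero[of "emeasure (leb I) Q" b] Qm \<rho> by auto
  then obtain N :: nat where N: "\<not> of_nat N * emeasure (leb I) Q \<le> b" by blast
  have N0: "N > 0" using N by (cases N) auto
  have "\<bar>x i\<bar> \<le> 4 * real N * \<rho>" if x: "x \<in> D" and i: "i \<in> I" for x i
  proof (rule ccontr)
    assume big: "\<not> \<bar>x i\<bar> \<le> 4 * real N * \<rho>"
    let ?v = "\<lambda>j::nat. (real j / (2 * real N)) *\<^sub>R x"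
    let ?U = "\<Union>j<N. {y. y - ?v j \<in> Q}"
    have Qb: "Q \<in> sets borel" unfolding Q_def by (rule box_measurable)
    have vE: "?v j \<in> coord_space I" for j using x D_E by auto
    have Ub: "?U \<in> sets borel" using emeasure_translate(1)[OF Qb vE] by (intro sets.finite_UN) auto
    have "of_nat N * emeasure (leb I) Q \<le> emeasure (leb I) ?U"
    proof (rule disjoint_translates[where v="?v"])
      fix y and j l :: nat assume jl: "j < l" "l < N" and y: "y - ?v j \<in> Q" "y - ?v l \<in> Q"
      have "\<bar>(y - ?v j) i\<bar> \<le> \<rho> / 2" "\<bar>(y - ?v l) i\<bar> \<le> \<rho> / 2" using y i unfolding Q_def by blast+
      then have "\<bar>(y - ?v j) i - (y - ?v l) i\<bar> \<le> \<rho>" using abs_triangle_ineq4[of "(y - ?v j) i" "(y - ?v l) i"] by simp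
      moreover have "(y - ?v j) i - (y - ?v l) i = (real l - real j) / (2 * real N) * x i"
        by (simp add: scaleR_fun_apply diff_divide_distrib left_diff_distrib)
      ultimately have "(real l - real j) / (2 * real N) * \<bar>x i\<bar> \<le> \<rho>" using jl by (simp add: abs_mult)
      moreover have "1 / (2 * real N) * \<bar>x i\<bar> \<le> (real l - real j) / (2 * real N) * \<bar>x i\<bar>"
        using jl N0 by (intro mult_right_mono divide_right_mono) auto
      ultimately have "1 / (2 * real N) * \<bar>x i\<bar> \<le> \<rho>" by (rule order_trans[rotated])
      then have "\<bar>x i\<bar> \<le> \<rho> * (2 * real N)" using N0 by (simp add: pos_divide_le_eq)
      moreover have "\<rho> * (2 * real N) \<le> 4 * real N * \<rho>" using \<rho>(1) by simp
      ultimately show False using big by (meson order_trans)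
    qed (use vE Qb Ub in blast)+
    also have "\<dots> \<le> b"
      unfolding b_def
    proof (rule D_measure[OF Ub])
      fix y assume "y \<in> ?U"
      then obtain j where j: "j < N" "y - ?v j \<in> Q" by blast
      define w where "w = 2 *\<^sub>R (y - ?v j)"
      have "w \<in> D"
      proof (rule \<rho>(2))
        show "w \<in> coord_space I" using j(2) by (simp add: w_def Q_def)
        show "\<forall>i\<in>I. \<bar>w i\<bar> \<le> \<rho>"
        proof
          fix k assume "k \<in> I"
          then have "\<bar>(y - ?v j) k\<bar> \<le> \<rho> / 2" using j(2) unfolding Q_def by blast
          moreover have "w k = 2 * (y - ?v j) k" unfolding w_def by (simp only: scaleR_fun_apply real_scaleR_def)
          moreover have "\<bar>2 * a\<bar> \<le> \<rho>" if "\<bar>a\<bar> \<le> \<rho> / 2" for a using that by (simp add: abs_mult)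
          ultimately show "\<bar>w k\<bar> \<le> \<rho>" by (simp only:)
        qed
      qed
      moreover have "(real j / real N) *\<^sub>R x \<in> D" using j(1) by (intro D_scale[OF x]) (simp add: divide_le_eq)
      ultimately have "(1/2) *\<^sub>R w + (1/2) *\<^sub>R ((real j / real N) *\<^sub>R x) \<in> D"
        by (intro convexD[OF D_convex]) auto
      moreover have "(1/2) *\<^sub>R w + (1/2) *\<^sub>R ((real j / real N) *\<^sub>R x) = y"
        unfolding w_def by (simp add: fun_eq_iff scaleR_fun_apply field_simps)
      ultimately show "(1/1) *\<^sub>R y \<in> D" by simp
    qed simp
    finally show False using N by blast
  qed
  moreover have "0 < 4 * real N * \<rho>" using N0 \<rho> by simp
  ultimately show ?thesis by blast
qed

text \<open>\<open>D\<close> may fail to be closed, so a nearest point need not exist. A point d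
  whose squared distance is minimal up to s^2 M serves instead: comparing with (1 - s) d + s e and
  dividing by s shows that <x - d, e> exceeds <x - d, d> by at most s M \<le> r/2, whereas <x - d,
  x> exceeds it by at least r.\<close>

lemma separation:
  assumes x: "x \<in> coord_space I" and r: "r > 0" and far: "\<And>d. d \<in> D \<Longrightarrow> r \<le> dot I (x - d) (x - d)"
  shows "\<exists>u\<in>coord_space I. (\<forall>d\<in>D. dot I u d \<le> 1) \<and> dot I u x > 1"
proof -
  obtain B where B: "B > 0" "\<And>x i. x \<in> D \<Longrightarrow> i \<in> I \<Longrightarrow> \<bar>x i\<bar> \<le> B" using D_bounded by blast
  define M where "M = real (card I) * (2 * B)\<^sup>2 + 1"
  have M: "M \<ge> 1" by (simp add: M_def)
  have diam: "dot I (d - e) (d - e) \<le> M" if "d \<in> D" "e \<in> D" for d e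
  proof -
    have "(d - e) i * (d - e) i \<le> (2 * B)\<^sup>2" if "i \<in> I" for i
    proof -
      have "\<bar>(d - e) i\<bar> \<le> 2 * B" using B(2)[OF \<open>d \<in> D\<close> that] B(2)[OF \<open>e \<in> D\<close> that] abs_triangle_ineq4[of "d i" "e i"] by simp
      then have "\<bar>(d - e) i\<bar>\<^sup>2 \<le> (2 * B)\<^sup>2" by (rule power_mono) simp
      then show ?thesis by (simp only: power2_abs power2_eq_square)
    qed
    then have "dot I (d - e) (d - e) \<le> (\<Sum>i\<in>I. (2 * B)\<^sup>2)" unfolding dot_def by (intro sum_mono) blast
    then show ?thesis by (simp add: M_def)
  qed
  let ?X = "(\<lambda>d. dot I (x - d) (x - d)) ` D"
  define mm where "mm = Inf ?X"
  have bdd: "bdd_below ?X" by (rule bdd_belowI[of _ 0]) auto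
  have ne: "?X \<noteq> {}" using D_0 by blast
  have mle: "mm \<le> dot I (x - d) (x - d)" if "d \<in> D" for d unfolding mm_def using that bdd by (intro cInf_lower) auto
  define s where "s = min 1 (r / (2 * M))"
  have s: "0 < s" "s \<le> 1" "s * M \<le> r / 2"
  proof -
    show "0 < s" using r M by (simp add: s_def)
    show "s \<le> 1" unfolding s_def by (rule min.cobounded1)
    have "s * M \<le> r / (2 * M) * M" using M by (intro mult_right_mono) (auto simp: s_def)
    then show "s * M \<le> r / 2" using M by simp
  qed
  have "mm < mm + s * s * M" using s M by simp
  then obtain d where d: "d \<in> D" "dot I (x - d) (x - d) < mm + s * s * M"
    using cInf_lessD[OF ne, of "mm + s * s * M"] unfolding mm_def by blast
  define v where "v = x - d"
  have vE: "v \<in> coord_space I" using x d(1) D_E by (auto simp: v_def)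
  define Rv where "Rv = dot I v v"
  have Rv: "r \<le> Rv" unfolding Rv_def v_def by (rule far[OF d(1)])
  have step: "dot I v e \<le> dot I v d + s * M" if e: "e \<in> D" for e
  proof -
    define w where "w = e - d"
    have "(1 - s) *\<^sub>R d + s *\<^sub>R e \<in> D" using s by (intro convexD[OF D_convex d(1) e]) auto
    from mle[OF this] have "mm \<le> dot I (v - s *\<^sub>R w) (v - s *\<^sub>R w)"
    proof -
      assume a: "mm \<le> dot I (x - ((1 - s) *\<^sub>R d + s *\<^sub>R e)) (x - ((1 - s) *\<^sub>R d + s *\<^sub>R e))"
      have "x - ((1 - s) *\<^sub>R d + s *\<^sub>R e) = v - s *\<^sub>R w" unfolding v_def w_def by (simp add: algebra_simps)
      then show ?thesis using a by (simp only:)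
    qed
    also have "\<dots> = Rv - 2 * (s * dot I v w) + s * s * dot I w w"
      unfolding Rv_def by (simp add: dot_simps(3-6) dot_commute[of I w v] algebra_simps)
    also have "s * s * dot I w w \<le> s * s * M" using diam[OF e d(1)] s unfolding w_def by (intro mult_left_mono) auto
    finally have "2 * (s * dot I v w) \<le> (Rv - mm) + s * s * M" by simp
    moreover have "Rv - mm \<le> s * s * M" using d(2) by (simp add: Rv_def v_def)
    ultimately have "s * dot I v w \<le> s * (s * M)" by (simp add: mult.assoc)
    then have "dot I v w \<le> s * M" using s by simp
    then show ?thesis unfolding w_def dot_simps(4) by simp
  qed
  define t where "t = dot I v d + s * M"
  have t0: "0 \<le> t" using step[OF D_0] by (simp only: t_def dot_simps(10))
  have vx: "dot I v x = dot I v d + Rv"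
  proof -
    have "x = d + v" by (simp add: v_def)
    then show ?thesis by (simp only: dot_simps(2) Rv_def)
  qed
  define h where "h = t + r / 4"
  have h: "h > 0" "t \<le> h" "h < dot I v x" using t0 r s(3) Rv unfolding h_def t_def vx by simp_all
  show ?thesis
  proof (intro bexI[of _ "(1/h) *\<^sub>R v"] conjI ballI)
    fix e assume "e \<in> D"
    from step[OF this] have "dot I v e \<le> h" using h by (simp add: t_def)
    then show "dot I ((1/h) *\<^sub>R v) e \<le> 1" unfolding dot_simps(5) using h by simp
  next
    show "dot I ((1/h) *\<^sub>R v) x > 1" unfolding dot_simps(5) using h by simp
  qed (use vE in simp)
qed

theorem Bourgain_Milman:
  "(emeasure (leb I) (uball I))\<^sup>2 \<le> ennreal (192 ^ card I) * (emeasure (leb I) K * emeasure (leb I) (polar_set I K 1))"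
proof -
  obtain B where B: "B > 0" "\<And>x i. x \<in> D \<Longrightarrow> i \<in> I \<Longrightarrow> \<bar>x i\<bar> \<le> B" using D_bounded by blast
  obtain \<rho> where \<rho>: "\<rho> > 0" "\<And>x. x \<in> coord_space I \<Longrightarrow> (\<forall>i\<in>I. \<bar>x i\<bar> \<le> \<rho>) \<Longrightarrow> x \<in> D" using cube_in_D by blast
  define M where "M = real (card I) * B\<^sup>2 + 1"
  have M: "M > 0" by (simp add: M_def add_nonneg_pos)
  have DM: "dot I x x \<le> M" if x: "x \<in> D" for x
  proof -
    have "x i * x i \<le> B\<^sup>2" if "i \<in> I" for i
    proof -
      have "\<bar>x i\<bar>\<^sup>2 \<le> B\<^sup>2" using B(2)[OF x that] by (rule power_mono) simp
      then show ?thesis by (simp only: power2_abs power2_eq_square)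
    qed
    then have "dot I x x \<le> (\<Sum>i\<in>I. B\<^sup>2)" unfolding dot_def by (intro sum_mono) blast
    then show ?thesis by (simp add: M_def)
  qed
  \<comment> \<open>Since |x|^2 \<le> M on \<open>D\<close>, vectors of squared length at most
    \<eta> lie in the polar of \<open>D\<close>.\<close>
  define \<eta> where "\<eta> = 1 / M"
  have \<eta>: "\<eta> > 0" using M by (simp add: \<eta>_def)
  have ball: "dot I x y \<le> 1" if "x \<in> D" "dot I y y \<le> \<eta>" for x y
  proof -
    have "(dot I x y)\<^sup>2 \<le> dot I x x * dot I y y" by (rule dot_Cauchy_Schwarz)
    also have "\<dots> \<le> M * \<eta>" using DM[OF that(1)] that(2) M by (intro mult_mono) auto
    finally have "(dot I x y)\<^sup>2 \<le> 1\<^sup>2" using M by (simp add: \<eta>_def)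
    then show ?thesis by (rule power2_le_imp_le) simp
  qed
  define P where "P = {u \<in> coord_space I. \<forall>d\<in>D. dot I u d \<le> 1}"
  \<comment> \<open>Outside this box one of the functionals sqrt \<eta> e_i, which belong to
    \<open>P\<close>, exceeds 1 in absolute value; so only a compact set has to be covered by
    further functionals.\<close>
  define Q0 where "Q0 = {x \<in> coord_space I. \<forall>i\<in>I. \<bar>x i\<bar> \<le> 1 / sqrt \<eta>}"
  \<comment> \<open>Removing this neighbourhood of \<open>D\<close> leaves points at a definite
    distance, to which \<open>separation\<close> applies. A point of \<open>coord_space I\<close> in
    the neighbourhood is a point of \<open>D\<close> plus a vector of the cube inside
    \<open>D\<close>, hence lies in 2 \<open>D\<close>.\<close>
  define O' where "O' = (\<Union>d\<in>D. {x. dot I (x - d) (x - d) < \<rho>\<^sup>2})"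
  have "open O'"
    unfolding O'_def dot_def minus_apply
    by (intro open_UN ballI open_Collect_less continuous_intros continuous_on_product_then_coordinatewise)
  then have cZ: "compact (Q0 - O')" unfolding Q0_def by (intro compact_diff compact_box)
  have "\<exists>F\<subseteq>P. finite F \<and> Q0 - O' \<subseteq> (\<Union>u\<in>F. {x. 1 < dot I u x})"
  proof (rule compactE_image[OF cZ])
    show "open {x. 1 < dot I u x}" for u
      by (intro open_Collect_less continuous_on_const continuous_on_dot)
    show "Q0 - O' \<subseteq> (\<Union>u\<in>P. {x. 1 < dot I u x})"
    proof
      fix x assume x: "x \<in> Q0 - O'"
      have "\<exists>u\<in>coord_space I. (\<forall>d\<in>D. dot I u d \<le> 1) \<and> dot I u x > 1"
      proof (rule separation)
        show "x \<in> coord_space I" using x by (simp add: Q0_def)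
        show "0 < \<rho>\<^sup>2" using \<rho> by simp
        show "\<rho>\<^sup>2 \<le> dot I (x - d) (x - d)" if "d \<in> D" for d
        proof (rule ccontr)
          assume "\<not> \<rho>\<^sup>2 \<le> dot I (x - d) (x - d)"
          then have "dot I (x - d) (x - d) < \<rho>\<^sup>2" by (rule not_le_imp_less)
          then have "x \<in> O'" unfolding O'_def using that by blast
          then show False using x by blast
        qed
      qed
      then show "x \<in> (\<Union>u\<in>P. {x. 1 < dot I u x})" unfolding P_def by blast
    qed
  qed blast
  then obtain F where F: "F \<subseteq> P" "finite F" "Q0 - O' \<subseteq> (\<Union>u\<in>F. {x. 1 < dot I u x})" by blast
  define F2 where "F2 = F \<union> (\<lambda>i. sqrt \<eta> *\<^sub>R unitv i) ` I"
  have F2: "finite F2" using F(2) I by (simp add: F2_def)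
  have F2P: "F2 \<subseteq> P"
  proof -
    have "sqrt \<eta> *\<^sub>R unitv i \<in> P" if i: "i \<in> I" for i
      unfolding P_def
    proof (intro CollectI conjI ballI)
      show "sqrt \<eta> *\<^sub>R unitv i \<in> coord_space I" using unitv_in[OF i] by simp
      fix d assume d: "d \<in> D"
      have "dot I (sqrt \<eta> *\<^sub>R unitv i) (sqrt \<eta> *\<^sub>R unitv i) = \<eta>"
        unfolding dot_simps(5,6) dot_unitv[OF I i] using \<eta> by (simp add: unitv_def)
      then show "dot I (sqrt \<eta> *\<^sub>R unitv i) d \<le> 1" using ball[OF d] dot_commute by (metis order.refl)
    qed
    then show ?thesis using F(1) by (auto simp: F2_def)
  qed
  obtain u m where um: "F2 = u ` {..<m::nat}" using F2 finite_conv_nat_seg_image[of F2] by (auto simp: lessThan_def)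
  have uP: "u j \<in> P" if "j < m" for j using um F2P that by blast
  have uD: "\<bar>dot I (u j) d\<bar> \<le> 1" if j: "j < m" and d: "d \<in> D" for j d
  proof -
    have "dot I (u j) d \<le> 1" "dot I (u j) (- d) \<le> 1" using uP[OF j] d D_sym[OF d] unfolding P_def by blast+
    then show ?thesis unfolding dot_simps(8) by simp
  qed
  have PD: "(1/2) *\<^sub>R x \<in> D" if x: "x \<in> coord_space I" and px: "\<And>j. j < m \<Longrightarrow> \<bar>dot I (u j) x\<bar> \<le> 1" for x
  proof -
    have f1: "\<bar>dot I w x\<bar> \<le> 1" if "w \<in> F2" for w using that px unfolding um by blast
    have "x \<in> Q0"
      unfolding Q0_def
    proof (intro CollectI conjI ballI x)
      fix i assume i: "i \<in> I"
      have "\<bar>dot I (sqrt \<eta> *\<^sub>R unitv i) x\<bar> \<le> 1" by (rule f1) (use i in \<open>unfold F2_def, blast\<close>)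
      then have "sqrt \<eta> * \<bar>x i\<bar> \<le> 1" unfolding dot_simps(5) dot_unitv[OF I i] using \<eta> by (simp add: abs_mult)
      then show "\<bar>x i\<bar> \<le> 1 / sqrt \<eta>" using \<eta> by (simp add: pos_le_divide_eq mult.commute)
    qed
    moreover have "\<not> 1 < dot I w x" if "w \<in> F" for w using f1[of w] that by (auto simp: F2_def)
    ultimately have "x \<in> O'" using F(3) by blast
    then obtain d where d: "d \<in> D" "dot I (x - d) (x - d) < \<rho>\<^sup>2" unfolding O'_def by blast
    have "x - d \<in> D"
    proof (rule \<rho>(2))
      show "x - d \<in> coord_space I" using x d(1) D_E by (intro coord_space_algebra(3)) auto
      show "\<forall>i\<in>I. \<bar>(x - d) i\<bar> \<le> \<rho>"
      proof
        fix i assume i: "i \<in> I"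
        have "((x - d) i)\<^sup>2 \<le> \<rho>\<^sup>2" using component_le_dot[OF I i] d(2) by (meson less_imp_le order_trans)
        then show "\<bar>(x - d) i\<bar> \<le> \<rho>" using \<rho>(1) by (simp add: abs_le_square_iff[symmetric])
      qed
    qed
    from convexD[OF D_convex d(1) this, of "1/2" "1/2"] have "(1/2) *\<^sub>R d + (1/2) *\<^sub>R (x - d) \<in> D" by simp
    moreover have "(1/2) *\<^sub>R d + (1/2) *\<^sub>R (x - d) = (1/2) *\<^sub>R x" by (simp only: scaleR_add_right[symmetric] add.commute[of d] diff_add_cancel)
    ultimately show ?thesis by simp
  qed
  \<comment> \<open>With \<delta> = \<eta>/4 the error vector d in
    \<open>polytope_lower_bound\<close> satisfies |d|^2 \<le> 4\<delta> = \<eta>, so its product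
    with points of \<open>D\<close> is at most 1.\<close>
  interpret pf: polytope_field I m u "\<eta> / 4"
    by standard (use I \<eta> uP in \<open>auto simp: P_def\<close>)
  define A where "A = {x \<in> coord_space I. \<forall>j\<in>{..<m}. \<bar>dot I (u j) x\<bar> \<le> 4}"
  have Am: "A \<in> sets borel"
  proof -
    have "{x. \<bar>dot I (u j) x\<bar> \<le> 4} \<in> sets borel" for j
      by (intro borel_closed closed_Collect_le continuous_on_rabs continuous_on_dot continuous_on_const)
    then have "coord_space I \<inter> (\<Inter>j\<in>{..<m}. {x. \<bar>dot I (u j) x\<bar> \<le> 4}) \<in> sets borel"
      by (cases "m = 0") (auto intro!: sets.finite_INT)
    moreover have "A = coord_space I \<inter> (\<Inter>j\<in>{..<m}. {x. \<bar>dot I (u j) x\<bar> \<le> 4})" unfolding A_def by blast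
    ultimately show ?thesis by simp
  qed
  \<comment> \<open>The level 3 is 2 for the combination of the functionals plus 1 for the error
    vector.\<close>
  have Pm: "polar_set I K 3 \<in> sets borel" by (rule borel_closed[OF closed_polar_set])
  have "(emeasure (leb I) (uball I))\<^sup>2 \<le> 2 ^ card I * emeasure (leb2 I) (A \<times> polar_set I K 3)"
  proof (rule pf.polytope_lower_bound)
    show "A \<times> polar_set I K 3 \<in> sets borel" using Am Pm by (simp add: borel_prod[symmetric] pair_measureI)
    fix X d :: vec and c :: "nat \<Rightarrow> real"
    assume X: "X \<in> coord_space I" "\<And>j. j < m \<Longrightarrow> \<bar>dot I (u j) X\<bar> \<le> 4" and d: "d \<in> coord_space I" "dot I d d \<le> 4 * (\<eta> / 4)"
      and c: "(\<Sum>j<m. \<bar>c j\<bar>) \<le> 2"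
    have "dot I x (d + pf.comb c) \<le> 3" if x: "x \<in> K" for x
    proof -
      have xD: "x \<in> D" using x K_D by blast
      have "dot I x (pf.comb c) = (\<Sum>j<m. c j * dot I (u j) x)"
        unfolding dot_commute[of I x "pf.comb c"] pf.dot_comb pf.zz_def ..
      also have "\<dots> \<le> (\<Sum>j<m. \<bar>c j\<bar> * 1)"
      proof (rule sum_mono)
        fix j assume "j \<in> {..<m}"
        then have "\<bar>c j\<bar> * \<bar>dot I (u j) x\<bar> \<le> \<bar>c j\<bar> * 1" using uD[of j x] xD by (intro mult_left_mono) auto
        then show "c j * dot I (u j) x \<le> \<bar>c j\<bar> * 1" using abs_ge_self[of "c j * dot I (u j) x"] by (simp add: abs_mult)
      qed
      finally have "dot I x (pf.comb c) \<le> 2" using c by simp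
      moreover have "dot I x d \<le> 1" using ball[OF xD, of d] d by simp
      ultimately show ?thesis unfolding dot_simps(2) by simp
    qed
    then show "(X, d + pf.comb c) \<in> A \<times> polar_set I K 3"
      using X unfolding A_def polar_set_def by blast
  qed
  also have "emeasure (leb2 I) (A \<times> polar_set I K 3) = emeasure (leb I) A * emeasure (leb I) (polar_set I K 3)"
  proof -
    interpret sigma_finite_measure "leb I" by (rule sigma_finite_leb[OF I])
    show ?thesis unfolding leb2_def by (rule emeasure_pair_measure_Times) (use Am Pm in auto)
  qed
  also have "emeasure (leb I) (polar_set I K 3) = ennreal (3 ^ card I) * emeasure (leb I) (polar_set I K 1)"
    by (rule emeasure_polar_set_scale[OF I]) simp
  \<comment> \<open>\<open>A\<close> lies in 8 \<open>D\<close>: a factor 4 from the bound on the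
    functionals, a factor 2 from the approximating polytope. By \<open>D_measure\<close> this costs
    16^n 2^n; with 2^n from the rotated integral and 3^n from the level of the polar set, 192 = 2 *
    32 * 3.\<close>
  also have "2 ^ card I * (emeasure (leb I) A * (ennreal (3 ^ card I) * emeasure (leb I) (polar_set I K 1))) \<le>
     2 ^ card I * ((ennreal ((2 * 8) ^ card I * 2 ^ card I) * emeasure (leb I) K) * (ennreal (3 ^ card I) * emeasure (leb I) (polar_set I K 1)))"
  proof (intro mult_left_mono mult_right_mono D_measure Am)
    fix x assume x: "x \<in> A"
    have "(1/2) *\<^sub>R ((1/4) *\<^sub>R x) \<in> D"
    proof (rule PD)
      show "(1/4) *\<^sub>R x \<in> coord_space I" using x by (simp add: A_def)
      fix j assume "j < m"
      then have "\<bar>dot I (u j) x\<bar> \<le> 4" using x unfolding A_def by blast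
      then show "\<bar>dot I (u j) ((1/4) *\<^sub>R x)\<bar> \<le> 1" unfolding dot_simps(6) by (simp add: abs_mult)
    qed
    then show "(1/8) *\<^sub>R x \<in> D" by simp
  qed simp_all
  also have "\<dots> = ennreal (192 ^ card I) * (emeasure (leb I) K * emeasure (leb I) (polar_set I K 1))"
  proof -
    have "(2::ennreal) ^ card I = ennreal (2 ^ card I)" by (simp add: ennreal_power[symmetric])
    moreover have "ennreal (2 ^ card I) * ennreal ((2 * 8) ^ card I * 2 ^ card I) * ennreal (3 ^ card I) = ennreal (192 ^ card I)"
      by (simp flip: ennreal_mult power_mult_distrib)
    moreover have "a * ((b * k) * (c * r)) = (a * b * c) * (k * r)" for a b c k r :: ennreal by (simp add: ac_simps)
    ultimately show ?thesis by (simp only:)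
  qed
  finally show ?thesis .
qed

end

section \<open>Transfer to the product model of Euclidean space\<close>

lemma space_Rn: "space (Rn n) = Rn_set n"
  by (simp add: Rn_def Rn_set_def space_PiM)

text \<open>The theorem is stated with extensional functions, whose values outside the index range
  are \<open>undefined\<close>, while the proof extends by 0; \<open>restrict\<close> and
  \<open>zext\<close> translate between the two.\<close>

lemma restrict_zext: "x \<in> Rn_set n \<Longrightarrow> restrict (zext {..<n} x) {..<n} = x"
  unfolding Rn_set_def PiE_def extensional_def by (auto simp: zext_def fun_eq_iff restrict_def)

lemma restrict_in_Rn_set: "restrict x {..<n} \<in> Rn_set n"
  by (simp add: Rn_set_def)

lemma Rn_inner_restrict: "Rn_inner n (restrict x {..<n}) y = dot {..<n} x y"
  unfolding Rn_inner_def dot_def by (intro sum.cong) auto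

lemma dot_restrict: "dot {..<n} x (restrict y {..<n}) = dot {..<n} x y"
  unfolding dot_def by (intro sum.cong) auto

lemma emeasure_unit_ball: "emeasure (Rn n) (unit_ball n) = emeasure (leb {..<n}) (uball {..<n})"
proof -
  have "emeasure (leb {..<n}) (uball {..<n}) = emeasure (Rn n) (zext {..<n} -` uball {..<n} \<inter> space (Rn n))"
    unfolding leb_def Rn_def by (rule emeasure_distr[OF measurable_zext measurable_uball])
  also have "zext {..<n} -` uball {..<n} \<inter> space (Rn n) = unit_ball n"
    unfolding space_Rn uball_def unit_ball_def vimage_def
    by (auto simp: dot_zext) (auto simp: dot_def power2_eq_square)
  finally show ?thesis by simp
qed

lemma nn_integral_Rn:
  assumes "(\<lambda>x. f (restrict x {..<n})) \<in> borel_measurable borel"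
  shows "(\<integral>\<^sup>+x. f x \<partial>Rn n) = (\<integral>\<^sup>+x. f (restrict x {..<n}) \<partial>leb {..<n})"
proof -
  have "(\<integral>\<^sup>+x. f (restrict x {..<n}) \<partial>leb {..<n}) = (\<integral>\<^sup>+x. f (restrict (zext {..<n} x) {..<n}) \<partial>Rn n)"
    unfolding Rn_def by (rule nn_integral_leb[OF assms])
  also have "\<dots> = (\<integral>\<^sup>+x. f x \<partial>Rn n)"
    by (intro nn_integral_cong) (simp only: space_Rn restrict_zext)
  finally show ?thesis by simp
qed

lemma continuous_on_restrict_vec: "continuous_on UNIV (\<lambda>x::vec. restrict x A)"
proof (rule continuous_on_coordinatewise_then_product)
  fix i show "continuous_on UNIV (\<lambda>x::vec. restrict x A i)"
    by (cases "i \<in> A") (simp_all add: continuous_on_product_coordinates)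
qed

text \<open>\<open>restrict\<close> is continuous, so an open set witnessing lower semicontinuity
  among extensional functions pulls back to the whole function space. \<open>Liminf\<close> ignores
  the base point, which is therefore treated separately.\<close>

lemma closed_sublevel:
  fixes \<phi> :: "vec \<Rightarrow> ereal"
  assumes lsc: "\<And>x. x \<in> Rn_set n \<Longrightarrow> \<phi> x \<le> Liminf (at x within Rn_set n) \<phi>"
  shows "closed {x. \<phi> (restrict x {..<n}) \<le> a}"
proof -
  have "open {x. a < \<phi> (restrict x {..<n})}"
    unfolding open_subopen[of "{x. a < \<phi> (restrict x {..<n})}"]
  proof
    fix x assume "x \<in> {x. a < \<phi> (restrict x {..<n})}"
    then have a: "a < \<phi> (restrict x {..<n})" by simp
    also have "\<dots> \<le> Liminf (at (restrict x {..<n}) within Rn_set n) \<phi>" by (rule lsc[OF restrict_in_Rn_set])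
    finally have "eventually (\<lambda>z. a < \<phi> z) (at (restrict x {..<n}) within Rn_set n)" by (rule less_LiminfD)
    then obtain S where S: "open S" "restrict x {..<n} \<in> S" "\<And>z. z \<in> S \<Longrightarrow> z \<noteq> restrict x {..<n} \<Longrightarrow> z \<in> Rn_set n \<Longrightarrow> a < \<phi> z"
      unfolding eventually_at_topological by blast
    have "open ((\<lambda>x. restrict x {..<n}) -` S)" using continuous_on_restrict_vec S(1) by (simp add: open_vimage)
    moreover have "x \<in> (\<lambda>x. restrict x {..<n}) -` S" using S(2) by blast
    moreover have "(\<lambda>x. restrict x {..<n}) -` S \<subseteq> {x. a < \<phi> (restrict x {..<n})}"
    proof
      fix y assume "y \<in> (\<lambda>x. restrict x {..<n}) -` S"
      then have y: "restrict y {..<n} \<in> S" by blast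
      have "a < \<phi> (restrict y {..<n})"
      proof (cases "restrict y {..<n} = restrict x {..<n}")
        case True then show ?thesis using a by metis
      next
        case False then show ?thesis by (rule S(3)[OF y _ restrict_in_Rn_set])
      qed
      then show "y \<in> {x. a < \<phi> (restrict x {..<n})}" by blast
    qed
    ultimately show "\<exists>T. open T \<and> x \<in> T \<and> T \<subseteq> {x. a < \<phi> (restrict x {..<n})}" by blast
  qed
  moreover have "{x. \<phi> (restrict x {..<n}) \<le> a} = - {x. a < \<phi> (restrict x {..<n})}" by (auto simp: not_less)
  ultimately show ?thesis by (simp only: closed_open double_complement)
qed

text \<open>The conventions for a zero denominator are those that turn a bound on the quotient into
  the linear inequality a \<le> t b: at b = 0 it reads a \<le> 0. An infinite b gives the quotient
  0.\<close>

lemma polar_quot_le_iff: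
  assumes b: "0 \<le> b" and t: "0 \<le> t"
  shows "polar_quot a b \<le> ereal t \<longleftrightarrow> b = \<infinity> \<or> a \<le> t * real_of_ereal b"
proof (cases b)
  case (real c)
  show ?thesis
  proof (cases "c = 0")
    case True
    then show ?thesis using real t by (simp add: polar_quot_def zero_ereal_def)
  next
    case False
    then have "c > 0" using b real by simp
    then show ?thesis using real False by (simp add: polar_quot_def pos_divide_le_eq)
  qed
qed (use b t in \<open>auto simp: polar_quot_def\<close>)

locale geometric_function =
  fixes n :: nat and \<phi> :: "vec \<Rightarrow> ereal"
  assumes gc: "geometric_convex n \<phi>"
begin

abbreviation I :: "nat set" where "I \<equiv> {..<n}"

definition f :: "vec \<Rightarrow> ereal" where
  "f x = \<phi> (restrict x I)"

definition g :: "vec \<Rightarrow> ereal" where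
  "g x = polarity n \<phi> (restrict x I)"

lemma \<phi>_nonneg: "x \<in> Rn_set n \<Longrightarrow> 0 \<le> \<phi> x"
  using gc by (simp add: geometric_convex_def)

lemma f_nonneg: "0 \<le> f x"
  unfolding f_def by (rule \<phi>_nonneg[OF restrict_in_Rn_set])

lemma closed_f: "closed {x. f x \<le> a}"
  unfolding f_def using gc by (intro closed_sublevel) (simp add: geometric_convex_def)

lemma f_0: "f 0 = 0"
proof -
  have "restrict (0::vec) I = Rn_zero n" by (auto simp: Rn_zero_def restrict_def fun_eq_iff)
  then show ?thesis using gc by (simp add: f_def geometric_convex_def)
qed

lemma f_convex:
  assumes "0 \<le> s" "s \<le> 1"
  shows "f (s *\<^sub>R x + (1 - s) *\<^sub>R y) \<le> ereal s * f x + ereal (1 - s) * f y"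
proof -
  have "restrict (s *\<^sub>R x + (1 - s) *\<^sub>R y) I = Rn_comb n s (restrict x I) (restrict y I)"
    by (auto simp: Rn_comb_def restrict_def fun_eq_iff scaleR_fun_apply)
  then show ?thesis using gc assms restrict_in_Rn_set[of x n] restrict_in_Rn_set[of y n]
    unfolding geometric_convex_def f_def by (metis atLeastAtMost_iff)
qed

text \<open>Exhibits the sublevel sets of the polar as intersections of half-spaces, from which both
  their closedness and the inequalities <x,y> \<le> 1 + st are read off.\<close>

lemma g_le_iff:
  assumes t: "0 \<le> t"
  shows "g y \<le> ereal t \<longleftrightarrow> (\<forall>x. f x = \<infinity> \<or> dot I x y - 1 \<le> t * real_of_ereal (f x))"
proof -
  have "g y \<le> ereal t \<longleftrightarrow> (\<forall>x\<in>Rn_set n. \<phi> x = \<infinity> \<or> dot I y x - 1 \<le> t * real_of_ereal (\<phi> x))"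
    unfolding g_def polarity_def SUP_le_iff Rn_inner_restrict using polar_quot_le_iff[OF \<phi>_nonneg t] by simp
  also have "\<dots> \<longleftrightarrow> (\<forall>x. f x = \<infinity> \<or> dot I x y - 1 \<le> t * real_of_ereal (f x))"
  proof (intro iffI allI ballI)
    fix x assume a: "\<forall>x\<in>Rn_set n. \<phi> x = \<infinity> \<or> dot I y x - 1 \<le> t * real_of_ereal (\<phi> x)"
    show "f x = \<infinity> \<or> dot I x y - 1 \<le> t * real_of_ereal (f x)"
      using bspec[OF a restrict_in_Rn_set[of x n]] unfolding f_def dot_restrict dot_commute[of I y x] .
  next
    fix x assume a: "\<forall>x. f x = \<infinity> \<or> dot I x y - 1 \<le> t * real_of_ereal (f x)" and x: "x \<in> Rn_set n"
    have r: "restrict x I = x" using x unfolding Rn_set_def PiE_def extensional_def by (auto simp: restrict_def fun_eq_iff)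
    show "\<phi> x = \<infinity> \<or> dot I y x - 1 \<le> t * real_of_ereal (\<phi> x)"
      using spec[OF a, of x] unfolding f_def r dot_commute[of I y x] .
  qed
  finally show ?thesis .
qed

lemma g_nonneg: "0 \<le> g y"
proof -
  have z: "Rn_zero n \<in> Rn_set n" by (simp add: Rn_zero_def Rn_set_def)
  have "\<phi> (Rn_zero n) = 0" using gc by (simp add: geometric_convex_def)
  then have "polar_quot (Rn_inner n (restrict y I) (Rn_zero n) - 1) (\<phi> (Rn_zero n)) = 0"
    by (simp add: polar_quot_def Rn_inner_def Rn_zero_def)
  then show ?thesis unfolding g_def polarity_def
    using SUP_upper[OF z, of "\<lambda>x. polar_quot (Rn_inner n (restrict y I) x - 1) (\<phi> x)"] by (simp only:)
qed

lemma closed_g: "closed {y. g y \<le> a}"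
proof (cases a)
  case (real t)
  show ?thesis
  proof (cases "0 \<le> t")
    case True
    have "{y. g y \<le> a} = (\<Inter>x\<in>{x. f x \<noteq> \<infinity>}. {y. dot I x y - 1 \<le> t * real_of_ereal (f x)})"
      unfolding real g_le_iff[OF True] by blast
    also have "closed \<dots>"
      by (intro closed_INT ballI closed_Collect_le continuous_on_diff continuous_on_dot continuous_on_const)
    finally show ?thesis .
  next
    case False
    have "a < g y" for y
      by (rule less_le_trans[OF _ g_nonneg]) (use False real in simp)
    then have "{y. g y \<le> a} = {}" by (simp add: not_le)
    then show ?thesis by simp
  qed
next
  case MInf
  have "a < g y" for y by (rule less_le_trans[OF _ g_nonneg]) (use MInf in simp)
  then have "{y. g y \<le> a} = {}" by (simp add: not_le)
  then show ?thesis by simp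
qed simp

lemma measurable_f [measurable]: "f \<in> borel_measurable borel"
  unfolding borel_measurable_iff_Iic_ereal using borel_closed[OF closed_f] by (simp add: vimage_def)

lemma measurable_g [measurable]: "g \<in> borel_measurable borel"
  unfolding borel_measurable_iff_Iic_ereal using borel_closed[OF closed_g] by (simp add: vimage_def)

end

section \<open>Integrals of \<open>exp_neg\<close> by sublevel sets\<close>

lemma measurable_exp_neg [measurable]: "exp_neg \<in> borel_measurable borel"
  unfolding exp_neg_def[abs_def] by measurable

lemma exp_neg_layer:
  assumes "0 \<le> v"
  shows "ennreal (exp_neg v) = (\<integral>\<^sup>+s. ennreal (exp (- s)) * indicator {0<..} s * (if v \<le> ereal s then 1 else 0) \<partial>lborel)"
proof (cases v)
  case (real c)
  then show ?thesis using assms nn_integral_exp_tail[of c] by (simp add: exp_neg_def)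
qed (use assms in \<open>auto simp: exp_neg_def\<close>)

lemma int_exp_neg_layer:
  fixes I :: "nat set" and f :: "vec \<Rightarrow> ereal"
  assumes I: "finite I" and [measurable]: "f \<in> borel_measurable borel" and nn: "\<And>x. 0 \<le> f x"
  shows "(\<integral>\<^sup>+x. ennreal (exp_neg (f x)) \<partial>leb I) = (\<integral>\<^sup>+s. (ennreal (exp (- s)) * emeasure (leb I) {x. f x \<le> ereal s}) * indicator {0<..} s \<partial>lborel)"
    and "(\<lambda>s. emeasure (leb I) {x. f x \<le> ereal s}) \<in> borel_measurable borel"
proof -
  interpret sigma_finite_measure "leb I" by (rule sigma_finite_leb[OF I])
  interpret pair_sigma_finite "leb I" lborel ..
  have e: "(\<integral>\<^sup>+x. (if f x \<le> ereal s then 1 else 0) \<partial>leb I) = emeasure (leb I) {x. f x \<le> ereal s}" for s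
  proof -
    have "(\<integral>\<^sup>+x. (if f x \<le> ereal s then 1 else 0) \<partial>leb I) = (\<integral>\<^sup>+x. indicator {x. f x \<le> ereal s} x \<partial>leb I)"
      by (intro nn_integral_cong) (simp add: indicator_def)
    also have "\<dots> = emeasure (leb I) {x. f x \<le> ereal s}" by (rule nn_integral_indicator) measurable
    finally show ?thesis .
  qed
  have "(\<lambda>s. \<integral>\<^sup>+x. (if f x \<le> ereal s then 1 else 0) \<partial>leb I) \<in> borel_measurable borel" by measurable
  then show "(\<lambda>s. emeasure (leb I) {x. f x \<le> ereal s}) \<in> borel_measurable borel" by (simp only: e)
  have "(\<integral>\<^sup>+x. ennreal (exp_neg (f x)) \<partial>leb I) =
     (\<integral>\<^sup>+x. (\<integral>\<^sup>+s. ennreal (exp (- s)) * indicator {0<..} s * (if f x \<le> ereal s then 1 else 0) \<partial>lborel) \<partial>leb I)"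
    by (simp only: exp_neg_layer[OF nn])
  also have "\<dots> = (\<integral>\<^sup>+s. (\<integral>\<^sup>+x. ennreal (exp (- s)) * indicator {0<..} s * (if f x \<le> ereal s then 1 else 0) \<partial>leb I) \<partial>lborel)"
    by (rule Fubini'[symmetric]) measurable
  also have "\<dots> = (\<integral>\<^sup>+s. (ennreal (exp (- s)) * emeasure (leb I) {x. f x \<le> ereal s}) * indicator {0<..} s \<partial>lborel)"
  proof (rule nn_integral_cong)
    fix s :: real
    have "(\<integral>\<^sup>+x. ennreal (exp (- s)) * indicator {0<..} s * (if f x \<le> ereal s then 1 else 0) \<partial>leb I) =
      ennreal (exp (- s)) * indicator {0<..} s * (\<integral>\<^sup>+x. (if f x \<le> ereal s then 1 else 0) \<partial>leb I)"
      by (rule nn_integral_cmult) measurable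
    then show "(\<integral>\<^sup>+x. ennreal (exp (- s)) * indicator {0<..} s * (if f x \<le> ereal s then 1 else 0) \<partial>leb I) =
      (ennreal (exp (- s)) * emeasure (leb I) {x. f x \<le> ereal s}) * indicator {0<..} s"
      unfolding e by (simp add: ac_simps)
  qed
  finally show "(\<integral>\<^sup>+x. ennreal (exp_neg (f x)) \<partial>leb I) = (\<integral>\<^sup>+s. (ennreal (exp (- s)) * emeasure (leb I) {x. f x \<le> ereal s}) * indicator {0<..} s \<partial>lborel)" .
qed

section \<open>The two inequalities\<close>

text \<open>Relative to n!, the range r < n/4 contributes at most a multiple of n (3/4)^n; one more
  factor n makes this O(1/n). With x = n/4 the bound follows from 3/4 \<le> exp (-1/4) and x/2 \<le>
  exp (x/2), and 64 is 8^2 because x/2 = n/8.\<close>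

lemma square_times_power_le: "(real n)\<^sup>2 * (3/4) ^ n \<le> 64"
proof -
  define x where "x = real n / 4"
  have x0: "0 \<le> x" by (simp add: x_def)
  have "(3/4::real) \<le> exp (- (1/4))" using exp_ge_add_one_self[of "- (1/4)"] by simp
  then have "(3/4::real) ^ n \<le> exp (- (1/4)) ^ n" by (intro power_mono) auto
  also have "\<dots> = exp (- x)" by (simp add: x_def exp_of_nat_mult[symmetric])
  finally have 1: "(3/4::real) ^ n \<le> exp (- x)" .
  have "x / 2 \<le> exp (x / 2)" using exp_ge_add_one_self[of "x / 2"] by linarith
  then have "(x / 2)\<^sup>2 \<le> (exp (x / 2))\<^sup>2" using x0 by (intro power_mono) auto
  also have "\<dots> = exp x" by (simp add: exp_double[symmetric])
  finally have "(x / 2)\<^sup>2 * exp (- x) \<le> exp x * exp (- x)" by (intro mult_right_mono) auto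
  then have 2: "(x / 2)\<^sup>2 * exp (- x) \<le> 1" by (simp add: exp_minus)
  have "(real n)\<^sup>2 * (3/4) ^ n \<le> (real n)\<^sup>2 * exp (- x)" using 1 by (intro mult_left_mono) auto
  also have "\<dots> = 64 * ((x / 2)\<^sup>2 * exp (- x))" by (simp add: x_def power2_eq_square)
  also have "\<dots> \<le> 64 * 1" using 2 by (intro mult_left_mono) auto
  finally show ?thesis by simp
qed

text \<open>The first term comes from \<open>r > n/4\<close>, where \<open>(1 + r\<^sup>2)\<^bsup>n/2\<^esup> \<le> r\<^sup>n e\<^bsup>8/n\<^esup>\<close>, the second from \<open>r \<le> n/4\<close>.\<close>
definition radial_const :: real where
  "radial_const = 8 * exp 8 + 16 * exp 4"

lemma radial_const_pos: "radial_const > 0" by (simp add: radial_const_def add_pos_pos)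

lemma radial_integral_le:
  assumes n: "n \<ge> 1"
  shows "(\<integral>\<^sup>+r. ennreal (exp (- r) * sqrt (1 + r\<^sup>2) ^ n) * indicator {0<..} r \<partial>lborel) \<le> ennreal (fact n * (1 + radial_const / real n))"
proof -
  have n0: "real n > 0" using n by simp
  define b where "b = (1 + real n / 4) ^ n"
  have pt: "ennreal (exp (- r) * sqrt (1 + r\<^sup>2) ^ n) * indicator {0<..} r \<le>
     ennreal (exp (8 / real n)) * (ennreal (r ^ n * exp (- r)) * indicator {0..} r) + ennreal b * indicator {0..real n / 4} r" for r
  proof (cases "0 < r")
    case False
    then show ?thesis by simp
  next
    case r: True
    show ?thesis
    proof (cases "r < real n / 4")
      case True
      have "1 + r\<^sup>2 \<le> (1 + r)\<^sup>2" using r by (simp add: power2_eq_square algebra_simps)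
      then have "sqrt (1 + r\<^sup>2) \<le> 1 + r" using r by (intro real_le_lsqrt) auto
      then have "sqrt (1 + r\<^sup>2) ^ n \<le> b" unfolding b_def using True by (intro power_mono) auto
      moreover have "exp (- r) \<le> 1" using r by simp
      ultimately have "exp (- r) * sqrt (1 + r\<^sup>2) ^ n \<le> 1 * b" by (intro mult_mono) auto
      then have "ennreal (exp (- r) * sqrt (1 + r\<^sup>2) ^ n) \<le> ennreal b" by (intro ennreal_leI) simp
      then show ?thesis using r True by (auto intro: add_increasing)
    next
      case False
      \<comment> \<open>Pulling out r leaves 1 + 1/r^2 \<le> exp (1/r^2); the n-th power then costs
        exp (n/(2 r^2)), at most exp (8/n) for r \<ge> n/4.\<close>
      have "sqrt (1 + r\<^sup>2) \<le> r * exp (1 / (2 * r\<^sup>2))"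
      proof (rule real_le_lsqrt)
        have "1 + 1 / r\<^sup>2 \<le> exp (1 / r\<^sup>2)" by (rule exp_ge_add_one_self)
        then have "r\<^sup>2 * (1 + 1 / r\<^sup>2) \<le> r\<^sup>2 * exp (1 / r\<^sup>2)" by (intro mult_left_mono) auto
        moreover have "r\<^sup>2 * (1 + 1 / r\<^sup>2) = 1 + r\<^sup>2" using r by (simp add: field_simps)
        moreover have "(exp (1 / (2 * r\<^sup>2)))\<^sup>2 = exp (1 / r\<^sup>2)" by (simp add: exp_double[symmetric])
        ultimately show "1 + r\<^sup>2 \<le> (r * exp (1 / (2 * r\<^sup>2)))\<^sup>2" by (simp add: power_mult_distrib)
      qed (use r in auto)
      then have "sqrt (1 + r\<^sup>2) ^ n \<le> (r * exp (1 / (2 * r\<^sup>2))) ^ n" by (intro power_mono) auto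
      also have "\<dots> = r ^ n * exp (real n * (1 / (2 * r\<^sup>2)))" by (simp only: power_mult_distrib exp_of_nat_mult)
      also have "\<dots> \<le> r ^ n * exp (8 / real n)"
      proof -
        have "(real n / 4)\<^sup>2 \<le> r\<^sup>2" using False n0 by (intro power_mono) auto
        then have "real n * real n \<le> 16 * r\<^sup>2" by (simp add: power2_eq_square)
        then have "real n * (1 / (2 * r\<^sup>2)) \<le> 8 / real n" using r n0 by (simp add: field_simps)
        then show ?thesis using r by (intro mult_left_mono) auto
      qed
      finally have "exp (- r) * sqrt (1 + r\<^sup>2) ^ n \<le> exp (- r) * (r ^ n * exp (8 / real n))" by (intro mult_left_mono) auto
      then have "ennreal (exp (- r) * sqrt (1 + r\<^sup>2) ^ n) \<le> ennreal (exp (8 / real n)) * ennreal (r ^ n * exp (- r))"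
        using r by (subst ennreal_mult[symmetric]) (auto intro!: ennreal_leI simp: ac_simps)
      then show ?thesis using r by (auto intro: add_increasing2)
    qed
  qed
  have "(\<integral>\<^sup>+r. ennreal (exp (- r) * sqrt (1 + r\<^sup>2) ^ n) * indicator {0<..} r \<partial>lborel) \<le>
    (\<integral>\<^sup>+r. ennreal (exp (8 / real n)) * (ennreal (r ^ n * exp (- r)) * indicator {0..} r) + ennreal b * indicator {0..real n / 4} r \<partial>lborel)"
    by (intro nn_integral_mono pt)
  also have "\<dots> = ennreal (exp (8 / real n)) * (\<integral>\<^sup>+r. ennreal (r ^ n * exp (- r)) * indicator {0..} r \<partial>lborel) + ennreal b * ennreal (real n / 4)"
    using n0 by (simp add: nn_integral_add nn_integral_cmult nn_integral_cmult_indicator)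
  also have "(\<integral>\<^sup>+r. ennreal (r ^ n * exp (- r)) * indicator {0..} r \<partial>lborel) = ennreal (fact n)"
    using nn_intergal_power_times_exp_Ici[of n] by simp
  also have "ennreal (exp (8 / real n)) * ennreal (fact n) + ennreal b * ennreal (real n / 4) = ennreal (exp (8 / real n) * fact n + b * (real n / 4))"
    by (subst ennreal_plus) (simp_all add: b_def ennreal_mult del: times_divide_eq_right)
  also have "\<dots> \<le> ennreal (fact n * (1 + radial_const / real n))"
  proof (rule ennreal_leI)
    have "exp (8 / real n) \<le> 1 + 8 * exp 8 / real n"
    proof -
      define x where "x = 8 / real n"
      have x: "0 \<le> x" "x \<le> 8" using n by (auto simp: x_def divide_le_eq)
      have "1 - x \<le> exp (- x)" using exp_ge_add_one_self[of "- x"] by simp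
      then have "exp x * (1 - x) \<le> exp x * exp (- x)" by (intro mult_left_mono) auto
      then have "exp x \<le> 1 + x * exp x" by (simp add: exp_minus algebra_simps)
      also have "x * exp x \<le> x * exp 8" using x by (intro mult_left_mono) auto
      finally show ?thesis by (simp add: x_def)
    qed
    then have 1: "exp (8 / real n) * fact n \<le> (1 + 8 * exp 8 / real n) * fact n" by (intro mult_right_mono) auto
    have 2: "b * (real n / 4) \<le> (16 * exp 4 / real n) * fact n"
    proof -
      have "(1 + 4 / real n) ^ n \<le> exp (4 / real n) ^ n" using n0 by (intro power_mono exp_ge_add_one_self) auto
      also have "\<dots> = exp 4" using n0 by (simp add: exp_of_nat_mult[symmetric])
      finally have e4: "(1 + 4 / real n) ^ n \<le> exp 4" .
      have "b = (real n / 4) ^ n * (1 + 4 / real n) ^ n"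
      proof -
        have "(real n / 4) * (1 + 4 / real n) = 1 + real n / 4" using n0 by (simp add: field_simps)
        then show ?thesis unfolding b_def power_mult_distrib[symmetric] by (simp only:)
      qed
      also have "\<dots> \<le> (real n / 4) ^ n * exp 4" using e4 n0 by (intro mult_left_mono) auto
      finally have b1: "b \<le> (real n / 4) ^ n * exp 4" .
      \<comment> \<open>A single term of the exponential series; with e \<le> 3 it gives (n/4)^n
        \<le> (3/4)^n n!.\<close>
      have "real n ^ n / fact n \<le> exp (real n)"
      proof -
        have "(\<lambda>k. real n ^ k /\<^sub>R fact k) sums exp (real n)" by (rule exp_converges)
        then have "(\<Sum>k\<in>{n}. real n ^ k /\<^sub>R fact k) \<le> exp (real n)"
          using sum_le_suminf[of "\<lambda>k. real n ^ k /\<^sub>R fact k" "{n}"] by (auto simp: sums_iff)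
        then show ?thesis by (simp add: divide_inverse_commute)
      qed
      also have "exp (real n) = exp 1 ^ n" using exp_of_nat_mult[of n "1::real"] by simp
      also have "\<dots> \<le> 3 ^ n" using exp_le by (intro power_mono) auto
      finally have "real n ^ n \<le> 3 ^ n * fact n" by (simp add: divide_le_eq)
      then have "(real n / 4) ^ n \<le> (3/4) ^ n * fact n" by (simp add: power_divide divide_right_mono)
      then have "(real n / 4) ^ n * exp 4 \<le> ((3/4) ^ n * fact n) * exp 4" by (intro mult_right_mono) auto
      then have "b \<le> ((3/4) ^ n * fact n) * exp 4" by (rule order_trans[OF b1])
      then have "b * (real n / 4) \<le> (((3/4) ^ n * fact n) * exp 4) * (real n / 4)" by (rule mult_right_mono) simp
      also have "\<dots> = ((real n)\<^sup>2 * (3/4) ^ n) * (fact n * exp 4 / (4 * real n))" using n0 by (simp add: power2_eq_square)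
      also have "\<dots> \<le> 64 * (fact n * exp 4 / (4 * real n))" using square_times_power_le[of n] n0 by (intro mult_right_mono) auto
      finally show ?thesis by (simp add: ac_simps)
    qed
    have "(1 + 8 * exp 8 / real n) * fact n + (16 * exp 4 / real n) * fact n = fact n * (1 + radial_const / real n)"
      by (simp add: radial_const_def add_divide_distrib algebra_simps)
    with add_mono[OF 1 2] show "exp (8 / real n) * fact n + b * (real n / 4) \<le> fact n * (1 + radial_const / real n)" by simp
  qed
  finally show ?thesis .
qed

section \<open>The two bounds for a geometric convex function\<close>

context geometric_function
begin

lemma int_f: "int_exp_neg n \<phi> = (\<integral>\<^sup>+x. ennreal (exp_neg (f x)) \<partial>leb I)"
  unfolding int_exp_neg_def f_def
  by (rule nn_integral_Rn) (simp only: f_def[symmetric], measurable)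

lemma int_g: "int_exp_neg n (polarity n \<phi>) = (\<integral>\<^sup>+x. ennreal (exp_neg (g x)) \<partial>leb I)"
  unfolding int_exp_neg_def g_def
  by (rule nn_integral_Rn) (simp only: g_def[symmetric], measurable)

lemma f_contract:
  assumes "1 \<le> r" "f x \<le> ereal r" shows "f ((1/r) *\<^sub>R x) \<le> 1"
proof -
  have "f ((1/r) *\<^sub>R x + (1 - 1/r) *\<^sub>R 0) \<le> ereal (1/r) * f x + ereal (1 - 1/r) * f 0"
    using assms(1) by (intro f_convex) auto
  also have "\<dots> = ereal (1/r) * f x" by (simp add: f_0)
  also have "\<dots> \<le> ereal (1/r) * ereal r" using assms by (intro ereal_mult_left_mono) auto
  also have "\<dots> = 1" using assms(1) by simp
  finally show ?thesis by simp
qed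

theorem lower_bound:
  assumes n: "n \<ge> 1" and pos: "0 < int_exp_neg n \<phi>" and fin: "int_exp_neg n \<phi> < \<infinity>"
  shows "ennreal ((exp (- 2) / 192) ^ n) * (emeasure (Rn n) (unit_ball n))\<^sup>2 \<le> int_exp_neg n \<phi> * int_exp_neg n (polarity n \<phi>)"
proof -
  define K where "K = {x \<in> coord_space I. f x \<le> 1}"
  have Km: "K \<in> sets borel"
  proof -
    have "K = coord_space I \<inter> {x. f x \<le> 1}" unfolding K_def by blast
    then show ?thesis using borel_closed[OF closed_f] measurable_coord_space by simp
  qed
  have e1: "ennreal (exp (- 1)) \<le> ennreal (exp_neg v)" if v: "0 \<le> v" "v \<le> 1" for v
  proof -
    obtain r where r: "v = ereal r" "r \<le> 1" using v by (cases v) auto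
    then have "exp (- 1) \<le> exp (- r)" by simp
    then show ?thesis using r by (intro ennreal_leI) (simp add: exp_neg_def)
  qed
  have lowK: "ennreal (exp (- 1)) * emeasure (leb I) K \<le> int_exp_neg n \<phi>"
  proof -
    have "ennreal (exp (- 1)) * emeasure (leb I) K = (\<integral>\<^sup>+x. ennreal (exp (- 1)) * indicator K x \<partial>leb I)"
      using Km by (simp add: nn_integral_cmult_indicator)
    also have "\<dots> \<le> int_exp_neg n \<phi>" unfolding int_f
      by (intro nn_integral_mono) (use e1 f_nonneg in \<open>auto simp: indicator_def K_def\<close>)
    finally show ?thesis .
  qed
  interpret cb: convex_body I K
  proof
    show "K \<subseteq> coord_space I" by (auto simp: K_def)
    show "0 \<in> K" by (simp add: K_def f_0)
    show "convex K"
    proof (rule convexI)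
      fix x y :: vec and s t :: real
      assume x: "x \<in> K" and y: "y \<in> K" and st: "0 \<le> s" "0 \<le> t" "s + t = 1"
      have t: "t = 1 - s" using st by simp
      have xy: "f x \<le> 1" "f y \<le> 1" "x \<in> coord_space I" "y \<in> coord_space I" using x y by (auto simp: K_def)
      have "f (s *\<^sub>R x + (1 - s) *\<^sub>R y) \<le> ereal s * f x + ereal (1 - s) * f y" using st by (intro f_convex) auto
      also have "\<dots> \<le> ereal s * 1 + ereal (1 - s) * 1" using st xy by (intro add_mono ereal_mult_left_mono) auto
      also have "\<dots> = 1" by (simp add: one_ereal_def)
      finally show "s *\<^sub>R x + t *\<^sub>R y \<in> K" unfolding t K_def using xy by simp
    qed
    show "emeasure (leb I) K < \<infinity>"
    proof (rule ccontr)
      assume "\<not> emeasure (leb I) K < \<infinity>"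
      then have "emeasure (leb I) K = \<infinity>" by (simp only: infinity_ennreal_def less_top[symmetric] not_not)
      then show False using lowK fin by (simp add: ennreal_mult_top)
    qed
    show "0 < emeasure (leb I) K"
    proof (rule ccontr)
      assume "\<not> 0 < emeasure (leb I) K"
      then have k0: "emeasure (leb I) K = 0" by simp
      \<comment> \<open>Convexity and f 0 = 0 put the sublevel set at level r \<ge> 1 inside r
        \<open>K\<close>. If \<open>K\<close> were null, f would thus be infinite almost everywhere
        and its integral zero.\<close>
      have zero: "emeasure (leb I) {x \<in> coord_space I. f x \<le> ereal (real (Suc k))} = 0" for k :: nat
      proof -
        let ?r = "real (Suc k)"
        have "{x \<in> coord_space I. f x \<le> ereal ?r} \<subseteq> (\<lambda>x. ?r *\<^sub>R x) ` K"
        proof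
          fix x assume x: "x \<in> {x \<in> coord_space I. f x \<le> ereal ?r}"
          have "(1/?r) *\<^sub>R x \<in> K" unfolding K_def using f_contract[of ?r x] x by simp
          moreover have "x = ?r *\<^sub>R ((1/?r) *\<^sub>R x)" by simp
          ultimately show "x \<in> (\<lambda>x. ?r *\<^sub>R x) ` K" by blast
        qed
        moreover have "emeasure (leb I) ((\<lambda>x. ?r *\<^sub>R x) ` K) = ennreal (?r ^ card I) * emeasure (leb I) K"
          by (rule emeasure_leb_scale) (use Km in auto)
        moreover have "(\<lambda>x. ?r *\<^sub>R x) ` K \<in> sets borel"
        proof -
          have "(\<lambda>x. ?r *\<^sub>R x) ` K = (\<lambda>x. (1/?r) *\<^sub>R x) -` K \<inter> space borel"
          proof -
            have "x \<in> (\<lambda>x. ?r *\<^sub>R x) ` K" if "(1/?r) *\<^sub>R x \<in> K" for x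
              using that by (intro image_eqI[of _ _ "(1/?r) *\<^sub>R x"]) auto
            then show ?thesis by auto
          qed
          moreover have "(\<lambda>x::vec. (1/?r) *\<^sub>R x) \<in> borel_measurable borel" by measurable
          ultimately show ?thesis using measurable_sets[OF _ Km] by metis
        qed
        ultimately show ?thesis using k0 emeasure_mono[of "{x \<in> coord_space I. f x \<le> ereal ?r}" "(\<lambda>x. ?r *\<^sub>R x) ` K" "leb I"] by simp
      qed
      have "AE x in leb I. \<not> (x \<in> coord_space I \<and> f x \<le> ereal (real (Suc k)))" for k :: nat
        by (rule AE_I[OF _ zero[of k]]) (use measurable_coord_space in \<open>auto simp: Collect_conj_eq intro!: borel_closed closed_f\<close>)
      then have "AE x in leb I. \<forall>k::nat. \<not> (x \<in> coord_space I \<and> f x \<le> ereal (real (Suc k)))"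
        by (simp only: AE_all_countable) blast
      then have "AE x in leb I. ennreal (exp_neg (f x)) = 0"
        using AE_leb_coord_space[of I]
      proof eventually_elim
        case (elim x)
        have "f x = \<infinity>"
        proof (rule ccontr)
          assume "f x \<noteq> \<infinity>"
          then obtain r where r: "f x = ereal r" using f_nonneg[of x] by (cases "f x") auto
          obtain k :: nat where "r \<le> real k" using real_arch_simple by blast
          then have "f x \<le> ereal (real (Suc k))" using r by simp
          then show False using elim by blast
        qed
        then show ?case by (simp add: exp_neg_def)
      qed
      then have "int_exp_neg n \<phi> = (\<integral>\<^sup>+x. 0 \<partial>leb I)" unfolding int_f by (rule nn_integral_cong_AE)
      then show False using pos by simp
    qed
  qed (use Km in auto)
  have polar: "g y \<le> 1" if y: "y \<in> polar_set I K 1" for y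
  proof -
    \<comment> \<open>Where f x = r is finite, x divided by max 1 r, up to coordinates outside the
      index range, lies in \<open>K\<close>, so <x,y> \<le> max 1 r \<le> 1 + r.\<close>
    have "f x = \<infinity> \<or> dot I x y - 1 \<le> 1 * real_of_ereal (f x)" for x
    proof (cases "f x = \<infinity>")
      case False
      then obtain r where r: "f x = ereal r" "0 \<le> r" using f_nonneg[of x] by (cases "f x") auto
      define x' where "x' = zext I x"
      have fx': "f x' = f x" unfolding f_def x'_def
        by (rule arg_cong[of _ _ \<phi>]) (auto simp: zext_def restrict_def fun_eq_iff)
      have dx': "dot I x' y = dot I x y" unfolding dot_def x'_def zext_def by (intro sum.cong) auto
      have "dot I x y \<le> max 1 r"
      proof -
        have "(1 / max 1 r) *\<^sub>R x' \<in> K"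
          unfolding K_def using f_contract[of "max 1 r" x'] fx' r(1) by (simp add: x'_def)
        then have "dot I ((1 / max 1 r) *\<^sub>R x') y \<le> 1" using y unfolding polar_set_def by blast
        then have "dot I x' y / max 1 r \<le> 1" unfolding dot_simps(5) by simp
        moreover have "max 1 r > 0" by simp
        ultimately show ?thesis unfolding dx' by (simp add: pos_divide_le_eq)
      qed
      then show ?thesis using r by simp
    qed simp
    then have "g y \<le> ereal 1" by (subst g_le_iff) auto
    then show ?thesis by (simp add: one_ereal_def)
  qed
  have Pm: "polar_set I K 1 \<in> sets borel" by (rule borel_closed[OF closed_polar_set])
  have lowP: "ennreal (exp (- 1)) * emeasure (leb I) (polar_set I K 1) \<le> int_exp_neg n (polarity n \<phi>)"
  proof -
    have "ennreal (exp (- 1)) * emeasure (leb I) (polar_set I K 1) = (\<integral>\<^sup>+x. ennreal (exp (- 1)) * indicator (polar_set I K 1) x \<partial>leb I)"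
      using Pm by (simp add: nn_integral_cmult_indicator)
    also have "\<dots> \<le> int_exp_neg n (polarity n \<phi>)" unfolding int_g
      by (intro nn_integral_mono) (use e1 g_nonneg polar in \<open>auto simp: indicator_def\<close>)
    finally show ?thesis .
  qed
  define U where "U = (emeasure (leb I) (uball I))\<^sup>2"
  define k where "k = emeasure (leb I) K"
  define l where "l = emeasure (leb I) (polar_set I K 1)"
  have BM: "U \<le> ennreal (192 ^ n) * (k * l)" using cb.Bourgain_Milman by (simp add: U_def k_def l_def)
  have "ennreal ((exp (- 2) / 192) ^ n) * U \<le> ennreal ((exp (- 2) / 192) ^ n) * (ennreal (192 ^ n) * (k * l))"
    using BM by (rule mult_left_mono) simp
  also have "\<dots> = ennreal (exp (- 2) ^ n) * (k * l)"
    by (simp add: mult.assoc[symmetric] flip: ennreal_mult power_mult_distrib)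
  also have "\<dots> \<le> ennreal (exp (- 1) * exp (- 1)) * (k * l)"
  proof (intro mult_right_mono ennreal_leI)
    \<comment> \<open>Two factors e^(-1) come from the sublevel sets at level 1; n \<ge> 1 lets
      their product be weakened to an n-th power.\<close>
    have "exp (- 2 :: real) ^ n \<le> exp (- 2) ^ 1" using n by (intro power_decreasing) auto
    then show "exp (- 2 :: real) ^ n \<le> exp (- 1) * exp (- 1)" by (simp add: exp_add[symmetric])
  qed simp
  also have "\<dots> = (ennreal (exp (- 1)) * k) * (ennreal (exp (- 1)) * l)"
    by (simp add: ennreal_mult ac_simps)
  also have "\<dots> \<le> int_exp_neg n \<phi> * int_exp_neg n (polarity n \<phi>)"
    using lowK lowP unfolding k_def l_def by (intro mult_mono) auto
  finally show ?thesis by (simp add: U_def emeasure_unit_ball)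
qed

theorem upper_bound:
  assumes n: "n \<ge> 1" and even: "\<And>x. x \<in> Rn_set n \<Longrightarrow> \<phi> (Rn_neg n x) = \<phi> x"
  shows "int_exp_neg n \<phi> * int_exp_neg n (polarity n \<phi>) \<le>
    (emeasure (Rn n) (unit_ball n) * ennreal (fact n))\<^sup>2 * ennreal (1 + (2 * radial_const + radial_const\<^sup>2) / real n)"
proof -
  have fI: "finite I" by simp
  define U where "U = emeasure (leb I) (uball I)"
  have f_even: "f (- x) = f x" for x
  proof -
    have "restrict (- x) I = Rn_neg n (restrict x I)" by (auto simp: Rn_neg_def restrict_def fun_eq_iff)
    then show ?thesis unfolding f_def using even[OF restrict_in_Rn_set] by metis
  qed
  have g_even: "g (- y) \<le> ereal t" if t: "0 \<le> t" and y: "g y \<le> ereal t" for y t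
    unfolding g_le_iff[OF t]
  proof
    fix x
    have "f (- x) = \<infinity> \<or> dot I (- x) y - 1 \<le> t * real_of_ereal (f (- x))" using y unfolding g_le_iff[OF t] by (rule spec)
    then show "f x = \<infinity> \<or> dot I x (- y) - 1 \<le> t * real_of_ereal (f x)" unfolding f_even dot_simps(7,8) .
  qed
  have key: "emeasure (leb I) {x. f x \<le> ereal s} * emeasure (leb I) {y. g y \<le> ereal t} \<le> ennreal ((1 + s * t) ^ n) * U\<^sup>2"
    if s: "0 < s" and t: "0 < t" for s t
  proof -
    \<comment> \<open>Shrinking the sublevel set of the polar by 1 + st makes the pair satisfy <x,y>
      \<le> 1; undoing the dilation gives the factor (1 + st)^n.\<close>
    define r where "r = 1 + s * t"
    have r: "r > 0" using s t by (simp add: r_def add_pos_pos)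
    define L where "L = {y. g (r *\<^sub>R y) \<le> ereal t}"
    have cL: "closed L"
    proof -
      have "continuous_on UNIV (\<lambda>y::vec. r *\<^sub>R y)"
        by (rule continuous_on_coordinatewise_then_product)
           (simp add: scaleR_fun_apply continuous_on_mult_left continuous_on_product_coordinates)
      then have "closed ((\<lambda>y. r *\<^sub>R y) -` {y. g y \<le> ereal t})" using closed_g by (intro closed_vimage)
      then show ?thesis unfolding L_def vimage_def by simp
    qed
    have BS: "emeasure (leb I) {x. f x \<le> ereal s} * emeasure (leb I) L \<le> U\<^sup>2"
      unfolding U_def
    proof (rule Blaschke_Santalo[OF fI closed_f cL])
      show "- x \<in> {x. f x \<le> ereal s}" if "x \<in> {x. f x \<le> ereal s}" for x using that f_even[of x] by simp
      show "- y \<in> L" if y: "y \<in> L" for y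
      proof -
        have "g (- (r *\<^sub>R y)) \<le> ereal t" using y t unfolding L_def by (intro g_even) auto
        then show ?thesis unfolding L_def by (simp only: mem_Collect_eq scaleR_minus_right)
      qed
      fix x y assume x: "x \<in> {x. f x \<le> ereal s} \<inter> coord_space I" and y: "y \<in> L \<inter> coord_space I"
      have fx: "f x \<le> ereal s" using x by blast
      then obtain a where a: "f x = ereal a" "a \<le> s" using f_nonneg[of x] by (cases "f x") auto
      have "g (r *\<^sub>R y) \<le> ereal t" using y unfolding L_def by blast
      then have "f x = \<infinity> \<or> dot I x (r *\<^sub>R y) - 1 \<le> t * real_of_ereal (f x)" using t by (subst (asm) g_le_iff) auto
      then have "r * dot I x y - 1 \<le> t * a" unfolding a(1) dot_simps(6) by simp
      also have "t * a \<le> t * s" using a(2) t by (intro mult_left_mono) auto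
      finally have "r * dot I x y \<le> r * 1" by (simp add: r_def mult.commute)
      then show "dot I x y \<le> 1" using r by (subst (asm) mult_le_cancel_left_pos)
    qed
    have scale: "emeasure (leb I) {y. g y \<le> ereal t} = ennreal (r ^ n) * emeasure (leb I) L"
    proof -
      have m1: "(\<lambda>y. indicator {y. g y \<le> ereal t} y :: ennreal) \<in> borel_measurable borel"
        using borel_closed[OF closed_g] by simp
      have "(\<integral>\<^sup>+y. indicator {y. g y \<le> ereal t} y \<partial>leb I) = ennreal (\<bar>r\<bar> ^ card I) * (\<integral>\<^sup>+y. indicator {y. g y \<le> ereal t} (r *\<^sub>R y) \<partial>leb I)"
        by (rule nn_integral_leb_scale[OF fI _ m1]) (use r in simp)
      also have "(\<lambda>y. indicator {y. g y \<le> ereal t} (r *\<^sub>R y) :: ennreal) = indicator L"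
        by (intro ext) (simp add: indicator_def L_def)
      finally show ?thesis using r borel_closed[OF closed_g] borel_closed[OF cL] by simp
    qed
    have "emeasure (leb I) {x. f x \<le> ereal s} * emeasure (leb I) {y. g y \<le> ereal t} = ennreal (r ^ n) * (emeasure (leb I) {x. f x \<le> ereal s} * emeasure (leb I) L)"
      unfolding scale by (simp add: ac_simps)
    also have "\<dots> \<le> ennreal (r ^ n) * U\<^sup>2" using BS by (rule mult_left_mono) simp
    finally show ?thesis by (simp add: r_def)
  qed
  \<comment> \<open>Chosen so that its square at r = sqrt (st) is e^(-2r) (1 + r^2)^n U^2, which
    dominates the product of the two level functions since s + t \<ge> 2 sqrt (st).\<close>
  define h where "h r = ennreal (exp (- r) * sqrt (1 + r\<^sup>2) ^ n) * U" for r
  note lf = int_exp_neg_layer[OF fI measurable_f f_nonneg]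
  note lg = int_exp_neg_layer[OF fI measurable_g g_nonneg]
  have "int_exp_neg n \<phi> * int_exp_neg n (polarity n \<phi>) \<le> (\<integral>\<^sup>+r. h r * indicator {0<..} r \<partial>lborel)\<^sup>2"
    unfolding int_f int_g lf(1) lg(1)
  proof (rule Prekopa_Leindler_multiplicative)
    show "(\<lambda>s. ennreal (exp (- s)) * emeasure (leb I) {x. f x \<le> ereal s}) \<in> borel_measurable borel"
      using lf(2) by simp
    show "(\<lambda>s. ennreal (exp (- s)) * emeasure (leb I) {x. g x \<le> ereal s}) \<in> borel_measurable borel"
      using lg(2) by simp
    show "h \<in> borel_measurable borel" unfolding h_def by simp
    fix s t :: real assume st: "0 < s" "0 < t"
    have amgm: "2 * sqrt (s * t) \<le> s + t" using arith_geo_mean_sqrt[of s t] st by simp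
    have ee: "ennreal (exp (- s)) * ennreal (exp (- t)) \<le> ennreal ((exp (- sqrt (s * t)))\<^sup>2)"
    proof -
      have "exp (- s) * exp (- t) \<le> exp (- (2 * sqrt (s * t)))"
        using amgm by (simp add: exp_add[symmetric])
      also have "\<dots> = (exp (- sqrt (s * t)))\<^sup>2" by (simp add: exp_double[symmetric])
      finally show ?thesis by (subst ennreal_mult[symmetric]) (auto intro: ennreal_leI)
    qed
    have hh: "(h (sqrt (s * t)))\<^sup>2 = ennreal ((exp (- sqrt (s * t)))\<^sup>2) * (ennreal ((1 + s * t) ^ n) * U\<^sup>2)"
    proof -
      have "(sqrt (1 + s * t) ^ n)\<^sup>2 = (1 + s * t) ^ n"
        using st by (simp add: power_mult[symmetric] mult.commute[of n 2]) (simp add: power_mult)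
      then have "(exp (- sqrt (s * t)) * sqrt (1 + (sqrt (s * t))\<^sup>2) ^ n)\<^sup>2 = (exp (- sqrt (s * t)))\<^sup>2 * (1 + s * t) ^ n"
        using st by (simp add: power_mult_distrib)
      then have "(ennreal (exp (- sqrt (s * t)) * sqrt (1 + (sqrt (s * t))\<^sup>2) ^ n))\<^sup>2 = ennreal ((exp (- sqrt (s * t)))\<^sup>2) * ennreal ((1 + s * t) ^ n)"
        using st by (subst ennreal_power, simp, simp only:) (rule ennreal_mult, simp_all)
      then show ?thesis unfolding h_def power_mult_distrib by (simp only: mult.assoc)
    qed
    have "(ennreal (exp (- s)) * emeasure (leb I) {x. f x \<le> ereal s}) * (ennreal (exp (- t)) * emeasure (leb I) {x. g x \<le> ereal t}) =
      (ennreal (exp (- s)) * ennreal (exp (- t))) * (emeasure (leb I) {x. f x \<le> ereal s} * emeasure (leb I) {x. g x \<le> ereal t})"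
      by (simp only: ac_simps)
    also have "\<dots> \<le> (h (sqrt (s * t)))\<^sup>2" unfolding hh by (intro mult_mono ee key st) auto
    finally show "(ennreal (exp (- s)) * emeasure (leb I) {x. f x \<le> ereal s}) * (ennreal (exp (- t)) * emeasure (leb I) {x. g x \<le> ereal t}) \<le> (h (sqrt (s * t)))\<^sup>2" .
  qed
  also have "(\<integral>\<^sup>+r. h r * indicator {0<..} r \<partial>lborel) = (\<integral>\<^sup>+r. ennreal (exp (- r) * sqrt (1 + r\<^sup>2) ^ n) * indicator {0<..} r \<partial>lborel) * U"
  proof -
    have "(\<integral>\<^sup>+r. h r * indicator {0<..} r \<partial>lborel) = (\<integral>\<^sup>+r. (ennreal (exp (- r) * sqrt (1 + r\<^sup>2) ^ n) * indicator {0<..} r) * U \<partial>lborel)"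
      unfolding h_def by (intro nn_integral_cong) (simp only: ac_simps)
    also have "\<dots> = (\<integral>\<^sup>+r. ennreal (exp (- r) * sqrt (1 + r\<^sup>2) ^ n) * indicator {0<..} r \<partial>lborel) * U"
      by (rule nn_integral_multc) simp
    finally show ?thesis .
  qed
  also have "\<dots>\<^sup>2 \<le> (ennreal (fact n * (1 + radial_const / real n)) * U)\<^sup>2"
    using radial_integral_le[OF n] by (intro power_mono mult_right_mono) auto
  also have "\<dots> = (U * ennreal (fact n))\<^sup>2 * ennreal ((1 + radial_const / real n)\<^sup>2)"
  proof -
    have "0 \<le> 1 + radial_const / real n" using radial_const_pos by (simp add: add_nonneg_nonneg)
    then show ?thesis
      by (simp only: ennreal_mult fact_ge_zero ennreal_power[symmetric] power_mult_distrib mult.commute mult.left_commute)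
  qed
  also have "\<dots> \<le> (U * ennreal (fact n))\<^sup>2 * ennreal (1 + (2 * radial_const + radial_const\<^sup>2) / real n)"
  proof (intro mult_left_mono ennreal_leI)
    \<comment> \<open>Squaring 1 + a/n and using n \<le> n^2 is the origin of the constant 2a +
      a^2.\<close>
    have n1: "1 \<le> real n" using n by simp
    have "radial_const\<^sup>2 / (real n)\<^sup>2 \<le> radial_const\<^sup>2 / real n"
    proof (rule divide_left_mono)
      show "real n \<le> (real n)\<^sup>2" using n1 mult_left_mono[OF n1, of "real n"] by (simp add: power2_eq_square)
    qed (use n1 in auto)
    then show "(1 + radial_const / real n)\<^sup>2 \<le> 1 + (2 * radial_const + radial_const\<^sup>2) / real n"
      by (simp add: power2_sum power_divide add_divide_distrib)
  qed simp
  finally show ?thesis by (simp add: U_def emeasure_unit_ball)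
qed

end

theorem theorem1:
  shows "\<exists>c C :: real. 0 < c \<and> 0 < C \<and>
    (\<forall>n::nat. \<forall>\<phi>. n \<ge> 1 \<longrightarrow> geometric_convex n \<phi> \<longrightarrow>
       0 < int_exp_neg n \<phi> \<longrightarrow> int_exp_neg n \<phi> < \<infinity> \<longrightarrow>
       ennreal (c ^ n) * (emeasure (Rn n) (unit_ball n))\<^sup>2
         \<le> int_exp_neg n \<phi> * int_exp_neg n (polarity n \<phi>) \<and>
       ((\<forall>x\<in>Rn_set n. \<phi> (Rn_neg n x) = \<phi> x) \<longrightarrow>
         int_exp_neg n \<phi> * int_exp_neg n (polarity n \<phi>)
           \<le> (emeasure (Rn n) (unit_ball n) * ennreal (fact n))\<^sup>2 * ennreal (1 + C / real n)))"
proof (rule exI[of _ "exp (- 2) / 192"], rule exI[of _ "2 * radial_const + radial_const\<^sup>2"], intro conjI allI impI)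
  show "0 < exp (- 2 :: real) / 192" by simp
  show "0 < 2 * radial_const + radial_const\<^sup>2" using radial_const_pos by (simp add: add_pos_nonneg)
next
  fix n :: nat and \<phi> :: "vec \<Rightarrow> ereal"
  assume n: "1 \<le> n" and gc: "geometric_convex n \<phi>" and i: "0 < int_exp_neg n \<phi>" "int_exp_neg n \<phi> < \<infinity>"
  interpret geometric_function n \<phi> by standard (rule gc)
  show "ennreal ((exp (- 2) / 192) ^ n) * (emeasure (Rn n) (unit_ball n))\<^sup>2 \<le> int_exp_neg n \<phi> * int_exp_neg n (polarity n \<phi>)"
    by (rule lower_bound[OF n i])
  assume "\<forall>x\<in>Rn_set n. \<phi> (Rn_neg n x) = \<phi> x"
  then show "int_exp_neg n \<phi> * int_exp_neg n (polarity n \<phi>) \<le>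
      (emeasure (Rn n) (unit_ball n) * ennreal (fact n))\<^sup>2 * ennreal (1 + (2 * radial_const + radial_const\<^sup>2) / real n)"
    using upper_bound[OF n] by blast
qed

end
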